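(* Let $\alpha\in(0,1)$ and let $\mu$ be a probability measure with $\operatorname{supp}(\mu)\subset[\underline\theta,\bar\theta]$, $-\alpha<\underline\theta\le 0\le\bar\theta<+\infty$. Let $(\Pi_n)_{n\ge1}$ be the exchangeable Gibbs partition with parameter $\alpha$ and weights $v_{n,k}=\int v_{n,k}(\alpha,\theta)\,d\mu(\theta)$, let $\mathsf k_n$ be its number of blocks and $\hat\alpha_n$ the quasi-maximum likelihood estimator. Then, as $n\to\infty$, $$\sqrt{\mathsf k_n\,\mathfrak i(\alpha)}\,(\hat\alpha_n-\alpha)\to N\qquad\mathcal F_\infty\text{-stably},$$ where $N\sim\mathcal N(0,1)$ is independent of $\mathcal F_\infty$. Consequently, for any $\epsilon\in(0,1)$, with $\tau_{1-\epsilon/2}$ the $(1-\epsilon/2)$-quantile of $\mathcal N(0,1)$, $$\lim_{n\to\infty}\mathbb P\left(\alpha\in\left[\hat\alpha_n-\frac{\tau_{1-\epsilon/2}}{\sqrt{\mathsf k_n\,\mathfrak i(\hat\alpha_n)}},\ \hat\alpha_n+\frac{\tau_{1-\epsilon/2}}{\sqrt{\mathsf k_n\,\mathfrak i(\hat\alpha_n)}}\right]\right)=1-\epsilon.$$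
   Context: Weights: for $1\le k\le n$, $v_{n,k}(\alpha,\theta)=\frac{\prod_{i=1}^{k-1}(\theta+i\alpha)}{\prod_{i=1}^{n-1}(\theta+i)}$ (empty products equal 1) and $v_{n,k}=\int v_{n,k}(\alpha,\theta)\,d\mu(\theta)$; $\mu$ does not depend on $\alpha$. Gibbs partition: $\Pi_n$ is a random partition of $\{1,\dots,n\}$ defined sequentially on a probability space $(\Omega,\mathcal F,P)$. $\Pi_1=\{\{1\}\}$. Given $\Pi_n=\{U_1,\dots,U_{\mathsf k_n}\}$ ($\mathsf k_n$ = number of blocks), $\Pi_{n+1}$ is obtained by putting $n+1$ into a new block with probability $v_{n+1,\mathsf k_n+1}/v_{n,\mathsf k_n}$ and into $U_i$ with probability $\frac{v_{n+1,\mathsf k_n}}{v_{n,\mathsf k_n}}(|U_i|-\alpha)$, $i=1,\dots,\mathsf k_n$. Let $\mathsf k_{n,j}$ be the number of blocks of $\Pi_n$ of size $j$, $\mathcal F_n=\sigma(\Pi_n)$ and $\mathcal F_\infty=\sigma(\cup_n\mathcal F_n)$. QMLE: for $n\ge2$, $\hat\alpha_n$ is the maximizer over $x\in(0,1)$ of $(\mathsf k_n-1)\log x+\sum_{j=2}^n\mathsf k_{n,j}\sum_{i=1}^{j-1}\log(i-x)$, understood as: $\hat\alpha_n=0$ if $\mathsf k_n=1$; $\hat\alpha_n=1$ if $\mathsf k_n=n$; and if $1<\mathsf k_n<n$, $\hat\alpha_n$ is the unique solution $x\in(0,1)$ of $\frac{\mathsf k_n-1}{x}-\sum_{j=2}^n\mathsf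 k_{n,j}\sum_{i=1}^{j-1}\frac1{i-x}=0$. Fisher information: for $x\in(0,1)$, $\mathfrak i(x)=\sum_{j\ge1}\mathfrak p_x(j)\left(\frac{\partial}{\partial x}\log\mathfrak p_x(j)\right)^2$ with $\mathfrak p_x(j)=\frac{x\prod_{i=1}^{j-1}(i-x)}{j!}$. By convention $1/\sqrt{\mathfrak i(x)}=0$ for $x\in\{0,1\}$. Stable convergence: for a sub-$\sigma$-field $\mathcal G\subset\mathcal F$, real random variables $X_n\to X$ $\mathcal G$-stably if $\lim_n\mathbb E[f\,\mathbb E[h(X_n)\mid\mathcal G]]=\mathbb E[f\,\mathbb E[h(X)\mid\mathcal G]]$ for every $\mathcal F$-measurable integrable $f$ and every bounded continuous $h:\mathbb R\to\mathbb R$. The probability space is assumed rich enough (enlarged if necessary) to carry $N$ independent of $\mathcal F_\infty$. *)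

theory Defs
  imports "HOL-Probability.Probability"
begin

section \<open>Gibbs partitions\<close>

definition gibbs_weight :: "real \<Rightarrow> real \<Rightarrow> nat \<Rightarrow> nat \<Rightarrow> real" where
  "gibbs_weight \<alpha> \<theta> n k =
     (\<Prod>i=1..<k. \<theta> + real i * \<alpha>) / (\<Prod>i=1..<n. \<theta> + real i)"

definition mixed_weight :: "real \<Rightarrow> real measure \<Rightarrow> nat \<Rightarrow> nat \<Rightarrow> real" where
  "mixed_weight \<alpha> \<mu> n k = (\<integral>\<theta>. gibbs_weight \<alpha> \<theta> n k \<partial>\<mu>)"

definition measure_support :: "'a::topological_space measure \<Rightarrow> 'a set" where
  "measure_support \<mu> = {x. \<forall>U. open U \<longrightarrow> x \<in> U \<longrightarrow> emeasure \<mu> U > 0}"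

text \<open>
  A partition of \<open>{1..n}\<close> is represented by the set of its blocks. The index \<open>n = 0\<close>, where
  the only partition is the empty one, is there only to make the sequence total.
  For the weights \<^const>\<open>mixed_weight\<close> the transition probabilities out of a partition sum
  to 1, so that almost surely each partition extends the preceding one.
\<close>

definition gibbs_partition ::
    "'a measure \<Rightarrow> real \<Rightarrow> (nat \<Rightarrow> nat \<Rightarrow> real) \<Rightarrow> (nat \<Rightarrow> 'a \<Rightarrow> nat set set) \<Rightarrow> bool" where
  "gibbs_partition M \<alpha> v Part \<longleftrightarrow>
     (\<forall>n. Part n \<in> M \<rightarrow>\<^sub>M count_space {P. partition_on {1..n} P}) \<and>
     (\<forall>\<omega>\<in>space M. Part 1 \<omega> = {{1}}) \<and>
     (\<forall>n\<ge>1. \<forall>P. \<P>(\<omega> in M. Part n \<omega> = P) > 0 \<longrightarrow>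
        \<P>(\<omega> in M. Part (n + 1) \<omega> = insert {n + 1} P \<bar> Part n \<omega> = P)
          = v (n + 1) (card P + 1) / v n (card P) \<and>
        (\<forall>U\<in>P. \<P>(\<omega> in M. Part (n + 1) \<omega> = insert (insert (n + 1) U) (P - {U}) \<bar> Part n \<omega> = P)
          = v (n + 1) (card P) / v n (card P) * (real (card U) - \<alpha>)))"

definition sigma_infinity :: "'a measure \<Rightarrow> (nat \<Rightarrow> 'a \<Rightarrow> nat set set) \<Rightarrow> 'a measure" where
  "sigma_infinity M Part =
     sigma (space M) (\<Union>n\<in>{1..}. sets (vimage_algebra (space M) (Part n) (count_space UNIV)))"

definition blocks_of_size :: "nat set set \<Rightarrow> nat \<Rightarrow> nat" where
  "blocks_of_size P j = card {U \<in> P. card U = j}"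

section \<open>Quasi-maximum likelihood estimator\<close>

text \<open>
  Derivative in \<open>x\<close> of the quasi log-likelihood
  \<open>(card P - 1) * ln x + (\<Sum>j=2..n. blocks_of_size P j * (\<Sum>i=1..j-1. ln (i - x)))\<close>.
\<close>

definition quasi_score :: "nat \<Rightarrow> nat set set \<Rightarrow> real \<Rightarrow> real" where
  "quasi_score n P x =
     (real (card P) - 1) / x
     - (\<Sum>j=2..n. real (blocks_of_size P j) * (\<Sum>i=1..j-1. 1 / (real i - x)))"

text \<open>
  The estimator is meaningful for \<open>n \<ge> 2\<close>. For \<open>1 < card P < n\<close> the score decreases from
  \<open>\<infinity>\<close> to \<open>-\<infinity>\<close> on \<open>(0, 1)\<close>, so the definite description is well defined.
\<close>

definition qmle :: "nat \<Rightarrow> nat set set \<Rightarrow> real" where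
  "qmle n P =
     (if card P = 1 then 0
      else if card P = n then 1
      else (THE x. x \<in> {0<..<1} \<and> quasi_score n P x = 0))"

section \<open>Fisher information\<close>

definition sibuya_prob :: "real \<Rightarrow> nat \<Rightarrow> real" where
  "sibuya_prob x j = x * (\<Prod>i=1..<j. real i - x) / fact j"

definition fisher_info :: "real \<Rightarrow> real" where
  "fisher_info x =
     (\<Sum>j. sibuya_prob x (Suc j) * (deriv (\<lambda>y. ln (sibuya_prob y (Suc j))) x)\<^sup>2)"

definition inv_sqrt_fisher_info :: "real \<Rightarrow> real" where
  "inv_sqrt_fisher_info x = (if x \<in> {0<..<1} then 1 / sqrt (fisher_info x) else 0)"

section \<open>Stable convergence and quantiles\<close>

text \<open>
  The measurability conditions are part of the notion because \<^const>\<open>real_cond_exp\<close> is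
  degenerate without them.
\<close>

definition stable_conv ::
    "'a measure \<Rightarrow> 'a measure \<Rightarrow> (nat \<Rightarrow> 'a \<Rightarrow> real) \<Rightarrow> ('a \<Rightarrow> real) \<Rightarrow> bool" where
  "stable_conv M G X Y \<longleftrightarrow>
     subalgebra M G \<and> (\<forall>n. X n \<in> borel_measurable M) \<and> Y \<in> borel_measurable M \<and>
     (\<forall>f (h :: real \<Rightarrow> real). integrable M f \<longrightarrow> continuous_on UNIV h \<longrightarrow> bounded (range h) \<longrightarrow>
        (\<lambda>n. \<integral>\<omega>. f \<omega> * real_cond_exp M G (\<lambda>\<omega>. h (X n \<omega>)) \<omega> \<partial>M)
          \<longlonglongrightarrow> (\<integral>\<omega>. f \<omega> * real_cond_exp M G (\<lambda>\<omega>. h (Y \<omega>)) \<omega> \<partial>M))"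

definition quantile :: "real measure \<Rightarrow> real \<Rightarrow> real" where
  "quantile D p = Inf {x. p \<le> cdf D x}"

end

theory Submission
  imports Defs "HOL-Real_Asymp.Real_Asymp"
begin

text \<open>
Let \<open>c l\<close> be the size of the block that element \<open>l + 1\<close> joins, with \<open>c l = 0\<close> if it opens a block.
A block passes from size at most \<open>s\<close> to size above \<open>s\<close> exactly when it is joined at size \<open>s\<close>. So the number
\<open>N s\<close> of blocks of size above \<open>s\<close> counts the \<open>l < n\<close> with \<open>c l = s\<close>, and \<open>N 0\<close> is the number \<open>k n\<close> of
blocks. Summation by parts turns the quasi score into
\<open>(k n - 1) / x - (\<Sum>s\<ge>1. N s / (s - x))\<close>, that is, into the sum over \<open>1 \<le> l < n\<close> of the increments
\<open>- 1 / (c l - x)\<close> (\<open>quasi_score_eq\<close>, \<open>score_fun_at_alpha\<close>). The whole proof studies the sequence \<open>c\<close>, in the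
locale \<open>size_chain\<close>.

The score at \<open>\<alpha>\<close> is nearly a martingale. If the probability of a new block is \<open>p\<close>, the conditional mean of an
increment telescopes to \<open>p / \<alpha> - (1 - p) * k / (n - \<alpha> * k)\<close>, which is zero for \<open>p = \<alpha> * k / n\<close>. For a fixed
\<open>\<theta>\<close> one has \<open>p = (\<theta> + k * \<alpha>) / (\<theta> + n)\<close>, and averaging over a bounded set of \<open>\<theta>\<close> keeps \<open>p\<close> within \<open>O(1 / n)\<close>
of \<open>\<alpha> * k / n\<close> (\<open>mixed_weight_new_bounds\<close>). The drift therefore adds up to \<open>O(ln n)\<close> (\<open>abs_drift_le\<close>), which is
negligible against the norming \<open>sqrt (k n)\<close>, of order \<open>n powr (\<alpha> / 2)\<close>. This is why one can argue under the given
law, without conditioning on \<open>\<theta>\<close> and without the almost sure limit of \<open>k n / n powr \<alpha>\<close>.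

The sum of the squared increments is a weighted sum of the \<open>N s\<close>. The fraction \<open>N s / k n\<close> converges to the tail
\<open>sibuya_tail \<alpha> s\<close> of the Sibuya law (\<open>expectation_D_squared_le\<close>, by induction on \<open>s\<close>), so this sum divided by
\<open>k n\<close> converges to \<open>1 / \<alpha>\<^sup>2 + (\<Sum>s\<ge>1. sibuya_tail \<alpha> s / (s - \<alpha>)\<^sup>2)\<close>. A second summation by parts identifies that
number as the Fisher information (\<open>fisher_info_eq\<close>).

The norming is random, and the limit law has to hold on every event of \<open>F_\<infinity>\<close>. Both points are settled by the fact
that \<open>ln (k n) - \<alpha> * ln n\<close> is a Cauchy sequence in \<open>L\<^sup>1\<close> (\<open>V_Cauchy\<close>): for large \<open>m\<close> and all \<open>n \<ge> m\<close>, the norming at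
time \<open>n\<close> is close to a quantity known at time \<open>m\<close>. Given the past up to \<open>m\<close>, the products
\<open>\<Prod>j. 1 + \<i> * x j\<close> over the normed increments \<open>x j\<close> have conditional mean close to 1, so the characteristic
function, integrated over any event of the past up to \<open>m\<close>, gets the factor \<open>exp (- t\<^sup>2 / 2)\<close>
(\<open>char_score_estimate\<close>, \<open>char_normed_score\<close>). Since such events form a generator of \<open>F_\<infinity>\<close> that is closed under
intersection, this gives stable convergence (\<open>stable_conv_std_normalI\<close>).

It remains to pass from the score to its root. The score function is decreasing, and in a neighbourhood of \<open>\<alpha>\<close> its
slope varies by a factor close to 1 only, whatever the block sizes are; hence the error of the root, multiplied by
\<open>sqrt (k n * fisher_info \<alpha>)\<close>, differs from the normed score by a vanishing amount (\<open>score_root_error\<close>,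
\<open>prob_not_accurate\<close>). Continuity of the Fisher information allows the estimator to be plugged in
(\<open>studentized_error_close\<close>), and the interval contains \<open>\<alpha>\<close> iff this studentized error is at most the quantile in
absolute value (\<open>coverage_event\<close>).
\<close>

section \<open>Fisher information of the Sibuya law\<close>

text \<open>
The probability that a variable with the law \<^const>\<open>sibuya_prob\<close> exceeds \<open>s\<close>: at each value \<open>i\<close> that it reaches, it
stops with the conditional probability \<open>x / i\<close>.
\<close>

definition sibuya_tail :: "real \<Rightarrow> nat \<Rightarrow> real" where
  "sibuya_tail x s = (\<Prod>i=1..s. (real i - x) / real i)"

definition hazard_sum :: "real \<Rightarrow> nat \<Rightarrow> real" where
  "hazard_sum x s = (\<Sum>i=1..s. 1 / (real i - x))"

lemma sibuya_tail_0 [simp]: "sibuya_tail x 0 = 1"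
  by (simp add: sibuya_tail_def)

lemma sibuya_tail_Suc: "sibuya_tail x (Suc s) = sibuya_tail x s * ((real (Suc s) - x) / real (Suc s))"
  by (simp add: sibuya_tail_def)

lemma hazard_sum_0 [simp]: "hazard_sum x 0 = 0"
  by (simp add: hazard_sum_def)

lemma hazard_sum_Suc: "hazard_sum x (Suc s) = hazard_sum x s + 1 / (real (Suc s) - x)"
  by (simp add: hazard_sum_def)

lemma sibuya_prob_eq_tail: "sibuya_prob x (Suc j) = x / real (Suc j) * sibuya_tail x j"
proof -
  have "(\<Prod>i=1..<Suc j. real i - x) = sibuya_tail x j * fact j"
    unfolding atLeastLessThanSuc_atLeastAtMost
  proof (induction j)
    case (Suc j)
    have "sibuya_tail x (Suc j) * fact (Suc j) = (sibuya_tail x j * fact j) * (real (Suc j) - x)"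
      by (simp add: sibuya_tail_Suc field_simps del: of_nat_Suc)
    then show ?case using Suc by simp
  qed simp
  then show ?thesis
    unfolding sibuya_prob_def by (simp add: fact_Suc del: of_nat_Suc prod.op_ivl_Suc)
qed

lemma sibuya_tail_bounds:
  assumes "0 < x" "x < 1"
  shows "0 < sibuya_tail x s" "sibuya_tail x s \<le> 1"
proof -
  show "0 < sibuya_tail x s"
    unfolding sibuya_tail_def using assms by (intro prod_pos) auto
  show "sibuya_tail x s \<le> 1"
    unfolding sibuya_tail_def using assms by (intro prod_le_1) auto
qed

text \<open>
This relation between successive tails is the stationarity condition for the fractions of blocks of each size; it makes
the main terms in \<open>jump_weight_drift\<close> cancel.
\<close>

lemma sibuya_tail_hazard:
  assumes "s \<ge> 1"
  shows "(real s - x) * (sibuya_tail x (s - 1) - sibuya_tail x s) = x * sibuya_tail x s"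
proof -
  obtain r where "s = Suc r" using assms by (cases s) auto
  then show ?thesis by (simp add: sibuya_tail_Suc field_simps)
qed

text \<open>
Summation by parts gives the partial sums of the Fisher information in closed form. The series on the right has only
the terms \<open>sibuya_tail / (s - x)\<^sup>2\<close>, in which squares of sums over \<open>i\<close> no longer occur, and the subtracted boundary
term tends to zero.
\<close>

lemma sum_sibuya_prob_score_squared:
  assumes "0 < x" "x < 1"
  shows "(\<Sum>j<n. sibuya_prob x (Suc j) * (1 / x - hazard_sum x j)\<^sup>2)
       = 1 / x\<^sup>2 + (\<Sum>s<n. sibuya_tail x (Suc s) / (real (Suc s) - x)\<^sup>2)
         - sibuya_tail x n * (1 / x\<^sup>2 + (hazard_sum x n)\<^sup>2)"
proof (induction n)
  case 0 then show ?case by simp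
next
  case (Suc n)
  define y P h where "y = real (Suc n)" and "P = sibuya_tail x n" and "h = hazard_sum x n"
  have nz: "x \<noteq> 0" "y \<noteq> 0" "y - x \<noteq> 0" using assms by (auto simp: y_def)
  \<comment> \<open>In terms of \<open>u\<close> all denominators become powers of \<open>x\<close> and of \<open>x * u + 1\<close>.\<close>
  define u where "u = 1 / (y - x)"
  have u: "y = x + 1 / u" "u \<noteq> 0" using nz by (auto simp: u_def)
  have "x + 1/u \<noteq> 0" using nz u by auto
  then have xu: "x * u + 1 \<noteq> 0" using u by (auto simp: field_simps)
  have "x / y * P * (1 / x - h)\<^sup>2
      = P * ((y - x) / y) * u\<^sup>2 - P * ((y - x) / y) * (1 / x\<^sup>2 + (h + u)\<^sup>2) + P * (1 / x\<^sup>2 + h\<^sup>2)"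
  proof -
    have d: "(y - x) / y = 1 / (x * u + 1)" "x / y = x * u / (x * u + 1)"
      using u xu nz by (auto simp: u(1) field_simps)
    show ?thesis unfolding d using xu nz
      by (simp add: divide_simps) (simp add: algebra_simps power2_eq_square)
  qed
  then show ?case
    using Suc by (simp add: sibuya_prob_eq_tail sibuya_tail_Suc hazard_sum_Suc y_def P_def h_def u_def
        power_one_over del: of_nat_Suc)
qed

text \<open>
Together with \<open>hazard_sum_le_harm\<close> this expresses the boundary term through the harmonic numbers alone.
\<close>

lemma sibuya_tail_le_exp:
  assumes "0 < x" "x < 1"
  shows "sibuya_tail x n \<le> exp (- x * harm n)"
proof -
  have "sibuya_tail x n \<le> (\<Prod>i=1..n. exp (- x / real i))"
    unfolding sibuya_tail_def
  proof (intro prod_mono conjI)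
    fix i assume i: "i \<in> {1..n}"
    show "0 \<le> (real i - x) / real i" using i assms by auto
    show "(real i - x) / real i \<le> exp (- x / real i)"
      using exp_ge_add_one_self[of "- x / real i"] i by (simp add: field_simps)
  qed
  also have "\<dots> = exp (- x * harm n)"
    by (simp add: exp_sum[symmetric] harm_def sum_distrib_left divide_inverse)
  finally show ?thesis .
qed

lemma hazard_sum_le_harm:
  assumes "0 < x" "x < 1"
  shows "hazard_sum x n \<le> 1 / (1 - x) + harm n"
proof -
  have "hazard_sum x (Suc n) \<le> 1 / (1 - x) + harm n" for n
  proof (induction n)
    case (Suc n)
    have "1 / (real (Suc (Suc n)) - x) \<le> inverse (real (Suc n))"
      using assms by (simp add: field_simps)
    then show ?case using Suc by (simp add: hazard_sum_Suc[of _ "Suc n"] harm_Suc)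
  qed (simp add: hazard_sum_def harm_def)
  moreover have "hazard_sum x n \<le> hazard_sum x (Suc n)"
    using assms by (simp add: hazard_sum_Suc)
  ultimately show ?thesis by (meson order_trans)
qed

lemma hazard_sum_nonneg:
  assumes "x < 1"
  shows "0 \<le> hazard_sum x n"
  unfolding hazard_sum_def using assms by (intro sum_nonneg) auto

lemma sibuya_tail_hazard_sum_tendsto:
  assumes "0 < x" "x < 1"
  shows "(\<lambda>n. sibuya_tail x n * (1 / x\<^sup>2 + (hazard_sum x n)\<^sup>2)) \<longlonglongrightarrow> 0"
proof (rule tendsto_sandwich[OF _ _ tendsto_const])
  have inner: "filterlim (\<lambda>n. harm n :: real) at_top sequentially"
    by (rule harm_at_top)
  have "((\<lambda>H. exp (- x * H) * (1 / x\<^sup>2 + (1 / (1 - x) + H)\<^sup>2)) \<longlongrightarrow> 0) at_top"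
    using assms by real_asymp
  then show "(\<lambda>n. exp (- x * harm n) * (1 / x\<^sup>2 + (1 / (1 - x) + harm n)\<^sup>2)) \<longlonglongrightarrow> 0"
    by (rule filterlim_compose[OF _ inner])
  show "\<forall>\<^sub>F n in sequentially. sibuya_tail x n * (1 / x\<^sup>2 + (hazard_sum x n)\<^sup>2)
          \<le> exp (- x * harm n) * (1 / x\<^sup>2 + (1 / (1 - x) + harm n)\<^sup>2)"
    using assms by (intro always_eventually allI mult_mono add_left_mono power_mono
        sibuya_tail_le_exp hazard_sum_le_harm hazard_sum_nonneg) auto
  show "\<forall>\<^sub>F n in sequentially. 0 \<le> sibuya_tail x n * (1 / x\<^sup>2 + (hazard_sum x n)\<^sup>2)"
    using assms sibuya_tail_bounds[of x] by (intro always_eventually allI mult_nonneg_nonneg)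
      (auto intro: less_imp_le)
qed

lemma DERIV_ln_sibuya_prob:
  assumes "0 < x" "x < 1"
  shows "((\<lambda>y. ln (sibuya_prob y (Suc j))) has_real_derivative 1 / x - hazard_sum x j) (at x)"
proof -
  have eq: "\<forall>\<^sub>F y in nhds x. ln (sibuya_prob y (Suc j))
      = ln y - ln (real (Suc j)) + (\<Sum>i=1..j. ln (real i - y) - ln (real i))"
  proof -
    have "\<forall>\<^sub>F y in nhds x. y \<in> {0<..<1}"
      using assms by (intro eventually_nhds_in_open) auto
    then show ?thesis
    proof eventually_elim
      case (elim y)
      have "ln (sibuya_tail y j) = (\<Sum>i=1..j. ln ((real i - y) / real i))"
        unfolding sibuya_tail_def using elim by (intro ln_prod) auto
      also have "\<dots> = (\<Sum>i=1..j. ln (real i - y) - ln (real i))"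
        using elim by (intro sum.cong refl ln_divide_pos) auto
      finally have 1: "ln (sibuya_tail y j) = (\<Sum>i=1..j. ln (real i - y) - ln (real i))" .
      have "ln (sibuya_prob y (Suc j)) = ln (y / real (Suc j)) + ln (sibuya_tail y j)"
        unfolding sibuya_prob_eq_tail using elim sibuya_tail_bounds[of y j]
        by (intro ln_mult_pos) auto
      then show ?case using 1 elim by (simp add: ln_divide_pos)
    qed
  qed
  have "((\<lambda>y. ln y - ln (real (Suc j)) + (\<Sum>i=1..j. ln (real i - y) - ln (real i)))
      has_real_derivative 1 / x + (\<Sum>i=1..j. - 1 / (real i - x))) (at x)"
    using assms by (auto intro!: derivative_eq_intros simp: divide_inverse)
  moreover have "1 / x + (\<Sum>i=1..j. - 1 / (real i - x)) = 1 / x - hazard_sum x j"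
    by (simp add: hazard_sum_def sum_negf)
  ultimately show ?thesis
    using DERIV_cong_ev[OF refl eq refl] by simp
qed

lemma summable_inverse_square_shift:
  assumes "x < 1"
  shows "summable (\<lambda>s. 1 / (real (Suc s) - x)\<^sup>2)"
proof (rule summable_comparison_test')
  have "summable (\<lambda>s. inverse (real (Suc s) ^ 2))"
    using inverse_power_summable[of 2] by (subst summable_Suc_iff) auto
  then show "summable (\<lambda>s. 1 / (min 1 (1 - x))\<^sup>2 * inverse (real (Suc s) ^ 2))"
    by (rule summable_mult)
  fix s :: nat
  have "min 1 (1 - x) * real (Suc s) \<le> real (Suc s) - x"
  proof (cases "x \<ge> 0")
    case True
    then have "x * 1 \<le> x * real (Suc s)" by (intro mult_left_mono) auto
    then show ?thesis using True by (simp add: algebra_simps min_def)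
  qed (auto simp: min_def)
  then have "(min 1 (1 - x) * real (Suc s))\<^sup>2 \<le> (real (Suc s) - x)\<^sup>2"
    using assms by (intro power_mono) auto
  moreover have "0 < (min 1 (1 - x) * real (Suc s))\<^sup>2" using assms by (auto simp: min_def)
  ultimately have "1 / (real (Suc s) - x)\<^sup>2 \<le> 1 / (min 1 (1 - x) * real (Suc s))\<^sup>2"
    by (intro frac_le) auto
  then show "norm (1 / (real (Suc s) - x)\<^sup>2) \<le> 1 / (min 1 (1 - x))\<^sup>2 * inverse (real (Suc s) ^ 2)"
    by (simp add: power_mult_distrib divide_inverse)
qed

lemma summable_sibuya_information:
  assumes "0 < x" "x < 1"
  shows "summable (\<lambda>s. sibuya_tail x (Suc s) / (real (Suc s) - x)\<^sup>2)"
proof (rule summable_comparison_test'[OF summable_inverse_square_shift[OF assms(2)]])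
  show "norm (sibuya_tail x (Suc s) / (real (Suc s) - x)\<^sup>2) \<le> 1 / (real (Suc s) - x)\<^sup>2" for s
    using sibuya_tail_bounds[OF assms, of "Suc s"] by (simp add: divide_right_mono)
qed

text \<open>
The form in which the Fisher information appears as the limit of the observed information.
\<close>

lemma fisher_info_eq:
  assumes "0 < x" "x < 1"
  shows "fisher_info x = 1 / x\<^sup>2 + (\<Sum>s. sibuya_tail x (Suc s) / (real (Suc s) - x)\<^sup>2)"
proof -
  have "(\<lambda>n. 1 / x\<^sup>2 + (\<Sum>s<n. sibuya_tail x (Suc s) / (real (Suc s) - x)\<^sup>2)
         - sibuya_tail x n * (1 / x\<^sup>2 + (hazard_sum x n)\<^sup>2))
      \<longlonglongrightarrow> 1 / x\<^sup>2 + (\<Sum>s. sibuya_tail x (Suc s) / (real (Suc s) - x)\<^sup>2) - 0"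
    by (intro tendsto_intros summable_LIMSEQ summable_sibuya_information
        sibuya_tail_hazard_sum_tendsto assms)
  then have "(\<lambda>j. sibuya_prob x (Suc j) * (1 / x - hazard_sum x j)\<^sup>2) sums
      (1 / x\<^sup>2 + (\<Sum>s. sibuya_tail x (Suc s) / (real (Suc s) - x)\<^sup>2))"
    unfolding sums_def sum_sibuya_prob_score_squared[OF assms] by simp
  then show ?thesis
    unfolding fisher_info_def
    using DERIV_imp_deriv[OF DERIV_ln_sibuya_prob[OF assms]] by (simp add: sums_iff)
qed

lemma fisher_info_ge:
  assumes "0 < x" "x < 1"
  shows "1 / x\<^sup>2 \<le> fisher_info x"
  unfolding fisher_info_eq[OF assms]
  using suminf_nonneg[OF summable_sibuya_information[OF assms]] sibuya_tail_bounds[OF assms]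
  by (simp add: less_imp_le)

text \<open>
On \<open>{0<..<r}\<close> with \<open>r < 1\<close> the tails are at most 1 and \<open>s - y\<close> exceeds \<open>s - r\<close>, so the series converges uniformly.
\<close>

lemma isCont_fisher_info:
  assumes "0 < x" "x < 1"
  shows "isCont fisher_info x"
proof -
  define r where "r = (1 + x) / 2"
  have r: "x < r" "r < 1" using assms by (auto simp: r_def)
  have "uniform_limit {0<..<r} (\<lambda>n y. \<Sum>s<n. sibuya_tail y (Suc s) / (real (Suc s) - y)\<^sup>2)
      (\<lambda>y. \<Sum>s. sibuya_tail y (Suc s) / (real (Suc s) - y)\<^sup>2) sequentially"
  proof (rule Weierstrass_m_test)
    fix s y assume y: "y \<in> {0<..<r}"
    have "sibuya_tail y (Suc s) / (real (Suc s) - y)\<^sup>2 \<le> 1 / (real (Suc s) - r)\<^sup>2"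
      using y r sibuya_tail_bounds[of y "Suc s"] by (intro frac_le power_mono) auto
    then show "norm (sibuya_tail y (Suc s) / (real (Suc s) - y)\<^sup>2) \<le> 1 / (real (Suc s) - r)\<^sup>2"
      using y r sibuya_tail_bounds[of y "Suc s"] by simp
  qed (rule summable_inverse_square_shift[OF r(2)])
  then have "continuous_on {0<..<r} (\<lambda>y. \<Sum>s. sibuya_tail y (Suc s) / (real (Suc s) - y)\<^sup>2)"
  proof (rule uniform_limit_theorem[rotated])
    show "\<forall>\<^sub>F n in sequentially. continuous_on {0<..<r}
        (\<lambda>y. \<Sum>s<n. sibuya_tail y (Suc s) / (real (Suc s) - y)\<^sup>2)"
      unfolding sibuya_tail_def using r
      by (intro always_eventually allI continuous_intros) auto
  qed simp
  then have "continuous_on {0<..<r} (\<lambda>y. 1 / y\<^sup>2 + (\<Sum>s. sibuya_tail y (Suc s) / (real (Suc s) - y)\<^sup>2))"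
    by (intro continuous_intros) auto
  then have "continuous_on {0<..<r} fisher_info"
    by (rule continuous_on_eq) (use r in \<open>auto simp: fisher_info_eq\<close>)
  then show ?thesis
    using assms r by (simp add: continuous_on_eq_continuous_at)
qed

lemma norm_one_plus_ix_le: "norm (1 + \<i> * complex_of_real x) \<le> exp (x\<^sup>2 / 2)"
proof -
  have "norm (1 + \<i> * complex_of_real x) = sqrt (1 + x\<^sup>2)"
    by (simp add: cmod_def)
  also have "\<dots> \<le> sqrt (exp (x\<^sup>2))"
    using exp_ge_add_one_self[of "x\<^sup>2"] by simp
  also have "\<dots> = exp (x\<^sup>2 / 2)"
    by (rule real_sqrt_unique) (auto simp: power2_eq_square mult_exp_exp)
  finally show ?thesis .
qed

text \<open>
The two functions agree up to second order, and their difference is at most 2 everywhere; this covers small and large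
\<open>x\<close> with the same cubic bound.
\<close>

lemma norm_iexp_minus_tilted_le:
  fixes x :: real
  shows "norm (iexp x - (1 + \<i> * x) * exp (- x\<^sup>2 / 2)) \<le> 2 * \<bar>x\<bar> ^ 3"
proof (cases "\<bar>x\<bar> \<le> 1")
  case True
  define e where "e = exp (- x\<^sup>2 / 2)"
  have 1: "norm (iexp x - (\<Sum>k\<le>2. (\<i> * x) ^ k / fact k)) \<le> \<bar>x\<bar> ^ 3 / 6"
    using iexp_approx1[of x 2] by (simp add: fact_numeral eval_nat_numeral)
  have eq: "(\<Sum>k\<le>2. (\<i> * complex_of_real x) ^ k / fact k) = 1 + \<i> * x - x\<^sup>2 / 2"
    by (simp add: eval_nat_numeral algebra_simps)
  have 2: "\<bar>e - (1 - x\<^sup>2 / 2)\<bar> \<le> x ^ 4 / 8"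
  proof -
    have "e \<ge> 1 - x\<^sup>2 / 2" using exp_ge_add_one_self[of "- x\<^sup>2 / 2"] by (simp add: e_def)
    moreover have "e \<le> 1 - x\<^sup>2 / 2 + x ^ 4 / 8"
    proof -
      have "exp (- y) \<le> 1 - y + y\<^sup>2 / 2" if "y \<ge> 0" for y :: real
      proof -
        have "(\<lambda>z::real. 1 - z + z\<^sup>2 / 2 - exp (- z)) 0 \<le> (\<lambda>z. 1 - z + z\<^sup>2 / 2 - exp (- z)) y"
        proof (rule DERIV_nonneg_imp_nondecreasing[OF that])
          fix z :: real
          show "\<exists>d. ((\<lambda>z. 1 - z + z\<^sup>2 / 2 - exp (- z)) has_real_derivative d) (at z) \<and> 0 \<le> d"
            using exp_ge_add_one_self[of "- z"]
            by (intro exI[of _ "- 1 + z + exp (- z)"]) (auto intro!: derivative_eq_intros)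
        qed
        then show ?thesis by simp
      qed
      from this[of "x\<^sup>2 / 2"] show ?thesis by (simp add: e_def power_divide flip: power_mult)
    qed
    ultimately show ?thesis by (simp add: abs_le_iff)
  qed
  have "iexp x - (1 + \<i> * x) * e = (iexp x - (1 + \<i> * x - x\<^sup>2 / 2))
      - ((1 + \<i> * x) * complex_of_real (e - (1 - x\<^sup>2 / 2)) - \<i> * complex_of_real (x ^ 3 / 2))"
    by (simp add: algebra_simps power2_eq_square power3_eq_cube)
  also have "norm \<dots> \<le> norm (iexp x - (1 + \<i> * x - x\<^sup>2 / 2))
      + (norm ((1 + \<i> * x) * complex_of_real (e - (1 - x\<^sup>2 / 2))) + norm (\<i> * complex_of_real (x ^ 3 / 2)))"
    by (rule order_trans[OF norm_triangle_ineq4 add_left_mono[OF norm_triangle_ineq4]])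
  also have "\<dots> \<le> \<bar>x\<bar> ^ 3 / 6 + (2 * (x ^ 4 / 8) + \<bar>x\<bar> ^ 3 / 2)"
  proof (intro add_mono)
    show "norm (iexp x - (1 + \<i> * x - x\<^sup>2 / 2)) \<le> \<bar>x\<bar> ^ 3 / 6" using 1 eq by simp
    have "norm (1 + \<i> * complex_of_real x) \<le> 2"
      using norm_triangle_ineq[of 1 "\<i> * complex_of_real x"] True by (simp add: norm_mult)
    then show "norm ((1 + \<i> * x) * complex_of_real (e - (1 - x\<^sup>2 / 2))) \<le> 2 * (x ^ 4 / 8)"
      unfolding norm_mult norm_of_real using 2 by (intro mult_mono) auto
    show "norm (\<i> * complex_of_real (x ^ 3 / 2)) \<le> \<bar>x\<bar> ^ 3 / 2"
      by (simp add: norm_mult norm_divide norm_power)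
  qed
  also have "x ^ 4 \<le> \<bar>x\<bar> ^ 3"
    using True power_decreasing[of 3 4 "\<bar>x\<bar>"] by simp
  finally have "norm (iexp x - (1 + \<i> * x) * e) \<le> \<bar>x\<bar> ^ 3 / 6 + (2 * (\<bar>x\<bar> ^ 3 / 8) + \<bar>x\<bar> ^ 3 / 2)"
    by simp
  also have "\<dots> \<le> 2 * \<bar>x\<bar> ^ 3" by simp
  finally show ?thesis by (simp only: e_def)
next
  case False
  have "norm ((1 + \<i> * x) * exp (- x\<^sup>2 / 2)) \<le> exp (x\<^sup>2 / 2) * exp (- x\<^sup>2 / 2)"
    unfolding norm_mult by (intro mult_mono norm_one_plus_ix_le) auto
  then have "norm ((1 + \<i> * x) * exp (- x\<^sup>2 / 2)) \<le> 1"
    by (simp add: mult_exp_exp)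
  then have "norm (iexp x - (1 + \<i> * x) * exp (- x\<^sup>2 / 2)) \<le> 2"
    using norm_triangle_ineq4[of "iexp x" "(1 + \<i> * x) * exp (- x\<^sup>2 / 2)"] by simp
  moreover have "1 \<le> \<bar>x\<bar> ^ 3" using False by (intro one_le_power) auto
  ultimately show ?thesis by linarith
qed

section \<open>Recursive inequalities with power growth\<close>

text \<open>
Bernoulli's inequality for a fractional exponent, here an instance of Young's inequality.
\<close>

lemma one_minus_div_le_powr:
  assumes "0 \<le> c" "c \<le> 1" "n \<ge> (1::nat)"
  shows "1 - c / real n \<le> (real n / real (Suc n)) powr c"
proof -
  have "((real n + 1) / real n) powr c * 1 powr (1 - c) \<le> c * ((real n + 1) / real n) + (1 - c) * 1"
    using assms by (intro Youngs_inequality_0) auto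
  also have "\<dots> = 1 + c / real n" using assms by (simp add: field_simps)
  finally have 1: "((real n + 1) / real n) powr c \<le> 1 + c / real n" by simp
  have "(1 - c / real n) * ((real n + 1) / real n) powr c \<le> (1 - c / real n) * (1 + c / real n)"
    using assms by (intro mult_left_mono 1) (simp add: field_simps)
  also have "\<dots> \<le> 1" by (simp add: algebra_simps)
  finally have "1 - c / real n \<le> inverse (((real n + 1) / real n) powr c)"
    using assms by (simp add: field_simps)
  also have "\<dots> = (real n / real (Suc n)) powr c"
    using assms by (simp add: powr_minus[symmetric] powr_divide field_simps powr_minus_divide)
  finally show ?thesis .
qed

lemma recursion_powr_decay:
  fixes a :: "nat \<Rightarrow> real"
  assumes "0 \<le> c" "c \<le> 1" and "\<And>n. n \<ge> 1 \<Longrightarrow> 0 \<le> a n"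
    and rec: "\<And>n. n \<ge> 1 \<Longrightarrow> a (Suc n) \<le> a n * (1 - c / real n)" and "n \<ge> 1"
  shows "a n \<le> a 1 * real n powr - c"
  using \<open>n \<ge> 1\<close>
proof (induction n rule: nat_induct_at_least)
  case (Suc n)
  have "a (Suc n) \<le> a n * (real n / real (Suc n)) powr c"
    using rec[OF Suc.hyps] assms(3)[OF Suc.hyps] one_minus_div_le_powr[OF assms(1,2) Suc.hyps]
    by (meson mult_left_mono order_trans)
  also have "\<dots> \<le> (a 1 * real n powr - c) * (real n / real (Suc n)) powr c"
    using Suc.IH by (intro mult_right_mono) auto
  also have "\<dots> = a 1 * real (Suc n) powr - c"
    using Suc.hyps by (simp add: powr_divide powr_minus field_simps)
  finally show ?case .
qed simp

lemma recursion_powr_growth: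
  fixes a :: "nat \<Rightarrow> real"
  assumes "0 \<le> c" and "\<And>n. n \<ge> 1 \<Longrightarrow> 0 \<le> a n"
    and rec: "\<And>n. n \<ge> 1 \<Longrightarrow> a (Suc n) \<le> a n * (1 + c / real n)" and "n \<ge> 1"
  shows "a n \<le> a 1 * (1 + c) * real n powr c"
proof -
  \<comment> \<open>A product of factors \<open>1 + c / j\<close> compares directly with a power of \<open>n\<close> only after a shift of the
    index by one; the first factor \<open>1 + c\<close> is kept as a constant.\<close>
  have shifted: "a (Suc n) \<le> a 1 * (1 + c) * real n powr c" if "n \<ge> 1" for n
    using that
  proof (induction n rule: nat_induct_at_least)
    case base
    show ?case using rec[of 1] by simp
  next
    case (Suc n)
    have n: "real n > 0" using Suc.hyps by simp
    have "1 + c / real (Suc n) \<le> exp (c / real (Suc n))"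
      by (rule exp_ge_add_one_self)
    also have "\<dots> \<le> (real (Suc n) / real n) powr c"
    proof -
      have "ln (real n / real (Suc n)) \<le> real n / real (Suc n) - 1"
        using n by (intro ln_le_minus_one) auto
      also have "\<dots> = - 1 / real (Suc n)" by (simp add: field_simps)
      finally have "1 / real (Suc n) \<le> ln (real (Suc n) / real n)"
        using n by (simp add: ln_divide_pos)
      then have "c * (1 / real (Suc n)) \<le> c * ln (real (Suc n) / real n)"
        using assms by (intro mult_left_mono) auto
      then show ?thesis using n by (simp add: powr_def)
    qed
    finally have 1: "1 + c / real (Suc n) \<le> (real (Suc n) / real n) powr c" .
    have "a (Suc (Suc n)) \<le> a (Suc n) * (1 + c / real (Suc n))"
      by (rule rec) simp
    also have "\<dots> \<le> (a 1 * (1 + c) * real n powr c) * (real (Suc n) / real n) powr c"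
      using Suc.IH 1 assms(1) assms(2)[of 1] by (intro mult_mono) auto
    also have "\<dots> = a 1 * (1 + c) * real (Suc n) powr c"
      using n by (simp add: powr_divide)
    finally show ?case .
  qed
  show ?thesis
  proof (cases "n = 1")
    case True
    then show ?thesis using assms(1) assms(2)[of 1] by (simp add: algebra_simps)
  next
    case False
    then obtain m where m: "n = Suc m" "m \<ge> 1" using \<open>n \<ge> 1\<close> by (cases n) auto
    have "a n \<le> a 1 * (1 + c) * real m powr c" unfolding m(1) by (rule shifted[OF m(2)])
    also have "\<dots> \<le> a 1 * (1 + c) * real n powr c"
      using m assms(1) assms(2)[of 1] by (intro mult_left_mono powr_mono2) auto
    finally show ?thesis .
  qed
qed

lemma sum_powr_minus_one_le:
  assumes "0 < c" "c \<le> 1"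
  shows "(\<Sum>j=1..<n. real j powr (c - 1)) \<le> real n powr c / c"
proof -
  have *: "(\<Sum>j=1..<Suc n. real j powr (c - 1)) \<le> real n powr c / c" for n
  proof (induction n)
    case 0 then show ?case using assms by simp
  next
    case (Suc n)
    have "(real n / real (Suc n)) powr c * 1 powr (1 - c) \<le> c * (real n / real (Suc n)) + (1 - c) * 1"
    proof (cases "n = 0")
      case False
      then show ?thesis using assms by (intro Youngs_inequality_0) auto
    qed (use assms in auto)
    then have "real n powr c / real (Suc n) powr c \<le> 1 - c / real (Suc n)"
      by (simp add: powr_divide field_simps del: of_nat_Suc) (simp add: field_simps)
    then have "real n powr c \<le> real (Suc n) powr c - c * (real (Suc n) powr c / real (Suc n))"
      by (simp add: field_simps)
    also have "real (Suc n) powr c / real (Suc n) = real (Suc n) powr (c - 1)"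
      by (simp add: powr_diff)
    finally have le: "real n powr c \<le> real (Suc n) powr c - c * real (Suc n) powr (c - 1)" .
    have "real n powr c / c + real (Suc n) powr (c - 1) \<le> real (Suc n) powr c / c"
    proof -
      have "real n powr c / c \<le> (real (Suc n) powr c - c * real (Suc n) powr (c - 1)) / c"
        using assms by (intro divide_right_mono le) auto
      also have "\<dots> = real (Suc n) powr c / c - real (Suc n) powr (c - 1)"
        using assms by (simp add: diff_divide_distrib del: of_nat_Suc)
      finally show ?thesis by simp
    qed
    then show ?case using Suc by simp
  qed
  show ?thesis
  proof (cases n)
    case (Suc m)
    have "(\<Sum>j=1..<n. real j powr (c - 1)) \<le> real m powr c / c" unfolding Suc by (rule *)
    also have "\<dots> \<le> real n powr c / c"
      using assms Suc by (intro divide_right_mono powr_mono2) auto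
    finally show ?thesis .
  qed simp
qed

lemma sum_inverse_le_ln:
  assumes "1 \<le> m" "m \<le> n"
  shows "(\<Sum>j=m..<n. 1 / real j) \<le> 1 + ln (real n)"
proof -
  have "(\<Sum>j=m..<n. 1 / real j) \<le> (\<Sum>j=1..n. 1 / real j)"
    using assms by (intro sum_mono2) auto
  also have "\<dots> = harm n" by (simp add: harm_def divide_inverse)
  also have "\<dots> \<le> ln (real n) + 1"
    using assms euler_mascheroni_sequence_decreasing[of 1 n] by (simp add: harm_expand)
  finally show ?thesis by simp
qed

section \<open>A criterion for stable convergence to an independent normal variable\<close>

context prob_space
begin

text \<open>
The functionals \<open>f \<mapsto> E (f * Z n)\<close> are uniformly Lipschitz in \<open>L\<^sup>1\<close>, so that their convergence passes to \<open>L\<^sup>1\<close> limits.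
\<close>

lemma weak_limit_closed_L1:
  fixes Z :: "nat \<Rightarrow> 'a \<Rightarrow> real" and s :: "nat \<Rightarrow> 'a \<Rightarrow> real"
  assumes Z: "\<And>n. Z n \<in> borel_measurable M" "\<And>n \<omega>. \<bar>Z n \<omega>\<bar> \<le> B"
    and f: "integrable M f" and s: "\<And>i. integrable M (s i)"
    and lim: "\<And>i. (\<lambda>n. \<integral>\<omega>. s i \<omega> * Z n \<omega> \<partial>M) \<longlonglongrightarrow> (\<integral>\<omega>. s i \<omega> \<partial>M) * c"
    and L1: "(\<lambda>i. \<integral>\<omega>. \<bar>f \<omega> - s i \<omega>\<bar> \<partial>M) \<longlonglongrightarrow> 0"
  shows "(\<lambda>n. \<integral>\<omega>. f \<omega> * Z n \<omega> \<partial>M) \<longlonglongrightarrow> (\<integral>\<omega>. f \<omega> \<partial>M) * c"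
proof (rule LIMSEQ_I)
  fix e :: real assume "e > 0"
  have "B \<ge> 0" using Z(2)[of undefined undefined] by linarith
  define d where "d = e / (2 * (B + \<bar>c\<bar> + 1))"
  have "d > 0" using \<open>e > 0\<close> \<open>B \<ge> 0\<close> by (simp add: d_def)
  from L1 have "\<forall>\<^sub>F i in sequentially. (\<integral>\<omega>. \<bar>f \<omega> - s i \<omega>\<bar> \<partial>M) < d"
    using \<open>d > 0\<close> by (rule order_tendstoD(2))
  then obtain i where i: "(\<integral>\<omega>. \<bar>f \<omega> - s i \<omega>\<bar> \<partial>M) < d"
    by (auto simp: eventually_sequentially)
  have int: "integrable M (\<lambda>\<omega>. g \<omega> * Z n \<omega>)" if "integrable M g" for g n
    by (rule Bochner_Integration.integrable_bound[of M "\<lambda>\<omega>. B * g \<omega>"])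
      (use that Z \<open>B \<ge> 0\<close> in \<open>auto simp: abs_mult mult.commute[of B] intro!: mult_left_mono\<close>)
  have close: "\<bar>(\<integral>\<omega>. f \<omega> * Z n \<omega> \<partial>M) - (\<integral>\<omega>. s i \<omega> * Z n \<omega> \<partial>M)\<bar> \<le> B * d" for n
  proof -
    have "\<bar>(\<integral>\<omega>. f \<omega> * Z n \<omega> \<partial>M) - (\<integral>\<omega>. s i \<omega> * Z n \<omega> \<partial>M)\<bar> = \<bar>\<integral>\<omega>. (f \<omega> - s i \<omega>) * Z n \<omega> \<partial>M\<bar>"
      using int[OF f] int[OF s] by (simp add: left_diff_distrib)
    also have "\<dots> \<le> (\<integral>\<omega>. B * \<bar>f \<omega> - s i \<omega>\<bar> \<partial>M)"
      by (rule order_trans[OF integral_abs_bound integral_mono])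
        (use integrable_abs[OF int[of "\<lambda>\<omega>. f \<omega> - s i \<omega>" n]] f s Z in \<open>auto simp: abs_mult mult.commute[of B] intro!: mult_left_mono\<close>)
    also have "\<dots> \<le> B * d" using i \<open>B \<ge> 0\<close> by (simp add: mult_left_mono)
    finally show ?thesis .
  qed
  have close': "\<bar>(\<integral>\<omega>. f \<omega> \<partial>M) - (\<integral>\<omega>. s i \<omega> \<partial>M)\<bar> \<le> d"
  proof -
    have "\<bar>(\<integral>\<omega>. f \<omega> \<partial>M) - (\<integral>\<omega>. s i \<omega> \<partial>M)\<bar> = \<bar>\<integral>\<omega>. f \<omega> - s i \<omega> \<partial>M\<bar>"
      using f s by simp
    also have "\<dots> \<le> (\<integral>\<omega>. \<bar>f \<omega> - s i \<omega>\<bar> \<partial>M)" by (rule integral_abs_bound)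
    finally show ?thesis using i by simp
  qed
  from LIMSEQ_D[OF lim[of i], of "e / 2"] \<open>e > 0\<close> obtain n0 where
    n0: "\<And>n. n \<ge> n0 \<Longrightarrow> \<bar>(\<integral>\<omega>. s i \<omega> * Z n \<omega> \<partial>M) - (\<integral>\<omega>. s i \<omega> \<partial>M) * c\<bar> < e / 2"
    by auto
  have "norm ((\<integral>\<omega>. f \<omega> * Z n \<omega> \<partial>M) - (\<integral>\<omega>. f \<omega> \<partial>M) * c) < e" if "n \<ge> n0" for n
  proof -
    have "\<bar>(\<integral>\<omega>. s i \<omega> \<partial>M) * c - (\<integral>\<omega>. f \<omega> \<partial>M) * c\<bar> \<le> d * \<bar>c\<bar>"
      using close' by (simp add: left_diff_distrib[symmetric] abs_mult mult_right_mono abs_minus_commute)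
    then have "\<bar>(\<integral>\<omega>. f \<omega> * Z n \<omega> \<partial>M) - (\<integral>\<omega>. f \<omega> \<partial>M) * c\<bar> < B * d + e / 2 + d * \<bar>c\<bar>"
      using close[of n] n0[OF that] by linarith
    also have "\<dots> = d * (B + \<bar>c\<bar>) + e / 2" by (simp add: algebra_simps)
    also have "\<dots> \<le> d * (B + \<bar>c\<bar> + 1) + e / 2" using \<open>d > 0\<close> by (simp add: mult_left_mono)
    also have "d * (B + \<bar>c\<bar> + 1) = e / 2" using \<open>B \<ge> 0\<close> by (simp add: d_def field_simps)
    finally show ?thesis by simp
  qed
  then show "\<exists>n0. \<forall>n\<ge>n0. norm ((\<integral>\<omega>. f \<omega> * Z n \<omega> \<partial>M) - (\<integral>\<omega>. f \<omega> \<partial>M) * c) < e" by blast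
qed

text \<open>
Levy's continuity theorem under the conditional law given \<open>A\<close>.
\<close>

lemma weak_limit_on_event:
  fixes X :: "nat \<Rightarrow> 'a \<Rightarrow> real" and h :: "real \<Rightarrow> real"
  assumes X [measurable]: "\<And>n. X n \<in> borel_measurable M" and A [measurable]: "A \<in> events"
    and char: "\<And>t. (\<lambda>n. \<integral>\<omega>. indicator A \<omega> * iexp (t * X n \<omega>) \<partial>M) \<longlonglongrightarrow> prob A * exp (- t\<^sup>2 / 2)"
    and h: "continuous_on UNIV h" "\<And>x. \<bar>h x\<bar> \<le> B"
  shows "(\<lambda>n. \<integral>\<omega>. indicator A \<omega> * h (X n \<omega>) \<partial>M) \<longlonglongrightarrow> prob A * (\<integral>x. h x \<partial>std_normal_distribution)"
proof (cases "prob A = 0")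
  case True
  then have "AE \<omega> in M. \<omega> \<notin> A"
    using A by (simp add: prob_eq_0)
  then have "(\<integral>\<omega>. indicator A \<omega> * h (X n \<omega>) \<partial>M) = 0" for n
    by (intro integral_eq_zero_AE) (auto simp: indicator_def)
  then show ?thesis using True by simp
next
  case False
  then have pA: "prob A > 0" by (simp add: zero_less_measure_iff)
  have [measurable]: "h \<in> borel_measurable borel" using h(1) by (rule borel_measurable_continuous_onI)
  define Q where "Q = density M (\<lambda>\<omega>. ennreal (indicator A \<omega> / prob A))"
  have int_Q: "(\<integral>\<omega>. g \<omega> \<partial>Q) = (\<integral>\<omega>. (indicator A \<omega> / prob A) *\<^sub>R g \<omega> \<partial>M)"
    if [measurable]: "g \<in> borel_measurable M" for g :: "'a \<Rightarrow> 'b::{banach, second_countable_topology}"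
    unfolding Q_def by (rule integral_density) auto
  interpret Q: prob_space Q
  proof
    have "emeasure Q (space Q) = (\<integral>\<^sup>+ \<omega>. ennreal (1 / prob A) * indicator A \<omega> \<partial>M)"
      unfolding Q_def by (subst emeasure_density) (auto intro!: nn_integral_cong split: split_indicator)
    also have "\<dots> = ennreal (1 / prob A) * ennreal (prob A)"
      by (subst nn_integral_cmult_indicator) (auto simp: emeasure_eq_measure)
    also have "\<dots> = 1" using pA by (simp flip: ennreal_mult)
    finally show "emeasure Q (space Q) = 1" .
  qed
  have XQ [measurable]: "X n \<in> borel_measurable Q" for n by (simp add: Q_def)
  have "weak_conv_m (\<lambda>n. distr Q borel (X n)) std_normal_distribution"
  proof (rule levy_continuity)
    show "real_distribution (distr Q borel (X n))" for n by (rule Q.real_distribution_distr) simp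
    show "real_distribution std_normal_distribution" by (rule real_dist_normal_dist)
    fix t
    have "char (distr Q borel (X n)) t = (\<integral>\<omega>. indicator A \<omega> * iexp (t * X n \<omega>) \<partial>M) / prob A" for n
    proof -
      have *: "(indicator A \<omega> / prob A) *\<^sub>R z = (indicator A \<omega> * z) / prob A" for \<omega> and z :: complex
        by (simp add: scaleR_conv_of_real divide_inverse split: split_indicator)
      show ?thesis
        unfolding char_def by (subst integral_distr) (simp_all add: int_Q *)
    qed
    moreover have "(\<lambda>n. (\<integral>\<omega>. indicator A \<omega> * iexp (t * X n \<omega>) \<partial>M) / prob A)
        \<longlonglongrightarrow> complex_of_real (prob A * exp (- t\<^sup>2 / 2)) / complex_of_real (prob A)"
      using pA by (intro tendsto_divide char tendsto_const) auto
    ultimately show "(\<lambda>n. char (distr Q borel (X n)) t) \<longlonglongrightarrow> char std_normal_distribution t"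
      using pA by (simp add: char_std_normal_distribution)
  qed
  then have "(\<lambda>n. integral\<^sup>L (distr Q borel (X n)) h) \<longlonglongrightarrow> integral\<^sup>L std_normal_distribution h"
    using h by (intro weak_conv_imp_integral_bdd_continuous_conv[where B=B])
      (auto simp: continuous_on_eq_continuous_at intro!: Q.real_distribution_distr real_dist_normal_dist)
  moreover have "integral\<^sup>L (distr Q borel (X n)) h = (\<integral>\<omega>. indicator A \<omega> * h (X n \<omega>) \<partial>M) / prob A" for n
    by (subst integral_distr) (simp_all add: int_Q)
  ultimately have "(\<lambda>n. (\<integral>\<omega>. indicator A \<omega> * h (X n \<omega>) \<partial>M) / prob A * prob A)
      \<longlonglongrightarrow> integral\<^sup>L std_normal_distribution h * prob A"
    by (intro tendsto_mult tendsto_const) simp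
  then show ?thesis using pA by (simp add: mult.commute)
qed

text \<open>
To test against an integrable \<open>f\<close>, one may replace \<open>f\<close> by its conditional expectation, which is \<open>G\<close>-measurable, and
then drop the conditional expectation of \<open>h (X n)\<close>. Limits against \<open>G\<close>-measurable functions are obtained from those
on \<open>E\<close> by a Dynkin argument followed by approximation in \<open>L\<^sup>1\<close>. Independence of \<open>N\<close> from \<open>G\<close> turns the limit into the
required one.
\<close>

lemma stable_conv_std_normalI:
  fixes X :: "nat \<Rightarrow> 'a \<Rightarrow> real"
  assumes G: "space G = space M" "sets G = sigma_sets (space M) E"
    and E: "Int_stable E" "E \<subseteq> events" "space M \<in> E"
    and XM [measurable]: "\<And>n. X n \<in> borel_measurable M"
    and char: "\<And>A t. A \<in> E \<Longrightarrow>
       (\<lambda>n. \<integral>\<omega>. indicator A \<omega> * iexp (t * X n \<omega>) \<partial>M) \<longlonglongrightarrow> prob A * exp (- t\<^sup>2 / 2)"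
    and N [measurable]: "N \<in> borel_measurable M" and distr_N: "distr M borel N = std_normal_distribution"
    and indep: "indep_set (sets G) (sets (vimage_algebra (space M) N borel))"
  shows "stable_conv M G X N"
proof -
  have subalg: "subalgebra M G"
    unfolding subalgebra_def using G sets.sigma_sets_subset[OF E(2)] by auto
  interpret G: finite_measure_subalgebra M G
    by unfold_locales (rule subalg)
  {
    fix f :: "'a \<Rightarrow> real" and h :: "real \<Rightarrow> real"
    assume f: "integrable M f" and h: "continuous_on UNIV h" "bounded (range h)"
    have [measurable]: "h \<in> borel_measurable borel" using h(1) by (rule borel_measurable_continuous_onI)
    from h(2) obtain B where B: "\<bar>h x\<bar> \<le> B" for x by (auto simp: bounded_iff)
    define c where "c = (\<integral>x. h x \<partial>std_normal_distribution)"
    \<comment> \<open>\<open>?lim g\<close> says that \<open>h (X n)\<close> is asymptotically uncorrelated with \<open>g\<close>.\<close>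
    let ?lim = "\<lambda>g. integrable M g \<and> (\<lambda>n. \<integral>\<omega>. g \<omega> * h (X n \<omega>) \<partial>M) \<longlonglongrightarrow> (\<integral>\<omega>. g \<omega> \<partial>M) * c"
    have int: "integrable M (\<lambda>\<omega>. g \<omega> * h (Y \<omega>))" if [measurable]: "integrable M g" "Y \<in> borel_measurable M" for g Y
      by (rule Bochner_Integration.integrable_bound[of M "\<lambda>\<omega>. B * g \<omega>"])
        (use that B order_trans[OF abs_ge_zero B] in \<open>auto simp: abs_mult mult.commute[of B] intro!: mult_left_mono\<close>)
    have closed: "?lim g" if "integrable M g" "\<And>i. ?lim (s i)" "(\<lambda>i. \<integral>\<omega>. \<bar>g \<omega> - s i \<omega>\<bar> \<partial>M) \<longlonglongrightarrow> 0"
      for g and s :: "nat \<Rightarrow> 'a \<Rightarrow> real"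
      using that by (auto intro!: weak_limit_closed_L1[of "\<lambda>n \<omega>. h (X n \<omega>)" B g s c] B)
    have add: "?lim (\<lambda>\<omega>. f \<omega> + g \<omega>)" if "?lim f" "?lim g" for f g
    proof -
      have "(\<lambda>n. (\<integral>\<omega>. f \<omega> * h (X n \<omega>) \<partial>M) + (\<integral>\<omega>. g \<omega> * h (X n \<omega>) \<partial>M)) \<longlonglongrightarrow>
          (\<integral>\<omega>. f \<omega> \<partial>M) * c + (\<integral>\<omega>. g \<omega> \<partial>M) * c"
        using that by (intro tendsto_add) auto
      then show ?thesis using that int by (simp add: distrib_right)
    qed
    have scale: "?lim (\<lambda>\<omega>. a * f \<omega>)" if "?lim f" for f a
    proof -
      have "(\<lambda>n. a * (\<integral>\<omega>. f \<omega> * h (X n \<omega>) \<partial>M)) \<longlonglongrightarrow> a * ((\<integral>\<omega>. f \<omega> \<partial>M) * c)"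
        using that by (intro tendsto_mult tendsto_const) auto
      then show ?thesis using that by (simp add: mult.assoc)
    qed
    have intind: "integrable M (indicator A :: _ \<Rightarrow> real)" if "A \<in> events" for A
      using that by (rule integrable_real_indicator) (simp add: less_top[symmetric])
    have EP: "E \<subseteq> Pow (space M)" using E(2) sets.sets_into_space by auto
    have ind: "?lim (indicator A)" if "A \<in> sigma_sets (space M) E" for A
      using E(1) EP that
    proof (induction A rule: sigma_sets_induct_disjoint)
      fix A assume A: "A \<in> E"
      have [measurable]: "A \<in> events" using A E(2) by auto
      show "?lim (indicator A)"
        using weak_limit_on_event[OF XM _ char[OF A] h(1) B] intind[of A] by (auto simp: c_def)
    next
      show "?lim (indicator {})" by simp
    next
      fix A assume A: "A \<in> sigma_sets (space M) E" "?lim (indicator A)"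
      have AM [measurable]: "A \<in> events" using A(1) G(2) subalg by (auto simp: subalgebra_def)
      have sp: "?lim (indicator (space M))"
        using weak_limit_on_event[OF XM _ char[OF E(3)] h(1) B] intind[of "space M"] by (auto simp: c_def)
      have "?lim (\<lambda>\<omega>. indicator (space M) \<omega> + (- 1) * indicator A \<omega>)"
        by (intro add sp scale A)
      moreover have "indicator (space M) \<omega> + (- 1) * indicator A \<omega> = (indicator (space M - A) \<omega> :: real)" for \<omega>
        using sets.sets_into_space[OF AM] by (auto split: split_indicator)
      ultimately show "?lim (indicator (space M - A))" by simp
    next
      fix A :: "nat \<Rightarrow> 'a set"
      assume disj: "disjoint_family A" and A: "range A \<subseteq> sigma_sets (space M) E"
        and lim: "\<And>i. ?lim (indicator (A i))"
      have [measurable]: "A i \<in> events" for i using A G(2) subalg by (auto simp: subalgebra_def)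
      have s: "?lim (\<lambda>\<omega>. \<Sum>i<k. indicator (A i) \<omega>)" for k
      proof (induction k)
        case (Suc k) show ?case using add[OF Suc lim[of k]] by simp
      qed simp
      have sum_ind: "(\<Sum>i<k. indicator (A i) \<omega>) = (indicator (\<Union>i<k. A i) \<omega> :: real)" for k \<omega>
        by (rule indicator_UN_disjoint[symmetric]) (use disj in \<open>auto simp: disjoint_family_on_def\<close>)
      show "?lim (indicator (\<Union>i. A i))"
      proof (rule closed[OF _ s])
        have "(\<lambda>k. \<integral>\<omega>. \<bar>indicator (\<Union>i. A i) \<omega> - (\<Sum>i<k. indicator (A i) \<omega>)\<bar> \<partial>M)
            \<longlonglongrightarrow> (\<integral>\<omega>. 0 \<partial>M :: real)"
        proof (rule integral_dominated_convergence[where w="\<lambda>_. 1"])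
          show "AE \<omega> in M. (\<lambda>k. \<bar>indicator (\<Union>i. A i) \<omega> - (\<Sum>i<k. indicator (A i) \<omega>)\<bar>) \<longlonglongrightarrow> (0::real)"
          proof (rule AE_I2, rule tendsto_eventually)
            fix \<omega>
            show "\<forall>\<^sub>F k in sequentially. \<bar>indicator (\<Union>i. A i) \<omega> - (\<Sum>i<k. indicator (A i) \<omega>)\<bar> = (0::real)"
            proof (cases "\<omega> \<in> (\<Union>i. A i)")
              case True
              then obtain i where "\<omega> \<in> A i" by auto
              then have "\<omega> \<in> (\<Union>i<k. A i)" if "k > i" for k using that by auto
              then show ?thesis using True unfolding sum_ind
                by (intro eventually_mono[OF eventually_gt_at_top[of i]]) auto
            qed (auto simp: sum_ind)
          qed
        qed (auto simp: sum_ind split: split_indicator)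
        then show "(\<lambda>k. \<integral>\<omega>. \<bar>indicator (\<Union>i. A i) \<omega> - (\<Sum>i<k. indicator (A i) \<omega>)\<bar> \<partial>M) \<longlonglongrightarrow> (0::real)"
          by simp
      qed (intro intind, auto)
    qed
    have gen: "?lim g" if "integrable (restr_to_subalg M G) g" for g
      using that
    proof (induction g rule: integrable_induct)
      case (base A a)
      then show ?case using scale[OF ind[of A], of a] G(2)
        by (simp add: sets_restr_to_subalg[OF subalg] mult.commute)
    next
      case (add f g)
      then show ?case using \<open>\<And>f g. ?lim f \<Longrightarrow> ?lim g \<Longrightarrow> ?lim (\<lambda>\<omega>. f \<omega> + g \<omega>)\<close> by blast
    next
      case (lim f s)
      have fM: "integrable M f" "\<And>i. integrable M (s i)"
        using lim(1,4) integrable_from_subalg[OF subalg] by auto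
      show ?case
      proof (rule closed[OF fM(1) lim(5)])
        have "(\<lambda>i. \<integral>\<omega>. \<bar>f \<omega> - s i \<omega>\<bar> \<partial>M) \<longlonglongrightarrow> (\<integral>\<omega>. 0 \<partial>M)"
        proof (rule integral_dominated_convergence[where w="\<lambda>\<omega>. 3 * \<bar>f \<omega>\<bar>"])
          show "AE \<omega> in M. (\<lambda>i. \<bar>f \<omega> - s i \<omega>\<bar>) \<longlonglongrightarrow> 0"
            using lim(2) by (auto intro!: AE_I2 tendsto_eq_intros simp: space_restr_to_subalg)
          show "AE \<omega> in M. norm \<bar>f \<omega> - s i \<omega>\<bar> \<le> 3 * \<bar>f \<omega>\<bar>" for i
          proof (rule AE_I2)
            fix \<omega> assume "\<omega> \<in> space M"
            then have "norm (s i \<omega>) \<le> 2 * norm (f \<omega>)"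
              using lim(3) by (auto simp: space_restr_to_subalg)
            then show "norm \<bar>f \<omega> - s i \<omega>\<bar> \<le> 3 * \<bar>f \<omega>\<bar>" by simp
          qed
        qed (use fM in auto)
        then show "(\<lambda>i. \<integral>\<omega>. \<bar>f \<omega> - s i \<omega>\<bar> \<partial>M) \<longlonglongrightarrow> 0" by simp
      qed
    qed
    \<comment> \<open>Conditional expectation is self-adjoint, so that it can be moved from \<open>h (Y)\<close> to \<open>f\<close>.\<close>
    define g where "g = real_cond_exp M G f"
    have gG [measurable]: "g \<in> borel_measurable G" by (simp add: g_def)
    have gM: "integrable M g" "(\<integral>\<omega>. g \<omega> \<partial>M) = (\<integral>\<omega>. f \<omega> \<partial>M)"
      using G.real_cond_exp_int[OF f] by (auto simp: g_def)
    have [measurable]: "g \<in> borel_measurable M" "f \<in> borel_measurable M" using gM f by auto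
    have swap: "(\<integral>\<omega>. f \<omega> * real_cond_exp M G (\<lambda>\<omega>. h (Y \<omega>)) \<omega> \<partial>M) = (\<integral>\<omega>. g \<omega> * h (Y \<omega>) \<partial>M)"
      if [measurable]: "Y \<in> borel_measurable M" for Y
    proof -
      let ?e = "real_cond_exp M G (\<lambda>\<omega>. h (Y \<omega>))"
      have hY: "integrable M (\<lambda>\<omega>. h (Y \<omega>))"
        by (rule integrable_const_bound[of _ B]) (auto intro: B)
      have le: "AE \<omega> in M. ?e \<omega> \<le> B" "AE \<omega> in M. - B \<le> ?e \<omega>"
        using B by (auto intro!: G.real_cond_exp_le_c G.real_cond_exp_ge_c hY simp: abs_le_iff
            intro: minus_le_iff[THEN iffD1])
      have "integrable M (\<lambda>\<omega>. ?e \<omega> * f \<omega>)"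
      proof (rule Bochner_Integration.integrable_bound[of M "\<lambda>\<omega>. B * f \<omega>"])
        show "AE \<omega> in M. norm (?e \<omega> * f \<omega>) \<le> norm (B * f \<omega>)"
          using le by eventually_elim (auto simp: abs_mult intro!: mult_right_mono)
      qed (use f in auto)
      then have "(\<integral>\<omega>. ?e \<omega> * f \<omega> \<partial>M) = (\<integral>\<omega>. ?e \<omega> * g \<omega> \<partial>M)"
        unfolding g_def by (intro G.real_cond_exp_intg(2)[symmetric]) auto
      also have "\<dots> = (\<integral>\<omega>. g \<omega> * h (Y \<omega>) \<partial>M)"
        using G.real_cond_exp_intg(2)[OF int[OF gM(1) that]] by (simp add: mult.commute)
      finally show ?thesis by (simp add: mult.commute)
    qed
    have "integrable (restr_to_subalg M G) g"
      by (rule integrable_in_subalg[OF subalg gG gM(1)])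
    then have "(\<lambda>n. \<integral>\<omega>. g \<omega> * h (X n \<omega>) \<partial>M) \<longlonglongrightarrow> (\<integral>\<omega>. g \<omega> \<partial>M) * c"
      using gen by blast
    moreover have "(\<integral>\<omega>. g \<omega> * h (N \<omega>) \<partial>M) = (\<integral>\<omega>. g \<omega> \<partial>M) * c"
    proof -
      have "indep_var borel g borel (\<lambda>\<omega>. h (N \<omega>))"
        unfolding indep_var_eq
      proof (intro conjI)
        show "indep_set (sigma_sets (space M) {g -` A \<inter> space M |A. A \<in> sets borel})
            (sigma_sets (space M) {(\<lambda>\<omega>. h (N \<omega>)) -` A \<inter> space M |A. A \<in> sets borel})"
        proof (intro indep_setI)
          have 1: "sigma_sets (space M) {g -` A \<inter> space M |A. A \<in> sets borel} \<subseteq> sets G"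
            using measurable_sets[OF gG] G(1) by (auto intro!: sets.sigma_sets_subset[of _ G, unfolded G(1)])
          have 2: "sigma_sets (space M) {(\<lambda>\<omega>. h (N \<omega>)) -` A \<inter> space M |A. A \<in> sets borel}
              \<subseteq> sets (vimage_algebra (space M) N borel)"
          proof -
            have "(\<lambda>\<omega>. h (N \<omega>)) -` A \<inter> space M \<in> sets (vimage_algebra (space M) N borel)" if "A \<in> sets borel" for A
            proof -
              have "h -` A \<in> sets borel" using measurable_sets[of h borel borel A] that by simp
              then have "N -` (h -` A) \<inter> space M \<in> sets (vimage_algebra (space M) N borel)"
                by (rule in_vimage_algebra)
              then show ?thesis by (simp add: vimage_def)
            qed
            then have "{(\<lambda>\<omega>. h (N \<omega>)) -` A \<inter> space M |A. A \<in> sets borel}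
                \<subseteq> sets (vimage_algebra (space M) N borel)" by auto
            from sets.sigma_sets_subset[OF this] show ?thesis by simp
          qed
          show "sigma_sets (space M) {g -` A \<inter> space M |A. A \<in> sets borel} \<subseteq> events"
            using 1 subalg by (auto simp: subalgebra_def)
          show "sigma_sets (space M) {(\<lambda>\<omega>. h (N \<omega>)) -` A \<inter> space M |A. A \<in> sets borel} \<subseteq> events"
            by (intro sets.sigma_sets_subset) auto
          fix a b assume "a \<in> sigma_sets (space M) {g -` A \<inter> space M |A. A \<in> sets borel}"
            "b \<in> sigma_sets (space M) {(\<lambda>\<omega>. h (N \<omega>)) -` A \<inter> space M |A. A \<in> sets borel}"
          then show "prob (a \<inter> b) = prob a * prob b"
            using indep_setD[OF indep] 1 2 by auto
        qed
      qed auto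
      then have "(\<integral>\<omega>. g \<omega> * h (N \<omega>) \<partial>M) = (\<integral>\<omega>. g \<omega> \<partial>M) * (\<integral>\<omega>. h (N \<omega>) \<partial>M)"
        by (rule indep_var_lebesgue_integral)
          (auto intro!: gM integrable_const_bound[of _ B] B)
      also have "(\<integral>\<omega>. h (N \<omega>) \<partial>M) = c"
        unfolding c_def distr_N[symmetric] by (subst integral_distr) auto
      finally show ?thesis .
    qed
    ultimately have "(\<lambda>n. \<integral>\<omega>. f \<omega> * real_cond_exp M G (\<lambda>\<omega>. h (X n \<omega>)) \<omega> \<partial>M)
          \<longlonglongrightarrow> (\<integral>\<omega>. f \<omega> * real_cond_exp M G (\<lambda>\<omega>. h (N \<omega>)) \<omega> \<partial>M)"
      by (simp add: swap)
  }
  then show ?thesis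
    unfolding stable_conv_def using subalg by auto
qed

end

section \<open>Growth of a partition as a sequence of joined block sizes\<close>

text \<open>
For a state \<open>Z\<close> with finitely many values this is measurability of \<open>X\<close> with respect to the \<open>\<sigma>\<close>-field of \<open>Z\<close>, but for
functions into any type and without measurability side conditions.
\<close>

definition determined_by :: "'a measure \<Rightarrow> ('a \<Rightarrow> 'z) \<Rightarrow> ('a \<Rightarrow> 'b) \<Rightarrow> bool" where
  "determined_by M Z X \<longleftrightarrow> (\<forall>\<omega>\<in>space M. \<forall>\<omega>'\<in>space M. Z \<omega> = Z \<omega>' \<longrightarrow> X \<omega> = X \<omega>')"

text \<open>
If \<open>c l\<close> is the size of the block that element \<open>l + 1\<close> joins, this is the number of blocks of size greater than \<open>s\<close>
after \<open>n\<close> elements, because a block gets larger than \<open>s\<close> at the moment when it is joined at size \<open>s\<close>.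
\<close>

definition tally :: "(nat \<Rightarrow> 'a \<Rightarrow> nat) \<Rightarrow> nat \<Rightarrow> nat \<Rightarrow> 'a \<Rightarrow> nat" where
  "tally c s n \<omega> = card {l. l < n \<and> c l \<omega> = s}"

lemma tally_0 [simp]: "tally c s 0 \<omega> = 0"
  by (simp add: tally_def)

lemma tally_Suc: "tally c s (Suc n) \<omega> = tally c s n \<omega> + of_bool (c n \<omega> = s)"
proof -
  have "{l. l < Suc n \<and> c l \<omega> = s} = {l. l < n \<and> c l \<omega> = s} \<union> (if c n \<omega> = s then {n} else {})"
    by (auto simp: less_Suc_eq)
  then show ?thesis by (auto simp: tally_def)
qed

lemma sum_tally:
  assumes "\<And>l. l < n \<Longrightarrow> c l \<omega> < m"
  shows "(\<Sum>s<m. f s * real (tally c s n \<omega>)) = (\<Sum>l<n. f (c l \<omega>))"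
  using assms
proof (induction n)
  case (Suc n)
  have "(\<Sum>s<m. f s * real (tally c s (Suc n) \<omega>))
      = (\<Sum>s<m. f s * real (tally c s n \<omega>) + (if s = c n \<omega> then f s else 0))"
    by (intro sum.cong) (auto simp: tally_Suc algebra_simps)
  then show ?case using Suc by (simp add: sum.distrib)
qed simp

text \<open>
The probability that the next element joins a block of size \<open>s\<close>. The difference of tallies counts the blocks of size
\<open>s\<close>, each of which is chosen with a probability proportional to \<open>s - \<alpha>\<close>; the weights \<open>s - \<alpha>\<close> of all blocks add up to
the denominator \<open>n - \<alpha> * k\<close>.
\<close>

definition jump_weight ::
    "real \<Rightarrow> (nat \<Rightarrow> 'a \<Rightarrow> nat) \<Rightarrow> (nat \<Rightarrow> 'a \<Rightarrow> real) \<Rightarrow> nat \<Rightarrow> nat \<Rightarrow> 'a \<Rightarrow> real" where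
  "jump_weight \<alpha> c p n s \<omega> =
     (if s = 0 then p n \<omega>
      else (1 - p n \<omega>) / (real n - \<alpha> * tally c 0 n \<omega>) * (real s - \<alpha>)
             * (real (tally c (s - 1) n \<omega>) - real (tally c s n \<omega>)))"

text \<open>
What the limit theorems use about a Gibbs partition. The state \<open>Z n\<close> is the history up to time \<open>n\<close>, \<open>c n\<close> is the size
of the block joined by the next element, and \<open>p n\<close> is the probability of a new block. The constants say how \<open>p n\<close>
relates to \<open>\<alpha> * k n / n\<close>: \<open>C\<close> bounds the error and keeps the score close to a martingale, while the lower bound with
\<open>\<kappa> > 0\<close> makes the number of blocks grow at least like a power of \<open>n\<close>. The last assumption is the Markov property,
written for integrands \<open>G s\<close> that are determined by the history.
\<close>

locale size_chain = prob_space M for M :: "'a measure" +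
  fixes Z :: "nat \<Rightarrow> 'a \<Rightarrow> 'z" and c :: "nat \<Rightarrow> 'a \<Rightarrow> nat" and p :: "nat \<Rightarrow> 'a \<Rightarrow> real"
    and \<alpha> C \<kappa> :: real
  assumes alpha: "0 < \<alpha>" "\<alpha> < 1" and kappa: "0 < \<kappa>"
    and Z_measurable: "\<And>n. Z n \<in> M \<rightarrow>\<^sub>M count_space UNIV"
    and Z_finite: "\<And>n. finite (Z n ` space M)"
    and Z_refine: "\<And>n. n \<ge> 1 \<Longrightarrow> determined_by M (Z (Suc n)) (Z n)"
    and c_determined: "\<And>n. determined_by M (Z (Suc n)) (c n)"
    and p_determined: "\<And>n. n \<ge> 1 \<Longrightarrow> determined_by M (Z n) (p n)"
    and c_0: "\<And>\<omega>. \<omega> \<in> space M \<Longrightarrow> c 0 \<omega> = 0"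
    and c_le: "\<And>n \<omega>. \<omega> \<in> space M \<Longrightarrow> c n \<omega> \<le> n"
    and tally_decreasing: "\<And>n s \<omega>. n \<ge> 1 \<Longrightarrow> \<omega> \<in> space M \<Longrightarrow> tally c (Suc s) n \<omega> \<le> tally c s n \<omega>"
    and p_bounds: "\<And>n \<omega>. n \<ge> 1 \<Longrightarrow> \<omega> \<in> space M \<Longrightarrow> \<kappa> * tally c 0 n \<omega> / real n \<le> p n \<omega>"
      "\<And>n \<omega>. n \<ge> 1 \<Longrightarrow> \<omega> \<in> space M \<Longrightarrow> p n \<omega> \<le> 1"
    and p_approx: "\<And>n \<omega>. n \<ge> 1 \<Longrightarrow> \<omega> \<in> space M \<Longrightarrow> \<bar>p n \<omega> - \<alpha> * tally c 0 n \<omega> / real n\<bar> \<le> C / real n"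
    and one_step: "\<And>n (G :: nat \<Rightarrow> 'a \<Rightarrow> real). n \<ge> 1 \<Longrightarrow> (\<And>s. determined_by M (Z n) (G s)) \<Longrightarrow>
      (\<integral>\<omega>. G (c n \<omega>) \<omega> \<partial>M) = (\<integral>\<omega>. (\<Sum>s\<le>n. jump_weight \<alpha> c p n s \<omega> * G s \<omega>) \<partial>M)"
begin

abbreviation det :: "nat \<Rightarrow> ('a \<Rightarrow> 'b) \<Rightarrow> bool" where
  "det n X \<equiv> determined_by M (Z n) X"

abbreviation N :: "nat \<Rightarrow> nat \<Rightarrow> 'a \<Rightarrow> real" where
  "N s n \<omega> \<equiv> real (tally c s n \<omega>)"

abbreviation k :: "nat \<Rightarrow> 'a \<Rightarrow> real" where
  "k n \<omega> \<equiv> N 0 n \<omega>"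

abbreviation w :: "nat \<Rightarrow> nat \<Rightarrow> 'a \<Rightarrow> real" where
  "w n s \<omega> \<equiv> jump_weight \<alpha> c p n s \<omega>"

lemma detI: "(\<And>\<omega> \<omega>'. \<omega> \<in> space M \<Longrightarrow> \<omega>' \<in> space M \<Longrightarrow> Z n \<omega> = Z n \<omega>' \<Longrightarrow> X \<omega> = X \<omega>') \<Longrightarrow> det n X"
  unfolding determined_by_def by blast

lemma detD: "det n X \<Longrightarrow> Z n \<omega> = Z n \<omega>' \<Longrightarrow> \<omega> \<in> space M \<Longrightarrow> \<omega>' \<in> space M \<Longrightarrow> X \<omega> = X \<omega>'"
  unfolding determined_by_def by blast

lemma Z_refine_le:
  assumes "1 \<le> m" "m \<le> n" "\<omega> \<in> space M" "\<omega>' \<in> space M" "Z n \<omega> = Z n \<omega>'"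
  shows "Z m \<omega> = Z m \<omega>'"
  using assms(2,1,3-)
proof (induction rule: dec_induct)
  case (step n)
  then have "n \<ge> 1" by simp
  show ?case
    by (rule step.IH[OF step.prems(1-3)])
      (rule detD[OF Z_refine[OF \<open>n \<ge> 1\<close>] step.prems(4,2,3)])
qed

lemma det_mono: "det m X \<Longrightarrow> 1 \<le> m \<Longrightarrow> m \<le> n \<Longrightarrow> det n X"
  by (rule detI, rule detD[where n=m], assumption, rule Z_refine_le)

lemma c_cong:
  assumes "Z n \<omega> = Z n \<omega>'" "\<omega> \<in> space M" "\<omega>' \<in> space M" "l < n"
  shows "c l \<omega> = c l \<omega>'"
  using assms by (intro detD[OF c_determined] Z_refine_le[of "Suc l" n]) auto

lemma p_cong:
  assumes "Z n \<omega> = Z n \<omega>'" "\<omega> \<in> space M" "\<omega>' \<in> space M" "1 \<le> l" "l \<le> n"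
  shows "p l \<omega> = p l \<omega>'"
  using assms by (intro detD[OF p_determined] Z_refine_le[of l n]) auto

lemma tally_cong:
  assumes "Z n \<omega> = Z n \<omega>'" "\<omega> \<in> space M" "\<omega>' \<in> space M" "l \<le> n"
  shows "tally c s l \<omega> = tally c s l \<omega>'"
proof -
  have "{i. i < l \<and> c i \<omega> = s} = {i. i < l \<and> c i \<omega>' = s}"
    using c_cong[OF assms(1-3)] assms(4) by auto
  then show ?thesis by (simp add: tally_def)
qed

lemma jump_weight_cong:
  assumes "Z n \<omega> = Z n \<omega>'" "\<omega> \<in> space M" "\<omega>' \<in> space M" "1 \<le> l" "l \<le> n"
  shows "w l s \<omega> = w l s \<omega>'"
  using tally_cong[OF assms(1-3,5)] p_cong[OF assms] by (simp add: jump_weight_def)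

lemma det_const: "det n (\<lambda>_. a)"
  by (simp add: determined_by_def)

lemma det_comp: "det n X \<Longrightarrow> det n (\<lambda>\<omega>. f (X \<omega>))"
  unfolding determined_by_def by metis

lemma det_comp2: "det n X \<Longrightarrow> det n Y \<Longrightarrow> det n (\<lambda>\<omega>. f (X \<omega>) (Y \<omega>))"
  unfolding determined_by_def by metis

lemmas det_arith = det_comp2[where f="(+)"] det_comp2[where f="(-)"] det_comp2[where f="(*)"]
  det_comp2[where f="(/)"] det_comp[where f=uminus] det_comp[where f=abs] det_comp[where f="\<lambda>x. x ^ m" for m]

lemma det_sum: "(\<And>i. i \<in> I \<Longrightarrow> det n (X i)) \<Longrightarrow> det n (\<lambda>\<omega>. \<Sum>i\<in>I. X i \<omega>)"
  unfolding determined_by_def by (metis (no_types, lifting) sum.cong)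

lemma det_factor:
  assumes "det n X"
  shows "\<exists>g. \<forall>\<omega>\<in>space M. X \<omega> = g (Z n \<omega>)"
proof (intro exI ballI)
  fix \<omega> assume \<omega>: "\<omega> \<in> space M"
  define \<omega>' where "\<omega>' = (SOME \<omega>'. \<omega>' \<in> space M \<and> Z n \<omega>' = Z n \<omega>)"
  have "\<omega>' \<in> space M \<and> Z n \<omega>' = Z n \<omega>" unfolding \<omega>'_def by (rule someI[of _ \<omega>]) (use \<omega> in simp)
  then have "X \<omega> = X \<omega>'" using \<omega> by (intro detD[OF assms]) auto
  then show "X \<omega> = (\<lambda>z. X (SOME \<omega>'. \<omega>' \<in> space M \<and> Z n \<omega>' = z)) (Z n \<omega>)" by (simp add: \<omega>'_def)
qed

lemma det_measurable:
  fixes X :: "'a \<Rightarrow> 'b::topological_space"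
  assumes "det n X"
  shows "X \<in> borel_measurable M"
proof -
  obtain g where g: "\<And>\<omega>. \<omega> \<in> space M \<Longrightarrow> X \<omega> = g (Z n \<omega>)"
    using det_factor[OF assms] by blast
  have "(\<lambda>\<omega>. g (Z n \<omega>)) \<in> borel_measurable M"
    using Z_measurable by (rule measurable_compose) simp
  then show ?thesis using g by (simp cong: measurable_cong)
qed

lemma det_integrable:
  fixes X :: "'a \<Rightarrow> 'b::{banach, second_countable_topology}"
  assumes "det n X"
  shows "integrable M X"
proof -
  obtain g where g: "\<And>\<omega>. \<omega> \<in> space M \<Longrightarrow> X \<omega> = g (Z n \<omega>)"
    using det_factor[OF assms] by blast
  have "finite (X ` space M)"
    using finite_imageI[OF Z_finite[of n], of g] by (rule finite_subset[rotated]) (auto simp: g)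
  then have "bounded (X ` space M)" by (rule finite_imp_bounded)
  then obtain B where "\<And>\<omega>. \<omega> \<in> space M \<Longrightarrow> norm (X \<omega>) \<le> B" by (auto simp: bounded_iff)
  then show ?thesis by (intro integrable_const_bound[of _ B] det_measurable[OF assms]) auto
qed

lemma k_ge_1: "n \<ge> 1 \<Longrightarrow> \<omega> \<in> space M \<Longrightarrow> 1 \<le> k n \<omega>"
proof (induction n rule: nat_induct_at_least)
  case base then show ?case using c_0 by (simp add: tally_Suc)
qed (simp add: tally_Suc)

lemma tally_le: "tally c s n \<omega> \<le> n"
  unfolding tally_def using card_mono[of "{..<n}" "{l. l < n \<and> c l \<omega> = s}"] by auto

lemma tally_eq_0:
  assumes "\<omega> \<in> space M" "n \<le> s"
  shows "tally c s n \<omega> = 0"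
proof -
  have "c l \<omega> \<noteq> s" if "l < n" for l
    using c_le[OF assms(1), of l] that assms(2) by linarith
  then show ?thesis by (auto simp: tally_def)
qed

lemma N_le_k: "n \<ge> 1 \<Longrightarrow> \<omega> \<in> space M \<Longrightarrow> N s n \<omega> \<le> k n \<omega>"
proof (induction s)
  case (Suc s) then show ?case using tally_decreasing[of n \<omega> s] by force
qed simp

text \<open>
The block sizes add up to \<open>n\<close>; in terms of tallies, \<open>\<Sum>s<n. N s = n\<close> because each element is counted once.
\<close>

lemma sum_size_weights:
  assumes "n \<ge> 1" "\<omega> \<in> space M"
  shows "(\<Sum>s=1..n. (real s - \<alpha>) * (N (s - 1) n \<omega> - N s n \<omega>)) = real n - \<alpha> * k n \<omega>"
proof -
  have 1: "(\<Sum>s=1..m. N (s - 1) n \<omega> - N s n \<omega>) = k n \<omega> - N m n \<omega>" for m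
    by (induction m) auto
  have 2: "(\<Sum>s=1..m. real s * (N (s - 1) n \<omega> - N s n \<omega>)) = (\<Sum>s<m. N s n \<omega>) - real m * N m n \<omega>" for m
    by (induction m) (auto simp: algebra_simps)
  have 3: "(\<Sum>s<n. N s n \<omega>) = real n"
    using sum_tally[of n c \<omega> n "\<lambda>_. 1"] le_less_trans[OF c_le[OF assms(2)]] by simp
  show ?thesis
    using 1[of n] 2[of n] 3 tally_eq_0[of \<omega> n n] assms
    by (simp add: left_diff_distrib sum_subtractf sum_distrib_left[symmetric])
qed

lemma size_total_pos:
  assumes "n \<ge> 1" "\<omega> \<in> space M"
  shows "(1 - \<alpha>) * real n \<le> real n - \<alpha> * k n \<omega>" "0 < real n - \<alpha> * k n \<omega>"
proof -
  have "\<alpha> * k n \<omega> \<le> \<alpha> * real n" using alpha tally_le[of 0 n \<omega>] by (intro mult_left_mono) auto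
  then show 1: "(1 - \<alpha>) * real n \<le> real n - \<alpha> * k n \<omega>" by (simp add: algebra_simps)
  have "0 < (1 - \<alpha>) * real n" using assms alpha by simp
  then show "0 < real n - \<alpha> * k n \<omega>" using 1 by linarith
qed

lemma p_nonneg: "n \<ge> 1 \<Longrightarrow> \<omega> \<in> space M \<Longrightarrow> 0 \<le> p n \<omega>"
  using p_bounds(1)[of n \<omega>] kappa by (meson divide_nonneg_nonneg mult_nonneg_nonneg less_imp_le of_nat_0_le_iff order_trans)

lemma C_nonneg: "0 \<le> C"
proof -
  obtain \<omega> where "\<omega> \<in> space M" using not_empty by auto
  then show ?thesis using p_approx[of 1 \<omega>] by simp
qed

lemma p_le: "n \<ge> 1 \<Longrightarrow> \<omega> \<in> space M \<Longrightarrow> p n \<omega> \<le> (1 + C) * k n \<omega> / real n"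
proof -
  assume n: "n \<ge> 1" "\<omega> \<in> space M"
  have "p n \<omega> \<le> (\<alpha> * k n \<omega> + C) / real n" using p_approx[OF n] by (simp add: add_divide_distrib)
  also have "\<alpha> * k n \<omega> + C \<le> (1 + C) * k n \<omega>"
  proof -
    have "\<alpha> * k n \<omega> \<le> k n \<omega>" using alpha k_ge_1[OF n] by (simp add: mult_le_cancel_right1)
    moreover have "C * 1 \<le> C * k n \<omega>" using C_nonneg k_ge_1[OF n] by (intro mult_left_mono)
    ultimately show ?thesis by (simp add: algebra_simps)
  qed
  finally show ?thesis using n by (simp add: divide_right_mono)
qed

lemma jump_weight_nonneg: "n \<ge> 1 \<Longrightarrow> \<omega> \<in> space M \<Longrightarrow> 0 \<le> w n s \<omega>"
proof -
  assume n: "n \<ge> 1" "\<omega> \<in> space M"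
  show ?thesis
  proof (cases s)
    case 0 then show ?thesis using p_nonneg[OF n] by (simp add: jump_weight_def)
  next
    case (Suc r)
    then show ?thesis
      using p_bounds(2)[OF n] size_total_pos[OF n] tally_decreasing[OF n, of r] alpha
      by (auto simp: jump_weight_def intro!: mult_nonneg_nonneg divide_nonneg_nonneg)
  qed
qed

lemma jump_weight_eq_0: "\<omega> \<in> space M \<Longrightarrow> n < s \<Longrightarrow> w n s \<omega> = 0"
  by (simp add: jump_weight_def tally_eq_0)

lemma sum_jump_weight_pos:
  assumes "n \<ge> 1" "\<omega> \<in> space M"
  shows "(\<Sum>s=1..n. w n s \<omega>) = 1 - p n \<omega>"
proof -
  have "(\<Sum>s=1..n. w n s \<omega>) = (1 - p n \<omega>) / (real n - \<alpha> * k n \<omega>)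
      * (\<Sum>s=1..n. (real s - \<alpha>) * (N (s - 1) n \<omega> - N s n \<omega>))"
    unfolding sum_distrib_left by (intro sum.cong) (auto simp: jump_weight_def)
  then show ?thesis using size_total_pos[OF assms] sum_size_weights[OF assms] by simp
qed

lemma sum_atMost_split: "(\<Sum>s\<le>n. f s) = f 0 + (\<Sum>s=1..n. f s)" for f :: "nat \<Rightarrow> real"
  by (simp add: atMost_atLeast0 sum.atLeast_Suc_atMost)

text \<open>
\<open>d\<close> is the conditional expectation of \<open>Y\<close> given the history up to time \<open>n\<close>. All functions take finitely many values,
so that the defining property can be stated for arbitrary determined \<open>H\<close> without integrability conditions.
\<close>

definition cmean :: "nat \<Rightarrow> ('a \<Rightarrow> real) \<Rightarrow> ('a \<Rightarrow> real) \<Rightarrow> bool" where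
  "cmean n Y d \<longleftrightarrow> det (Suc n) Y \<and> det n d \<and>
     (\<forall>H. det n H \<longrightarrow> (\<integral>\<omega>. H \<omega> * Y \<omega> \<partial>M) = (\<integral>\<omega>. H \<omega> * d \<omega> \<partial>M))"

lemma cmeanI:
  assumes n: "n \<ge> 1" and G: "\<And>s. det n (G s)"
    and Y: "\<And>\<omega>. \<omega> \<in> space M \<Longrightarrow> Y \<omega> = G (c n \<omega>) \<omega>"
    and d: "\<And>\<omega>. \<omega> \<in> space M \<Longrightarrow> d \<omega> = (\<Sum>s\<le>n. w n s \<omega> * G s \<omega>)"
  shows "cmean n Y d"
  unfolding cmean_def
proof (intro conjI allI impI)
  show "det (Suc n) Y"
  proof (rule detI)
    fix \<omega> \<omega>' assume *: "\<omega> \<in> space M" "\<omega>' \<in> space M" "Z (Suc n) \<omega> = Z (Suc n) \<omega>'"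
    have "G s \<omega> = G s \<omega>'" for s
      using n * by (intro detD[OF G] Z_refine_le[of n "Suc n"]) auto
    then show "Y \<omega> = Y \<omega>'" using * c_cong[of "Suc n" \<omega> \<omega>' n] by (simp add: Y)
  qed
  show "det n d"
  proof (rule detI)
    fix \<omega> \<omega>' assume *: "\<omega> \<in> space M" "\<omega>' \<in> space M" "Z n \<omega> = Z n \<omega>'"
    then show "d \<omega> = d \<omega>'"
      using detD[OF G *(3,1,2)] jump_weight_cong[OF *(3,1,2) n order_refl] by (simp add: d)
  qed
  fix H :: "'a \<Rightarrow> real" assume H: "det n H"
  have "(\<integral>\<omega>. H \<omega> * Y \<omega> \<partial>M) = (\<integral>\<omega>. (\<lambda>s \<omega>. H \<omega> * G s \<omega>) (c n \<omega>) \<omega> \<partial>M)"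
    by (intro Bochner_Integration.integral_cong) (auto simp: Y)
  also have "\<dots> = (\<integral>\<omega>. (\<Sum>s\<le>n. w n s \<omega> * (H \<omega> * G s \<omega>)) \<partial>M)"
    using n by (intro one_step det_arith G H) auto
  also have "\<dots> = (\<integral>\<omega>. H \<omega> * d \<omega> \<partial>M)"
    by (intro Bochner_Integration.integral_cong) (auto simp: d sum_distrib_left mult_ac)
  finally show "(\<integral>\<omega>. H \<omega> * Y \<omega> \<partial>M) = (\<integral>\<omega>. H \<omega> * d \<omega> \<partial>M)" .
qed

lemma cmeanD:
  assumes "cmean n Y d"
  shows "det (Suc n) Y" "det n d" "det n H \<Longrightarrow> (\<integral>\<omega>. H \<omega> * Y \<omega> \<partial>M) = (\<integral>\<omega>. H \<omega> * d \<omega> \<partial>M)"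
    "(\<integral>\<omega>. Y \<omega> \<partial>M) = (\<integral>\<omega>. d \<omega> \<partial>M)"
proof -
  show *: "det (Suc n) Y" "det n d" "\<And>H. det n H \<Longrightarrow> (\<integral>\<omega>. H \<omega> * Y \<omega> \<partial>M) = (\<integral>\<omega>. H \<omega> * d \<omega> \<partial>M)"
    using assms by (auto simp: cmean_def)
  from *(3)[of "\<lambda>_. 1"] show "(\<integral>\<omega>. Y \<omega> \<partial>M) = (\<integral>\<omega>. d \<omega> \<partial>M)" by (simp add: determined_by_def)
qed

lemma abs_expectation_le_sqrt:
  fixes X :: "'a \<Rightarrow> real"
  assumes "integrable M X" "integrable M (\<lambda>\<omega>. (X \<omega>)\<^sup>2)"
  shows "(\<integral>\<omega>. \<bar>X \<omega>\<bar> \<partial>M) \<le> sqrt (\<integral>\<omega>. (X \<omega>)\<^sup>2 \<partial>M)"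
proof (rule real_le_rsqrt)
  show "(\<integral>\<omega>. \<bar>X \<omega>\<bar> \<partial>M)\<^sup>2 \<le> (\<integral>\<omega>. (X \<omega>)\<^sup>2 \<partial>M)"
    using variance_positive[of "\<lambda>\<omega>. \<bar>X \<omega>\<bar>"] variance_eq[of "\<lambda>\<omega>. \<bar>X \<omega>\<bar>"] assms by simp
qed

lemma det_partial_sum:
  fixes Y :: "nat \<Rightarrow> 'a \<Rightarrow> real"
  assumes "\<And>j. m \<le> j \<Longrightarrow> det (Suc j) (Y j)" "1 \<le> m"
  shows "m \<le> n \<Longrightarrow> det n (\<lambda>\<omega>. \<Sum>j=m..<n. Y j \<omega>)"
proof (rule detI, rule sum.cong)
  fix \<omega> \<omega>' j assume "m \<le> n" "\<omega> \<in> space M" "\<omega>' \<in> space M" "Z n \<omega> = Z n \<omega>'" "j \<in> {m..<n}"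
  then show "Y j \<omega> = Y j \<omega>'"
    using assms(2) by (intro detD[OF det_mono[OF assms(1)[of j], of n]]) auto
qed simp

text \<open>
The compensated increments \<open>Y j - d j\<close> are orthogonal in \<open>L\<^sup>2\<close>, and compensation does not increase second moments.
\<close>

lemma expectation_sum_le:
  assumes Y: "\<And>j. m \<le> j \<Longrightarrow> cmean j (Y j) (d j)" and m: "1 \<le> m" "m \<le> n"
  shows "(\<integral>\<omega>. \<bar>\<Sum>j=m..<n. Y j \<omega>\<bar> \<partial>M)
    \<le> (\<Sum>j=m..<n. \<integral>\<omega>. \<bar>d j \<omega>\<bar> \<partial>M) + sqrt (\<Sum>j=m..<n. \<integral>\<omega>. (Y j \<omega>)\<^sup>2 \<partial>M)"
proof -
  define W where "W n \<omega> = (\<Sum>j=m..<n. Y j \<omega> - d j \<omega>)" for n \<omega>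
  have dY: "det (Suc j) (Y j)" "det j (d j)" "det (Suc j) (d j)" if "m \<le> j" for j
    using cmeanD[OF Y[OF that]] det_mono[of j "d j" "Suc j"] m that by auto
  have detW: "det n (W n)" if "m \<le> n" for n
    unfolding W_def using dY m that by (intro det_partial_sum det_arith) auto
  have ortho: "(\<integral>\<omega>. (W n \<omega>)\<^sup>2 \<partial>M) \<le> (\<Sum>j=m..<n. \<integral>\<omega>. (Y j \<omega>)\<^sup>2 \<partial>M)" if "m \<le> n" for n
    using that
  proof (induction n rule: dec_induct)
    case base then show ?case by (simp add: W_def)
  next
    case (step n)
    note n = step.hyps(1)
    have sq: "det n (\<lambda>\<omega>. (W n \<omega>)\<^sup>2)" "det (Suc n) (\<lambda>\<omega>. (Y n \<omega>)\<^sup>2)" "det (Suc n) (\<lambda>\<omega>. d n \<omega> * Y n \<omega>)"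
       "det n (\<lambda>\<omega>. d n \<omega> * d n \<omega>)" "det (Suc n) (\<lambda>\<omega>. W n \<omega> * Y n \<omega>)" "det n (\<lambda>\<omega>. W n \<omega> * d n \<omega>)"
      using detW[OF n] det_mono[OF detW[OF n], of "Suc n"] dY[OF n] m n
      by (auto intro!: det_arith)
    have "(W (Suc n) \<omega>)\<^sup>2 = (W n \<omega>)\<^sup>2 + (Y n \<omega>)\<^sup>2 - 2 * (d n \<omega> * Y n \<omega>) + d n \<omega> * d n \<omega>
        + 2 * (W n \<omega> * Y n \<omega>) - 2 * (W n \<omega> * d n \<omega>)" for \<omega>
      using n by (simp add: W_def power2_eq_square algebra_simps)
    then have "(\<integral>\<omega>. (W (Suc n) \<omega>)\<^sup>2 \<partial>M) = (\<integral>\<omega>. (W n \<omega>)\<^sup>2 \<partial>M) + (\<integral>\<omega>. (Y n \<omega>)\<^sup>2 \<partial>M)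
        - 2 * (\<integral>\<omega>. d n \<omega> * Y n \<omega> \<partial>M) + (\<integral>\<omega>. d n \<omega> * d n \<omega> \<partial>M)
        + 2 * (\<integral>\<omega>. W n \<omega> * Y n \<omega> \<partial>M) - 2 * (\<integral>\<omega>. W n \<omega> * d n \<omega> \<partial>M)"
      using sq[THEN det_integrable] by simp
    also have "\<dots> = (\<integral>\<omega>. (W n \<omega>)\<^sup>2 \<partial>M) + (\<integral>\<omega>. (Y n \<omega>)\<^sup>2 \<partial>M) - (\<integral>\<omega>. d n \<omega> * d n \<omega> \<partial>M)"
      using cmeanD(3)[OF Y[OF n] detW[OF n]] cmeanD(3)[OF Y[OF n] dY(2)[OF n]] by simp
    also have "\<dots> \<le> (\<integral>\<omega>. (W n \<omega>)\<^sup>2 \<partial>M) + (\<integral>\<omega>. (Y n \<omega>)\<^sup>2 \<partial>M)"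
      by (simp add: integral_nonneg_AE)
    finally show ?case using step.IH n by simp
  qed
  have iW: "integrable M (W n)" "integrable M (\<lambda>\<omega>. (W n \<omega>)\<^sup>2)"
    using detW[OF m(2)] by (auto intro!: det_integrable[of n] det_arith)
  have id: "integrable M (d j)" if "m \<le> j" for j
    using dY(2)[OF that] by (rule det_integrable)
  have "(\<integral>\<omega>. \<bar>\<Sum>j=m..<n. Y j \<omega>\<bar> \<partial>M) \<le> (\<integral>\<omega>. \<bar>W n \<omega>\<bar> + (\<Sum>j=m..<n. \<bar>d j \<omega>\<bar>) \<partial>M)"
  proof (rule integral_mono)
    show "integrable M (\<lambda>\<omega>. \<bar>\<Sum>j=m..<n. Y j \<omega>\<bar>)"
      using det_partial_sum[OF dY(1) m] by (intro integrable_abs det_integrable) auto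
    show "integrable M (\<lambda>\<omega>. \<bar>W n \<omega>\<bar> + (\<Sum>j=m..<n. \<bar>d j \<omega>\<bar>))"
      using iW id by (intro Bochner_Integration.integrable_add Bochner_Integration.integrable_sum integrable_abs) auto
    fix \<omega>
    have "(\<Sum>j=m..<n. Y j \<omega>) = W n \<omega> + (\<Sum>j=m..<n. d j \<omega>)" by (simp add: W_def sum_subtractf)
    then show "\<bar>\<Sum>j=m..<n. Y j \<omega>\<bar> \<le> \<bar>W n \<omega>\<bar> + (\<Sum>j=m..<n. \<bar>d j \<omega>\<bar>)"
      using sum_abs[of "\<lambda>j. d j \<omega>" "{m..<n}"] by linarith
  qed
  also have "\<dots> = (\<integral>\<omega>. \<bar>W n \<omega>\<bar> \<partial>M) + (\<Sum>j=m..<n. \<integral>\<omega>. \<bar>d j \<omega>\<bar> \<partial>M)"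
    using iW id by (subst Bochner_Integration.integral_add) (auto intro!: Bochner_Integration.integral_sum)
  also have "(\<integral>\<omega>. \<bar>W n \<omega>\<bar> \<partial>M) \<le> sqrt (\<Sum>j=m..<n. \<integral>\<omega>. (Y j \<omega>)\<^sup>2 \<partial>M)"
    using abs_expectation_le_sqrt[OF iW] real_sqrt_le_mono[OF ortho[OF m(2)]] by (rule order_trans)
  finally show ?thesis by simp
qed

end

section \<open>The number of blocks\<close>

context prob_space
begin

definition vanishes_in_prob :: "(nat \<Rightarrow> 'a \<Rightarrow> real) \<Rightarrow> bool" where
  "vanishes_in_prob X \<longleftrightarrow> (\<forall>e>0. (\<lambda>n. prob {\<omega>\<in>space M. e < \<bar>X n \<omega>\<bar>}) \<longlonglongrightarrow> 0)"

lemma prob_markov: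
  fixes X :: "'a \<Rightarrow> real"
  assumes "integrable M X" "e > 0"
  shows "prob {\<omega>\<in>space M. e \<le> \<bar>X \<omega>\<bar>} \<le> (\<integral>\<omega>. \<bar>X \<omega>\<bar> \<partial>M) / e"
  using assms by (intro integral_Markov_inequality_measure[where A="{}"]) auto

lemma prob_tendsto_0_subset:
  assumes "\<forall>\<^sub>F n in sequentially. A n \<subseteq> B n \<and> B n \<in> events" "(\<lambda>n. prob (B n)) \<longlonglongrightarrow> 0"
  shows "(\<lambda>n. prob (A n)) \<longlonglongrightarrow> 0"
proof (rule tendsto_sandwich[OF _ _ tendsto_const assms(2)])
  show "\<forall>\<^sub>F n in sequentially. prob (A n) \<le> prob (B n)"
    using assms(1) by eventually_elim (auto intro: finite_measure_mono)
qed auto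

lemma prob_tendsto_0_Un:
  assumes "(\<lambda>n. prob (A n)) \<longlonglongrightarrow> 0" "(\<lambda>n. prob (B n)) \<longlonglongrightarrow> 0"
    "\<forall>\<^sub>F n in sequentially. A n \<in> events \<and> B n \<in> events"
  shows "(\<lambda>n. prob (A n \<union> B n)) \<longlonglongrightarrow> 0"
proof (rule tendsto_sandwich[OF _ _ tendsto_const])
  show "(\<lambda>n. prob (A n) + prob (B n)) \<longlonglongrightarrow> 0" using tendsto_add[OF assms(1,2)] by simp
  show "\<forall>\<^sub>F n in sequentially. prob (A n \<union> B n) \<le> prob (A n) + prob (B n)"
    using assms(3) by eventually_elim (auto intro: measure_Un_le)
qed auto

lemma vanishes_in_prob_add:
  assumes "vanishes_in_prob X" "vanishes_in_prob Y"
    and "\<forall>\<^sub>F n in sequentially. X n \<in> borel_measurable M \<and> Y n \<in> borel_measurable M"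
  shows "vanishes_in_prob (\<lambda>n \<omega>. X n \<omega> + Y n \<omega>)"
  unfolding vanishes_in_prob_def
proof (intro allI impI)
  fix e :: real assume e: "e > 0"
  let ?A = "\<lambda>n. {\<omega>\<in>space M. e / 2 < \<bar>X n \<omega>\<bar>}" and ?B = "\<lambda>n. {\<omega>\<in>space M. e / 2 < \<bar>Y n \<omega>\<bar>}"
  have ev: "\<forall>\<^sub>F n in sequentially. ?A n \<in> events \<and> ?B n \<in> events"
    using assms(3)
  proof eventually_elim
    case (elim n)
    then have [measurable]: "X n \<in> borel_measurable M" "Y n \<in> borel_measurable M" by auto
    show ?case by (intro conjI) measurable
  qed
  show "(\<lambda>n. prob {\<omega>\<in>space M. e < \<bar>X n \<omega> + Y n \<omega>\<bar>}) \<longlonglongrightarrow> 0"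
  proof (rule prob_tendsto_0_subset)
    show "(\<lambda>n. prob (?A n \<union> ?B n)) \<longlonglongrightarrow> 0"
    proof (rule prob_tendsto_0_Un[OF _ _ ev])
      show "(\<lambda>n. prob (?A n)) \<longlonglongrightarrow> 0" "(\<lambda>n. prob (?B n)) \<longlonglongrightarrow> 0"
        using assms(1,2)[unfolded vanishes_in_prob_def, rule_format, of "e / 2"] e by simp_all
    qed
    show "\<forall>\<^sub>F n in sequentially. {\<omega>\<in>space M. e < \<bar>X n \<omega> + Y n \<omega>\<bar>} \<subseteq> ?A n \<union> ?B n \<and> ?A n \<union> ?B n \<in> events"
      using ev by eventually_elim auto
  qed
qed

lemma vanishes_in_prob_cmult:
  assumes "vanishes_in_prob X"
  shows "vanishes_in_prob (\<lambda>n \<omega>. a * X n \<omega>)"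
proof (cases "a = 0")
  case False
  have "{\<omega>\<in>space M. e < \<bar>a * X n \<omega>\<bar>} = {\<omega>\<in>space M. e / \<bar>a\<bar> < \<bar>X n \<omega>\<bar>}" for e n
    using False by (auto simp: abs_mult field_simps)
  then show ?thesis using assms False by (simp add: vanishes_in_prob_def)
qed (simp add: vanishes_in_prob_def)

lemma vanishes_in_prob_sum:
  assumes "finite I" "\<And>i. i \<in> I \<Longrightarrow> vanishes_in_prob (X i)"
    and "\<And>i. i \<in> I \<Longrightarrow> \<forall>\<^sub>F n in sequentially. X i n \<in> borel_measurable M"
  shows "vanishes_in_prob (\<lambda>n \<omega>. \<Sum>i\<in>I. X i n \<omega>)"
  using assms
proof (induction I rule: finite_induct)
  case empty then show ?case by (simp add: vanishes_in_prob_def)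
next
  case (insert i I)
  have "\<forall>\<^sub>F n in sequentially. \<forall>i\<in>I. X i n \<in> borel_measurable M"
    using insert by (intro eventually_ball_finite) auto
  then have "\<forall>\<^sub>F n in sequentially. (\<lambda>\<omega>. \<Sum>i\<in>I. X i n \<omega>) \<in> borel_measurable M"
    by eventually_elim (intro borel_measurable_sum, auto)
  then show ?case
    using insert by (simp add: vanishes_in_prob_add eventually_conj)
qed

end

context size_chain
begin

lemma kappa_le_1: "\<kappa> \<le> 1"
proof -
  obtain \<omega> where \<omega>: "\<omega> \<in> space M" using not_empty by auto
  have "k 1 \<omega> = 1" using c_0[OF \<omega>] by (simp add: tally_Suc)
  then show ?thesis using p_bounds[of 1 \<omega>] \<omega> by simp
qed

lemma det_N: "m \<le> n \<Longrightarrow> det n (N s m)"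
  by (rule detI, rule arg_cong[where f=real], rule tally_cong)

lemma sum_jump_weight_two:
  assumes "n \<ge> 1" "\<omega> \<in> space M"
  shows "(\<Sum>s\<le>n. w n s \<omega> * (if s = 0 then a else b)) = p n \<omega> * a + (1 - p n \<omega>) * b"
proof -
  have "(\<Sum>s=1..n. w n s \<omega> * (if s = 0 then a else b)) = (\<Sum>s=1..n. w n s \<omega>) * b"
    unfolding sum_distrib_right by (intro sum.cong) auto
  then show ?thesis
    using sum_jump_weight_pos[OF assms] by (simp add: sum_atMost_split) (simp add: jump_weight_def)
qed

lemma k_Suc: "k (Suc n) \<omega> = k n \<omega> + of_bool (c n \<omega> = 0)"
  by (simp add: tally_Suc)

text \<open>
A first lower bound on the growth of \<open>k n\<close>: a new block reduces \<open>1 / k\<close> by \<open>1 / (k * (k + 1)) \<ge> 1 / (2 * k\<^sup>2)\<close>, and a new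
block has probability at least \<open>\<kappa> * k / n\<close>. The exponent is far from optimal, but it suffices for the error terms in
\<open>expectation_V_diff\<close> to be summable.
\<close>

lemma expectation_inverse_k:
  assumes "n \<ge> 1"
  shows "(\<integral>\<omega>. 1 / k n \<omega> \<partial>M) \<le> real n powr - (\<kappa> / 2)"
proof -
  define a where "a n = (\<integral>\<omega>. 1 / k n \<omega> \<partial>M)" for n
  have int: "integrable M (\<lambda>\<omega>. 1 / k n \<omega>)" for n
    by (rule det_integrable[of n], rule det_comp, rule det_N) simp
  have "a n \<le> a 1 * real n powr - (\<kappa> / 2)"
  proof (rule recursion_powr_decay)
    fix n :: nat assume n: "n \<ge> 1"
    show "0 \<le> a n" unfolding a_def by (intro integral_nonneg_AE) auto
    define d where "d \<omega> = p n \<omega> * (1 / (k n \<omega> + 1)) + (1 - p n \<omega>) * (1 / k n \<omega>)" for \<omega>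
    have cm: "cmean n (\<lambda>\<omega>. 1 / k (Suc n) \<omega>) d"
    proof (rule cmeanI[OF n, where G="\<lambda>s \<omega>. if s = 0 then 1 / (k n \<omega> + 1) else 1 / k n \<omega>"])
      show "det n (\<lambda>\<omega>. if s = 0 then 1 / (k n \<omega> + 1) else 1 / k n \<omega>)" for s
        by (rule det_comp, rule det_N) simp
    qed (simp_all only: k_Suc sum_jump_weight_two[OF n] d_def, simp_all)
    have "a (Suc n) = (\<integral>\<omega>. d \<omega> \<partial>M)" unfolding a_def by (rule cmeanD(4)[OF cm])
    also have "\<dots> \<le> (\<integral>\<omega>. (1 - \<kappa> / 2 / real n) * (1 / k n \<omega>) \<partial>M)"
    proof (rule integral_mono)
      show "integrable M d" using cmeanD(2)[OF cm] by (rule det_integrable)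
      show "integrable M (\<lambda>\<omega>. (1 - \<kappa> / 2 / real n) * (1 / k n \<omega>))" by (intro integrable_mult_right int)
      fix \<omega> assume \<omega>: "\<omega> \<in> space M"
      note k1 = k_ge_1[OF n \<omega>]
      have "\<kappa> / 2 / real n * (1 / k n \<omega>) \<le> p n \<omega> * (1 / (k n \<omega> * (k n \<omega> + 1)))"
      proof -
        have "1 / 2 \<le> k n \<omega> / (k n \<omega> + 1)" using k1 by (simp add: field_simps)
        then have "\<kappa> / real n * (1 / k n \<omega>) * (1 / 2) \<le> \<kappa> / real n * (1 / k n \<omega>) * (k n \<omega> / (k n \<omega> + 1))"
          using kappa by (intro mult_left_mono) auto
        also have "\<dots> = \<kappa> * k n \<omega> / real n * (1 / (k n \<omega> * (k n \<omega> + 1)))" using k1 by simp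
        also have "\<dots> \<le> p n \<omega> * (1 / (k n \<omega> * (k n \<omega> + 1)))"
          using p_bounds(1)[OF n \<omega>] by (intro mult_right_mono) auto
        finally show ?thesis by simp
      qed
      moreover have "d \<omega> = 1 / k n \<omega> - p n \<omega> * (1 / (k n \<omega> * (k n \<omega> + 1)))"
      proof -
        have "k n \<omega> \<noteq> 0" "k n \<omega> + 1 \<noteq> 0" using k1 by linarith+
        then show ?thesis unfolding d_def by (simp add: divide_simps) (simp add: algebra_simps)
      qed
      ultimately show "d \<omega> \<le> (1 - \<kappa> / 2 / real n) * (1 / k n \<omega>)"
        by (simp add: diff_divide_distrib)
    qed
    also have "\<dots> = a n * (1 - \<kappa> / 2 / real n)"
      by (subst integral_mult_right_zero) (simp only: a_def mult.commute)
    finally show "a (Suc n) \<le> a n * (1 - \<kappa> / 2 / real n)" .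
  qed (use kappa kappa_le_1 assms in auto)
  moreover have "a 1 = 1"
  proof -
    have "a 1 = (\<integral>\<omega>. 1 \<partial>M)" unfolding a_def
      by (intro Bochner_Integration.integral_cong) (auto simp: tally_Suc c_0)
    then show ?thesis by (simp add: prob_space)
  qed
  ultimately show ?thesis by (simp add: a_def)
qed

text \<open>
The logarithm of \<open>k n / n powr \<alpha>\<close>; for a Gibbs partition, this ratio converges to the \<open>\<alpha>\<close>-diversity.
\<close>

definition V :: "nat \<Rightarrow> 'a \<Rightarrow> real" where
  "V n \<omega> = ln (k n \<omega>) - \<alpha> * ln (real n)"

lemma det_V: "det n (V n)"
  unfolding V_def by (rule det_comp, rule det_N) simp

text \<open>
A step from \<open>j\<close> to \<open>j + 1\<close> changes \<open>ln k\<close> by about \<open>1 / k\<close> with probability \<open>p\<close>, hence by \<open>\<alpha> / j\<close> on average, which is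
what \<open>\<alpha> * ln j\<close> compensates. The conditional mean and the conditional second moment of the change of \<open>V\<close> are both
\<open>O(1 / (j * k j))\<close>, and \<open>expectation_inverse_k\<close> makes this summable.
\<close>

lemma expectation_V_diff:
  assumes "1 \<le> m" "m \<le> n"
  defines "S \<equiv> (\<Sum>j=m..<n. (2 * C + 2) * real j powr - (1 + \<kappa> / 2))"
  shows "(\<integral>\<omega>. \<bar>V n \<omega> - V m \<omega>\<bar> \<partial>M) \<le> S + sqrt S"
proof -
  define L where "L j \<omega> = ln (1 + 1 / k j \<omega>)" for j \<omega>
  define l where "l j = \<alpha> * ln (1 + 1 / real j)" for j :: nat
  define Y where "Y j \<omega> = (if c j \<omega> = 0 then L j \<omega> - l j else - l j)" for j \<omega>
  define d where "d j \<omega> = p j \<omega> * (L j \<omega> - l j) + (1 - p j \<omega>) * (- l j)" for j \<omega>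
  define d2 where "d2 j \<omega> = p j \<omega> * (L j \<omega> - l j)\<^sup>2 + (1 - p j \<omega>) * (l j)\<^sup>2" for j \<omega>
  have YV: "Y j \<omega> = V (Suc j) \<omega> - V j \<omega>" if "j \<ge> 1" "\<omega> \<in> space M" for j \<omega>
  proof -
    have "L j \<omega> = ln (k j \<omega> + 1) - ln (k j \<omega>)"
      using k_ge_1[OF that] by (simp add: L_def ln_divide_pos[symmetric] add_divide_distrib)
    moreover have "ln (1 + 1 / real j) = ln (real (Suc j)) - ln (real j)"
      using that by (simp add: ln_divide_pos[symmetric] add_divide_distrib add.commute)
    ultimately show ?thesis by (simp add: Y_def V_def k_Suc l_def right_diff_distrib)
  qed
  have detL: "det j (\<lambda>\<omega>. f (L j \<omega>))" for j and f :: "real \<Rightarrow> real"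
    unfolding L_def by (rule det_comp, rule det_N) simp
  have cm: "cmean j (Y j) (d j)" "cmean j (\<lambda>\<omega>. (Y j \<omega>)\<^sup>2) (d2 j)" if j: "j \<ge> 1" for j
  proof -
    show "cmean j (Y j) (d j)"
    proof (rule cmeanI[OF j, where G="\<lambda>s \<omega>. if s = 0 then L j \<omega> - l j else - l j"])
      show "det j (\<lambda>\<omega>. if s = 0 then L j \<omega> - l j else - l j)" for s by (rule detL)
    qed (simp_all only: d_def sum_jump_weight_two[OF j] Y_def)
    show "cmean j (\<lambda>\<omega>. (Y j \<omega>)\<^sup>2) (d2 j)"
    proof (rule cmeanI[OF j, where G="\<lambda>s \<omega>. if s = 0 then (L j \<omega> - l j)\<^sup>2 else (l j)\<^sup>2"])
      show "det j (\<lambda>\<omega>. if s = 0 then (L j \<omega> - l j)\<^sup>2 else (l j)\<^sup>2)" for s by (rule detL)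
    qed (simp_all only: d2_def sum_jump_weight_two[OF j] Y_def, simp_all)
  qed
  have bounds: "\<bar>d j \<omega>\<bar> \<le> (2 * C + 2) / real j * (1 / k j \<omega>)" "d2 j \<omega> \<le> (2 * C + 2) / real j * (1 / k j \<omega>)"
    if j: "j \<ge> 1" and \<omega>: "\<omega> \<in> space M" for j \<omega>
  proof -
    \<comment> \<open>The bounds reduce to \<open>ln (1 + x) = x + O(x\<^sup>2)\<close> with \<open>y \<le> x\<close>, where \<open>y\<close> is \<open>1 / j\<close> and \<open>q * x\<close> is close to
      \<open>\<alpha> * y\<close>.\<close>
    define x where "x = 1 / k j \<omega>"
    define y where "y = 1 / real j"
    define q where "q = p j \<omega>"
    have k1: "1 \<le> k j \<omega>" "k j \<omega> \<le> real j" using k_ge_1[OF j \<omega>] tally_le[of 0 j \<omega>] by auto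
    have x: "0 < x" "x \<le> 1" and y: "0 < y" "y \<le> x" using k1 j by (auto simp: x_def y_def field_simps)
    have L: "x - x\<^sup>2 \<le> L j \<omega>" "L j \<omega> \<le> x" "0 \<le> L j \<omega>"
      using x ln_one_plus_pos_lower_bound[of x] ln_add_one_self_le_self[of x] by (auto simp: L_def x_def[symmetric])
    have l: "\<alpha> * (y - y\<^sup>2) \<le> l j" "l j \<le> \<alpha> * y" "0 \<le> l j"
      using x y alpha ln_one_plus_pos_lower_bound[of y] ln_add_one_self_le_self[of y]
      by (auto simp: l_def y_def[symmetric] intro!: mult_left_mono)
    have q: "0 \<le> q" "q \<le> 1" "q * x \<le> (1 + C) * y" "\<bar>q * x - \<alpha> * y\<bar> \<le> C * y * x"
    proof -
      show "0 \<le> q" "q \<le> 1" using p_nonneg[OF j \<omega>] p_bounds(2)[OF j \<omega>] by (auto simp: q_def)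
      have "q * x \<le> ((1 + C) * k j \<omega> / real j) * x"
        using p_le[OF j \<omega>] x by (intro mult_right_mono) (auto simp: q_def)
      then show "q * x \<le> (1 + C) * y" using k1 by (simp add: x_def y_def)
      have "\<bar>q - \<alpha> * k j \<omega> / real j\<bar> * x \<le> C / real j * x"
        using p_approx[OF j \<omega>] x by (intro mult_right_mono) (auto simp: q_def)
      also have "\<bar>q - \<alpha> * k j \<omega> / real j\<bar> * x = \<bar>(q - \<alpha> * k j \<omega> / real j) * x\<bar>"
        using x by (simp add: abs_mult)
      also have "(q - \<alpha> * k j \<omega> / real j) * x = q * x - \<alpha> * y"
        using k1 by (simp add: x_def y_def field_simps)
      finally show "\<bar>q * x - \<alpha> * y\<bar> \<le> C * y * x" by (simp add: y_def)
    qed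
    have qxx: "q * x\<^sup>2 \<le> (1 + C) * y * x"
      using mult_right_mono[OF q(3), of x] x by (simp add: power2_eq_square mult.assoc)
    have qL: "\<bar>q * x - q * L j \<omega>\<bar> \<le> q * x\<^sup>2"
      using mult_left_mono[OF L(1) q(1)] mult_left_mono[OF L(2) q(1)] by (simp add: right_diff_distrib)
    have yy: "\<alpha> * y\<^sup>2 \<le> y * x" "y\<^sup>2 \<le> y * x"
    proof -
      show 1: "y\<^sup>2 \<le> y * x" using y by (simp add: power2_eq_square mult_left_mono)
      have "\<alpha> * y\<^sup>2 \<le> 1 * y\<^sup>2" using alpha by (intro mult_right_mono) auto
      then show "\<alpha> * y\<^sup>2 \<le> y * x" using 1 by linarith
    qed
    have "d j \<omega> = q * L j \<omega> - l j" by (simp add: d_def q_def algebra_simps)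
    moreover have "\<bar>\<alpha> * y - l j\<bar> \<le> \<alpha> * y\<^sup>2" using l by (simp add: right_diff_distrib)
    ultimately have "\<bar>d j \<omega>\<bar> \<le> q * x\<^sup>2 + C * y * x + \<alpha> * y\<^sup>2"
      using qL q(4) by linarith
    also have "\<dots> \<le> (2 * C + 2) * y * x" using qxx yy by (simp add: algebra_simps)
    finally show "\<bar>d j \<omega>\<bar> \<le> (2 * C + 2) / real j * (1 / k j \<omega>)" by (simp add: x_def y_def)
    have "(L j \<omega> - l j)\<^sup>2 \<le> (L j \<omega>)\<^sup>2 + (l j)\<^sup>2"
      using mult_nonneg_nonneg[OF L(3) l(3)] by (simp add: power2_eq_square algebra_simps)
    then have "d2 j \<omega> \<le> q * ((L j \<omega>)\<^sup>2 + (l j)\<^sup>2) + (1 - q) * (l j)\<^sup>2"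
      unfolding d2_def q_def[symmetric] using q by (intro add_right_mono mult_left_mono) auto
    also have "\<dots> = q * (L j \<omega>)\<^sup>2 + (l j)\<^sup>2" by (simp add: algebra_simps)
    also have "(L j \<omega>)\<^sup>2 \<le> x\<^sup>2" using L by (intro power_mono) auto
    also have "(l j)\<^sup>2 \<le> y\<^sup>2"
    proof (rule power_mono)
      have "\<alpha> * y \<le> 1 * y" using alpha y by (intro mult_right_mono) auto
      then show "l j \<le> y" using l by linarith
    qed (rule l)
    finally have "d2 j \<omega> \<le> q * x\<^sup>2 + y\<^sup>2" using q by (simp add: mult_left_mono)
    also have "\<dots> \<le> (1 + C) * y * x + y * x" using qxx yy by linarith
    also have "\<dots> \<le> (2 * C + 2) * y * x" using C_nonneg x y by (simp add: algebra_simps)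
    finally show "d2 j \<omega> \<le> (2 * C + 2) / real j * (1 / k j \<omega>)" by (simp add: x_def y_def)
  qed
  \<comment> \<open>In the mean, \<open>1 / (j * k j)\<close> is of order \<open>j powr - (1 + \<kappa> / 2)\<close>.\<close>
  have E: "(\<integral>\<omega>. f \<omega> \<partial>M) \<le> (2 * C + 2) * real j powr - (1 + \<kappa> / 2)"
    if j: "j \<ge> 1" and f: "det j f" and le: "\<And>\<omega>. \<omega> \<in> space M \<Longrightarrow> f \<omega> \<le> (2 * C + 2) / real j * (1 / k j \<omega>)" for f j
  proof -
    have "(\<integral>\<omega>. f \<omega> \<partial>M) \<le> (\<integral>\<omega>. (2 * C + 2) / real j * (1 / k j \<omega>) \<partial>M)"
      by (rule integral_mono[OF det_integrable[OF f] _ le], rule det_integrable[of j],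
          rule det_comp, rule det_N) auto
    also have "\<dots> = (2 * C + 2) / real j * (\<integral>\<omega>. 1 / k j \<omega> \<partial>M)" by (rule integral_mult_right_zero)
    also have "\<dots> \<le> (2 * C + 2) / real j * real j powr - (\<kappa> / 2)"
      using C_nonneg by (intro mult_left_mono expectation_inverse_k j) auto
    also have "\<dots> = (2 * C + 2) * (1 / real j * real j powr - (\<kappa> / 2))" by simp
    also have "1 / real j = real j powr - 1" using j by (simp add: powr_minus_divide)
    also have "real j powr - 1 * real j powr - (\<kappa> / 2) = real j powr (- 1 + - (\<kappa> / 2))"
      by (rule powr_add[symmetric])
    also have "- 1 + - (\<kappa> / 2) = - (1 + \<kappa> / 2)" by simp
    finally show ?thesis .
  qed
  have "(\<integral>\<omega>. \<bar>V n \<omega> - V m \<omega>\<bar> \<partial>M) = (\<integral>\<omega>. \<bar>\<Sum>j=m..<n. Y j \<omega>\<bar> \<partial>M)"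
  proof (rule Bochner_Integration.integral_cong)
    fix \<omega> assume \<omega>: "\<omega> \<in> space M"
    have "(\<Sum>j=m..<n. Y j \<omega>) = (\<Sum>j=m..<n. V (Suc j) \<omega> - V j \<omega>)"
      using assms by (intro sum.cong) (auto simp: YV \<omega>)
    also have "\<dots> = V n \<omega> - V m \<omega>" by (rule sum_Suc_diff'[OF assms(2)])
    finally show "\<bar>V n \<omega> - V m \<omega>\<bar> = \<bar>\<Sum>j=m..<n. Y j \<omega>\<bar>" by simp
  qed simp
  also have "\<dots> \<le> (\<Sum>j=m..<n. \<integral>\<omega>. \<bar>d j \<omega>\<bar> \<partial>M) + sqrt (\<Sum>j=m..<n. \<integral>\<omega>. (Y j \<omega>)\<^sup>2 \<partial>M)"
    by (rule expectation_sum_le) (use cm assms in auto)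
  also have "\<dots> \<le> S + sqrt S"
  proof (intro add_mono real_sqrt_le_mono)
    show "(\<Sum>j=m..<n. \<integral>\<omega>. \<bar>d j \<omega>\<bar> \<partial>M) \<le> S"
      unfolding S_def
    proof (rule sum_mono)
      fix j assume "j \<in> {m..<n}"
      then have j: "j \<ge> 1" using assms by auto
      show "(\<integral>\<omega>. \<bar>d j \<omega>\<bar> \<partial>M) \<le> (2 * C + 2) * real j powr - (1 + \<kappa> / 2)"
        by (rule E[OF j det_comp[where f=abs, OF cmeanD(2)[OF cm(1)[OF j]]] bounds(1)[OF j]])
    qed
    show "(\<Sum>j=m..<n. \<integral>\<omega>. (Y j \<omega>)\<^sup>2 \<partial>M) \<le> S"
      unfolding S_def
    proof (rule sum_mono)
      fix j assume "j \<in> {m..<n}"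
      then have j: "j \<ge> 1" using assms by auto
      show "(\<integral>\<omega>. (Y j \<omega>)\<^sup>2 \<partial>M) \<le> (2 * C + 2) * real j powr - (1 + \<kappa> / 2)"
        unfolding cmeanD(4)[OF cm(2)[OF j]]
        by (rule E[OF j cmeanD(2)[OF cm(2)[OF j]] bounds(2)[OF j]])
    qed
  qed
  finally show ?thesis .
qed

lemma V_Cauchy:
  assumes "e > 0"
  obtains m0 where "m0 \<ge> 1" "\<And>m n. m0 \<le> m \<Longrightarrow> m \<le> n \<Longrightarrow> (\<integral>\<omega>. \<bar>V n \<omega> - V m \<omega>\<bar> \<partial>M) < e"
proof -
  define e' where "e' = min (e / 2) ((e / 2)\<^sup>2)"
  have e': "e' > 0" using assms by (simp add: e'_def)
  have "summable (\<lambda>j. (2 * C + 2) * real j powr - (1 + \<kappa> / 2))"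
    using kappa by (intro summable_mult) (simp add: summable_real_powr_iff)
  then obtain m1 where m1: "\<And>m n. m \<ge> m1 \<Longrightarrow> norm (\<Sum>j=m..<n. (2 * C + 2) * real j powr - (1 + \<kappa> / 2)) < e'"
    using e' unfolding summable_Cauchy by blast
  show ?thesis
  proof (rule that[of "max 1 m1"])
    fix m n assume mn: "max 1 m1 \<le> m" "m \<le> n"
    define S where "S = (\<Sum>j=m..<n. (2 * C + 2) * real j powr - (1 + \<kappa> / 2))"
    have "norm S < e'" unfolding S_def using mn by (intro m1) simp
    then have S: "S < e / 2" "S < (e / 2)\<^sup>2" by (auto simp: e'_def)
    have "sqrt S < e / 2" using S(2) assms by (intro real_less_lsqrt) auto
    then show "(\<integral>\<omega>. \<bar>V n \<omega> - V m \<omega>\<bar> \<partial>M) < e"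
    proof -
      have "(\<integral>\<omega>. \<bar>V n \<omega> - V m \<omega>\<bar> \<partial>M) \<le> S + sqrt S"
        unfolding S_def using mn by (intro expectation_V_diff) auto
      then show ?thesis using S(1) \<open>sqrt S < e / 2\<close> by linarith
    qed
  qed simp
qed

lemma V_bounded:
  obtains B where "B \<ge> 0" "\<And>n. n \<ge> 1 \<Longrightarrow> (\<integral>\<omega>. \<bar>V n \<omega>\<bar> \<partial>M) \<le> B"
proof -
  define f where "f j = (2 * C + 2) * real j powr - (1 + \<kappa> / 2)" for j :: nat
  have f: "summable f" "\<And>j. 0 \<le> f j"
    using kappa C_nonneg unfolding f_def by (auto intro!: summable_mult simp: summable_real_powr_iff)
  show ?thesis
  proof (rule that[of "suminf f + sqrt (suminf f)"])
    show "0 \<le> suminf f + sqrt (suminf f)" using f by (simp add: suminf_nonneg)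
    fix n :: nat assume n: "n \<ge> 1"
    have S: "(\<Sum>j=1..<n. f j) \<le> suminf f" using f by (intro sum_le_suminf) auto
    have "(\<integral>\<omega>. \<bar>V n \<omega>\<bar> \<partial>M) = (\<integral>\<omega>. \<bar>V n \<omega> - V 1 \<omega>\<bar> \<partial>M)"
      by (intro Bochner_Integration.integral_cong) (auto simp: V_def tally_Suc c_0)
    also have "\<dots> \<le> (\<Sum>j=1..<n. f j) + sqrt (\<Sum>j=1..<n. f j)"
      using expectation_V_diff[of 1 n] n by (simp add: f_def)
    also have "\<dots> \<le> suminf f + sqrt (suminf f)" using S by (intro add_mono) auto
    finally show "(\<integral>\<omega>. \<bar>V n \<omega>\<bar> \<partial>M) \<le> suminf f + sqrt (suminf f)" .
  qed
qed

section \<open>Law of large numbers for the block sizes\<close>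

lemma det_event:
  assumes "det n R"
  shows "{\<omega>\<in>space M. R \<omega>} \<in> events"
proof -
  have [measurable]: "(\<lambda>\<omega>. of_bool (R \<omega>) :: real) \<in> borel_measurable M"
    by (rule det_measurable[of n], rule det_comp, rule assms)
  have "{\<omega>\<in>space M. R \<omega>} = {\<omega>\<in>space M. (of_bool (R \<omega>) :: real) = 1}" by auto
  also have "\<dots> \<in> events" by measurable
  finally show ?thesis .
qed

text \<open>
From \<open>p \<le> \<alpha> * k / n + C / n\<close>; the shift by \<open>C / \<alpha>\<close> absorbs the inhomogeneous term of the recursion.
\<close>

lemma expectation_k_le:
  obtains A where "A \<ge> 0" "\<And>n. n \<ge> 1 \<Longrightarrow> (\<integral>\<omega>. k n \<omega> \<partial>M) \<le> A * real n powr \<alpha>"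
proof -
  define b where "b n = (\<integral>\<omega>. k n \<omega> \<partial>M) + C / \<alpha>" for n
  have int: "integrable M (k n)" for n by (rule det_integrable[of n], rule det_N) simp
  have b0: "0 \<le> b n" for n
    unfolding b_def using C_nonneg alpha by (intro add_nonneg_nonneg integral_nonneg_AE) auto
  have b: "b n \<le> b 1 * (1 + \<alpha>) * real n powr \<alpha>" if "n \<ge> 1" for n
    using that
  proof (rule recursion_powr_growth[rotated 3])
    fix n :: nat assume n: "n \<ge> 1"
    have cm: "cmean n (\<lambda>\<omega>. k (Suc n) \<omega>) (\<lambda>\<omega>. p n \<omega> * (k n \<omega> + 1) + (1 - p n \<omega>) * k n \<omega>)"
    proof (rule cmeanI[OF n, where G="\<lambda>s \<omega>. if s = 0 then k n \<omega> + 1 else k n \<omega>"])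
      show "det n (\<lambda>\<omega>. if s = 0 then k n \<omega> + 1 else k n \<omega>)" for s
        by (rule det_comp, rule det_N) simp
    qed (simp_all only: k_Suc sum_jump_weight_two[OF n], simp_all)
    have "(\<integral>\<omega>. k (Suc n) \<omega> \<partial>M) = (\<integral>\<omega>. p n \<omega> * (k n \<omega> + 1) + (1 - p n \<omega>) * k n \<omega> \<partial>M)"
      by (rule cmeanD(4)[OF cm])
    also have "\<dots> \<le> (\<integral>\<omega>. (1 + \<alpha> / real n) * k n \<omega> + C / real n \<partial>M)"
    proof (rule integral_mono[OF det_integrable[OF cmeanD(2)[OF cm]]])
      show "integrable M (\<lambda>\<omega>. (1 + \<alpha> / real n) * k n \<omega> + C / real n)"
        using int by (intro Bochner_Integration.integrable_add integrable_mult_right) auto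
      fix \<omega> assume "\<omega> \<in> space M"
      then show "p n \<omega> * (k n \<omega> + 1) + (1 - p n \<omega>) * k n \<omega> \<le> (1 + \<alpha> / real n) * k n \<omega> + C / real n"
        using p_approx[OF n] by (force simp: algebra_simps abs_le_iff)
    qed
    also have "\<dots> = (1 + \<alpha> / real n) * (\<integral>\<omega>. k n \<omega> \<partial>M) + C / real n"
      using int by (simp add: prob_space)
    finally have "(\<integral>\<omega>. k (Suc n) \<omega> \<partial>M) \<le> (1 + \<alpha> / real n) * (\<integral>\<omega>. k n \<omega> \<partial>M) + C / real n" .
    moreover have "b n * (1 + \<alpha> / real n) = (1 + \<alpha> / real n) * (\<integral>\<omega>. k n \<omega> \<partial>M) + C / real n + C / \<alpha>"
      using alpha n by (simp add: b_def field_simps)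
    ultimately show "b (Suc n) \<le> b n * (1 + \<alpha> / real n)" by (simp add: b_def)
  qed (use alpha b0 in auto)
  show ?thesis
  proof (rule that[of "b 1 * (1 + \<alpha>)"])
    show "0 \<le> b 1 * (1 + \<alpha>)" using b0 alpha by simp
    show "(\<integral>\<omega>. k n \<omega> \<partial>M) \<le> b 1 * (1 + \<alpha>) * real n powr \<alpha>" if "n \<ge> 1" for n
    proof -
      have "0 \<le> C / \<alpha>" using C_nonneg alpha by simp
      then show ?thesis using b[OF that] by (simp add: b_def)
    qed
  qed
qed

definition D :: "nat \<Rightarrow> nat \<Rightarrow> 'a \<Rightarrow> real" where
  "D s n \<omega> = N s n \<omega> - sibuya_tail \<alpha> s * k n \<omega>"

lemma det_D: "det n (D s n)"
  unfolding D_def by (intro det_arith det_const det_N order_refl)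

lemma abs_D_le:
  assumes "n \<ge> 1" "\<omega> \<in> space M"
  shows "\<bar>D s n \<omega>\<bar> \<le> k n \<omega>"
proof -
  have "0 \<le> sibuya_tail \<alpha> s * k n \<omega>"
    using sibuya_tail_bounds[OF alpha, of s] by (intro mult_nonneg_nonneg) auto
  moreover have "sibuya_tail \<alpha> s * k n \<omega> \<le> 1 * k n \<omega>"
    using sibuya_tail_bounds[OF alpha, of s] by (intro mult_right_mono) auto
  ultimately have "0 \<le> sibuya_tail \<alpha> s * k n \<omega>" "sibuya_tail \<alpha> s * k n \<omega> \<le> k n \<omega>" by simp_all
  then show ?thesis using N_le_k[OF assms, of s] unfolding D_def by (simp add: abs_le_iff)
qed

lemma sum_jump_weight_indicator:
  assumes "\<omega> \<in> space M"
  shows "(\<Sum>r\<le>n. w n r \<omega> * of_bool (r = s)) = w n s \<omega>"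
proof (cases "s \<le> n")
  case True
  then show ?thesis by (simp add: of_bool_def if_distrib cong: if_cong)
next
  case False
  then show ?thesis using jump_weight_eq_0[OF assms, of n s] by (auto intro!: sum.neutral)
qed

lemma size_term_le:
  assumes "n \<ge> 1" "\<omega> \<in> space M" "s \<ge> 1"
  shows "0 \<le> (real s - \<alpha>) * (N (s - 1) n \<omega> - N s n \<omega>)"
    "(real s - \<alpha>) * (N (s - 1) n \<omega> - N s n \<omega>) \<le> real n - \<alpha> * k n \<omega>"
proof -
  have nn: "0 \<le> (real r - \<alpha>) * (N (r - 1) n \<omega> - N r n \<omega>)" if "r \<ge> 1" for r
    using tally_decreasing[OF assms(1,2), of "r - 1"] that alpha by (intro mult_nonneg_nonneg) auto
  then show "0 \<le> (real s - \<alpha>) * (N (s - 1) n \<omega> - N s n \<omega>)" using assms by simp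
  show "(real s - \<alpha>) * (N (s - 1) n \<omega> - N s n \<omega>) \<le> real n - \<alpha> * k n \<omega>"
  proof (cases "s \<le> n")
    case True
    then have "(real s - \<alpha>) * (N (s - 1) n \<omega> - N s n \<omega>)
        \<le> (\<Sum>s=1..n. (real s - \<alpha>) * (N (s - 1) n \<omega> - N s n \<omega>))"
      using assms nn by (intro member_le_sum) auto
    then show ?thesis using sum_size_weights[OF assms(1,2)] by simp
  next
    case False
    then show ?thesis using size_total_pos(2)[OF assms(1,2)] tally_eq_0[OF assms(2)] by simp
  qed
qed

text \<open>
The conditional mean of the increment of \<open>D s\<close> is \<open>w n s - sibuya_tail \<alpha> s * p n\<close>. For \<open>p = \<alpha> * k / n\<close> it equals the
linear expression in \<open>D (s - 1)\<close> and \<open>D s\<close> exactly, by \<open>sibuya_tail_hazard\<close>; the remaining error is proportional to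
\<open>p - \<alpha> * k / n\<close>.
\<close>

lemma jump_weight_drift:
  assumes n: "n \<ge> 1" "\<omega> \<in> space M" and s: "s \<ge> 1"
  shows "\<bar>w n s \<omega> - sibuya_tail \<alpha> s * p n \<omega> - (real s - \<alpha>) / real n * (D (s - 1) n \<omega> - D s n \<omega>)\<bar>
     \<le> 2 * C / real n"
proof -
  define P where "P = sibuya_tail \<alpha>"
  define T where "T = real n - \<alpha> * k n \<omega>"
  define x where "x = (real s - \<alpha>) * (N (s - 1) n \<omega> - N s n \<omega>)"
  define e where "e = p n \<omega> - \<alpha> * k n \<omega> / real n"
  have T: "T > 0" using size_total_pos[OF n] by (simp add: T_def)
  have n0: "real n > 0" using n by simp
  have q: "(1 - p n \<omega>) / T = 1 / real n - e / T"
    using T n0 by (simp add: e_def T_def field_simps)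
  have hz: "(real s - \<alpha>) * P (s - 1) = (real s - \<alpha>) * P s + \<alpha> * P s"
    using sibuya_tail_hazard[OF s, of \<alpha>] by (simp add: P_def right_diff_distrib)
  have "(real s - \<alpha>) * (D (s - 1) n \<omega> - D s n \<omega>) = x - ((real s - \<alpha>) * P (s - 1) - (real s - \<alpha>) * P s) * k n \<omega>"
    by (simp add: D_def x_def P_def algebra_simps)
  then have Dd: "(real s - \<alpha>) * (D (s - 1) n \<omega> - D s n \<omega>) = x - \<alpha> * P s * k n \<omega>"
    using hz by simp
  have "w n s \<omega> = (1 - p n \<omega>) / T * x" using s by (simp add: jump_weight_def T_def x_def)
  then have "w n s \<omega> = x / real n - e * (x / T)" unfolding q by (simp add: algebra_simps)
  moreover have "P s * p n \<omega> = \<alpha> * P s * k n \<omega> / real n + P s * e"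
    by (simp add: e_def algebra_simps)
  moreover have "(real s - \<alpha>) / real n * (D (s - 1) n \<omega> - D s n \<omega>) = x / real n - \<alpha> * P s * k n \<omega> / real n"
    unfolding times_divide_eq_left Dd by (rule diff_divide_distrib)
  ultimately have "w n s \<omega> - P s * p n \<omega> - (real s - \<alpha>) / real n * (D (s - 1) n \<omega> - D s n \<omega>)
      = - e * (x / T + P s)"
    by (simp only:) (simp add: algebra_simps)
  moreover have "\<bar>x / T + P s\<bar> \<le> 2"
  proof -
    have "0 \<le> x / T" "x / T \<le> 1"
      using size_term_le[OF n s] T unfolding x_def T_def by auto
    then show ?thesis using sibuya_tail_bounds[OF alpha, of s] unfolding P_def by linarith
  qed
  moreover have "\<bar>e\<bar> \<le> C / real n" using p_approx[OF n] by (simp add: e_def)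
  ultimately have eq: "w n s \<omega> - P s * p n \<omega> - (real s - \<alpha>) / real n * (D (s - 1) n \<omega> - D s n \<omega>)
      = - e * (x / T + P s)" and le: "\<bar>x / T + P s\<bar> \<le> 2" "\<bar>e\<bar> \<le> C / real n"
    by blast+
  have "\<bar>e\<bar> * \<bar>x / T + P s\<bar> \<le> C / real n * 2"
    using le C_nonneg by (intro mult_mono) auto
  then have "\<bar>- e * (x / T + P s)\<bar> \<le> 2 * C / real n"
    by (simp add: abs_mult mult.commute[of 2])
  then show ?thesis unfolding P_def[symmetric] eq .
qed

text \<open>
Induction on \<open>s\<close>. The drift pulls \<open>D s\<close> towards \<open>D (s - 1)\<close> at the rate \<open>(s - \<alpha>) / n\<close>, so it contributes at most
\<open>(s / n) * (D (s - 1))\<^sup>2\<close> to the growth of the second moment. The squares of the increments, which are nonzero with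
probability \<open>O(k n / n)\<close> only, contribute \<open>O(k n / n)\<close>. Both are \<open>O(n powr (\<alpha> - 1))\<close> in the mean.
\<close>

lemma expectation_D_squared_le:
  "\<exists>A\<ge>0. \<forall>n\<ge>1. (\<integral>\<omega>. (D s n \<omega>)\<^sup>2 \<partial>M) \<le> A * real n powr \<alpha>"
proof (induction s)
  case 0
  show ?case by (intro exI[of _ 0]) (simp add: D_def)
next
  case (Suc r)
  define s where "s = Suc r"
  have s1: "s \<ge> 1" "s - 1 = r" by (auto simp: s_def)
  obtain A0 where A0: "A0 \<ge> 0" "\<And>n. n \<ge> 1 \<Longrightarrow> (\<integral>\<omega>. (D r n \<omega>)\<^sup>2 \<partial>M) \<le> A0 * real n powr \<alpha>"
    using Suc by blast
  obtain Ak where Ak: "Ak \<ge> 0" "\<And>n. n \<ge> 1 \<Longrightarrow> (\<integral>\<omega>. k n \<omega> \<partial>M) \<le> Ak * real n powr \<alpha>"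
    using expectation_k_le by metis
  define P where "P = sibuya_tail \<alpha> s"
  have P: "0 < P" "P \<le> 1" using sibuya_tail_bounds[OF alpha] by (auto simp: P_def)
  \<comment> \<open>The three summands bound the error term of the drift, the probability of joining a block of size \<open>s\<close>, and
    the probability of a new block.\<close>
  define B where "B = 4 * C + real s / (1 - \<alpha>) + (1 + C)"
  have B: "B \<ge> 0" using C_nonneg alpha by (auto simp: B_def intro!: add_nonneg_nonneg)
  define A where "A = real s * A0 + B * Ak"
  have A: "A \<ge> 0" using A0 Ak B by (simp add: A_def)
  define e where "e n = (\<integral>\<omega>. (D s n \<omega>)\<^sup>2 \<partial>M)" for n
  have int: "integrable M (k n)" for n by (rule det_integrable[of n], rule det_N) simp
  have iD: "integrable M (\<lambda>\<omega>. (D s' n \<omega>)\<^sup>2)" for n s'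
    by (rule det_integrable[of n], intro det_arith det_D)
  have step: "e (Suc n) \<le> e n + A * real n powr (\<alpha> - 1)" if n: "n \<ge> 1" for n
  proof -
    define Y where "Y \<omega> = of_bool (c n \<omega> = s) - P * of_bool (c n \<omega> = 0)" for \<omega>
    define d where "d \<omega> = w n s \<omega> - P * p n \<omega>" for \<omega>
    define Y2 where "Y2 \<omega> = (of_bool (c n \<omega> = s) + of_bool (c n \<omega> = 0) :: real)" for \<omega>
    define d2 where "d2 \<omega> = w n s \<omega> + p n \<omega>" for \<omega>
    have w0: "w n 0 \<omega> = p n \<omega>" for \<omega> by (simp add: jump_weight_def)
    have cm: "cmean n Y d"
    proof (rule cmeanI[OF n, where G="\<lambda>r \<omega>. of_bool (r = s) - P * of_bool (r = 0)"])
      show "d \<omega> = (\<Sum>r\<le>n. w n r \<omega> * (of_bool (r = s) - P * of_bool (r = 0)))" if "\<omega> \<in> space M" for \<omega>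
        by (simp only: d_def right_diff_distrib sum_subtractf mult.left_commute[of _ P]
            sum_jump_weight_indicator[OF that] w0 flip: sum_distrib_left)
    qed (simp_all add: det_const Y_def)
    have cm2: "cmean n Y2 d2"
    proof (rule cmeanI[OF n, where G="\<lambda>r \<omega>. of_bool (r = s) + of_bool (r = 0)"])
      show "d2 \<omega> = (\<Sum>r\<le>n. w n r \<omega> * (of_bool (r = s) + of_bool (r = 0)))" if "\<omega> \<in> space M" for \<omega>
        by (simp only: d2_def distrib_left sum.distrib sum_jump_weight_indicator[OF that] w0)
    qed (simp_all add: det_const Y2_def)
    have detY: "det (Suc n) Y" "det (Suc n) (D s n)" "det n d" "det n d2" "det (Suc n) Y2"
      using cmeanD[OF cm] cmeanD[OF cm2] det_mono[OF det_D n, of "Suc n" s] by auto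
    have iDY: "integrable M (\<lambda>\<omega>. D s n \<omega> * Y \<omega>)" "integrable M Y2"
      by (rule det_integrable[of "Suc n"], intro det_arith detY)
        (rule det_integrable, rule detY)
    have iDd: "integrable M (\<lambda>\<omega>. D s n \<omega> * d \<omega>)" "integrable M d2"
      by (rule det_integrable[of n], intro det_arith detY det_D)
        (rule det_integrable, rule detY)
    have "e (Suc n) \<le> (\<integral>\<omega>. (D s n \<omega>)\<^sup>2 + 2 * (D s n \<omega> * Y \<omega>) + Y2 \<omega> \<partial>M)"
      unfolding e_def
    proof (rule integral_mono[OF iD])
      show "integrable M (\<lambda>\<omega>. (D s n \<omega>)\<^sup>2 + 2 * (D s n \<omega> * Y \<omega>) + Y2 \<omega>)"
        using iD iDY by (intro Bochner_Integration.integrable_add integrable_mult_right)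
      fix \<omega>
      have "D s (Suc n) \<omega> = D s n \<omega> + Y \<omega>"
        by (simp add: D_def Y_def tally_Suc P_def algebra_simps)
      moreover have "(Y \<omega>)\<^sup>2 \<le> Y2 \<omega>"
        using s1 P by (auto simp: Y_def Y2_def power_le_one)
      ultimately show "(D s (Suc n) \<omega>)\<^sup>2 \<le> (D s n \<omega>)\<^sup>2 + 2 * (D s n \<omega> * Y \<omega>) + Y2 \<omega>"
        by (simp add: power2_sum)
    qed
    also have "\<dots> = e n + 2 * (\<integral>\<omega>. D s n \<omega> * Y \<omega> \<partial>M) + (\<integral>\<omega>. Y2 \<omega> \<partial>M)"
      using iD iDY by (simp add: e_def)
    also have "\<dots> = e n + 2 * (\<integral>\<omega>. D s n \<omega> * d \<omega> \<partial>M) + (\<integral>\<omega>. d2 \<omega> \<partial>M)"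
      using cmeanD(3)[OF cm det_D] cmeanD(4)[OF cm2] by simp
    also have "\<dots> = (\<integral>\<omega>. (D s n \<omega>)\<^sup>2 + 2 * (D s n \<omega> * d \<omega>) + d2 \<omega> \<partial>M)"
      using iD iDd by (simp add: e_def)
    also have "\<dots> \<le> (\<integral>\<omega>. (D s n \<omega>)\<^sup>2 + real s / real n * (D r n \<omega>)\<^sup>2 + B / real n * k n \<omega> \<partial>M)"
    proof (rule integral_mono)
      show "integrable M (\<lambda>\<omega>. (D s n \<omega>)\<^sup>2 + 2 * (D s n \<omega> * d \<omega>) + d2 \<omega>)"
        using iD iDd by (intro Bochner_Integration.integrable_add integrable_mult_right)
      show "integrable M (\<lambda>\<omega>. (D s n \<omega>)\<^sup>2 + real s / real n * (D r n \<omega>)\<^sup>2 + B / real n * k n \<omega>)"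
        using iD int by (intro Bochner_Integration.integrable_add integrable_mult_right)
      fix \<omega> assume \<omega>: "\<omega> \<in> space M"
      define u v where "u = D s n \<omega>" and "v = D r n \<omega>"
      define a where "a = (real s - \<alpha>) / real n"
      have a: "0 \<le> a" "a \<le> real s / real n" using alpha s1 by (auto simp: a_def divide_right_mono)
      define er where "er = d \<omega> - a * (v - u)"
      have er: "\<bar>er\<bar> \<le> 2 * C / real n"
        using jump_weight_drift[OF n \<omega> s1(1)]
        unfolding er_def d_def P_def a_def u_def v_def s1(2) .
      have "u * er \<le> \<bar>u\<bar> * \<bar>er\<bar>" by (metis abs_ge_self abs_mult)
      also have "\<dots> \<le> k n \<omega> * (2 * C / real n)"
        using abs_D_le[OF n \<omega>, of s] er C_nonneg by (intro mult_mono) (auto simp: u_def)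
      finally have 1: "u * er \<le> 2 * C / real n * k n \<omega>" by (simp add: mult.commute)
      \<comment> \<open>The drift towards \<open>v\<close> can only help, up to \<open>v\<^sup>2\<close>: \<open>2 * u * (v - u) = v\<^sup>2 - u\<^sup>2 - (v - u)\<^sup>2\<close>.\<close>
      have 2: "2 * (u * (v - u)) \<le> v\<^sup>2"
      proof -
        have "2 * (u * (v - u)) = v\<^sup>2 - (v - u)\<^sup>2 - u\<^sup>2" by (simp add: power2_eq_square algebra_simps)
        then show ?thesis using zero_le_power2[of "v - u"] zero_le_power2[of u] by linarith
      qed
      have 3: "a * (2 * (u * (v - u))) \<le> real s / real n * v\<^sup>2"
        using mult_left_mono[OF 2 a(1)] mult_right_mono[OF a(2), of "v\<^sup>2"] by simp
      have "2 * (u * d \<omega>) = a * (2 * (u * (v - u))) + 2 * (u * er)" by (simp add: er_def algebra_simps)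
      then have 4: "2 * (u * d \<omega>) \<le> real s / real n * v\<^sup>2 + 4 * C / real n * k n \<omega>"
      proof -
        have "2 * (u * er) \<le> 2 * (2 * C / real n * k n \<omega>)" using 1 by linarith
        also have "\<dots> = 4 * C / real n * k n \<omega>" by simp
        finally show ?thesis using 3 \<open>2 * (u * d \<omega>) = _\<close> by linarith
      qed
      have 5: "w n s \<omega> \<le> real s / (1 - \<alpha>) / real n * k n \<omega>"
      proof -
        have "(1 - p n \<omega>) / (real n - \<alpha> * k n \<omega>) \<le> 1 / ((1 - \<alpha>) * real n)"
          using p_nonneg[OF n \<omega>] p_bounds(2)[OF n \<omega>] size_total_pos[OF n \<omega>] alpha n by (intro frac_le) auto
        moreover have "(real s - \<alpha>) * (N (s - 1) n \<omega> - N s n \<omega>) \<le> real s * k n \<omega>"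
          using N_le_k[OF n \<omega>, of "s - 1"] tally_decreasing[OF n \<omega>, of r] alpha s1
          by (intro mult_mono) (auto simp: s_def)
        ultimately have "(1 - p n \<omega>) / (real n - \<alpha> * k n \<omega>) * ((real s - \<alpha>) * (N (s - 1) n \<omega> - N s n \<omega>))
            \<le> 1 / ((1 - \<alpha>) * real n) * (real s * k n \<omega>)"
          by (rule mult_mono) (use size_term_le(1)[OF n \<omega> s1(1)] alpha in auto)
        then show ?thesis using s1 by (simp add: jump_weight_def mult.assoc)
      qed
      have 6: "p n \<omega> \<le> (1 + C) / real n * k n \<omega>" using p_le[OF n \<omega>] by simp
      have "d2 \<omega> \<le> (real s / (1 - \<alpha>) / real n + (1 + C) / real n) * k n \<omega>"
        using 5 6 by (simp add: d2_def distrib_right)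
      moreover have "B / real n = 4 * C / real n + (real s / (1 - \<alpha>) / real n + (1 + C) / real n)"
        by (simp add: B_def add_divide_distrib)
      ultimately show "(D s n \<omega>)\<^sup>2 + 2 * (D s n \<omega> * d \<omega>) + d2 \<omega>
          \<le> (D s n \<omega>)\<^sup>2 + real s / real n * (D r n \<omega>)\<^sup>2 + B / real n * k n \<omega>"
        using 4 unfolding u_def v_def by (simp add: distrib_right)
    qed
    also have "\<dots> = e n + real s / real n * (\<integral>\<omega>. (D r n \<omega>)\<^sup>2 \<partial>M) + B / real n * (\<integral>\<omega>. k n \<omega> \<partial>M)"
      using iD int by (simp add: e_def)
    also have "\<dots> \<le> e n + real s / real n * (A0 * real n powr \<alpha>) + B / real n * (Ak * real n powr \<alpha>)"
      using A0(2)[OF n] Ak(2)[OF n] B by (intro add_mono mult_left_mono) auto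
    also have "\<dots> = e n + A * real n powr (\<alpha> - 1)"
      using n by (simp add: A_def powr_diff field_simps)
    finally show ?thesis .
  qed
  have e1: "e 1 \<le> 1"
  proof -
    have "e 1 \<le> (\<integral>\<omega>. 1 \<partial>M)"
      unfolding e_def
    proof (rule integral_mono[OF iD])
      fix \<omega> assume \<omega>: "\<omega> \<in> space M"
      have "k 1 \<omega> = 1" using c_0[OF \<omega>] by (simp add: tally_Suc)
      then show "(D s 1 \<omega>)\<^sup>2 \<le> 1" using abs_D_le[of 1 \<omega> s] \<omega> by (simp add: abs_square_le_1)
    qed simp
    then show ?thesis by (simp add: prob_space)
  qed
  have "e n \<le> 1 + A * (\<Sum>j=1..<n. real j powr (\<alpha> - 1))" if "n \<ge> 1" for n
    using that
  proof (induction n rule: nat_induct_at_least)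
    case (Suc n)
    then show ?case using step[of n] by (simp add: distrib_left)
  qed (use e1 in simp)
  then have "e n \<le> (1 + A / \<alpha>) * real n powr \<alpha>" if n: "n \<ge> 1" for n
  proof -
    have "e n \<le> 1 + A * (real n powr \<alpha> / \<alpha>)"
      using \<open>\<And>n. 1 \<le> n \<Longrightarrow> e n \<le> _\<close>[OF n] mult_left_mono[OF sum_powr_minus_one_le[of \<alpha> n] A] alpha by force
    moreover have "1 \<le> real n powr \<alpha>" using n alpha by (intro ge_one_powr_ge_zero) auto
    ultimately show ?thesis by (simp add: algebra_simps)
  qed
  then show ?case
    using A alpha by (intro exI[of _ "1 + A / \<alpha>"]) (auto simp: e_def s_def)
qed

text \<open>
If \<open>k n \<le> n powr b\<close>, then \<open>\<bar>V n\<bar>\<close> is at least \<open>(\<alpha> - b) * ln n\<close>, whereas its mean is bounded.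
\<close>

lemma k_exceeds_powr:
  assumes "b < \<alpha>"
  shows "(\<lambda>n. prob {\<omega>\<in>space M. k n \<omega> \<le> real n powr b}) \<longlonglongrightarrow> 0"
proof -
  obtain B where B: "B \<ge> 0" "\<And>n. n \<ge> 1 \<Longrightarrow> (\<integral>\<omega>. \<bar>V n \<omega>\<bar> \<partial>M) \<le> B" using V_bounded by metis
  show ?thesis
  proof (rule tendsto_sandwich[OF _ _ tendsto_const])
    show "(\<lambda>n. B / ((\<alpha> - b) * ln (real n))) \<longlonglongrightarrow> 0"
      using assms by real_asymp
    show "\<forall>\<^sub>F n in sequentially. prob {\<omega>\<in>space M. k n \<omega> \<le> real n powr b} \<le> B / ((\<alpha> - b) * ln (real n))"
    proof (rule eventually_mono[OF eventually_ge_at_top[of 2]])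
      fix n :: nat assume n: "n \<ge> 2"
      then have pos: "(\<alpha> - b) * ln (real n) > 0" using assms by simp
      have iV: "integrable M (V n)" by (rule det_integrable[OF det_V])
      then have [measurable]: "V n \<in> borel_measurable M" by auto
      have "{\<omega>\<in>space M. k n \<omega> \<le> real n powr b} \<subseteq> {\<omega>\<in>space M. (\<alpha> - b) * ln (real n) \<le> \<bar>V n \<omega>\<bar>}"
      proof safe
        fix \<omega> assume \<omega>: "\<omega> \<in> space M" "k n \<omega> \<le> real n powr b"
        then have "ln (k n \<omega>) \<le> ln (real n powr b)" using k_ge_1[of n \<omega>] n by (intro ln_mono) auto
        also have "\<dots> = b * ln (real n)" using n by (simp add: ln_powr)
        finally have "V n \<omega> \<le> - ((\<alpha> - b) * ln (real n))" by (simp add: V_def algebra_simps)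
        then show "(\<alpha> - b) * ln (real n) \<le> \<bar>V n \<omega>\<bar>" by linarith
      qed
      then have "prob {\<omega>\<in>space M. k n \<omega> \<le> real n powr b} \<le> prob {\<omega>\<in>space M. (\<alpha> - b) * ln (real n) \<le> \<bar>V n \<omega>\<bar>}"
        by (intro finite_measure_mono) auto
      also have "\<dots> \<le> (\<integral>\<omega>. \<bar>V n \<omega>\<bar> \<partial>M) / ((\<alpha> - b) * ln (real n))"
        by (rule prob_markov[OF iV pos])
      also have "\<dots> \<le> B / ((\<alpha> - b) * ln (real n))"
        using B(2)[of n] n pos by (intro divide_right_mono) auto
      finally show "prob {\<omega>\<in>space M. k n \<omega> \<le> real n powr b} \<le> B / ((\<alpha> - b) * ln (real n))" .
    qed
  qed auto
qed

text \<open>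
Division by the random \<open>k n\<close> is replaced by division by \<open>n powr b\<close>, at the cost of an event of small probability.
\<close>

lemma vanishes_div_k:
  assumes det: "\<And>n. n \<ge> 1 \<Longrightarrow> det n (X n)" and b: "b < \<alpha>" "0 < q"
    and lim: "(\<lambda>n. (\<integral>\<omega>. \<bar>X n \<omega>\<bar> powr q \<partial>M) / real n powr (b * q)) \<longlonglongrightarrow> 0"
  shows "vanishes_in_prob (\<lambda>n \<omega>. X n \<omega> / k n \<omega>)"
  unfolding vanishes_in_prob_def
proof (intro allI impI)
  fix e :: real assume e: "e > 0"
  let ?A = "\<lambda>n. {\<omega>\<in>space M. k n \<omega> \<le> real n powr b}"
  let ?B = "\<lambda>n. {\<omega>\<in>space M. (e * real n powr b) powr q \<le> \<bar>\<bar>X n \<omega>\<bar> powr q\<bar>}"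
  have meas: "?A n \<in> events" "?B n \<in> events" if "n \<ge> 1" for n
  proof -
    show "?A n \<in> events"
      by (rule det_event[of n], rule det_comp[where f="\<lambda>x. x \<le> real n powr b"], rule det_N) simp
    show "?B n \<in> events"
      by (rule det_event[of n], rule det_comp[where f="\<lambda>x. (e * real n powr b) powr q \<le> \<bar>\<bar>x\<bar> powr q\<bar>"],
          rule det, rule that)
  qed
  have ev: "\<forall>\<^sub>F n in sequentially. ?A n \<in> events \<and> ?B n \<in> events"
    by (rule eventually_mono[OF eventually_ge_at_top[of 1]]) (rule conjI[OF meas])
  have B: "(\<lambda>n. prob (?B n)) \<longlonglongrightarrow> 0"
  proof (rule tendsto_sandwich[OF _ _ tendsto_const])
    show "(\<lambda>n. (\<integral>\<omega>. \<bar>X n \<omega>\<bar> powr q \<partial>M) / real n powr (b * q) * (1 / e powr q)) \<longlonglongrightarrow> 0"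
      using tendsto_mult_right[OF lim, of "1 / e powr q"] by (simp only: mult_zero_left)
    show "\<forall>\<^sub>F n in sequentially. prob (?B n)
        \<le> (\<integral>\<omega>. \<bar>X n \<omega>\<bar> powr q \<partial>M) / real n powr (b * q) * (1 / e powr q)"
    proof (rule eventually_mono[OF eventually_ge_at_top[of 1]])
      fix n :: nat assume n: "n \<ge> 1"
      have "integrable M (\<lambda>\<omega>. \<bar>X n \<omega>\<bar> powr q)"
        by (rule det_integrable[of n], rule det_comp, rule det[OF n])
      moreover have "0 < (e * real n powr b) powr q" using e n by simp
      ultimately have "prob (?B n) \<le> (\<integral>\<omega>. \<bar>\<bar>X n \<omega>\<bar> powr q\<bar> \<partial>M) / (e * real n powr b) powr q"
        by (rule prob_markov)
      also have "\<dots> = (\<integral>\<omega>. \<bar>X n \<omega>\<bar> powr q \<partial>M) / (e powr q * real n powr (b * q))"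
        using e by (simp add: powr_mult powr_powr)
      also have "\<dots> = (\<integral>\<omega>. \<bar>X n \<omega>\<bar> powr q \<partial>M) / real n powr (b * q) * (1 / e powr q)"
        by simp
      finally show "prob (?B n) \<le> (\<integral>\<omega>. \<bar>X n \<omega>\<bar> powr q \<partial>M) / real n powr (b * q) * (1 / e powr q)" .
    qed
  qed auto
  show "(\<lambda>n. prob {\<omega>\<in>space M. e < \<bar>X n \<omega> / k n \<omega>\<bar>}) \<longlonglongrightarrow> 0"
  proof (rule prob_tendsto_0_subset)
    show "(\<lambda>n. prob (?A n \<union> ?B n)) \<longlonglongrightarrow> 0"
      by (rule prob_tendsto_0_Un[OF k_exceeds_powr[OF b(1)] B ev])
    show "\<forall>\<^sub>F n in sequentially. {\<omega>\<in>space M. e < \<bar>X n \<omega> / k n \<omega>\<bar>} \<subseteq> ?A n \<union> ?B n \<and> ?A n \<union> ?B n \<in> events"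
    proof (rule eventually_mono[OF eventually_conj[OF ev eventually_ge_at_top[of 1]]])
      fix n assume *: "(?A n \<in> events \<and> ?B n \<in> events) \<and> 1 \<le> n"
      have "{\<omega>\<in>space M. e < \<bar>X n \<omega> / k n \<omega>\<bar>} \<subseteq> ?A n \<union> ?B n"
      proof (rule subsetI, rule ccontr)
        fix \<omega> assume 1: "\<omega> \<in> {\<omega>\<in>space M. e < \<bar>X n \<omega> / k n \<omega>\<bar>}" "\<omega> \<notin> ?A n \<union> ?B n"
        then have \<omega>: "\<omega> \<in> space M" "e < \<bar>X n \<omega> / k n \<omega>\<bar>" "real n powr b < k n \<omega>" by auto
        have "0 < k n \<omega>" using k_ge_1[of n \<omega>] \<omega>(1) * by linarith
        then have "e * k n \<omega> < \<bar>X n \<omega>\<bar>" using \<omega>(2) by (simp add: abs_divide pos_less_divide_eq)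
        have "e * real n powr b \<le> e * k n \<omega>" using \<omega> e by (intro mult_left_mono) auto
        then have "e * real n powr b \<le> \<bar>X n \<omega>\<bar>" using \<open>e * k n \<omega> < \<bar>X n \<omega>\<bar>\<close> by linarith
        then have "(e * real n powr b) powr q \<le> \<bar>X n \<omega>\<bar> powr q"
          using e b(2) by (intro powr_mono2) auto
        then show False using 1 \<omega>(1) by auto
      qed
      then show "{\<omega>\<in>space M. e < \<bar>X n \<omega> / k n \<omega>\<bar>} \<subseteq> ?A n \<union> ?B n \<and> ?A n \<union> ?B n \<in> events"
        using * by (intro conjI sets.Un) blast+
    qed
  qed
qed

lemma D_div_k_vanishes: "vanishes_in_prob (\<lambda>n \<omega>. D s n \<omega> / k n \<omega>)"
\<comment> \<open>Any exponent \<open>b\<close> between \<open>\<alpha> / 2\<close> and \<open>\<alpha>\<close> works: the square of \<open>D s\<close> is of order \<open>n powr \<alpha>\<close> and is divided by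
  \<open>n powr (2 * b)\<close>.\<close>
proof (rule vanishes_div_k[where b="3 * \<alpha> / 4" and q=2])
  obtain A where A: "A \<ge> 0" "\<And>n. n \<ge> 1 \<Longrightarrow> (\<integral>\<omega>. (D s n \<omega>)\<^sup>2 \<partial>M) \<le> A * real n powr \<alpha>"
    using expectation_D_squared_le[of s] by blast
  show "(\<lambda>n. (\<integral>\<omega>. \<bar>D s n \<omega>\<bar> powr 2 \<partial>M) / real n powr (3 * \<alpha> / 4 * 2)) \<longlonglongrightarrow> 0"
  proof (rule tendsto_sandwich[OF _ _ tendsto_const])
    show "(\<lambda>n. A * real n powr \<alpha> / real n powr (3 * \<alpha> / 4 * 2)) \<longlonglongrightarrow> 0"
      using alpha by real_asymp
    show "\<forall>\<^sub>F n in sequentially. (\<integral>\<omega>. \<bar>D s n \<omega>\<bar> powr 2 \<partial>M) / real n powr (3 * \<alpha> / 4 * 2)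
        \<le> A * real n powr \<alpha> / real n powr (3 * \<alpha> / 4 * 2)"
      using A by (intro eventually_mono[OF eventually_ge_at_top[of 1]] divide_right_mono) auto
  qed (auto intro!: always_eventually divide_nonneg_nonneg integral_nonneg_AE)
qed (use alpha det_D in auto)

definition weighted_tally :: "(nat \<Rightarrow> real) \<Rightarrow> nat \<Rightarrow> 'a \<Rightarrow> real" where
  "weighted_tally u n \<omega> = (\<Sum>l<n. u (c l \<omega>))"

lemma det_weighted_tally: "det n (weighted_tally u n)"
  unfolding weighted_tally_def
  by (rule det_sum, rule det_comp, rule detI, rule c_cong) auto

text \<open>
Since \<open>N s \<le> k n\<close>, the terms with \<open>s \<ge> T\<close> contribute at most the tail of \<open>\<Sum>s. u s\<close>, uniformly in \<open>n\<close>; the finitely many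
others converge by \<open>D_div_k_vanishes\<close>.
\<close>

lemma weighted_tally_law_of_large_numbers:
  assumes u: "summable u" "\<And>s. 0 \<le> u s"
  shows "vanishes_in_prob (\<lambda>n \<omega>. weighted_tally u n \<omega> / k n \<omega> - (\<Sum>s. u s * sibuya_tail \<alpha> s))"
  unfolding vanishes_in_prob_def
proof (intro allI impI)
  fix e :: real assume e: "e > 0"
  have P: "0 \<le> sibuya_tail \<alpha> s" "sibuya_tail \<alpha> s \<le> 1" for s
    using sibuya_tail_bounds[OF alpha, of s] by auto
  have uP: "summable (\<lambda>s. u s * sibuya_tail \<alpha> s)"
    by (rule summable_comparison_test'[OF u(1)]) (use u P in \<open>auto simp: mult_left_le\<close>)
  have "(\<lambda>T. \<Sum>s. u (s + T)) \<longlonglongrightarrow> 0" by (rule suminf_exist_split2[OF u(1)])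
  then have "\<forall>\<^sub>F T in sequentially. (\<Sum>s. u (s + T)) < e / 2" using e by (intro order_tendstoD(2)) auto
  then obtain T where T: "(\<Sum>s. u (s + T)) < e / 2" by (auto simp: eventually_sequentially)
  let ?R = "\<lambda>n \<omega>. \<Sum>s<T. u s * \<bar>D s n \<omega> / k n \<omega>\<bar>"
  have detR: "det n (?R n)" for n
    by (intro det_sum det_arith det_const det_D det_N order_refl)
  have R: "vanishes_in_prob ?R"
  proof (intro vanishes_in_prob_sum vanishes_in_prob_cmult)
    fix s
    show "vanishes_in_prob (\<lambda>n \<omega>. \<bar>D s n \<omega> / k n \<omega>\<bar>)"
      using D_div_k_vanishes[of s] by (simp add: vanishes_in_prob_def)
    show "\<forall>\<^sub>F n in sequentially. (\<lambda>\<omega>. u s * \<bar>D s n \<omega> / k n \<omega>\<bar>) \<in> borel_measurable M"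
    proof (intro always_eventually allI)
      fix n show "(\<lambda>\<omega>. u s * \<bar>D s n \<omega> / k n \<omega>\<bar>) \<in> borel_measurable M"
        by (rule det_measurable[of n]) (intro det_arith det_const det_D det_N order_refl)
    qed
  qed auto
  show "(\<lambda>n. prob {\<omega>\<in>space M. e < \<bar>weighted_tally u n \<omega> / k n \<omega> - (\<Sum>s. u s * sibuya_tail \<alpha> s)\<bar>}) \<longlonglongrightarrow> 0"
  proof (rule prob_tendsto_0_subset)
    show "(\<lambda>n. prob {\<omega>\<in>space M. e / 2 < \<bar>?R n \<omega>\<bar>}) \<longlonglongrightarrow> 0"
      using R[unfolded vanishes_in_prob_def, rule_format, of "e / 2"] e by simp
    show "\<forall>\<^sub>F n in sequentially. {\<omega>\<in>space M. e < \<bar>weighted_tally u n \<omega> / k n \<omega> - (\<Sum>s. u s * sibuya_tail \<alpha> s)\<bar>}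
        \<subseteq> {\<omega>\<in>space M. e / 2 < \<bar>?R n \<omega>\<bar>} \<and> {\<omega>\<in>space M. e / 2 < \<bar>?R n \<omega>\<bar>} \<in> events"
    proof (rule eventually_mono[OF eventually_ge_at_top[of 1]])
      fix n :: nat assume n: "n \<ge> 1"
      have ev: "{\<omega>\<in>space M. e / 2 < \<bar>?R n \<omega>\<bar>} \<in> events"
        by (rule det_event[of n], rule det_comp[where f="\<lambda>x. e / 2 < \<bar>x\<bar>"], rule detR)
      have bound: "\<bar>weighted_tally u n \<omega> / k n \<omega> - (\<Sum>s. u s * sibuya_tail \<alpha> s)\<bar> \<le> ?R n \<omega> + e / 2"
        if \<omega>: "\<omega> \<in> space M" for \<omega>
      proof -
        define x where "x s = u s * (D s n \<omega> / k n \<omega>)" for s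
        have k0: "k n \<omega> > 0" using k_ge_1[OF n \<omega>] by linarith
        have xN: "x s = u s * N s n \<omega> / k n \<omega> - u s * sibuya_tail \<alpha> s" for s
          using k0 by (simp add: x_def D_def diff_divide_distrib right_diff_distrib)
        have abs_x: "\<bar>x s\<bar> \<le> u s" for s
        proof -
          have "\<bar>D s n \<omega> / k n \<omega>\<bar> \<le> 1" using abs_D_le[OF n \<omega>, of s] k0 by (simp add: field_simps)
          then have "u s * \<bar>D s n \<omega> / k n \<omega>\<bar> \<le> u s * 1" by (rule mult_left_mono[OF _ u(2)])
          then show ?thesis by (simp only: x_def abs_mult abs_of_nonneg[OF u(2)] mult_1_right)
        qed
        have sx: "summable x" by (rule summable_comparison_test'[OF u(1)]) (simp add: abs_x)
        have Nsums: "(\<lambda>s. u s * N s n \<omega> / k n \<omega>) sums (weighted_tally u n \<omega> / k n \<omega>)"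
        proof -
          have "(\<lambda>s. u s * N s n \<omega> / k n \<omega>) sums (\<Sum>s<n. u s * N s n \<omega> / k n \<omega>)"
            by (rule sums_finite) (auto simp: tally_eq_0[OF \<omega>])
          moreover have "(\<Sum>s<n. u s * N s n \<omega>) = weighted_tally u n \<omega>"
            unfolding weighted_tally_def by (rule sum_tally) (rule le_less_trans[OF c_le[OF \<omega>]])
          ultimately show ?thesis by (simp flip: sum_divide_distrib)
        qed
        have "weighted_tally u n \<omega> / k n \<omega> - (\<Sum>s. u s * sibuya_tail \<alpha> s) = suminf x"
        proof -
          have "(\<lambda>s. u s * N s n \<omega> / k n \<omega> - u s * sibuya_tail \<alpha> s) sums
              (weighted_tally u n \<omega> / k n \<omega> - (\<Sum>s. u s * sibuya_tail \<alpha> s))"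
            by (rule sums_diff[OF Nsums summable_sums[OF uP]])
          moreover have "x = (\<lambda>s. u s * N s n \<omega> / k n \<omega> - u s * sibuya_tail \<alpha> s)" by (rule ext) (rule xN)
          ultimately show ?thesis by (simp add: sums_iff)
        qed
        also have "\<dots> = (\<Sum>s. x (s + T)) + (\<Sum>s<T. x s)" by (rule suminf_split_initial_segment[OF sx])
        also have "\<bar>\<dots>\<bar> \<le> \<bar>\<Sum>s. x (s + T)\<bar> + \<bar>\<Sum>s<T. x s\<bar>" by (rule abs_triangle_ineq)
        also have "\<bar>\<Sum>s. x (s + T)\<bar> \<le> (\<Sum>s. u (s + T))"
        proof -
          have su: "summable (\<lambda>s. u (s + T))" using u(1) by (subst summable_iff_shift)
          have sa: "summable (\<lambda>s. \<bar>x (s + T)\<bar>)"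
            by (rule summable_comparison_test'[OF su]) (simp add: abs_x)
          have "\<bar>\<Sum>s. x (s + T)\<bar> \<le> (\<Sum>s. \<bar>x (s + T)\<bar>)" by (rule summable_rabs[OF sa])
          also have "\<dots> \<le> (\<Sum>s. u (s + T))" by (rule suminf_le[OF _ sa su]) (rule abs_x)
          finally show ?thesis .
        qed
        also have "\<bar>\<Sum>s<T. x s\<bar> \<le> ?R n \<omega>"
          by (rule order_trans[OF sum_abs]) (use u(2) in \<open>simp add: x_def abs_mult\<close>)
        finally show ?thesis using T by linarith
      qed
      show "{\<omega>\<in>space M. e < \<bar>weighted_tally u n \<omega> / k n \<omega> - (\<Sum>s. u s * sibuya_tail \<alpha> s)\<bar>}
          \<subseteq> {\<omega>\<in>space M. e / 2 < \<bar>?R n \<omega>\<bar>} \<and> {\<omega>\<in>space M. e / 2 < \<bar>?R n \<omega>\<bar>} \<in> events"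
      proof (intro conjI ev subsetI)
        fix \<omega> assume "\<omega> \<in> {\<omega>\<in>space M. e < \<bar>weighted_tally u n \<omega> / k n \<omega> - (\<Sum>s. u s * sibuya_tail \<alpha> s)\<bar>}"
        then have "\<omega> \<in> space M" "e / 2 < ?R n \<omega>" using bound[of \<omega>] by auto
        then show "\<omega> \<in> {\<omega>\<in>space M. e / 2 < \<bar>?R n \<omega>\<bar>}" by simp
      qed
    qed
  qed
qed

section \<open>The score at the true parameter\<close>

text \<open>
The increment of the score at \<open>\<alpha>\<close> when a block of size \<open>s\<close> is joined; the value \<open>1 / \<alpha>\<close> at \<open>s = 0\<close> belongs to a new
block.
\<close>

definition mark :: "nat \<Rightarrow> real" where
  "mark s = - 1 / (real s - \<alpha>)"

definition mark_bound :: real where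
  "mark_bound = 1 / \<alpha> + 1 / (1 - \<alpha>)"

lemma mark_0: "mark 0 = 1 / \<alpha>"
  by (simp add: mark_def)

lemma mark_bound_ge: "1 / \<alpha> \<le> mark_bound" "1 / (1 - \<alpha>) \<le> mark_bound" "1 \<le> mark_bound"
proof -
  show "1 / \<alpha> \<le> mark_bound" "1 / (1 - \<alpha>) \<le> mark_bound" using alpha by (auto simp: mark_bound_def)
  moreover have "1 \<le> 1 / \<alpha>" using alpha by simp
  ultimately show "1 \<le> mark_bound" by linarith
qed

lemma abs_mark_le: "\<bar>mark s\<bar> \<le> mark_bound"
proof (cases "s = 0")
  case True
  then show ?thesis using alpha mark_bound_ge by (simp add: mark_0)
next
  case False
  then have "1 - \<alpha> \<le> real s - \<alpha>" by simp
  then have "1 / (real s - \<alpha>) \<le> 1 / (1 - \<alpha>)" using alpha by (intro divide_left_mono) auto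
  moreover have "0 < real s - \<alpha>" using False alpha by linarith
  ultimately show ?thesis using mark_bound_ge by (simp add: mark_def)
qed

lemma mark_squared_le: "(mark s)\<^sup>2 \<le> mark_bound\<^sup>2"
  using abs_mark_le[of s] by (metis abs_ge_zero power2_abs power_mono)

abbreviation info :: real where
  "info \<equiv> fisher_info \<alpha>"

lemma info_ge_1: "1 \<le> info"
proof -
  have "1 \<le> 1 / \<alpha>\<^sup>2" using alpha by (simp add: power_le_one)
  then show ?thesis using fisher_info_ge[OF alpha] by linarith
qed

lemma summable_mark_squared: "summable (\<lambda>s. (mark s)\<^sup>2)"
proof -
  have "summable (\<lambda>s. (mark (Suc s))\<^sup>2)"
    using summable_inverse_square_shift[OF alpha(2)] by (simp add: mark_def power_divide)
  then show ?thesis by (subst (asm) summable_Suc_iff)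
qed

lemma suminf_mark_squared_tail: "(\<Sum>s. (mark s)\<^sup>2 * sibuya_tail \<alpha> s) = info"
proof -
  have eq: "(\<lambda>s. (mark (Suc s))\<^sup>2 * sibuya_tail \<alpha> (Suc s)) = (\<lambda>s. sibuya_tail \<alpha> (Suc s) / (real (Suc s) - \<alpha>)\<^sup>2)"
    by (simp add: mark_def power_divide)
  have "summable (\<lambda>s. (mark (Suc s))\<^sup>2 * sibuya_tail \<alpha> (Suc s))"
    unfolding eq by (rule summable_sibuya_information[OF alpha])
  then have "summable (\<lambda>s. (mark s)\<^sup>2 * sibuya_tail \<alpha> s)"
    using summable_Suc_iff[of "\<lambda>s. (mark s)\<^sup>2 * sibuya_tail \<alpha> s"] by simp
  from suminf_split_head[OF this]
  have "(\<Sum>s. (mark (Suc s))\<^sup>2 * sibuya_tail \<alpha> (Suc s)) = (\<Sum>s. (mark s)\<^sup>2 * sibuya_tail \<alpha> s) - 1 / \<alpha>\<^sup>2"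
    by (simp add: mark_0 power_divide)
  then show ?thesis unfolding eq by (simp add: fisher_info_eq[OF alpha])
qed

definition drift :: "nat \<Rightarrow> 'a \<Rightarrow> real" where
  "drift n \<omega> = (\<Sum>s\<le>n. w n s \<omega> * mark s)"

lemma cmean_mark: "n \<ge> 1 \<Longrightarrow> cmean n (\<lambda>\<omega>. mark (c n \<omega>)) (drift n)"
  by (rule cmeanI[where G="\<lambda>s \<omega>. mark s"]) (simp_all add: det_const drift_def)

lemma jump_weight_mark:
  assumes "s \<ge> 1"
  shows "w n s \<omega> * mark s = - ((1 - p n \<omega>) / (real n - \<alpha> * k n \<omega>) * (N (s - 1) n \<omega> - N s n \<omega>))"
proof -
  have "real s - \<alpha> \<noteq> 0" using assms alpha by linarith
  then show ?thesis using assms by (simp add: jump_weight_def mark_def)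
qed

text \<open>
The factor \<open>s - \<alpha>\<close> in the probability of joining a block of size \<open>s\<close> cancels against the increment of the score, so
that the sum telescopes.
\<close>

lemma sum_jump_weight_mark:
  assumes "n \<ge> 1" "\<omega> \<in> space M"
  shows "(\<Sum>s=1..n. w n s \<omega> * mark s) = - ((1 - p n \<omega>) / (real n - \<alpha> * k n \<omega>) * k n \<omega>)"
proof -
  have tel: "(\<Sum>s=1..m. N (s - 1) n \<omega> - N s n \<omega>) = k n \<omega> - N m n \<omega>" for m
    by (induction m) auto
  have "(\<Sum>s=1..n. w n s \<omega> * mark s)
      = (\<Sum>s=1..n. - ((1 - p n \<omega>) / (real n - \<alpha> * k n \<omega>) * (N (s - 1) n \<omega> - N s n \<omega>)))"
    by (intro sum.cong refl jump_weight_mark) auto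
  also have "\<dots> = - ((1 - p n \<omega>) / (real n - \<alpha> * k n \<omega>) * (\<Sum>s=1..n. N (s - 1) n \<omega> - N s n \<omega>))"
    by (simp only: sum_negf sum_distrib_left)
  finally show ?thesis using tel[of n] tally_eq_0[OF assms(2) order_refl] by simp
qed

lemma jump_rate_le:
  assumes "n \<ge> 1" "\<omega> \<in> space M"
  shows "0 \<le> (1 - p n \<omega>) / (real n - \<alpha> * k n \<omega>)"
    "(1 - p n \<omega>) / (real n - \<alpha> * k n \<omega>) \<le> 1 / ((1 - \<alpha>) * real n)"
  using p_nonneg[OF assms] p_bounds(2)[OF assms] size_total_pos[OF assms] alpha assms
  by (auto intro!: frac_le)

text \<open>
The two contributions to the drift, from new blocks and from existing ones, cancel for \<open>p = \<alpha> * k / n\<close>.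
\<close>

lemma abs_drift_le:
  assumes n: "n \<ge> 1" "\<omega> \<in> space M"
  shows "\<bar>drift n \<omega>\<bar> \<le> C * mark_bound / real n"
proof -
  define T where "T = real n - \<alpha> * k n \<omega>"
  define e where "e = p n \<omega> - \<alpha> * k n \<omega> / real n"
  have T: "T > 0" "(1 - \<alpha>) * real n \<le> T" using size_total_pos[OF n] by (auto simp: T_def)
  have n0: "real n > 0" using n by simp
  \<comment> \<open>The total weight of the joined blocks deviates from its ideal value by the same error \<open>e\<close>.\<close>
  have q: "(1 - p n \<omega>) / T = 1 / real n - e / T"
    using T n0 by (simp add: e_def T_def field_simps)
  have "drift n \<omega> = p n \<omega> / \<alpha> - (1 - p n \<omega>) / T * k n \<omega>"
    unfolding drift_def sum_atMost_split sum_jump_weight_mark[OF n] T_def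
    by (simp add: jump_weight_def mark_0)
  also have "\<dots> = e * (1 / \<alpha> + k n \<omega> / T)"
  proof -
    have "p n \<omega> / \<alpha> = e / \<alpha> + k n \<omega> / real n" using alpha by (simp add: e_def field_simps)
    then show ?thesis unfolding q by (simp add: algebra_simps)
  qed
  finally have "\<bar>drift n \<omega>\<bar> = \<bar>e\<bar> * \<bar>1 / \<alpha> + k n \<omega> / T\<bar>" by (simp add: abs_mult)
  also have "\<dots> \<le> C / real n * mark_bound"
  proof (rule mult_mono)
    show "\<bar>e\<bar> \<le> C / real n" using p_approx[OF n] by (simp add: e_def)
    have "k n \<omega> / T \<le> real n / ((1 - \<alpha>) * real n)"
      using T tally_le[of 0 n \<omega>] alpha n0 by (intro frac_le) auto
    also have "\<dots> = 1 / (1 - \<alpha>)" using n0 by simp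
    finally show "\<bar>1 / \<alpha> + k n \<omega> / T\<bar> \<le> mark_bound" using T alpha by (simp add: mark_bound_def)
  qed (use C_nonneg in auto)
  finally show ?thesis by simp
qed

text \<open>
The increments are bounded, so that their conditional second moment is at most a constant times their conditional
absolute moment, which telescopes like the drift and is \<open>O(k n / n)\<close>.
\<close>

lemma expectation_mark_squared_le:
  obtains A where "A \<ge> 0" "\<And>n. n \<ge> 1 \<Longrightarrow> (\<integral>\<omega>. (mark (c n \<omega>))\<^sup>2 \<partial>M) \<le> A * real n powr (\<alpha> - 1)"
proof -
  obtain Ak where Ak: "Ak \<ge> 0" "\<And>n. n \<ge> 1 \<Longrightarrow> (\<integral>\<omega>. k n \<omega> \<partial>M) \<le> Ak * real n powr \<alpha>"
    using expectation_k_le by metis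
  define K where "K = mark_bound * ((1 + C) / \<alpha> + 1 / (1 - \<alpha>))"
  have K: "K \<ge> 0" using mark_bound_ge C_nonneg alpha by (auto simp: K_def intro!: mult_nonneg_nonneg add_nonneg_nonneg)
  show ?thesis
  proof (rule that[of "K * Ak"])
    show "0 \<le> K * Ak" using K Ak by simp
    fix n :: nat assume n: "n \<ge> 1"
    have int: "integrable M (k n)" by (rule det_integrable[of n], rule det_N) simp
    define d where "d \<omega> = (\<Sum>s\<le>n. w n s \<omega> * (mark s)\<^sup>2)" for \<omega>
    have cm: "cmean n (\<lambda>\<omega>. (mark (c n \<omega>))\<^sup>2) d"
      by (rule cmeanI[OF n, where G="\<lambda>s \<omega>. (mark s)\<^sup>2"]) (simp_all add: det_const d_def)
    have "(\<integral>\<omega>. (mark (c n \<omega>))\<^sup>2 \<partial>M) = (\<integral>\<omega>. d \<omega> \<partial>M)" by (rule cmeanD(4)[OF cm])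
    also have "\<dots> \<le> (\<integral>\<omega>. K / real n * k n \<omega> \<partial>M)"
    proof (rule integral_mono[OF det_integrable[OF cmeanD(2)[OF cm]]])
      show "integrable M (\<lambda>\<omega>. K / real n * k n \<omega>)" using int by (rule integrable_mult_right)
      fix \<omega> assume \<omega>: "\<omega> \<in> space M"
      have "d \<omega> \<le> (\<Sum>s\<le>n. mark_bound * (w n s \<omega> * \<bar>mark s\<bar>))"
        unfolding d_def
      proof (rule sum_mono)
        fix s
        have "(mark s)\<^sup>2 = \<bar>mark s\<bar> * \<bar>mark s\<bar>" by (simp add: power2_eq_square)
        also have "\<dots> \<le> mark_bound * \<bar>mark s\<bar>" by (intro mult_right_mono abs_mark_le) auto
        finally have "w n s \<omega> * (mark s)\<^sup>2 \<le> w n s \<omega> * (mark_bound * \<bar>mark s\<bar>)"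
          by (intro mult_left_mono jump_weight_nonneg n \<omega>)
        then show "w n s \<omega> * (mark s)\<^sup>2 \<le> mark_bound * (w n s \<omega> * \<bar>mark s\<bar>)" by (simp add: mult_ac)
      qed
      also have "\<dots> = mark_bound * (\<Sum>s\<le>n. w n s \<omega> * \<bar>mark s\<bar>)" by (simp add: sum_distrib_left)
      also have "(\<Sum>s\<le>n. w n s \<omega> * \<bar>mark s\<bar>) = p n \<omega> / \<alpha> + (1 - p n \<omega>) / (real n - \<alpha> * k n \<omega>) * k n \<omega>"
      proof -
        have "(\<Sum>s=1..n. w n s \<omega> * \<bar>mark s\<bar>) = (\<Sum>s=1..n. - (w n s \<omega> * mark s))"
          using alpha by (intro sum.cong) (auto simp: mark_def)
        then show ?thesis
          unfolding sum_atMost_split using sum_jump_weight_mark[OF n \<omega>] alpha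
          by (simp add: sum_negf jump_weight_def mark_0)
      qed
      also have "mark_bound * (p n \<omega> / \<alpha> + (1 - p n \<omega>) / (real n - \<alpha> * k n \<omega>) * k n \<omega>)
          \<le> mark_bound * ((1 + C) * k n \<omega> / real n / \<alpha> + 1 / ((1 - \<alpha>) * real n) * k n \<omega>)"
        using p_le[OF n \<omega>] jump_rate_le(2)[OF n \<omega>] alpha mark_bound_ge
        by (intro mult_left_mono add_mono divide_right_mono mult_right_mono) auto
      also have "\<dots> = K / real n * k n \<omega>"
      proof -
        define x y z where "x = (1 + C) / \<alpha>" and "y = 1 / (1 - \<alpha>)" and "z = k n \<omega> / real n"
        have "(1 + C) * k n \<omega> / real n / \<alpha> = x * z" "1 / ((1 - \<alpha>) * real n) * k n \<omega> = y * z"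
          "K / real n * k n \<omega> = mark_bound * (x + y) * z"
          by (simp_all add: x_def y_def z_def K_def)
        then show ?thesis by (simp only: distrib_right mult.assoc)
      qed
      finally show "d \<omega> \<le> K / real n * k n \<omega>" .
    qed
    also have "\<dots> = K / real n * (\<integral>\<omega>. k n \<omega> \<partial>M)" by simp
    also have "\<dots> \<le> K / real n * (Ak * real n powr \<alpha>)" using Ak(2)[OF n] K by (intro mult_left_mono) auto
    also have "\<dots> = K * Ak * real n powr (\<alpha> - 1)" using n by (simp add: powr_diff)
    finally show "(\<integral>\<omega>. (mark (c n \<omega>))\<^sup>2 \<partial>M) \<le> K * Ak * real n powr (\<alpha> - 1)" .
  qed
qed

text \<open>
The sum starts at \<open>l = 1\<close>: the first element opens a block in every partition and carries no information on \<open>\<alpha>\<close>, which is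
why the quasi score contains \<open>k n - 1\<close>.
\<close>

definition score :: "nat \<Rightarrow> 'a \<Rightarrow> real" where
  "score n \<omega> = (\<Sum>l=1..<n. mark (c l \<omega>))"

lemma det_mark: "l < n \<Longrightarrow> det n (\<lambda>\<omega>. f (c l \<omega>))"
  by (rule det_comp, rule detI, rule c_cong)

lemma det_score: "det n (score n)"
  unfolding score_def by (rule det_sum, rule det_mark) simp

lemma expectation_abs_score_le:
  obtains A where "A \<ge> 0" "\<And>n. n \<ge> 1 \<Longrightarrow> (\<integral>\<omega>. \<bar>score n \<omega>\<bar> \<partial>M) \<le> A * real n powr (\<alpha> / 2)"
proof -
  obtain A where A: "A \<ge> 0" "\<And>n. n \<ge> 1 \<Longrightarrow> (\<integral>\<omega>. (mark (c n \<omega>))\<^sup>2 \<partial>M) \<le> A * real n powr (\<alpha> - 1)"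
    using expectation_mark_squared_le by metis
  define K where "K = C * mark_bound"
  have K: "K \<ge> 0" using C_nonneg mark_bound_ge by (simp add: K_def)
  show ?thesis
  proof (rule that[of "K * (1 + 2 / \<alpha>) + sqrt (A / \<alpha>)"])
    show "0 \<le> K * (1 + 2 / \<alpha>) + sqrt (A / \<alpha>)" using A K alpha by simp
    fix n :: nat assume n: "n \<ge> 1"
    have "(\<integral>\<omega>. \<bar>score n \<omega>\<bar> \<partial>M) \<le> (\<Sum>j=1..<n. \<integral>\<omega>. \<bar>drift j \<omega>\<bar> \<partial>M)
        + sqrt (\<Sum>j=1..<n. \<integral>\<omega>. (mark (c j \<omega>))\<^sup>2 \<partial>M)"
      unfolding score_def by (rule expectation_sum_le) (use n cmean_mark in auto)
    also have "(\<Sum>j=1..<n. \<integral>\<omega>. \<bar>drift j \<omega>\<bar> \<partial>M) \<le> (\<Sum>j=1..<n. K * (1 / real j))"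
    proof (rule sum_mono)
      fix j assume "j \<in> {1..<n}"
      then have j: "j \<ge> 1" by simp
      have "(\<integral>\<omega>. \<bar>drift j \<omega>\<bar> \<partial>M) \<le> (\<integral>\<omega>. K * (1 / real j) \<partial>M)"
      proof (rule integral_mono)
        show "integrable M (\<lambda>\<omega>. \<bar>drift j \<omega>\<bar>)"
          by (rule integrable_abs, rule det_integrable, rule cmeanD(2)[OF cmean_mark[OF j]])
        show "\<bar>drift j \<omega>\<bar> \<le> K * (1 / real j)" if "\<omega> \<in> space M" for \<omega>
          using abs_drift_le[OF j that] by (simp add: K_def)
      qed simp
      then show "(\<integral>\<omega>. \<bar>drift j \<omega>\<bar> \<partial>M) \<le> K * (1 / real j)" by (simp add: prob_space)
    qed
    also have "\<dots> = K * (\<Sum>j=1..<n. 1 / real j)" by (simp add: sum_distrib_left)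
    also have "\<dots> \<le> K * (1 + ln (real n))" using K n by (intro mult_left_mono sum_inverse_le_ln) auto
    \<comment> \<open>The drift only adds a logarithm, which any power of \<open>n\<close> dominates.\<close>
    also have "\<dots> \<le> K * ((1 + 2 / \<alpha>) * real n powr (\<alpha> / 2))"
    proof (rule mult_left_mono[OF _ K])
      have 1: "1 \<le> real n powr (\<alpha> / 2)" using n alpha by (intro ge_one_powr_ge_zero) auto
      have "ln (real n powr (\<alpha> / 2)) \<le> real n powr (\<alpha> / 2) - 1" using n by (intro ln_le_minus_one) auto
      then have "\<alpha> / 2 * ln (real n) \<le> real n powr (\<alpha> / 2)" using n by (simp add: ln_powr)
      then have "ln (real n) \<le> 2 / \<alpha> * real n powr (\<alpha> / 2)" using alpha by (simp add: field_simps)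
      then show "1 + ln (real n) \<le> (1 + 2 / \<alpha>) * real n powr (\<alpha> / 2)" using 1 by (simp add: distrib_right)
    qed
    also have "sqrt (\<Sum>j=1..<n. \<integral>\<omega>. (mark (c j \<omega>))\<^sup>2 \<partial>M) \<le> sqrt (A / \<alpha>) * real n powr (\<alpha> / 2)"
    proof -
      have "(\<Sum>j=1..<n. \<integral>\<omega>. (mark (c j \<omega>))\<^sup>2 \<partial>M) \<le> (\<Sum>j=1..<n. A * real j powr (\<alpha> - 1))"
        using A(2) by (intro sum_mono) auto
      also have "\<dots> = A * (\<Sum>j=1..<n. real j powr (\<alpha> - 1))" by (simp add: sum_distrib_left)
      also have "\<dots> \<le> A * (real n powr \<alpha> / \<alpha>)"
        using A alpha by (intro mult_left_mono sum_powr_minus_one_le) auto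
      finally have "sqrt (\<Sum>j=1..<n. \<integral>\<omega>. (mark (c j \<omega>))\<^sup>2 \<partial>M) \<le> sqrt (A / \<alpha> * real n powr \<alpha>)"
        by (intro real_sqrt_le_mono) simp
      also have "sqrt (real n powr \<alpha>) = real n powr (\<alpha> / 2)"
        using n by (simp add: powr_half_sqrt[symmetric] powr_powr)
      then have "sqrt (A / \<alpha> * real n powr \<alpha>) = sqrt (A / \<alpha>) * real n powr (\<alpha> / 2)"
        by (simp only: real_sqrt_mult)
      finally show ?thesis .
    qed
    finally show "(\<integral>\<omega>. \<bar>score n \<omega>\<bar> \<partial>M) \<le> (K * (1 + 2 / \<alpha>) + sqrt (A / \<alpha>)) * real n powr (\<alpha> / 2)"
      by (simp add: distrib_right mult.assoc)
  qed
qed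

definition normed_score :: "nat \<Rightarrow> 'a \<Rightarrow> real" where
  "normed_score n \<omega> = score n \<omega> / sqrt (k n \<omega> * info)"

lemma det_normed_score: "det n (normed_score n)"
  unfolding normed_score_def
  by (intro det_arith(4) det_score det_comp[where f="\<lambda>x. sqrt (x * info)"] det_N order_refl)

text \<open>
On the event \<open>\<bar>V n\<bar> < Q\<close> the norming is at least \<open>exp (- Q / 2) * n powr (\<alpha> / 2)\<close>, and the mean of the absolute score is
\<open>O(n powr (\<alpha> / 2))\<close>.
\<close>

lemma normed_score_tight:
  assumes "e > 0"
  obtains L where "L > 0" "\<And>n. n \<ge> 1 \<Longrightarrow> prob {\<omega>\<in>space M. L < \<bar>normed_score n \<omega>\<bar>} < e"
proof -
  obtain A where A: "A \<ge> 0" "\<And>n. n \<ge> 1 \<Longrightarrow> (\<integral>\<omega>. \<bar>score n \<omega>\<bar> \<partial>M) \<le> A * real n powr (\<alpha> / 2)"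
    using expectation_abs_score_le by metis
  obtain B where B: "B \<ge> 0" "\<And>n. n \<ge> 1 \<Longrightarrow> (\<integral>\<omega>. \<bar>V n \<omega>\<bar> \<partial>M) \<le> B"
    using V_bounded by metis
  define Q where "Q = 2 * (B + 1) / e"
  define L where "L = exp (Q / 2) * (2 * (A + 1) / e)"
  have Q: "Q > 0" and L: "L > 0" using A B assms by (auto simp: Q_def L_def)
  show ?thesis
  proof (rule that[OF L])
    fix n :: nat assume n: "n \<ge> 1"
    define a where "a = L * exp (- Q / 2) * real n powr (\<alpha> / 2)"
    have a: "a = 2 * (A + 1) / e * real n powr (\<alpha> / 2)" "a > 0"
      using n A assms by (auto simp: a_def L_def exp_minus)
    let ?V = "{\<omega>\<in>space M. Q \<le> \<bar>V n \<omega>\<bar>}" and ?S = "{\<omega>\<in>space M. a \<le> \<bar>score n \<omega>\<bar>}"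
    have ev: "?V \<in> events" "?S \<in> events"
      by (rule det_event[of n], rule det_comp[where f="\<lambda>x. Q \<le> \<bar>x\<bar>"], rule det_V)
        (rule det_event[of n], rule det_comp[where f="\<lambda>x. a \<le> \<bar>x\<bar>"], rule det_score)
    have "{\<omega>\<in>space M. L < \<bar>normed_score n \<omega>\<bar>} \<subseteq> ?V \<union> ?S"
    proof (rule subsetI, rule ccontr)
      fix \<omega> assume 1: "\<omega> \<in> {\<omega>\<in>space M. L < \<bar>normed_score n \<omega>\<bar>}" "\<omega> \<notin> ?V \<union> ?S"
      then have \<omega>: "\<omega> \<in> space M" "L < \<bar>normed_score n \<omega>\<bar>" "- Q < V n \<omega>" "\<bar>score n \<omega>\<bar> < a" by auto
      have k0: "0 < k n \<omega>" using k_ge_1[OF n \<omega>(1)] by linarith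
      have kV: "k n \<omega> = exp (V n \<omega>) * real n powr \<alpha>"
        using k0 n by (simp add: V_def exp_diff powr_def)
      have "exp (- Q / 2) * real n powr (\<alpha> / 2) = sqrt (exp (- Q) * real n powr \<alpha>)"
      proof -
        have "sqrt (exp (- Q)) = exp (- Q / 2)"
          by (rule real_sqrt_unique) (auto simp: power2_eq_square mult_exp_exp)
        moreover have "sqrt (real n powr \<alpha>) = real n powr (\<alpha> / 2)"
          using n by (simp add: powr_half_sqrt[symmetric] powr_powr)
        ultimately show ?thesis by (simp only: real_sqrt_mult)
      qed
      also have "\<dots> \<le> sqrt (k n \<omega> * info)"
      proof (rule real_sqrt_le_mono)
        have "exp (- Q) * real n powr \<alpha> \<le> k n \<omega> * 1"
          unfolding kV using \<omega>(3) by (simp add: mult_right_mono)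
        also have "\<dots> \<le> k n \<omega> * info" using info_ge_1 k0 by (intro mult_left_mono) auto
        finally show "exp (- Q) * real n powr \<alpha> \<le> k n \<omega> * info" .
      qed
      finally have "L * (exp (- Q / 2) * real n powr (\<alpha> / 2)) \<le> L * sqrt (k n \<omega> * info)"
        using L by (intro mult_left_mono) auto
      moreover have "L * sqrt (k n \<omega> * info) < \<bar>score n \<omega>\<bar>"
        using \<omega>(2) k0 info_ge_1 by (simp add: normed_score_def abs_divide pos_less_divide_eq)
      ultimately show False using \<omega>(4) by (simp add: a_def)
    qed
    then have "prob {\<omega>\<in>space M. L < \<bar>normed_score n \<omega>\<bar>} \<le> prob (?V \<union> ?S)"
      using ev by (intro finite_measure_mono sets.Un)
    also have "\<dots> \<le> prob ?V + prob ?S" using ev by (rule measure_Un_le)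
    also have "\<dots> \<le> (\<integral>\<omega>. \<bar>V n \<omega>\<bar> \<partial>M) / Q + (\<integral>\<omega>. \<bar>score n \<omega>\<bar> \<partial>M) / a"
      by (intro add_mono prob_markov det_integrable[OF det_V] det_integrable[OF det_score] Q a)
    also have "\<dots> \<le> B / Q + A * real n powr (\<alpha> / 2) / a"
      using A(2)[OF n] B(2)[OF n] Q a by (intro add_mono divide_right_mono) auto
    also have "B / Q < e / 2"
      using B assms by (simp add: Q_def field_simps)
    also have "A * real n powr (\<alpha> / 2) / a \<le> e / 2"
    proof -
      have "A * real n powr (\<alpha> / 2) / a = A / (A + 1) * (e / 2)"
        unfolding a(1) using n by simp
      also have "\<dots> \<le> 1 * (e / 2)" using A assms by (intro mult_right_mono) auto
      finally show ?thesis by simp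
    qed
    finally show "prob {\<omega>\<in>space M. L < \<bar>normed_score n \<omega>\<bar>} < e" by simp
  qed
qed

section \<open>Products of martingale increments\<close>

lemma cmean_complex:
  fixes H :: "'a \<Rightarrow> complex"
  assumes n1: "1 \<le> n" and cm: "cmean n Y d" and H: "det n H"
  shows "(\<integral>\<omega>. H \<omega> * complex_of_real (Y \<omega>) \<partial>M) = (\<integral>\<omega>. H \<omega> * complex_of_real (d \<omega>) \<partial>M)"
proof -
  have detH: "det n (\<lambda>\<omega>. Re (H \<omega>))" "det n (\<lambda>\<omega>. Im (H \<omega>))" by (rule det_comp, rule H)+
  have split: "(\<integral>\<omega>. H \<omega> * complex_of_real (X \<omega>) \<partial>M)
      = complex_of_real (\<integral>\<omega>. Re (H \<omega>) * X \<omega> \<partial>M) + \<i> * complex_of_real (\<integral>\<omega>. Im (H \<omega>) * X \<omega> \<partial>M)"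
    if X: "det l X" "det l H" for X l
  proof -
    have i: "integrable M (\<lambda>\<omega>. Re (H \<omega>) * X \<omega>)" "integrable M (\<lambda>\<omega>. Im (H \<omega>) * X \<omega>)"
      by (rule det_integrable[of l], intro det_arith(3) det_comp[where f=Re] det_comp[where f=Im] X)+
    have "(\<integral>\<omega>. H \<omega> * complex_of_real (X \<omega>) \<partial>M)
        = (\<integral>\<omega>. complex_of_real (Re (H \<omega>) * X \<omega>) + \<i> * complex_of_real (Im (H \<omega>) * X \<omega>) \<partial>M)"
      by (intro Bochner_Integration.integral_cong) (auto simp: complex_eq_iff)
    also have "\<dots> = (\<integral>\<omega>. complex_of_real (Re (H \<omega>) * X \<omega>) \<partial>M) + (\<integral>\<omega>. \<i> * complex_of_real (Im (H \<omega>) * X \<omega>) \<partial>M)"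
      using i by (intro Bochner_Integration.integral_add integrable_mult_right integrable_of_real)
    also have "(\<integral>\<omega>. \<i> * complex_of_real (Im (H \<omega>) * X \<omega>) \<partial>M) = \<i> * (\<integral>\<omega>. complex_of_real (Im (H \<omega>) * X \<omega>) \<partial>M)"
      by (rule integral_mult_right_zero)
    finally show ?thesis by (simp only: integral_complex_of_real)
  qed
  have n: "det (Suc n) H"
    by (rule detI, rule detD[OF H]) (rule Z_refine_le[OF n1 le_SucI[OF order_refl]])
  show ?thesis
    unfolding split[OF cmeanD(1)[OF cm] n] split[OF cmeanD(2)[OF cm] H]
      cmeanD(3)[OF cm detH(1)] cmeanD(3)[OF cm detH(2)] ..
qed

text \<open>
The form in which all approximations below are used: a uniform error off an exceptional event, and a crude bound on it.
\<close>

lemma norm_expectation_diff_le: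
  fixes F G :: "'a \<Rightarrow> complex"
  assumes "det n F" "det n G" "bad \<in> events"
    and le: "\<And>\<omega>. \<omega> \<in> space M \<Longrightarrow> norm (F \<omega> - G \<omega>) \<le> h + r * indicator bad \<omega>"
  shows "norm ((\<integral>\<omega>. F \<omega> \<partial>M) - (\<integral>\<omega>. G \<omega> \<partial>M)) \<le> h + r * prob bad"
proof -
  have i: "integrable M F" "integrable M G" using assms by (auto intro: det_integrable)
  have ib: "integrable M (indicator bad :: 'a \<Rightarrow> real)"
    using assms(3) by (rule integrable_real_indicator) (simp add: less_top[symmetric])
  have "norm ((\<integral>\<omega>. F \<omega> \<partial>M) - (\<integral>\<omega>. G \<omega> \<partial>M)) = norm (\<integral>\<omega>. F \<omega> - G \<omega> \<partial>M)"
    using i by simp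
  also have "\<dots> \<le> (\<integral>\<omega>. norm (F \<omega> - G \<omega>) \<partial>M)" by (rule integral_norm_bound)
  also have "\<dots> \<le> (\<integral>\<omega>. h + r * indicator bad \<omega> \<partial>M)"
    using i ib le by (intro integral_mono integrable_norm Bochner_Integration.integrable_diff
        Bochner_Integration.integrable_add integrable_mult_right) auto
  also have "\<dots> = h + r * prob bad"
    using ib assms(3) by (simp add: prob_space)
  finally show ?thesis .
qed

lemma norm_expectation_iexp_diff_le:
  fixes g X Y :: "'a \<Rightarrow> real"
  assumes g: "det n g" "\<And>\<omega>. \<bar>g \<omega>\<bar> \<le> 1" and X: "det n X" and Y: "det n Y" and bad: "bad \<in> events" and h: "0 \<le> h"
    and close: "\<And>\<omega>. \<omega> \<in> space M \<Longrightarrow> \<omega> \<notin> bad \<Longrightarrow> \<bar>X \<omega> - Y \<omega>\<bar> \<le> h"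
  shows "norm ((\<integral>\<omega>. g \<omega> * iexp (t * X \<omega>) \<partial>M) - (\<integral>\<omega>. g \<omega> * iexp (t * Y \<omega>) \<partial>M)) \<le> \<bar>t\<bar> * h + 2 * prob bad"
proof (rule norm_expectation_diff_le[OF _ _ bad])
  have dg: "det n (\<lambda>\<omega>. complex_of_real (g \<omega>))" using g(1) by (rule det_comp)
  show "det n (\<lambda>\<omega>. g \<omega> * iexp (t * X \<omega>))"
    by (intro det_arith(3) dg det_comp[where f="\<lambda>x. iexp (t * x)"] X)
  show "det n (\<lambda>\<omega>. g \<omega> * iexp (t * Y \<omega>))"
    by (intro det_arith(3) dg det_comp[where f="\<lambda>x. iexp (t * x)"] Y)
  fix \<omega> assume \<omega>: "\<omega> \<in> space M"
  have *: "norm (g \<omega> * iexp (t * X \<omega>) - g \<omega> * iexp (t * Y \<omega>)) \<le> norm (iexp (t * X \<omega>) - iexp (t * Y \<omega>))"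
    unfolding right_diff_distrib[symmetric] norm_mult using g(2)[of \<omega>] by (simp add: mult_left_le_one_le)
  show "norm (g \<omega> * iexp (t * X \<omega>) - g \<omega> * iexp (t * Y \<omega>)) \<le> \<bar>t\<bar> * h + 2 * indicator bad \<omega>"
  proof (cases "\<omega> \<in> bad")
    case True
    have "norm (iexp (t * X \<omega>) - iexp (t * Y \<omega>)) \<le> 2"
      using norm_triangle_ineq4[of "iexp (t * X \<omega>)" "iexp (t * Y \<omega>)"] by simp
    moreover have "indicator bad \<omega> = (1::real)" using True by (rule indicator_simps)
    moreover have "0 \<le> \<bar>t\<bar> * h" using h by simp
    ultimately show ?thesis using * by linarith
  next
    case False
    have "norm (iexp (t * X \<omega>) - iexp (t * Y \<omega>)) = norm (iexp (t * Y \<omega>) * (iexp (t * X \<omega> - t * Y \<omega>) - 1))"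
      by (simp add: right_diff_distrib mult_exp_exp)
    also have "\<dots> = norm (iexp (t * X \<omega> - t * Y \<omega>) - 1)"
      by (simp only: norm_mult norm_exp_i_times mult_1)
    also have "\<dots> \<le> \<bar>t * X \<omega> - t * Y \<omega>\<bar>"
      using iexp_approx1[of "t * X \<omega> - t * Y \<omega>" 0] by simp
    also have "\<dots> = \<bar>t\<bar> * \<bar>X \<omega> - Y \<omega>\<bar>"
      unfolding right_diff_distrib[symmetric] abs_mult ..
    also have "\<dots> \<le> \<bar>t\<bar> * h" using close[OF \<omega> False] by (intro mult_left_mono) auto
    finally show ?thesis using * False by simp
  qed
qed

text \<open>
The value of the norming \<open>sqrt (k n * info)\<close> that is predicted at time \<open>m\<close> from the growth \<open>k n \<approx> k m * (n / m) powr \<alpha>\<close>.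
\<close>

definition scale :: "nat \<Rightarrow> nat \<Rightarrow> 'a \<Rightarrow> real" where
  "scale m n \<omega> = sqrt (k m \<omega> * info * (real n / real m) powr \<alpha>)"

definition qv :: "nat \<Rightarrow> nat \<Rightarrow> 'a \<Rightarrow> real" where
  "qv m n \<omega> = (\<Sum>j=m..<n. (mark (c j \<omega>))\<^sup>2)"

lemma det_scale: "det m (scale m n)"
  unfolding scale_def
  by (rule det_comp[where f="\<lambda>x. sqrt (x * info * (real n / real m) powr \<alpha>)"]) (rule det_N[OF order_refl])

lemma det_qv: "det n (qv m n)"
  unfolding qv_def by (rule det_sum, rule det_mark) simp

lemma scale_ge:
  assumes "1 \<le> m" "m \<le> n" "\<omega> \<in> space M"
  shows "(real n / real m) powr (\<alpha> / 2) \<le> scale m n \<omega>" "1 \<le> (real n / real m) powr (\<alpha> / 2)"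
proof -
  have "1 \<le> real n / real m" using assms by simp
  then show "1 \<le> (real n / real m) powr (\<alpha> / 2)" using alpha by (intro ge_one_powr_ge_zero) auto
  have "(real n / real m) powr (\<alpha> / 2) = sqrt ((real n / real m) powr \<alpha>)"
    using assms by (simp add: powr_half_sqrt[symmetric] powr_powr)
  also have "\<dots> \<le> scale m n \<omega>"
    unfolding scale_def
  proof (rule real_sqrt_le_mono)
    have "1 * 1 \<le> k m \<omega> * info" using k_ge_1[OF assms(1,3)] info_ge_1 by (intro mult_mono) auto
    then have "1 * (real n / real m) powr \<alpha> \<le> k m \<omega> * info * (real n / real m) powr \<alpha>"
      by (intro mult_right_mono) auto
    then show "(real n / real m) powr \<alpha> \<le> k m \<omega> * info * (real n / real m) powr \<alpha>" by simp
  qed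
  finally show "(real n / real m) powr (\<alpha> / 2) \<le> scale m n \<omega>" .
qed

text \<open>
McLeish's argument for martingale arrays. Put \<open>x j = t * mark (c j) / scale m n\<close>. Then \<open>iexp (\<Sum>j. x j)\<close> is close to
\<open>(\<Prod>j. 1 + \<i> * x j) * exp (- (\<Sum>j. (x j)\<^sup>2) / 2)\<close>. The scale is known at time \<open>m\<close>, so the product, integrated against a
function \<open>g\<close> of the past up to \<open>m\<close>, keeps its initial mean up to the total drift, and \<open>\<Sum>j. (x j)\<^sup>2\<close> is close to \<open>t\<^sup>2\<close>
outside the event \<open>bad\<close>. The first term of the error bound tends to zero as \<open>n\<close> tends to infinity; the other two
become small by the choice of \<open>e\<close> and \<open>m\<close>.
\<close>

lemma char_score_estimate:
  fixes g :: "'a \<Rightarrow> real" and t :: real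
  assumes m: "1 \<le> m" "m \<le> n" and g: "det m g" "\<And>\<omega>. \<bar>g \<omega>\<bar> \<le> 1" and e: "0 \<le> e" "e \<le> 1"
  defines "bad \<equiv> {\<omega>\<in>space M. \<not> \<bar>qv m n \<omega> - (scale m n \<omega>)\<^sup>2\<bar> \<le> e * (scale m n \<omega>)\<^sup>2}"
    and "B \<equiv> exp (t\<^sup>2 * (2 + mark_bound\<^sup>2) / 2)"
    and "R \<equiv> \<bar>t\<bar> * exp (t\<^sup>2 * (2 + mark_bound\<^sup>2) / 2) * C * mark_bound + 2 * (\<bar>t\<bar> * mark_bound) * (t\<^sup>2 * (2 + mark_bound\<^sup>2))"
  shows "norm ((\<integral>\<omega>. g \<omega> * iexp (t * ((score n \<omega> - score m \<omega>) / scale m n \<omega>)) \<partial>M) - (\<integral>\<omega>. g \<omega> \<partial>M) * exp (- t\<^sup>2 / 2))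
    \<le> R * ((1 + ln (real n)) / (real n / real m) powr (\<alpha> / 2)) + B * t\<^sup>2 * e + (2 + B) * prob bad"
proof -
  define b where "b = mark_bound"
  define q where "q = (real n / real m) powr (\<alpha> / 2)"
  define a where "a \<omega> = scale m n \<omega>" for \<omega>
  define S where "S l \<omega> = qv m l \<omega>" for l \<omega>
  \<comment> \<open>The increments stop once the sum of squares exceeds twice its predicted value. This is decided by the history
    before the increment, and it bounds the products uniformly.\<close>
  define x where "x l \<omega> = (if S l \<omega> \<le> 2 * (a \<omega>)\<^sup>2 then t * mark (c l \<omega>) / a \<omega> else 0)" for l \<omega>
  define Q where "Q l \<omega> = (\<Sum>j=m..<l. (x j \<omega>)\<^sup>2)" for l \<omega>
  define P where "P l \<omega> = (\<Prod>j=m..<l. 1 + \<i> * complex_of_real (x j \<omega>))" for l \<omega>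
  have b1: "b \<ge> 1" using mark_bound_ge by (simp add: b_def)
  have q1: "q \<ge> 1" using scale_ge(2) m not_empty by (auto simp: q_def)
  have B1: "B \<ge> 1" by (simp add: B_def)
  have a: "q \<le> a \<omega>" "1 \<le> a \<omega>" if "\<omega> \<in> space M" for \<omega>
    using scale_ge[OF m that] by (auto simp: a_def q_def)
  have S_Suc: "S (Suc l) \<omega> = S l \<omega> + (mark (c l \<omega>))\<^sup>2" if "m \<le> l" for l \<omega>
    using that by (simp add: S_def qv_def)
  have S_mono: "S l \<omega> \<le> S l' \<omega>" if "l \<le> l'" for l l' \<omega>
    unfolding S_def qv_def using that by (intro sum_mono2) auto
  \<comment> \<open>The last counted increment may overshoot the level, by at most \<open>mark_bound\<^sup>2\<close>; \<open>scale \<ge> 1\<close> absorbs it.\<close>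
  have Qle: "Q l \<omega> \<le> t\<^sup>2 * (2 + b\<^sup>2)" if "m \<le> l" "\<omega> \<in> space M" for l \<omega>
  proof -
    have "Q l \<omega> \<le> (t / a \<omega>)\<^sup>2 * S l \<omega> \<and> Q l \<omega> \<le> (t / a \<omega>)\<^sup>2 * (2 * (a \<omega>)\<^sup>2 + b\<^sup>2)"
      using that(1)
    proof (induction l rule: dec_induct)
      case base then show ?case by (simp add: Q_def S_def qv_def)
    next
      case (step l)
      have Q_Suc: "Q (Suc l) \<omega> = Q l \<omega> + (x l \<omega>)\<^sup>2" using step.hyps by (simp add: Q_def)
      show ?case
      proof (cases "S l \<omega> \<le> 2 * (a \<omega>)\<^sup>2")
        case True
        then have "(x l \<omega>)\<^sup>2 = (t / a \<omega>)\<^sup>2 * (mark (c l \<omega>))\<^sup>2"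
          by (simp add: x_def power_mult_distrib power_divide)
        then have 1: "Q (Suc l) \<omega> \<le> (t / a \<omega>)\<^sup>2 * S (Suc l) \<omega>"
          using step.IH Q_Suc S_Suc[OF step.hyps(1)] by (simp add: distrib_left)
        also have "\<dots> \<le> (t / a \<omega>)\<^sup>2 * (2 * (a \<omega>)\<^sup>2 + b\<^sup>2)"
          using True S_Suc[OF step.hyps(1), of \<omega>] mark_squared_le[of "c l \<omega>"]
          by (intro mult_left_mono) (auto simp: b_def)
        finally show ?thesis using 1 by simp
      next
        case False
        then have "Q (Suc l) \<omega> = Q l \<omega>" using Q_Suc by (simp add: x_def)
        moreover have "(t / a \<omega>)\<^sup>2 * S l \<omega> \<le> (t / a \<omega>)\<^sup>2 * S (Suc l) \<omega>"
          using S_mono[of l "Suc l"] by (intro mult_left_mono) auto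
        ultimately show ?thesis using step.IH by simp
      qed
    qed
    then have "Q l \<omega> \<le> (t / a \<omega>)\<^sup>2 * (2 * (a \<omega>)\<^sup>2 + b\<^sup>2)" ..
    also have "\<dots> = t\<^sup>2 * (2 + b\<^sup>2 / (a \<omega>)\<^sup>2)" using a[OF that(2)] by (simp add: power_divide field_simps)
    also have "\<dots> \<le> t\<^sup>2 * (2 + b\<^sup>2)"
    proof -
      have "b\<^sup>2 / (a \<omega>)\<^sup>2 \<le> b\<^sup>2 / 1" using a[OF that(2)] by (intro divide_left_mono) auto
      then show ?thesis by (intro mult_left_mono) auto
    qed
    finally show ?thesis .
  qed
  have Ple: "norm (P l \<omega>) \<le> B" if "m \<le> l" "\<omega> \<in> space M" for l \<omega>
  proof -
    have "norm (P l \<omega>) \<le> (\<Prod>j=m..<l. exp ((x j \<omega>)\<^sup>2 / 2))"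
      unfolding P_def prod_norm[symmetric] by (intro prod_mono conjI norm_one_plus_ix_le norm_ge_zero)
    also have "\<dots> = exp (Q l \<omega> / 2)" by (simp add: Q_def exp_sum[symmetric] sum_divide_distrib)
    also have "\<dots> \<le> B" using Qle[OF that] by (simp add: B_def b_def)
    finally show ?thesis .
  qed
  have det_x: "det l (x j)" if "m \<le> j" "j < l" for j l
  proof -
    have "det l (S j)" unfolding S_def using det_mono[OF det_qv, of j l] that m by simp
    moreover have "det l a" unfolding a_def using det_mono[OF det_scale, of m l n] that m by simp
    moreover have "det l (\<lambda>\<omega>. mark (c j \<omega>))" using that(2) by (rule det_mark)
    ultimately show ?thesis
      unfolding x_def determined_by_def by (metis (no_types))
  qed
  have det_xl: "det l (\<lambda>\<omega>. of_bool (S l \<omega> \<le> 2 * (a \<omega>)\<^sup>2) * t / a \<omega>)" if "m \<le> l" for l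
  proof -
    have "det l (S l)" unfolding S_def by (rule det_qv)
    moreover have "det l a" unfolding a_def using det_mono[OF det_scale, of m l n] that m by simp
    ultimately show ?thesis
      unfolding determined_by_def by (metis (no_types))
  qed
  have det_P: "det l (P l)" if "m \<le> l" for l
  proof -
    have "det l (\<lambda>\<omega>. \<lambda>j. if m \<le> j \<and> j < l then x j \<omega> else 0)"
      using det_x[of _ l] unfolding determined_by_def by (metis (no_types))
    then have "det l (\<lambda>\<omega>. (\<lambda>y. \<Prod>j=m..<l. 1 + \<i> * complex_of_real (y j)) (\<lambda>j. if m \<le> j \<and> j < l then x j \<omega> else 0))"
      by (rule det_comp)
    moreover have "(\<lambda>y. \<Prod>j=m..<l. 1 + \<i> * complex_of_real (y j)) (\<lambda>j. if m \<le> j \<and> j < l then x j \<omega> else 0) = P l \<omega>" for \<omega>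
      unfolding P_def by (intro prod.cong) auto
    ultimately show ?thesis by simp
  qed
  have det_g: "det l (\<lambda>\<omega>. complex_of_real (g \<omega>))" if "m \<le> l" for l
    using det_mono[OF g(1) m(1) that] by (rule det_comp)
  \<comment> \<open>Conditionally on the history, the new factor has the mean \<open>1 + \<i> * t * drift / scale\<close>, or is 1 after the
    increments have stopped.\<close>
  have drift_bound: "norm ((\<integral>\<omega>. g \<omega> * P (Suc l) \<omega> \<partial>M) - (\<integral>\<omega>. g \<omega> * P l \<omega> \<partial>M))
      \<le> \<bar>t\<bar> * B * C * b / q * (1 / real l)" if l: "m \<le> l" "l < n" for l
  proof -
    have l1: "1 \<le> l" using l m by simp
    define H where "H \<omega> = g \<omega> * P l \<omega> * (\<i> * complex_of_real (of_bool (S l \<omega> \<le> 2 * (a \<omega>)\<^sup>2) * t / a \<omega>))" for \<omega>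
    have det_H: "det l H"
      unfolding H_def by (intro det_arith(3) det_g det_P l det_const det_comp[where f=complex_of_real] det_xl)
    have "(\<integral>\<omega>. g \<omega> * P (Suc l) \<omega> \<partial>M) - (\<integral>\<omega>. g \<omega> * P l \<omega> \<partial>M) = (\<integral>\<omega>. g \<omega> * P (Suc l) \<omega> - g \<omega> * P l \<omega> \<partial>M)"
      by (rule Bochner_Integration.integral_diff[symmetric];
          rule det_integrable, rule det_arith(3)[OF det_g det_P]) (use l in auto)
    also have "\<dots> = (\<integral>\<omega>. H \<omega> * complex_of_real (mark (c l \<omega>)) \<partial>M)"
    proof (rule Bochner_Integration.integral_cong)
      fix \<omega>
      have "P (Suc l) \<omega> = P l \<omega> * (1 + \<i> * complex_of_real (x l \<omega>))" using l by (simp add: P_def)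
      then show "g \<omega> * P (Suc l) \<omega> - g \<omega> * P l \<omega> = H \<omega> * complex_of_real (mark (c l \<omega>))"
        by (simp add: H_def x_def algebra_simps)
    qed simp
    also have "\<dots> = (\<integral>\<omega>. H \<omega> * complex_of_real (drift l \<omega>) \<partial>M)"
      by (rule cmean_complex[OF l1 cmean_mark[OF l1] det_H])
    also have "norm \<dots> \<le> (\<integral>\<omega>. norm (H \<omega> * complex_of_real (drift l \<omega>)) \<partial>M)" by (rule integral_norm_bound)
    also have "\<dots> \<le> (\<integral>\<omega>. \<bar>t\<bar> * B * C * b / q * (1 / real l) \<partial>M)"
    proof (rule integral_mono)
      show "integrable M (\<lambda>\<omega>. norm (H \<omega> * complex_of_real (drift l \<omega>)))"
        by (rule integrable_norm, rule det_integrable[of l], intro det_arith(3) det_H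
            det_comp[where f=complex_of_real] cmeanD(2)[OF cmean_mark[OF l1]])
      fix \<omega> assume \<omega>: "\<omega> \<in> space M"
      have 1: "norm (complex_of_real (of_bool (S l \<omega> \<le> 2 * (a \<omega>)\<^sup>2) * t / a \<omega>)) \<le> \<bar>t\<bar> / q"
      proof -
        have "\<bar>t\<bar> / a \<omega> \<le> \<bar>t\<bar> / q" using a[OF \<omega>] q1 by (intro divide_left_mono) auto
        then show ?thesis using a[OF \<omega>] q1 by (auto simp: norm_divide of_bool_def)
      qed
      have 2: "norm (g \<omega> * P l \<omega>) \<le> 1 * B"
        unfolding norm_mult using g(2)[of \<omega>] Ple[OF l(1) \<omega>] by (intro mult_mono) auto
      have "norm (H \<omega>) \<le> (1 * B) * (\<bar>t\<bar> / q)"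
        unfolding H_def norm_mult[of "_ * P l \<omega>"]
      proof (rule mult_mono[OF 2])
        show "norm (\<i> * complex_of_real (of_bool (S l \<omega> \<le> 2 * (a \<omega>)\<^sup>2) * t / a \<omega>)) \<le> \<bar>t\<bar> / q"
          using 1 by (simp only: norm_mult[of \<i>] norm_ii mult_1)
      qed (use B1 in auto)
      then have "norm (H \<omega> * complex_of_real (drift l \<omega>)) \<le> (1 * B) * (\<bar>t\<bar> / q) * (C * b / real l)"
        unfolding norm_mult[of "H \<omega>"] using abs_drift_le[OF l1 \<omega>] B1 q1
        by (intro mult_mono) (auto simp: b_def)
      then show "norm (H \<omega> * complex_of_real (drift l \<omega>)) \<le> \<bar>t\<bar> * B * C * b / q * (1 / real l)"
        by (simp add: mult_ac)
    qed simp
    finally show ?thesis by (simp add: prob_space)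
  qed
  have P_mean: "norm ((\<integral>\<omega>. g \<omega> * P n \<omega> \<partial>M) - (\<integral>\<omega>. g \<omega> \<partial>M)) \<le> \<bar>t\<bar> * B * C * b / q * (1 + ln (real n))"
  proof -
    have tel: "norm ((\<integral>\<omega>. g \<omega> * P l \<omega> \<partial>M) - (\<integral>\<omega>. g \<omega> \<partial>M)) \<le> (\<Sum>j=m..<l. \<bar>t\<bar> * B * C * b / q * (1 / real j))"
      if "m \<le> l" "l \<le> n" for l
      using that
    proof (induction l rule: dec_induct)
      case base
      have "(\<integral>\<omega>. g \<omega> * P m \<omega> \<partial>M) = complex_of_real (\<integral>\<omega>. g \<omega> \<partial>M)" by (simp add: P_def)
      then show ?case by simp
    next
      case (step l)
      have "(\<integral>\<omega>. g \<omega> * P (Suc l) \<omega> \<partial>M) - (\<integral>\<omega>. g \<omega> \<partial>M)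
          = ((\<integral>\<omega>. g \<omega> * P (Suc l) \<omega> \<partial>M) - (\<integral>\<omega>. g \<omega> * P l \<omega> \<partial>M)) + ((\<integral>\<omega>. g \<omega> * P l \<omega> \<partial>M) - (\<integral>\<omega>. g \<omega> \<partial>M))"
        by simp
      also have "norm \<dots> \<le> norm ((\<integral>\<omega>. g \<omega> * P (Suc l) \<omega> \<partial>M) - (\<integral>\<omega>. g \<omega> * P l \<omega> \<partial>M))
          + norm ((\<integral>\<omega>. g \<omega> * P l \<omega> \<partial>M) - (\<integral>\<omega>. g \<omega> \<partial>M))"
        by (rule norm_triangle_ineq)
      finally show ?case using drift_bound[of l] step by simp
    qed
    have "norm ((\<integral>\<omega>. g \<omega> * P n \<omega> \<partial>M) - (\<integral>\<omega>. g \<omega> \<partial>M)) \<le> \<bar>t\<bar> * B * C * b / q * (\<Sum>j=m..<n. 1 / real j)"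
      using tel[OF m(2) order_refl] by (simp add: sum_distrib_left)
    also have "\<dots> \<le> \<bar>t\<bar> * B * C * b / q * (1 + ln (real n))"
      using B1 C_nonneg b1 q1 m by (intro mult_left_mono sum_inverse_le_ln) auto
    finally show ?thesis .
  qed
  have bad: "bad \<in> events"
  proof -
    have "det n (scale m n)" using det_mono[OF det_scale m] .
    then have "det n (\<lambda>\<omega>. \<not> \<bar>qv m n \<omega> - (scale m n \<omega>)\<^sup>2\<bar> \<le> e * (scale m n \<omega>)\<^sup>2)"
      by (rule det_comp2[where f="\<lambda>u v. \<not> \<bar>u - v\<^sup>2\<bar> \<le> e * v\<^sup>2", OF det_qv])
    then show ?thesis unfolding bad_def by (rule det_event)
  qed
  \<comment> \<open>Outside \<open>bad\<close> the total sum of squares stays below the level, so that no increment is cut off.\<close>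
  have good: "(\<Sum>j=m..<n. x j \<omega>) = t * ((score n \<omega> - score m \<omega>) / a \<omega>)" "\<bar>Q n \<omega> - t\<^sup>2\<bar> \<le> t\<^sup>2 * e"
    if \<omega>: "\<omega> \<in> space M" "\<omega> \<notin> bad" for \<omega>
  proof -
    have Sn: "\<bar>S n \<omega> - (a \<omega>)\<^sup>2\<bar> \<le> e * (a \<omega>)\<^sup>2" using \<omega> by (simp add: bad_def S_def a_def)
    have a0: "a \<omega> > 0" using a[OF \<omega>(1)] by linarith
    have "e * (a \<omega>)\<^sup>2 \<le> 1 * (a \<omega>)\<^sup>2" using e by (intro mult_right_mono) auto
    then have "S n \<omega> \<le> 2 * (a \<omega>)\<^sup>2" using Sn by linarith
    then have xj: "x j \<omega> = t * mark (c j \<omega>) / a \<omega>" if "j \<in> {m..<n}" for j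
      using S_mono[of j n \<omega>] that by (simp add: x_def)
    have "score n \<omega> = score m \<omega> + (\<Sum>j=m..<n. mark (c j \<omega>))"
      unfolding score_def using m by (simp add: sum.atLeastLessThan_concat)
    then show "(\<Sum>j=m..<n. x j \<omega>) = t * ((score n \<omega> - score m \<omega>) / a \<omega>)"
      using xj by (simp add: sum_distrib_left sum_divide_distrib)
    have "Q n \<omega> = (\<Sum>j=m..<n. (t / a \<omega>)\<^sup>2 * (mark (c j \<omega>))\<^sup>2)"
      unfolding Q_def using xj by (intro sum.cong) (auto simp: power_mult_distrib power_divide)
    also have "\<dots> = (t / a \<omega>)\<^sup>2 * S n \<omega>" by (simp add: S_def qv_def sum_distrib_left)
    finally have "Q n \<omega> - t\<^sup>2 = (t / a \<omega>)\<^sup>2 * (S n \<omega> - (a \<omega>)\<^sup>2)"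
      using a0 by (simp add: right_diff_distrib power_divide)
    then have "\<bar>Q n \<omega> - t\<^sup>2\<bar> = (t / a \<omega>)\<^sup>2 * \<bar>S n \<omega> - (a \<omega>)\<^sup>2\<bar>" by (simp add: abs_mult)
    also have "\<dots> \<le> (t / a \<omega>)\<^sup>2 * (e * (a \<omega>)\<^sup>2)" using Sn by (intro mult_left_mono) auto
    also have "\<dots> = t\<^sup>2 * e" using a0 by (simp add: power_divide)
    finally show "\<bar>Q n \<omega> - t\<^sup>2\<bar> \<le> t\<^sup>2 * e" .
  qed
  define h where "h = 2 * (\<bar>t\<bar> * b / q) * (t\<^sup>2 * (2 + b\<^sup>2))"
  \<comment> \<open>The error per factor is cubic in \<open>x j\<close>; the maximal increment is \<open>O(1 / q)\<close>, and the squares have a bounded sum.\<close>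
  have tilt: "norm (iexp (\<Sum>j=m..<n. x j \<omega>) - P n \<omega> * exp (- Q n \<omega> / 2)) \<le> h" if \<omega>: "\<omega> \<in> space M" for \<omega>
  proof -
    have 1: "iexp (\<Sum>j=m..<n. x j \<omega>) = (\<Prod>j=m..<n. iexp (x j \<omega>))"
      by (simp add: sum_distrib_left exp_sum)
    have 2: "P n \<omega> * exp (- Q n \<omega> / 2)
        = (\<Prod>j=m..<n. (1 + \<i> * complex_of_real (x j \<omega>)) * complex_of_real (exp (- (x j \<omega>)\<^sup>2 / 2)))"
    proof -
      have "exp (- Q n \<omega> / 2) = (\<Prod>j=m..<n. exp (- (x j \<omega>)\<^sup>2 / 2))"
        by (simp add: Q_def exp_sum[symmetric] sum_negf sum_divide_distrib)
      then show ?thesis by (simp add: P_def prod.distrib)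
    qed
    have "norm (iexp (\<Sum>j=m..<n. x j \<omega>) - P n \<omega> * exp (- Q n \<omega> / 2))
        \<le> (\<Sum>j=m..<n. norm (iexp (x j \<omega>) - (1 + \<i> * complex_of_real (x j \<omega>)) * complex_of_real (exp (- (x j \<omega>)\<^sup>2 / 2))))"
      unfolding 1 2
    proof (rule norm_prod_diff)
      fix j
      show "norm (iexp (x j \<omega>)) \<le> 1" by simp
      have "norm ((1 + \<i> * complex_of_real (x j \<omega>)) * complex_of_real (exp (- (x j \<omega>)\<^sup>2 / 2)))
          \<le> exp ((x j \<omega>)\<^sup>2 / 2) * exp (- (x j \<omega>)\<^sup>2 / 2)"
        unfolding norm_mult by (intro mult_mono norm_one_plus_ix_le) auto
      then show "norm ((1 + \<i> * complex_of_real (x j \<omega>)) * complex_of_real (exp (- (x j \<omega>)\<^sup>2 / 2))) \<le> 1"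
        by (simp add: mult_exp_exp)
    qed
    also have "\<dots> \<le> (\<Sum>j=m..<n. 2 * (\<bar>t\<bar> * b / q) * (x j \<omega>)\<^sup>2)"
    proof (rule sum_mono)
      fix j
      have "\<bar>x j \<omega>\<bar> \<le> \<bar>t\<bar> * b / q"
      proof -
        have "\<bar>t\<bar> * \<bar>mark (c j \<omega>)\<bar> / a \<omega> \<le> \<bar>t\<bar> * b / q"
          using a[OF \<omega>] q1 abs_mark_le[of "c j \<omega>"] b1 by (intro frac_le mult_left_mono) (auto simp: b_def)
        then show ?thesis using a[OF \<omega>] b1 q1 by (auto simp: x_def abs_mult)
      qed
      then have "\<bar>x j \<omega>\<bar> * (x j \<omega>)\<^sup>2 \<le> \<bar>t\<bar> * b / q * (x j \<omega>)\<^sup>2" by (intro mult_right_mono) auto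
      moreover have "\<bar>x j \<omega>\<bar> ^ 3 = \<bar>x j \<omega>\<bar> * (x j \<omega>)\<^sup>2" by (simp add: power3_eq_cube power2_eq_square)
      ultimately have "2 * \<bar>x j \<omega>\<bar> ^ 3 \<le> 2 * (\<bar>t\<bar> * b / q) * (x j \<omega>)\<^sup>2" by simp
      then show "norm (iexp (x j \<omega>) - (1 + \<i> * complex_of_real (x j \<omega>)) * complex_of_real (exp (- (x j \<omega>)\<^sup>2 / 2)))
          \<le> 2 * (\<bar>t\<bar> * b / q) * (x j \<omega>)\<^sup>2"
        using norm_iexp_minus_tilted_le[of "x j \<omega>"] by linarith
    qed
    also have "\<dots> = 2 * (\<bar>t\<bar> * b / q) * Q n \<omega>" by (simp add: Q_def sum_distrib_left)
    also have "\<dots> \<le> h" unfolding h_def using Qle[OF m(2) \<omega>] b1 q1 by (intro mult_left_mono) auto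
    finally show ?thesis .
  qed
  have total: "norm ((\<integral>\<omega>. g \<omega> * iexp (t * ((score n \<omega> - score m \<omega>) / a \<omega>)) \<partial>M)
      - (\<integral>\<omega>. g \<omega> * P n \<omega> * exp (- t\<^sup>2 / 2) \<partial>M)) \<le> (h + B * (t\<^sup>2 * e)) + (2 + B) * prob bad"
  proof (rule norm_expectation_diff_le[OF _ _ bad])
    have "det n a" unfolding a_def using det_mono[OF det_scale m] by simp
    moreover have "det n (\<lambda>\<omega>. score n \<omega> - score m \<omega>)"
      using det_mono[OF det_score m] det_score by (intro det_arith(2)) auto
    ultimately have "det n (\<lambda>\<omega>. iexp (t * ((score n \<omega> - score m \<omega>) / a \<omega>)))"
      by (intro det_comp2[where f="\<lambda>u v. iexp (t * (u / v))"])
    then show "det n (\<lambda>\<omega>. g \<omega> * iexp (t * ((score n \<omega> - score m \<omega>) / a \<omega>)))"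
      by (intro det_arith(3) det_g m)
    show "det n (\<lambda>\<omega>. g \<omega> * P n \<omega> * exp (- t\<^sup>2 / 2))"
      by (intro det_arith(3) det_g det_P m det_const)
    fix \<omega> assume \<omega>: "\<omega> \<in> space M"
    let ?U = "iexp (t * ((score n \<omega> - score m \<omega>) / a \<omega>))" and ?X = "iexp (\<Sum>j=m..<n. x j \<omega>)"
    have Qn: "0 \<le> Q n \<omega>" by (simp add: Q_def sum_nonneg)
    have 1: "norm (?U - ?X) \<le> 2 * indicator bad \<omega>"
    proof (cases "\<omega> \<in> bad")
      case True
      then show ?thesis using norm_triangle_ineq4[of ?U ?X] by simp
    qed (use good(1)[OF \<omega>] in simp)
    have 2: "\<bar>exp (- Q n \<omega> / 2) - exp (- t\<^sup>2 / 2)\<bar> \<le> t\<^sup>2 * e + indicator bad \<omega>"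
    proof (cases "\<omega> \<in> bad")
      case True
      have "exp (- Q n \<omega> / 2) \<le> 1" "exp (- t\<^sup>2 / 2) \<le> 1" using Qn by auto
      moreover have "0 < exp (- Q n \<omega> / 2)" "0 < exp (- t\<^sup>2 / 2)" by simp_all
      moreover have "0 \<le> t\<^sup>2 * e" using e by simp
      ultimately have "\<bar>exp (- Q n \<omega> / 2) - exp (- t\<^sup>2 / 2)\<bar> \<le> t\<^sup>2 * e + 1" by linarith
      then show ?thesis using True by simp
    next
      case False
      have lip: "exp (- v) - exp (- u) \<le> \<bar>u - v\<bar>" if "0 \<le> u" "0 \<le> v" for u v :: real
      proof (cases "v \<le> u")
        case True
        have "1 - exp (v - u) \<le> u - v" using exp_ge_add_one_self[of "v - u"] by linarith
        then have "exp (- v) * (1 - exp (v - u)) \<le> 1 * (u - v)"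
          using True that by (intro mult_mono) auto
        then show ?thesis using True by (simp add: right_diff_distrib mult_exp_exp)
      next
        case False
        then have "exp (- v) \<le> exp (- u)" by simp
        then show ?thesis using False by linarith
      qed
      have "\<bar>exp (- (Q n \<omega> / 2)) - exp (- (t\<^sup>2 / 2))\<bar> \<le> \<bar>Q n \<omega> / 2 - t\<^sup>2 / 2\<bar>"
        using lip[of "Q n \<omega> / 2" "t\<^sup>2 / 2"] lip[of "t\<^sup>2 / 2" "Q n \<omega> / 2"] Qn by (simp add: abs_le_iff abs_minus_commute)
      also have "\<dots> \<le> t\<^sup>2 * e" using good(2)[OF \<omega> False] e by linarith
      finally show ?thesis using False by simp
    qed
    have "g \<omega> * ?U - g \<omega> * P n \<omega> * exp (- t\<^sup>2 / 2) = g \<omega> * ((?U - ?X) + (?X - P n \<omega> * exp (- Q n \<omega> / 2))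
        + P n \<omega> * complex_of_real (exp (- Q n \<omega> / 2) - exp (- t\<^sup>2 / 2)))"
      by (simp add: algebra_simps)
    also have "norm \<dots> \<le> 1 * (2 * indicator bad \<omega> + h + B * (t\<^sup>2 * e + indicator bad \<omega>))"
      unfolding norm_mult[of "complex_of_real (g \<omega>)"]
    proof (rule mult_mono)
      show "norm ((?U - ?X) + (?X - P n \<omega> * exp (- Q n \<omega> / 2)) + P n \<omega> * complex_of_real (exp (- Q n \<omega> / 2) - exp (- t\<^sup>2 / 2)))
          \<le> 2 * indicator bad \<omega> + h + B * (t\<^sup>2 * e + indicator bad \<omega>)"
      proof (rule norm_triangle_le[OF add_mono[OF norm_triangle_le[OF add_mono]]])
        show "norm (P n \<omega> * complex_of_real (exp (- Q n \<omega> / 2) - exp (- t\<^sup>2 / 2))) \<le> B * (t\<^sup>2 * e + indicator bad \<omega>)"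
          unfolding norm_mult norm_of_real using 2 Ple[OF m(2) \<omega>] B1 by (intro mult_mono) auto
      qed (use 1 tilt[OF \<omega>] in auto)
    qed (use g(2) in auto)
    finally show "norm (g \<omega> * ?U - g \<omega> * P n \<omega> * exp (- t\<^sup>2 / 2)) \<le> h + B * (t\<^sup>2 * e) + (2 + B) * indicator bad \<omega>"
      by (simp add: algebra_simps)
  qed
  have "(\<integral>\<omega>. g \<omega> * P n \<omega> * exp (- t\<^sup>2 / 2) \<partial>M) = (\<integral>\<omega>. g \<omega> * P n \<omega> \<partial>M) * exp (- t\<^sup>2 / 2)"
    by (rule integral_mult_left_zero)
  then have "norm ((\<integral>\<omega>. g \<omega> * P n \<omega> * exp (- t\<^sup>2 / 2) \<partial>M) - (\<integral>\<omega>. g \<omega> \<partial>M) * exp (- t\<^sup>2 / 2))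
      = norm ((\<integral>\<omega>. g \<omega> * P n \<omega> \<partial>M) - (\<integral>\<omega>. g \<omega> \<partial>M)) * exp (- t\<^sup>2 / 2)"
    by (simp add: norm_mult flip: left_diff_distrib)
  also have "\<dots> \<le> (\<bar>t\<bar> * B * C * b / q * (1 + ln (real n))) * 1"
    using P_mean by (intro mult_mono) (auto intro: order_trans[OF norm_ge_zero])
  finally have last: "norm ((\<integral>\<omega>. g \<omega> * P n \<omega> * exp (- t\<^sup>2 / 2) \<partial>M) - (\<integral>\<omega>. g \<omega> \<partial>M) * exp (- t\<^sup>2 / 2))
      \<le> \<bar>t\<bar> * B * C * b / q * (1 + ln (real n))" by simp
  have "h + \<bar>t\<bar> * B * C * b / q * (1 + ln (real n)) \<le> R * ((1 + ln (real n)) / q)"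
  proof -
    define x y l where "x = \<bar>t\<bar> * B * C * b" and "y = 2 * (\<bar>t\<bar> * b) * (t\<^sup>2 * (2 + b\<^sup>2))"
      and "l = 1 + ln (real n)"
    have "y / q * 1 \<le> y / q * l"
      using b1 q1 m by (intro mult_left_mono) (auto simp: y_def l_def)
    moreover have "h = y / q" "R = x + y" by (simp_all add: h_def y_def x_def R_def B_def b_def)
    ultimately have "h + x / q * l \<le> R * (l / q)" by (simp add: distrib_right add_divide_distrib)
    then show ?thesis by (simp only: x_def l_def)
  qed
  moreover have "norm ((\<integral>\<omega>. g \<omega> * iexp (t * ((score n \<omega> - score m \<omega>) / a \<omega>)) \<partial>M) - (\<integral>\<omega>. g \<omega> \<partial>M) * exp (- t\<^sup>2 / 2))
      \<le> ((h + B * (t\<^sup>2 * e)) + (2 + B) * prob bad) + \<bar>t\<bar> * B * C * b / q * (1 + ln (real n))"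
    by (rule norm_diff_triangle_le[OF total last])
  ultimately show ?thesis by (simp add: a_def q_def mult.assoc)
qed

end

section \<open>Mixing central limit theorem for the normed score\<close>

lemma abs_exp_minus_one_le:
  fixes v :: real
  assumes "\<bar>v\<bar> \<le> 1"
  shows "\<bar>exp v - 1\<bar> \<le> 2 * \<bar>v\<bar>"
proof (cases "v \<ge> 0")
  case True
  then have "exp v \<le> 1 + v + v\<^sup>2" using assms by (intro exp_bound) auto
  moreover have "v\<^sup>2 \<le> v" using True assms by (simp add: power2_eq_square mult_left_le)
  moreover have "1 \<le> exp v" using True by simp
  ultimately show ?thesis using True by linarith
next
  case False
  then have "exp v \<le> 1" by simp
  then show ?thesis using False exp_ge_add_one_self[of v] by linarith
qed

context size_chain
begin

lemma prob_V_diff: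
  assumes "e > 0" "d > 0"
  obtains m0 where "m0 \<ge> 1" "\<And>m n. m0 \<le> m \<Longrightarrow> m \<le> n \<Longrightarrow> prob {\<omega>\<in>space M. e < \<bar>V n \<omega> - V m \<omega>\<bar>} \<le> d"
proof -
  have "e * d > 0" using assms by simp
  from V_Cauchy[OF this] obtain m0 where m0: "m0 \<ge> 1"
    "\<And>m n. m0 \<le> m \<Longrightarrow> m \<le> n \<Longrightarrow> (\<integral>\<omega>. \<bar>V n \<omega> - V m \<omega>\<bar> \<partial>M) < e * d" by metis
  show ?thesis
  proof (rule that[OF m0(1)])
    fix m n assume mn: "m0 \<le> m" "m \<le> n"
    have detD: "det n (\<lambda>\<omega>. V n \<omega> - V m \<omega>)"
      using mn m0(1) det_mono[OF det_V[of m], of n] det_V[of n] by (intro det_arith(2)) auto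
    have "prob {\<omega>\<in>space M. e < \<bar>V n \<omega> - V m \<omega>\<bar>} \<le> prob {\<omega>\<in>space M. e \<le> \<bar>V n \<omega> - V m \<omega>\<bar>}"
    proof (rule finite_measure_mono)
      show "{\<omega>\<in>space M. e \<le> \<bar>V n \<omega> - V m \<omega>\<bar>} \<in> events"
        by (rule det_event[of n], rule det_comp[where f="\<lambda>x. e \<le> \<bar>x\<bar>"], rule detD)
    qed auto
    also have "\<dots> \<le> (\<integral>\<omega>. \<bar>V n \<omega> - V m \<omega>\<bar> \<partial>M) / e"
      by (rule prob_markov[OF det_integrable[OF detD] assms(1)])
    also have "\<dots> \<le> d" using m0(2)[OF mn] assms by (simp add: field_simps)
    finally show "prob {\<omega>\<in>space M. e < \<bar>V n \<omega> - V m \<omega>\<bar>} \<le> d" .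
  qed
qed

definition observed_info :: "nat \<Rightarrow> 'a \<Rightarrow> real" where
  "observed_info = weighted_tally (\<lambda>s. (mark s)\<^sup>2)"

text \<open>
The limit is the Fisher information because of \<open>fisher_info_eq\<close>.
\<close>

lemma observed_info_law_of_large_numbers:
  "vanishes_in_prob (\<lambda>n \<omega>. observed_info n \<omega> / k n \<omega> - info)"
  using weighted_tally_law_of_large_numbers[OF summable_mark_squared]
  unfolding observed_info_def suminf_mark_squared_tail by simp

lemma k_info_eq_scale:
  assumes "1 \<le> m" "m \<le> n" "\<omega> \<in> space M"
  shows "k n \<omega> * info = (scale m n \<omega>)\<^sup>2 * exp (V n \<omega> - V m \<omega>)"
    "sqrt (k n \<omega> * info) = scale m n \<omega> * exp ((V n \<omega> - V m \<omega>) / 2)"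
proof -
  have km: "0 < k m \<omega>" "0 < k n \<omega>" using k_ge_1[of m \<omega>] k_ge_1[of n \<omega>] assms by force+
  have nm: "0 < real m" "0 < real n" using assms by auto
  have "exp (V n \<omega> - V m \<omega>) = k n \<omega> / k m \<omega> / (real n / real m) powr \<alpha>"
    using km nm by (simp add: V_def exp_diff powr_def ln_divide_pos right_diff_distrib)
  moreover have "(scale m n \<omega>)\<^sup>2 = k m \<omega> * info * (real n / real m) powr \<alpha>"
    unfolding scale_def using info_ge_1 by (intro real_sqrt_pow2) auto
  ultimately show 1: "k n \<omega> * info = (scale m n \<omega>)\<^sup>2 * exp (V n \<omega> - V m \<omega>)"
    using km nm by simp
  have "0 \<le> scale m n \<omega>" using scale_ge[OF assms] by linarith
  then show "sqrt (k n \<omega> * info) = scale m n \<omega> * exp ((V n \<omega> - V m \<omega>) / 2)"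
    unfolding 1 by (intro real_sqrt_unique) (auto simp: power_mult_distrib power2_eq_square mult_exp_exp)
qed

text \<open>
The observed information is close to \<open>k n * info\<close>, which differs from the square of the predicted scale by a factor close
to 1. The part of the observed information that was collected before time \<open>m\<close> is bounded and is outweighed for large
\<open>n\<close>.
\<close>

lemma qv_close_to_scale:
  assumes m: "1 \<le> m" "m \<le> n" and \<omega>: "\<omega> \<in> space M" and e: "0 < e" "e \<le> 1"
    and J: "\<bar>observed_info n \<omega> / k n \<omega> - info\<bar> \<le> e" and V: "\<bar>V n \<omega> - V m \<omega>\<bar> \<le> e"
    and large: "mark_bound\<^sup>2 * real m \<le> e * ((real n / real m) powr (\<alpha> / 2))\<^sup>2"
  shows "\<bar>qv m n \<omega> - (scale m n \<omega>)\<^sup>2\<bar> \<le> 6 * e * (scale m n \<omega>)\<^sup>2"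
proof -
  define r where "r = (scale m n \<omega>)\<^sup>2"
  define E where "E = exp (V n \<omega> - V m \<omega>)"
  have r0: "0 \<le> r" by (simp add: r_def)
  have kn: "0 < k n \<omega>" using k_ge_1[of n \<omega>] \<omega> m by force
  have rE: "k n \<omega> * info = r * E" using k_info_eq_scale(1)[OF m \<omega>] by (simp add: r_def E_def)
  have E: "\<bar>E - 1\<bar> \<le> 2 * e" using abs_exp_minus_one_le[of "V n \<omega> - V m \<omega>"] V e by (simp add: E_def)
  have "\<bar>observed_info n \<omega> - k n \<omega> * info\<bar> = k n \<omega> * \<bar>observed_info n \<omega> / k n \<omega> - info\<bar>"
    using kn by (simp add: abs_mult_pos' right_diff_distrib)
  also have "\<dots> \<le> k n \<omega> * e" using J kn by (intro mult_left_mono) auto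
  also have "\<dots> \<le> (k n \<omega> * info) * e"
    using info_ge_1 kn e by (intro mult_right_mono) auto
  also have "\<dots> = r * (E * e)" by (simp add: rE)
  also have "\<dots> \<le> r * (3 * e)"
    using E e by (intro mult_left_mono[OF mult_right_mono] r0) auto
  finally have 1: "\<bar>observed_info n \<omega> - r * E\<bar> \<le> 3 * e * r"
    unfolding rE by (simp only: mult_ac)
  have "\<bar>r * E - r\<bar> = r * \<bar>E - 1\<bar>" using r0 by (simp add: abs_mult_pos' right_diff_distrib)
  also have "\<dots> \<le> r * (2 * e)" by (intro mult_left_mono E r0)
  finally have 2: "\<bar>r * E - r\<bar> \<le> 2 * e * r" by (simp add: mult_ac)
  have "observed_info m \<omega> \<le> (\<Sum>l<m. mark_bound\<^sup>2)"
    unfolding observed_info_def weighted_tally_def by (intro sum_mono mark_squared_le)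
  also have "\<dots> \<le> e * ((real n / real m) powr (\<alpha> / 2))\<^sup>2" using large by (simp add: mult.commute)
  also have "\<dots> \<le> e * r" unfolding r_def using scale_ge[OF m \<omega>] e by (intro mult_left_mono power_mono) auto
  finally have 3: "observed_info m \<omega> \<le> e * r" .
  have 4: "0 \<le> observed_info m \<omega>" unfolding observed_info_def weighted_tally_def by (intro sum_nonneg) auto
  have "observed_info n \<omega> = observed_info m \<omega> + qv m n \<omega>"
    unfolding observed_info_def weighted_tally_def qv_def atLeast0LessThan[symmetric]
    using m by (simp add: sum.atLeastLessThan_concat)
  then show ?thesis using 1 2 3 4 unfolding r_def[symmetric] by (simp add: abs_le_iff)
qed

text \<open>
Given a precision \<open>r\<close>, choose \<open>m\<close> so large that the norming is predictable from time \<open>m\<close> on up to a small relative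
error, and only then let \<open>n\<close> tend to infinity. The limit does not depend on \<open>g\<close>, apart from its mean: the convergence
is mixing.
\<close>

lemma char_normed_score:
  fixes g :: "'a \<Rightarrow> real"
  assumes g: "det m0 g" "\<And>\<omega>. \<bar>g \<omega>\<bar> \<le> 1" and m0: "1 \<le> m0"
  shows "(\<lambda>n. \<integral>\<omega>. g \<omega> * iexp (t * normed_score n \<omega>) \<partial>M) \<longlonglongrightarrow> (\<integral>\<omega>. g \<omega> \<partial>M) * exp (- t\<^sup>2 / 2)"
proof (rule LIMSEQ_I)
  fix r :: real assume r: "r > 0"
  define B where "B = exp (t\<^sup>2 * (2 + mark_bound\<^sup>2) / 2)"
  define R where "R = \<bar>t\<bar> * exp (t\<^sup>2 * (2 + mark_bound\<^sup>2) / 2) * C * mark_bound + 2 * (\<bar>t\<bar> * mark_bound) * (t\<^sup>2 * (2 + mark_bound\<^sup>2))"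
  have B1: "B \<ge> 1" by (simp add: B_def)
  obtain L where L: "L > 0" "\<And>n. n \<ge> 1 \<Longrightarrow> prob {\<omega>\<in>space M. L < \<bar>normed_score n \<omega>\<bar>} < r / 16"
    using normed_score_tight[of "r / 16"] r by auto
  define h where "h = r / (8 * (\<bar>t\<bar> + 1))"
  have h: "h > 0" "\<bar>t\<bar> * h \<le> r / 8"
    using r by (auto simp: h_def field_simps)
  \<comment> \<open>The factor 6 comes from \<open>qv_close_to_scale\<close>; \<open>h\<close> is the tolerance in the argument of the exponential.\<close>
  define e where "e = min (1 / 6) (min (r / (48 * (B * t\<^sup>2 + 1))) (h / (2 * L)))"
  have Bt: "0 < B * t\<^sup>2 + 1" using B1 by (intro add_nonneg_pos) auto
  have e: "0 < e" "e \<le> 1 / 6" "B * t\<^sup>2 * (6 * e) \<le> r / 8" "L * e \<le> h / 2"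
  proof -
    show "0 < e" using r h L Bt by (simp add: e_def)
    show "e \<le> 1 / 6" unfolding e_def by (rule min.cobounded1)
    have "e \<le> r / (48 * (B * t\<^sup>2 + 1))" by (simp add: e_def)
    then have "e * (48 * (B * t\<^sup>2 + 1)) \<le> r" using Bt by (simp add: pos_le_divide_eq)
    then show "B * t\<^sup>2 * (6 * e) \<le> r / 8" using \<open>0 < e\<close> by (simp add: algebra_simps)
    have "e \<le> h / (2 * L)" by (simp add: e_def)
    then show "L * e \<le> h / 2" using L by (simp add: field_simps)
  qed
  have "r / (8 * (4 + B)) > 0" using r B1 by simp
  from prob_V_diff[OF e(1) this] obtain m1 where m1: "m1 \<ge> 1"
    "\<And>m n. m1 \<le> m \<Longrightarrow> m \<le> n \<Longrightarrow> prob {\<omega>\<in>space M. e < \<bar>V n \<omega> - V m \<omega>\<bar>} \<le> r / (8 * (4 + B))" by metis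
  \<comment> \<open>From here on \<open>m\<close> is fixed and \<open>n\<close> tends to infinity.\<close>
  define m where "m = max m0 m1"
  have m: "1 \<le> m" "m1 \<le> m" "m0 \<le> m" using m0 by (auto simp: m_def)
  have detg: "det m g" using det_mono[OF g(1) m0 m(3)] .
  define q where "q n = (real n / real m) powr (\<alpha> / 2)" for n :: nat
  have mpos: "real m > 0" using m by simp
  have q_lim: "filterlim q at_top sequentially"
    unfolding q_def using alpha mpos by real_asymp
  have "(\<lambda>n. R * ((1 + ln (real n)) / q n)) \<longlonglongrightarrow> R * 0"
    unfolding q_def using alpha mpos by (intro tendsto_mult tendsto_const) real_asymp
  then have ev1: "\<forall>\<^sub>F n in sequentially. R * ((1 + ln (real n)) / q n) < r / 8"
    using r by (intro order_tendstoD(2)) auto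
  have ev2: "\<forall>\<^sub>F n in sequentially. prob {\<omega>\<in>space M. e < \<bar>observed_info n \<omega> / k n \<omega> - info\<bar>} < r / (16 * (2 + B))"
    using observed_info_law_of_large_numbers e(1) r B1 unfolding vanishes_in_prob_def
    by (intro order_tendstoD(2)) auto
  have ev3: "\<forall>\<^sub>F n in sequentially. max (mark_bound\<^sup>2 * real m / e) (max 1 (2 * mark_bound * real m / h)) \<le> q n"
    using q_lim unfolding filterlim_at_top by blast
  have "\<forall>\<^sub>F n in sequentially. norm ((\<integral>\<omega>. g \<omega> * iexp (t * normed_score n \<omega>) \<partial>M) - (\<integral>\<omega>. g \<omega> \<partial>M) * exp (- t\<^sup>2 / 2)) < r"
    using ev1 ev2 ev3 eventually_ge_at_top[of m]
  proof eventually_elim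
    case (elim n)
    note n = elim(4)
    have n1: "1 \<le> n" using m n by simp
    have q: "1 \<le> q n" "mark_bound\<^sup>2 * real m \<le> e * q n" "2 * mark_bound * real m \<le> h * q n"
      using elim(3) e h by (auto simp: field_simps)
    have large: "mark_bound\<^sup>2 * real m \<le> e * (q n)\<^sup>2"
    proof -
      have "e * q n \<le> e * (q n)\<^sup>2" using q(1) e by (intro mult_left_mono) (auto simp: power2_eq_square)
      then show ?thesis using q(2) by linarith
    qed
    let ?bad = "{\<omega>\<in>space M. \<not> \<bar>qv m n \<omega> - (scale m n \<omega>)\<^sup>2\<bar> \<le> 6 * e * (scale m n \<omega>)\<^sup>2}"
    let ?BV = "{\<omega>\<in>space M. e < \<bar>V n \<omega> - V m \<omega>\<bar>}"
    let ?BJ = "{\<omega>\<in>space M. e < \<bar>observed_info n \<omega> / k n \<omega> - info\<bar>}"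
    let ?BY = "{\<omega>\<in>space M. L < \<bar>normed_score n \<omega>\<bar>}"
    have detV: "det n (\<lambda>\<omega>. V n \<omega> - V m \<omega>)"
      using det_mono[OF det_V m(1) n] det_V[of n] by (intro det_arith(2)) auto
    have evs: "?BV \<in> events" "?BJ \<in> events" "?BY \<in> events"
    proof -
      show "?BV \<in> events" by (rule det_event[of n], rule det_comp[where f="\<lambda>x. e < \<bar>x\<bar>"], rule detV)
      show "?BY \<in> events" by (rule det_event[of n], rule det_comp[where f="\<lambda>x. L < \<bar>x\<bar>"], rule det_normed_score)
      have "det n (\<lambda>\<omega>. observed_info n \<omega> / k n \<omega> - info)"
        unfolding observed_info_def by (intro det_arith det_weighted_tally det_N det_const order_refl)
      then show "?BJ \<in> events" by (intro det_event[of n] det_comp[where f="\<lambda>x. e < \<bar>x\<bar>"])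
    qed
    have bad_le: "prob ?bad \<le> prob ?BJ + prob ?BV"
    proof -
      have "?bad \<subseteq> ?BJ \<union> ?BV"
      proof (rule subsetI, rule ccontr)
        fix \<omega> assume 1: "\<omega> \<in> ?bad" "\<omega> \<notin> ?BJ \<union> ?BV"
        then have \<omega>: "\<omega> \<in> space M" "\<bar>observed_info n \<omega> / k n \<omega> - info\<bar> \<le> e" "\<bar>V n \<omega> - V m \<omega>\<bar> \<le> e" by auto
        have "\<bar>qv m n \<omega> - (scale m n \<omega>)\<^sup>2\<bar> \<le> 6 * e * (scale m n \<omega>)\<^sup>2"
          using large e \<omega> by (intro qv_close_to_scale[OF m(1) n]) (auto simp: q_def)
        then show False using 1(1) by blast
      qed
      then have "prob ?bad \<le> prob (?BJ \<union> ?BV)" using evs by (intro finite_measure_mono sets.Un)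
      also have "\<dots> \<le> prob ?BJ + prob ?BV" using evs by (intro measure_Un_le)
      finally show ?thesis .
    qed
    let ?U = "\<lambda>\<omega>. (score n \<omega> - score m \<omega>) / scale m n \<omega>"
    have est: "norm ((\<integral>\<omega>. g \<omega> * iexp (t * ?U \<omega>) \<partial>M) - (\<integral>\<omega>. g \<omega> \<partial>M) * exp (- t\<^sup>2 / 2))
        \<le> R * ((1 + ln (real n)) / q n) + B * t\<^sup>2 * (6 * e) + (2 + B) * prob ?bad"
      unfolding R_def B_def q_def
      by (rule char_score_estimate[OF m(1) n detg]) (use e g(2) in auto)
    have det_U: "det n ?U"
      using det_mono[OF det_scale m(1) n] det_mono[OF det_score m(1) n] det_score[of n]
      by (intro det_arith(2,4)) auto
    \<comment> \<open>Exchange the random norming for the predicted one and drop the score up to time \<open>m\<close>.\<close>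
    have cmp: "norm ((\<integral>\<omega>. g \<omega> * iexp (t * normed_score n \<omega>) \<partial>M) - (\<integral>\<omega>. g \<omega> * iexp (t * ?U \<omega>) \<partial>M))
        \<le> \<bar>t\<bar> * h + 2 * prob (?BY \<union> ?BV)"
    proof (rule norm_expectation_iexp_diff_le[OF det_mono[OF detg m(1) n] g(2) det_normed_score det_U])
      show "?BY \<union> ?BV \<in> events" using evs by (intro sets.Un)
      fix \<omega> assume \<omega>: "\<omega> \<in> space M" and good: "\<omega> \<notin> ?BY \<union> ?BV"
      from \<omega> good have Y: "\<bar>normed_score n \<omega>\<bar> \<le> L" and v: "\<bar>V n \<omega> - V m \<omega>\<bar> \<le> e" by auto
      define a where "a = scale m n \<omega>"
      define E where "E = exp ((V n \<omega> - V m \<omega>) / 2)"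
      have a: "q n \<le> a" "1 \<le> a" using scale_ge[OF m(1) n \<omega>] by (auto simp: a_def q_def)
      have E: "\<bar>E - 1\<bar> \<le> e" using abs_exp_minus_one_le[of "(V n \<omega> - V m \<omega>) / 2"] v e by (simp add: E_def)
      have "normed_score n \<omega> = score n \<omega> / (a * E)"
        unfolding normed_score_def k_info_eq_scale(2)[OF m(1) n \<omega>] a_def E_def ..
      moreover have "E > 0" by (simp add: E_def)
      ultimately have "score n \<omega> / a = normed_score n \<omega> * E" by simp
      then have "?U \<omega> - normed_score n \<omega> = normed_score n \<omega> * (E - 1) - score m \<omega> / a"
        by (simp add: a_def[symmetric] diff_divide_distrib right_diff_distrib)
      then have "\<bar>?U \<omega> - normed_score n \<omega>\<bar> \<le> \<bar>normed_score n \<omega>\<bar> * \<bar>E - 1\<bar> + \<bar>score m \<omega>\<bar> / a"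
        using a abs_triangle_ineq4[of "normed_score n \<omega> * (E - 1)" "score m \<omega> / a"] by (simp add: abs_mult)
      also have "\<bar>normed_score n \<omega>\<bar> * \<bar>E - 1\<bar> \<le> L * e" using Y E by (intro mult_mono) auto
      also have "\<bar>score m \<omega>\<bar> / a \<le> mark_bound * real m / q n"
      proof (intro frac_le)
        have "\<bar>score m \<omega>\<bar> \<le> (\<Sum>l=1..<m. mark_bound)"
          unfolding score_def by (rule order_trans[OF sum_abs sum_mono]) (rule abs_mark_le)
        also have "\<dots> \<le> mark_bound * real m"
          using mark_bound_ge(3) by (simp add: mult.commute mult_left_mono)
        finally show "\<bar>score m \<omega>\<bar> \<le> mark_bound * real m" .
      qed (use a q mark_bound_ge in auto)
      also have "mark_bound * real m / q n \<le> h / 2" using q by (simp add: field_simps)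
      finally have "\<bar>?U \<omega> - normed_score n \<omega>\<bar> \<le> h" using e(4) by linarith
      then show "\<bar>normed_score n \<omega> - ?U \<omega>\<bar> \<le> h" by (subst abs_minus_commute)
    qed (use h in simp)
    have BY: "prob (?BY \<union> ?BV) \<le> r / 16 + r / (8 * (4 + B))"
      using measure_Un_le[OF evs(3,1)] L(2)[OF n1] m1(2)[OF m(2) n] by linarith
    have badp: "prob ?bad \<le> r / (16 * (2 + B)) + r / (8 * (4 + B))"
      using bad_le elim(2) m1(2)[OF m(2) n] by linarith
    have "(2 + B) * prob ?bad + 2 * prob (?BY \<union> ?BV)
        \<le> (2 + B) * (r / (16 * (2 + B)) + r / (8 * (4 + B))) + 2 * (r / 16 + r / (8 * (4 + B)))"
      using BY badp B1 by (intro add_mono mult_left_mono) auto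
    also have "\<dots> = r / 16 + r / 8 + r / 8"
    proof -
      define u v where "u = r / (16 * (2 + B))" and "v = r / (8 * (4 + B))"
      have "(2 + B) * u = r / 16" "(4 + B) * v = r / 8"
        using B1 by (simp_all add: u_def v_def field_simps)
      moreover have "(2 + B) * (u + v) + 2 * (r / 16 + v) = (2 + B) * u + (4 + B) * v + r / 8"
        by (simp add: algebra_simps)
      ultimately show ?thesis by (simp only: u_def v_def)
    qed
    finally have sum: "(2 + B) * prob ?bad + 2 * prob (?BY \<union> ?BV) \<le> r / 16 + r / 8 + r / 8" .
    have "norm ((\<integral>\<omega>. g \<omega> * iexp (t * normed_score n \<omega>) \<partial>M) - (\<integral>\<omega>. g \<omega> \<partial>M) * exp (- t\<^sup>2 / 2))
        \<le> (\<bar>t\<bar> * h + 2 * prob (?BY \<union> ?BV)) + (R * ((1 + ln (real n)) / q n) + B * t\<^sup>2 * (6 * e) + (2 + B) * prob ?bad)"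
      by (rule norm_diff_triangle_le[OF cmp est])
    also have "\<dots> < r" using sum elim(1) e(3) h(2) r by linarith
    finally show ?case .
  qed
  then show "\<exists>n0. \<forall>n\<ge>n0. norm ((\<integral>\<omega>. g \<omega> * iexp (t * normed_score n \<omega>) \<partial>M) - (\<integral>\<omega>. g \<omega> \<partial>M) * exp (- t\<^sup>2 / 2)) < r"
    by (simp add: eventually_sequentially)
qed

end

section \<open>The root of a decreasing score function\<close>

text \<open>
The quasi score after summation by parts: \<open>K\<close> is the number of blocks minus one, and \<open>N s\<close> is the number of blocks of
size greater than \<open>s\<close>. Minus its derivative is \<open>info_fun\<close>, the observed information.
\<close>

definition score_fun :: "nat \<Rightarrow> real \<Rightarrow> (nat \<Rightarrow> real) \<Rightarrow> real \<Rightarrow> real" where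
  "score_fun n K N x = K / x - (\<Sum>s=1..<n. N s / (real s - x))"

definition info_fun :: "nat \<Rightarrow> real \<Rightarrow> (nat \<Rightarrow> real) \<Rightarrow> real \<Rightarrow> real" where
  "info_fun n K N x = K / x\<^sup>2 + (\<Sum>s=1..<n. N s / (real s - x)\<^sup>2)"

lemma DERIV_score_fun:
  assumes "0 < x" "x < 1"
  shows "(score_fun n K N has_real_derivative - info_fun n K N x) (at x)"
proof -
  have "((\<lambda>x. K / x - (\<Sum>s=1..<n. N s / (real s - x))) has_real_derivative
      - (K / x\<^sup>2) - (\<Sum>s=1..<n. N s / (real s - x)\<^sup>2)) (at x)"
  proof (intro DERIV_diff DERIV_sum)
    show "((\<lambda>x. K / x) has_real_derivative - (K / x\<^sup>2)) (at x)"
      using assms by (auto intro!: derivative_eq_intros simp: power2_eq_square)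
    fix s assume "s \<in> {1..<n}"
    then show "((\<lambda>x. N s / (real s - x)) has_real_derivative N s / (real s - x)\<^sup>2) (at x)"
      using assms by (auto intro!: derivative_eq_intros simp: power2_eq_square)
  qed
  then show ?thesis
    unfolding score_fun_def[abs_def] info_fun_def by (rule DERIV_cong) simp
qed

lemma info_fun_pos:
  assumes "0 < x" "x < 1" "0 < K" "\<And>s. 0 \<le> N s"
  shows "0 < info_fun n K N x"
  unfolding info_fun_def using assms by (intro add_pos_nonneg sum_nonneg) auto

lemma score_fun_strict_decreasing:
  assumes "0 < K" "\<And>s. 0 \<le> N s" "0 < x" "x < y" "y < 1"
  shows "score_fun n K N y < score_fun n K N x"
proof (rule DERIV_neg_imp_decreasing[OF assms(4)])
  fix z assume "x \<le> z" "z \<le> y"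
  then have z: "0 < z" "z < 1" using assms by auto
  show "\<exists>d. (score_fun n K N has_real_derivative d) (at z) \<and> d < 0"
    using DERIV_score_fun[OF z, of n K N] info_fun_pos[of z K N n, OF z assms(1,2)] by (intro exI conjI) auto
qed

text \<open>
Every denominator \<open>x\<close> or \<open>s - x\<close> changes by a relative amount of at most \<open>r\<close> if \<open>x\<close> moves from \<open>a\<close> by at most
\<open>r * min a (1 - a)\<close>. Thus the relative change of the information is controlled uniformly in \<open>n\<close>, \<open>K\<close> and \<open>N\<close>.
\<close>

lemma info_fun_ratio:
  assumes a: "0 < a" "a < 1" and N: "0 \<le> K" "\<And>s. 0 \<le> N s" and r: "0 < r" "r < 1"
    and x: "\<bar>x - a\<bar> \<le> r * min a (1 - a)"
  shows "info_fun n K N a / (1 + r)\<^sup>2 \<le> info_fun n K N x" "info_fun n K N x \<le> info_fun n K N a / (1 - r)\<^sup>2"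
proof -
  have quot: "c / u\<^sup>2 / (1 + r)\<^sup>2 \<le> c / v\<^sup>2 \<and> c / v\<^sup>2 \<le> c / u\<^sup>2 / (1 - r)\<^sup>2"
    if "0 \<le> c" "0 < u" "\<bar>v - u\<bar> \<le> r * u" for c u v :: real
  proof -
    have v: "(1 - r) * u \<le> v" "v \<le> (1 + r) * u" using that(3) by (simp_all add: abs_le_iff algebra_simps)
    have lo: "0 < (1 - r) * u" using r that by simp
    then have v0: "0 < v" using v by linarith
    have "c / ((1 + r) * u)\<^sup>2 \<le> c / v\<^sup>2" using that(1) v0 power_mono[OF v(2), of 2] by (intro frac_le) simp_all
    moreover have "c / v\<^sup>2 \<le> c / ((1 - r) * u)\<^sup>2" using that(1,2) r lo power_mono[OF v(1), of 2] by (intro frac_le) simp_all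
    ultimately show ?thesis by (simp add: power_mult_distrib mult.commute)
  qed
  have xa: "\<bar>x - a\<bar> \<le> r * a"
    by (rule order_trans[OF x mult_left_mono[OF min.cobounded1]]) (use r in simp)
  have xs: "\<bar>(real s - x) - (real s - a)\<bar> \<le> r * (real s - a)" if "s \<ge> 1" for s
  proof -
    have "\<bar>(real s - x) - (real s - a)\<bar> = \<bar>x - a\<bar>" by linarith
    also have "\<dots> \<le> r * (1 - a)"
      by (rule order_trans[OF x mult_left_mono[OF min.cobounded2]]) (use r in simp)
    also have "\<dots> \<le> r * (real s - a)" using that r by (intro mult_left_mono) auto
    finally show ?thesis .
  qed
  have t0: "K / a\<^sup>2 / (1 + r)\<^sup>2 \<le> K / x\<^sup>2 \<and> K / x\<^sup>2 \<le> K / a\<^sup>2 / (1 - r)\<^sup>2"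
    by (rule quot[OF N(1) a(1) xa])
  have ts: "N s / (real s - a)\<^sup>2 / (1 + r)\<^sup>2 \<le> N s / (real s - x)\<^sup>2 \<and> N s / (real s - x)\<^sup>2 \<le> N s / (real s - a)\<^sup>2 / (1 - r)\<^sup>2"
    if "s \<in> {1..<n}" for s
    using that a by (intro quot N xs) auto
  show "info_fun n K N a / (1 + r)\<^sup>2 \<le> info_fun n K N x"
    unfolding info_fun_def add_divide_distrib sum_divide_distrib using t0 ts by (intro add_mono sum_mono) auto
  show "info_fun n K N x \<le> info_fun n K N a / (1 - r)\<^sup>2"
    unfolding info_fun_def add_divide_distrib sum_divide_distrib using t0 ts by (intro add_mono sum_mono) auto
qed

text \<open>
The slope of the score near \<open>a\<close> is at least \<open>info_fun n K N a / (1 + r)\<^sup>2\<close> in absolute value. If the score at \<open>a\<close> is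
smaller than this slope times the radius of the neighbourhood, then the score changes sign inside it.
\<close>

lemma score_root_linearization:
  assumes a: "0 < a" "a < 1" and K: "0 < K" and N: "\<And>s. 0 \<le> N s" and r: "0 < r" "r < 1"
    and small: "\<bar>score_fun n K N a\<bar> < r * min a (1 - a) * (info_fun n K N a / (1 + r)\<^sup>2)"
  obtains x z where "x \<in> {0<..<1}" "score_fun n K N x = 0" "\<forall>y\<in>{0<..<1}. score_fun n K N y = 0 \<longrightarrow> y = x"
    "\<bar>x - a\<bar> \<le> r * min a (1 - a)" "score_fun n K N a = info_fun n K N z * (x - a)"
    "info_fun n K N a / (1 + r)\<^sup>2 \<le> info_fun n K N z" "info_fun n K N z \<le> info_fun n K N a / (1 - r)\<^sup>2"
proof -
  define f where "f = score_fun n K N"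
  define g where "g = info_fun n K N"
  define d where "d = r * min a (1 - a)"
  have m: "0 < min a (1 - a)" "min a (1 - a) \<le> a" "min a (1 - a) \<le> 1 - a" using a by auto
  have d: "0 < d" "d < a" "d < 1 - a"
  proof -
    show "0 < d" using m r by (simp add: d_def)
    have "d < 1 * min a (1 - a)" unfolding d_def using m r by (intro mult_strict_right_mono) auto
    then show "d < a" "d < 1 - a" using m by auto
  qed
  have deriv: "(f has_real_derivative - g x) (at x)" if "0 < x" "x < 1" for x
    unfolding f_def g_def by (rule DERIV_score_fun[OF that])
  have mvt: "\<exists>z. u < z \<and> z < v \<and> f v - f u = (v - u) * (- g z)" if "0 < u" "u < v" "v < 1" for u v
    by (rule MVT2[OF that(2)]) (use that deriv in auto)
  have ratio: "g a / (1 + r)\<^sup>2 \<le> g z" "g z \<le> g a / (1 - r)\<^sup>2" if "\<bar>z - a\<bar> \<le> d" for z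
    using info_fun_ratio[OF a less_imp_le[OF K] N r, of z n] that by (auto simp: g_def d_def)
  have hi: "f (a + d) \<le> 0"
  proof -
    obtain z where z: "a < z" "z < a + d" "f (a + d) - f a = (a + d - a) * (- g z)"
      using mvt[of a "a + d"] a d by auto
    have "d * (g a / (1 + r)\<^sup>2) \<le> d * g z" using ratio(1)[of z] z d by (intro mult_left_mono) auto
    then show ?thesis using z small by (simp add: f_def[symmetric] g_def[symmetric] d_def[symmetric] abs_less_iff)
  qed
  have lo: "0 \<le> f (a - d)"
  proof -
    obtain z where z: "a - d < z" "z < a" "f a - f (a - d) = (a - (a - d)) * (- g z)"
      using mvt[of "a - d" a] a d by auto
    have "d * (g a / (1 + r)\<^sup>2) \<le> d * g z" using ratio(1)[of z] z d by (intro mult_left_mono) auto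
    then show ?thesis using z small by (simp add: f_def[symmetric] g_def[symmetric] d_def[symmetric] abs_less_iff)
  qed
  have "continuous_on {a - d..a + d} f"
    by (rule DERIV_continuous_on, rule has_field_derivative_at_within, rule deriv) (use d a in auto)
  from IVT2'[OF hi lo _ this] d obtain x where x: "a - d \<le> x" "x \<le> a + d" "f x = 0" by auto
  have x01: "0 < x" "x < 1" using x d by auto
  have xd: "\<bar>x - a\<bar> \<le> d" using x by (auto simp: abs_le_iff)
  have uniq: "y = x" if "y \<in> {0<..<1}" "f y = 0" for y
    using score_fun_strict_decreasing[where N=N, OF K N, of x y n]
      score_fun_strict_decreasing[where N=N, OF K N, of y x n] that x x01
    by (cases x y rule: linorder_cases) (simp_all add: f_def)
  obtain z where z: "\<bar>z - a\<bar> \<le> d" "f a = g z * (x - a)"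
  proof (cases x a rule: linorder_cases)
    case less
    then obtain z where "x < z" "z < a" "f a - f x = (a - x) * (- g z)" using mvt[of x a] x01 a by auto
    then show ?thesis using x less by (intro that[of z]) (auto simp: algebra_simps abs_le_iff)
  next
    case equal
    then show ?thesis using x d by (intro that[of a]) auto
  next
    case greater
    then obtain z where "a < z" "z < x" "f x - f a = (x - a) * (- g z)" using mvt[of a x] x01 a by auto
    then show ?thesis using x greater by (intro that[of z]) (auto simp: algebra_simps abs_le_iff)
  qed
  show ?thesis
  proof (rule that[of x z, unfolded f_def[symmetric] g_def[symmetric] d_def[symmetric]])
    show "x \<in> {0<..<1}" using x01 by simp
    show "\<forall>y\<in>{0<..<1}. f y = 0 \<longrightarrow> y = x" using uniq by blast
  qed (fact x(3) xd z(2) ratio[OF z(1)])+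
qed

text \<open>
The version for a deterministic norming \<open>F\<close> that approximates the observed information.
\<close>

lemma score_root_error:
  assumes a: "0 < a" "a < 1" and K: "0 < K" and N: "\<And>s. 0 \<le> N s" and r: "0 < r" "r \<le> 1 / 4"
    and F: "F > 0" "\<bar>info_fun n K N a / F - 1\<bar> \<le> r"
    and small: "\<bar>score_fun n K N a\<bar> < r * min a (1 - a) * (F / 3)"
  obtains x where "x \<in> {0<..<1}" "score_fun n K N x = 0" "\<forall>y\<in>{0<..<1}. score_fun n K N y = 0 \<longrightarrow> y = x"
    "\<bar>x - a\<bar> \<le> r" "\<bar>sqrt F * (x - a) - score_fun n K N a / sqrt F\<bar> \<le> 6 * r * \<bar>score_fun n K N a / sqrt F\<bar>"
proof -
  define g where "g = info_fun n K N a"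
  have g: "(1 - r) * F \<le> g" "g \<le> (1 + r) * F"
  proof -
    have "1 - r \<le> g / F" "g / F \<le> 1 + r" using F(2) unfolding g_def by linarith+
    then show "(1 - r) * F \<le> g" "g \<le> (1 + r) * F" using F(1) by (auto simp: field_simps)
  qed
  have r1: "0 < (1 + r)\<^sup>2" "0 < (1 - r)\<^sup>2" using r by auto
  have "F / 3 \<le> g / (1 + r)\<^sup>2"
  proof -
    have "(1 + r)\<^sup>2 \<le> (5 / 4)\<^sup>2" using r by (intro power_mono) auto
    then have "F / 3 * (1 + r)\<^sup>2 \<le> F / 3 * (5 / 4)\<^sup>2" using F by (intro mult_left_mono) auto
    also have "\<dots> \<le> (1 - 1 / 4) * F" using F by (simp add: power2_eq_square)
    also have "\<dots> \<le> (1 - r) * F" using r F by (intro mult_right_mono) auto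
    finally show ?thesis using g r1 by (simp add: pos_le_divide_eq)
  qed
  then have "r * min a (1 - a) * (F / 3) \<le> r * min a (1 - a) * (g / (1 + r)\<^sup>2)"
    using r a by (intro mult_left_mono) auto
  then have small': "\<bar>score_fun n K N a\<bar> < r * min a (1 - a) * (info_fun n K N a / (1 + r)\<^sup>2)"
    using small unfolding g_def by (rule less_le_trans[rotated])
  have r': "r < 1" using r by simp
  obtain x z where x: "x \<in> {0<..<1}" "score_fun n K N x = 0" "\<forall>y\<in>{0<..<1}. score_fun n K N y = 0 \<longrightarrow> y = x"
    "\<bar>x - a\<bar> \<le> r * min a (1 - a)" and T: "score_fun n K N a = info_fun n K N z * (x - a)"
    and gz: "g / (1 + r)\<^sup>2 \<le> info_fun n K N z" "info_fun n K N z \<le> g / (1 - r)\<^sup>2"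
    unfolding g_def using score_root_linearization[OF a K N r(1) r' small'] by blast
  define G where "G = info_fun n K N z"
  have "0 < (1 - r) * F" using F r by (intro mult_pos_pos) auto
  then have gpos: "0 < g" using g(1) by linarith
  have "0 < g / (1 + r)\<^sup>2" using gpos r1 by (intro divide_pos_pos)
  then have G0: "0 < G" using gz(1) unfolding G_def by linarith
  \<comment> \<open>The information at the intermediate point, \<open>G\<close>, differs from \<open>F\<close> by a factor between \<open>(1 - r) / (1 + r)\<^sup>2\<close>
    and \<open>(1 + r) / (1 - r)\<^sup>2\<close>.\<close>
  have up: "F / G \<le> 1 + 6 * r"
  proof -
    have "F * (1 - r) \<le> (1 + r)\<^sup>2 * G" using g(1) gz(1) r1 by (simp add: G_def[symmetric] field_simps)
    also have "(1 + r)\<^sup>2 \<le> (1 + 6 * r) * (1 - r)"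
    proof -
      have "0 \<le> r * (3 - 7 * r)" using r by (intro mult_nonneg_nonneg) auto
      then show ?thesis by (simp add: power2_eq_square algebra_simps)
    qed
    then have "(1 + r)\<^sup>2 * G \<le> (1 + 6 * r) * (1 - r) * G" using G0 by (intro mult_right_mono) auto
    finally have "F * (1 - r) \<le> (1 + 6 * r) * G * (1 - r)" by (simp add: mult_ac)
    then have "F \<le> (1 + 6 * r) * G" using r by (simp add: mult_le_cancel_right)
    then show ?thesis using G0 by (simp add: pos_divide_le_eq)
  qed
  have low: "1 - 6 * r \<le> F / G"
  proof -
    have "(1 - r)\<^sup>2 * G \<le> (1 + r) * F" using g(2) gz(2) r1 by (simp add: G_def[symmetric] field_simps)
    moreover have "(1 - 6 * r) * (1 + r) \<le> (1 - r)\<^sup>2"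
    proof -
      have "0 \<le> r * (3 + 7 * r)" using r by (intro mult_nonneg_nonneg) auto
      then show ?thesis by (simp add: power2_eq_square algebra_simps)
    qed
    then have "(1 - 6 * r) * (1 + r) * G \<le> (1 - r)\<^sup>2 * G" using G0 by (intro mult_right_mono) auto
    ultimately have "(1 - 6 * r) * G * (1 + r) \<le> F * (1 + r)" by (simp add: mult_ac)
    then have "(1 - 6 * r) * G \<le> F" using r by (simp add: mult_le_cancel_right)
    then show ?thesis using G0 by (simp add: pos_le_divide_eq)
  qed
  have "x - a = score_fun n K N a / G" using T G0 by (simp add: G_def)
  then have "sqrt F * (x - a) = (F / G) * (score_fun n K N a / sqrt F)"
  proof -
    have "(F / G) * (score_fun n K N a / sqrt F) = (F / sqrt F) * (score_fun n K N a / G)" by simp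
    also have "F / sqrt F = sqrt F" using F(1) by (intro real_div_sqrt) simp
    finally show ?thesis using \<open>x - a = _\<close> by simp
  qed
  then have "sqrt F * (x - a) - score_fun n K N a / sqrt F = (F / G - 1) * (score_fun n K N a / sqrt F)"
    by (simp only: left_diff_distrib mult_1_left)
  then have "\<bar>sqrt F * (x - a) - score_fun n K N a / sqrt F\<bar> = \<bar>F / G - 1\<bar> * \<bar>score_fun n K N a / sqrt F\<bar>"
    by (simp add: abs_mult)
  also have "\<dots> \<le> 6 * r * \<bar>score_fun n K N a / sqrt F\<bar>"
    using up low by (intro mult_right_mono) auto
  finally have err: "\<bar>sqrt F * (x - a) - score_fun n K N a / sqrt F\<bar> \<le> 6 * r * \<bar>score_fun n K N a / sqrt F\<bar>" .
  have "r * min a (1 - a) \<le> r * 1" using r a by (intro mult_left_mono) auto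
  then have "\<bar>x - a\<bar> \<le> r" using x(4) by linarith
  then show ?thesis using x(1-3) err by (intro that[of x])
qed

section \<open>The estimator and its studentized error\<close>

context size_chain
begin

text \<open>
\<^const>\<open>qmle\<close> expressed through tallies, so that it is a function of the size chain.
\<close>

definition estimator :: "nat \<Rightarrow> 'a \<Rightarrow> real" where
  "estimator n \<omega> = (if k n \<omega> = 1 then 0 else if k n \<omega> = real n then 1
     else (THE x. x \<in> {0<..<1} \<and> score_fun n (k n \<omega> - 1) (\<lambda>s. N s n \<omega>) x = 0))"

lemma det_estimator: "det n (estimator n)"
proof (rule detI)
  fix \<omega> \<omega>' assume *: "\<omega> \<in> space M" "\<omega>' \<in> space M" "Z n \<omega> = Z n \<omega>'"
  have "tally c s n \<omega> = tally c s n \<omega>'" for s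
    by (rule tally_cong[OF *(3,1,2) order_refl])
  then show "estimator n \<omega> = estimator n \<omega>'" by (simp add: estimator_def)
qed

lemma weighted_tally_eq:
  assumes "\<omega> \<in> space M" "n \<ge> 1"
  shows "weighted_tally u n \<omega> = u 0 * k n \<omega> + (\<Sum>s=1..<n. u s * N s n \<omega>)"
proof -
  have "weighted_tally u n \<omega> = (\<Sum>s<n. u s * N s n \<omega>)"
    unfolding weighted_tally_def by (rule sum_tally[symmetric]) (rule le_less_trans[OF c_le[OF assms(1)]])
  also have "\<dots> = u 0 * k n \<omega> + (\<Sum>s=1..<n. u s * N s n \<omega>)"
    unfolding atLeast0LessThan[symmetric] using assms(2) by (simp add: sum.atLeast_Suc_lessThan)
  finally show ?thesis .
qed

lemma score_fun_at_alpha: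
  assumes "\<omega> \<in> space M" "n \<ge> 1"
  shows "score_fun n (k n \<omega> - 1) (\<lambda>s. N s n \<omega>) \<alpha> = score n \<omega>"
proof -
  have "score n \<omega> = weighted_tally mark n \<omega> - mark 0"
    unfolding weighted_tally_def score_def atLeast0LessThan[symmetric]
    using assms(2) c_0[OF assms(1)] by (simp add: sum.atLeast_Suc_lessThan)
  then show ?thesis
    unfolding weighted_tally_eq[OF assms] score_fun_def mark_0
    by (simp add: mark_def diff_divide_distrib sum_negf)
qed

text \<open>
The term \<open>1 / \<alpha>\<^sup>2\<close> comes from the first element, which the score does not count.
\<close>

lemma info_fun_at_alpha:
  assumes "\<omega> \<in> space M" "n \<ge> 1"
  shows "info_fun n (k n \<omega> - 1) (\<lambda>s. N s n \<omega>) \<alpha> = observed_info n \<omega> - 1 / \<alpha>\<^sup>2"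
  unfolding observed_info_def weighted_tally_eq[OF assms] info_fun_def mark_0
  by (simp add: mark_def diff_divide_distrib power_divide)

text \<open>
Pointwise version: the lower bounds on \<open>k n\<close> ensure that the contribution of the first element to the information is
negligible and that the score at \<open>\<alpha>\<close> is small enough for \<open>score_root_error\<close>.
\<close>

lemma estimator_error:
  assumes n: "n \<ge> 1" "\<omega> \<in> space M" and r: "0 < r" "r \<le> 1 / 4" and L: "0 < L" "\<bar>normed_score n \<omega>\<bar> \<le> L"
    and J: "\<bar>observed_info n \<omega> / k n \<omega> - info\<bar> \<le> r / 2"
    and large: "1 < k n \<omega>" "2 / (\<alpha>\<^sup>2 * r) \<le> k n \<omega>" "(3 * L / (r * min \<alpha> (1 - \<alpha>)))\<^sup>2 < k n \<omega>"
  shows "estimator n \<omega> \<in> {0<..<1}" "\<bar>estimator n \<omega> - \<alpha>\<bar> \<le> r"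
    "\<bar>sqrt (k n \<omega> * info) * (estimator n \<omega> - \<alpha>) - normed_score n \<omega>\<bar> \<le> 6 * r * L"
proof -
  define F where "F = k n \<omega> * info"
  define m where "m = min \<alpha> (1 - \<alpha>)"
  let ?S = "score_fun n (k n \<omega> - 1) (\<lambda>s. N s n \<omega>)"
  have m: "m > 0" using alpha by (simp add: m_def)
  have k0: "0 < k n \<omega>" using large(1) by linarith
  have kF: "k n \<omega> \<le> F" unfolding F_def using mult_left_mono[OF info_ge_1, of "k n \<omega>"] k0 by simp
  then have F0: "0 < F" using k0 by linarith
  have S: "?S \<alpha> = score n \<omega>" by (rule score_fun_at_alpha[OF n(2,1)])
  have Y: "?S \<alpha> / sqrt F = normed_score n \<omega>" by (simp add: S normed_score_def F_def)
  have ratio: "\<bar>info_fun n (k n \<omega> - 1) (\<lambda>s. N s n \<omega>) \<alpha> / F - 1\<bar> \<le> r"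
  proof -
    have "observed_info n \<omega> / F - 1 = (observed_info n \<omega> / k n \<omega> - info) / info"
      using info_ge_1 k0 by (simp add: F_def diff_divide_distrib)
    then have "\<bar>observed_info n \<omega> / F - 1\<bar> = \<bar>observed_info n \<omega> / k n \<omega> - info\<bar> / info"
      using info_ge_1 by (simp add: abs_divide)
    also have "\<dots> \<le> (r / 2) / 1" using J info_ge_1 r by (intro frac_le) auto
    finally have 1: "\<bar>observed_info n \<omega> / F - 1\<bar> \<le> r / 2" by simp
    have "2 / (\<alpha>\<^sup>2 * r) \<le> F" using large(2) kF by linarith
    then have "2 \<le> F * (\<alpha>\<^sup>2 * r)" using alpha r by (simp add: pos_divide_le_eq)
    then have 2: "1 / \<alpha>\<^sup>2 / F \<le> r / 2" using alpha F0 by (simp add: pos_divide_le_eq mult_ac)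
    have 3: "0 \<le> 1 / \<alpha>\<^sup>2 / F" using F0 by simp
    show ?thesis
      unfolding info_fun_at_alpha[OF n(2,1)] diff_divide_distrib[of _ _ F] using 1 2 3 by linarith
  qed
  have small: "\<bar>?S \<alpha>\<bar> < r * m * (F / 3)"
  proof -
    have "3 * L / (r * m) < sqrt (k n \<omega>)"
      using large(3) by (intro real_less_rsqrt) (simp add: m_def)
    also have "\<dots> \<le> sqrt F" using kF by simp
    finally have "L < r * m * (sqrt F / 3)" using r m by (simp add: field_simps)
    then have "\<bar>normed_score n \<omega>\<bar> < r * m * (sqrt F / 3)" using L(2) by linarith
    then have "\<bar>normed_score n \<omega>\<bar> * sqrt F < r * m * (sqrt F / 3) * sqrt F"
      using F0 by (intro mult_strict_right_mono) auto
    moreover have "\<bar>normed_score n \<omega>\<bar> * sqrt F = \<bar>?S \<alpha>\<bar>" using F0 by (simp add: Y[symmetric] abs_divide)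
    moreover have "r * m * (sqrt F / 3) * sqrt F = r * m * (F / 3)" using F0 by simp
    ultimately show ?thesis by linarith
  qed
  have K: "0 < k n \<omega> - 1" using large(1) by simp
  have N0: "\<And>s. 0 \<le> N s n \<omega>" by simp
  obtain x where x: "x \<in> {0<..<1}" "?S x = 0" "\<forall>y\<in>{0<..<1}. ?S y = 0 \<longrightarrow> y = x"
    "\<bar>x - \<alpha>\<bar> \<le> r" "\<bar>sqrt F * (x - \<alpha>) - ?S \<alpha> / sqrt F\<bar> \<le> 6 * r * \<bar>?S \<alpha> / sqrt F\<bar>"
    using score_root_error[OF alpha K N0 r F0 ratio small[unfolded m_def]] by blast
  \<comment> \<open>If all blocks are singletons, the score is positive and has no root.\<close>
  have kn: "k n \<omega> \<noteq> real n"
  proof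
    assume "k n \<omega> = real n"
    have "N s n \<omega> = 0" if "s \<in> {1..<n}" for s
    proof -
      have sum_n: "(\<Sum>s<n. 1 * N s n \<omega>) = (\<Sum>l<n. 1)"
        by (rule sum_tally) (rule le_less_trans[OF c_le[OF n(2)]])
      have "(\<Sum>s<n. N s n \<omega>) = k n \<omega> + (\<Sum>s=1..<n. N s n \<omega>)"
        unfolding atLeast0LessThan[symmetric] using n(1) by (simp add: sum.atLeast_Suc_lessThan)
      then have "(\<Sum>s=1..<n. N s n \<omega>) = 0" using sum_n \<open>k n \<omega> = real n\<close> by simp
      then show ?thesis using that by (simp add: sum_nonneg_eq_0_iff)
    qed
    then have "?S x = (k n \<omega> - 1) / x" by (simp add: score_fun_def)
    then show False using x K by simp
  qed
  have "(THE y. y \<in> {0<..<1} \<and> ?S y = 0) = x"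
    by (rule the_equality) (use x(1,2,3) in blast)+
  moreover have "k n \<omega> \<noteq> 1" using large(1) by linarith
  ultimately have est: "estimator n \<omega> = x" unfolding estimator_def using kn by (simp only: if_False)
  show "estimator n \<omega> \<in> {0<..<1}" "\<bar>estimator n \<omega> - \<alpha>\<bar> \<le> r" unfolding est by (fact x(1), fact x(4))
  have "6 * r * \<bar>normed_score n \<omega>\<bar> \<le> 6 * r * L" using L r by (intro mult_left_mono) auto
  moreover have "\<bar>sqrt F * (x - \<alpha>) - normed_score n \<omega>\<bar> \<le> 6 * r * \<bar>normed_score n \<omega>\<bar>"
    using x(5) unfolding Y .
  ultimately show "\<bar>sqrt (k n \<omega> * info) * (estimator n \<omega> - \<alpha>) - normed_score n \<omega>\<bar> \<le> 6 * r * L"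
    unfolding est F_def[symmetric] by linarith
qed

definition accurate :: "real \<Rightarrow> nat \<Rightarrow> 'a \<Rightarrow> bool" where
  "accurate r n \<omega> \<longleftrightarrow> estimator n \<omega> \<in> {0<..<1} \<and> \<bar>estimator n \<omega> - \<alpha>\<bar> \<le> r \<and>
     \<bar>sqrt (k n \<omega> * info) * (estimator n \<omega> - \<alpha>) - normed_score n \<omega>\<bar> \<le> r"

lemma det_accurate: "det n (accurate r n)"
proof (rule detI)
  fix \<omega> \<omega>' assume *: "\<omega> \<in> space M" "\<omega>' \<in> space M" "Z n \<omega> = Z n \<omega>'"
  have "estimator n \<omega> = estimator n \<omega>'" "normed_score n \<omega> = normed_score n \<omega>'" "k n \<omega> = k n \<omega>'"
    by (rule detD[OF det_estimator *(3,1,2)], rule detD[OF det_normed_score *(3,1,2)],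
        rule detD[OF det_N[OF order_refl] *(3,1,2)])
  then show "accurate r n \<omega> = accurate r n \<omega>'" by (simp add: accurate_def)
qed

lemma prob_not_accurate:
  assumes r: "r > 0" and d: "d > 0"
  shows "\<forall>\<^sub>F n in sequentially. prob {\<omega>\<in>space M. \<not> accurate r n \<omega>} < d"
proof -
  obtain L where L: "L > 0" "\<And>n. n \<ge> 1 \<Longrightarrow> prob {\<omega>\<in>space M. L < \<bar>normed_score n \<omega>\<bar>} < d / 3"
    using normed_score_tight[of "d / 3"] d by auto
  define r' where "r' = min (1 / 4) (min r (r / (6 * L)))"
  have r': "0 < r'" "r' \<le> 1 / 4" "r' \<le> r" "6 * r' * L \<le> r"
  proof -
    show "0 < r'" using r L by (simp add: r'_def)
    show "r' \<le> 1 / 4" unfolding r'_def by (rule min.cobounded1)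
    show "r' \<le> r" unfolding r'_def by simp
    have "r' \<le> r / (6 * L)" unfolding r'_def by simp
    then show "6 * r' * L \<le> r" using L by (simp add: field_simps)
  qed
  define Q where "Q = max 1 (max (2 / (\<alpha>\<^sup>2 * r')) ((3 * L / (r' * min \<alpha> (1 - \<alpha>)))\<^sup>2))"
  have ab: "\<alpha> / 2 < \<alpha>" using alpha by simp
  have ev1: "\<forall>\<^sub>F n in sequentially. prob {\<omega>\<in>space M. k n \<omega> \<le> real n powr (\<alpha> / 2)} < d / 3"
    using k_exceeds_powr[OF ab] d by (intro order_tendstoD(2)) auto
  have "filterlim (\<lambda>n. real n powr (\<alpha> / 2)) at_top sequentially"
    using alpha by real_asymp
  then have ev2: "\<forall>\<^sub>F n in sequentially. Q \<le> real n powr (\<alpha> / 2)"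
    unfolding filterlim_at_top by blast
  have ev3: "\<forall>\<^sub>F n in sequentially. prob {\<omega>\<in>space M. r' / 2 < \<bar>observed_info n \<omega> / k n \<omega> - info\<bar>} < d / 3"
    by (rule order_tendstoD(2)[OF observed_info_law_of_large_numbers[unfolded vanishes_in_prob_def, rule_format]])
      (use r'(1) d in auto)
  show ?thesis
    using ev1 ev2 ev3 eventually_ge_at_top[of 1]
  proof eventually_elim
    case (elim n)
    let ?A = "{\<omega>\<in>space M. k n \<omega> \<le> real n powr (\<alpha> / 2)}"
    let ?B = "{\<omega>\<in>space M. r' / 2 < \<bar>observed_info n \<omega> / k n \<omega> - info\<bar>}"
    let ?C = "{\<omega>\<in>space M. L < \<bar>normed_score n \<omega>\<bar>}"
    have evs: "?A \<in> events" "?B \<in> events" "?C \<in> events"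
    proof -
      show "?A \<in> events"
        by (rule det_event[of n], rule det_comp[where f="\<lambda>x. x \<le> real n powr (\<alpha> / 2)"], rule det_N) simp
      show "?C \<in> events" by (rule det_event[of n], rule det_comp[where f="\<lambda>x. L < \<bar>x\<bar>"], rule det_normed_score)
      have "det n (\<lambda>\<omega>. observed_info n \<omega> / k n \<omega> - info)"
        unfolding observed_info_def by (intro det_arith det_weighted_tally det_N det_const order_refl)
      then show "?B \<in> events" by (intro det_event[of n] det_comp[where f="\<lambda>x. r' / 2 < \<bar>x\<bar>"])
    qed
    have "{\<omega>\<in>space M. \<not> accurate r n \<omega>} \<subseteq> ?A \<union> ?B \<union> ?C"
    proof (rule subsetI, rule ccontr)
      fix \<omega> assume 1: "\<omega> \<in> {\<omega>\<in>space M. \<not> accurate r n \<omega>}" "\<omega> \<notin> ?A \<union> ?B \<union> ?C"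
      then have \<omega>: "\<omega> \<in> space M" "real n powr (\<alpha> / 2) < k n \<omega>" "\<bar>observed_info n \<omega> / k n \<omega> - info\<bar> \<le> r' / 2"
        "\<bar>normed_score n \<omega>\<bar> \<le> L" by auto
      have "Q < k n \<omega>" using \<omega>(2) elim(2) by linarith
      then have large: "1 < k n \<omega>" "2 / (\<alpha>\<^sup>2 * r') \<le> k n \<omega>" "(3 * L / (r' * min \<alpha> (1 - \<alpha>)))\<^sup>2 < k n \<omega>"
        unfolding Q_def max_less_iff_conj by auto
      have "accurate r n \<omega>"
        using estimator_error[OF elim(4) \<omega>(1) r'(1,2) L(1) \<omega>(4,3) large] r'(3,4)
        unfolding accurate_def by (intro conjI) (assumption | linarith)+
      then show False using 1(1) by blast
    qed
    then have "prob {\<omega>\<in>space M. \<not> accurate r n \<omega>} \<le> prob (?A \<union> ?B \<union> ?C)"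
      using evs by (intro finite_measure_mono sets.Un)
    also have "\<dots> \<le> prob ?A + prob ?B + prob ?C"
      using measure_Un_le[OF sets.Un[OF evs(1,2)] evs(3)] measure_Un_le[OF evs(1,2)] by linarith
    also have "\<dots> < d" using elim(1,3) L(2)[OF elim(4)] by linarith
    finally show ?case .
  qed
qed

definition normed_error :: "nat \<Rightarrow> 'a \<Rightarrow> real" where
  "normed_error n \<omega> = sqrt (k n \<omega> * info) * (estimator n \<omega> - \<alpha>)"

lemma det_normed_error: "det n (normed_error n)"
  unfolding normed_error_def
  by (intro det_arith(3) det_comp[where f="\<lambda>x. sqrt (x * info)"] det_comp[where f="\<lambda>x. x - \<alpha>"]
      det_estimator det_N order_refl)

text \<open>
Slutsky's lemma for mixing convergence.
\<close>

lemma char_perturb: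
  fixes g :: "'a \<Rightarrow> real" and X :: "nat \<Rightarrow> 'a \<Rightarrow> real"
  assumes g: "det m0 g" "\<And>\<omega>. \<bar>g \<omega>\<bar> \<le> 1" and m0: "1 \<le> m0" and X: "\<And>n. det n (X n)"
    and close: "\<And>r. r > 0 \<Longrightarrow> (\<lambda>n. prob {\<omega>\<in>space M. r < \<bar>X n \<omega> - normed_score n \<omega>\<bar>}) \<longlonglongrightarrow> 0"
  shows "(\<lambda>n. \<integral>\<omega>. g \<omega> * iexp (t * X n \<omega>) \<partial>M) \<longlonglongrightarrow> (\<integral>\<omega>. g \<omega> \<partial>M) * exp (- t\<^sup>2 / 2)"
proof -
  let ?d = "\<lambda>n. (\<integral>\<omega>. g \<omega> * iexp (t * X n \<omega>) \<partial>M) - (\<integral>\<omega>. g \<omega> * iexp (t * normed_score n \<omega>) \<partial>M)"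
  have "?d \<longlonglongrightarrow> 0"
  proof (rule LIMSEQ_I)
    fix e :: real assume e: "e > 0"
    define r where "r = e / (2 * (\<bar>t\<bar> + 1))"
    have r: "r > 0" "\<bar>t\<bar> * r \<le> e / 2" using e by (auto simp: r_def field_simps)
    have "\<forall>\<^sub>F n in sequentially. prob {\<omega>\<in>space M. r < \<bar>X n \<omega> - normed_score n \<omega>\<bar>} < e / 4"
      using close[OF r(1)] e by (intro order_tendstoD(2)) auto
    then have "\<forall>\<^sub>F n in sequentially. norm (?d n - 0) < e"
      using eventually_ge_at_top[of m0]
    proof eventually_elim
      case (elim n)
      let ?B = "{\<omega>\<in>space M. r < \<bar>X n \<omega> - normed_score n \<omega>\<bar>}"
      have detD: "det n (\<lambda>\<omega>. X n \<omega> - normed_score n \<omega>)" by (intro det_arith(2) X det_normed_score)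
      have B: "?B \<in> events" by (rule det_event[of n], rule det_comp[where f="\<lambda>x. r < \<bar>x\<bar>"], rule detD)
      have "norm (?d n) \<le> \<bar>t\<bar> * r + 2 * prob ?B"
        by (rule norm_expectation_iexp_diff_le[OF det_mono[OF g(1) m0 elim(2)] g(2) X det_normed_score B])
          (use r(1) in auto)
      then show ?case using elim(1) r(2) by simp
    qed
    then show "\<exists>n0. \<forall>n\<ge>n0. norm (?d n - 0) < e" by (simp add: eventually_sequentially)
  qed
  from tendsto_add[OF this char_normed_score[OF g m0, of t]] show ?thesis by simp
qed

lemma normed_error_close:
  assumes "r > 0"
  shows "(\<lambda>n. prob {\<omega>\<in>space M. r < \<bar>normed_error n \<omega> - normed_score n \<omega>\<bar>}) \<longlonglongrightarrow> 0"
proof (rule prob_tendsto_0_subset)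
  show "(\<lambda>n. prob {\<omega>\<in>space M. \<not> accurate r n \<omega>}) \<longlonglongrightarrow> 0"
  proof (rule order_tendstoI)
    show "\<forall>\<^sub>F n in sequentially. a < prob {\<omega>\<in>space M. \<not> accurate r n \<omega>}" if "a < 0" for a
      using that by (intro always_eventually allI) (auto intro: less_le_trans)
  qed (rule prob_not_accurate[OF assms])
  show "\<forall>\<^sub>F n in sequentially. {\<omega>\<in>space M. r < \<bar>normed_error n \<omega> - normed_score n \<omega>\<bar>} \<subseteq> {\<omega>\<in>space M. \<not> accurate r n \<omega>}
      \<and> {\<omega>\<in>space M. \<not> accurate r n \<omega>} \<in> events"
  proof (intro always_eventually allI conjI)
    fix n
    show "{\<omega>\<in>space M. r < \<bar>normed_error n \<omega> - normed_score n \<omega>\<bar>} \<subseteq> {\<omega>\<in>space M. \<not> accurate r n \<omega>}"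
      by (auto simp: accurate_def normed_error_def)
    show "{\<omega>\<in>space M. \<not> accurate r n \<omega>} \<in> events"
      by (rule det_event[of n], rule det_comp[where f=Not], rule det_accurate)
  qed
qed

lemmas char_normed_error = char_perturb[OF _ _ _ det_normed_error normed_error_close]

text \<open>
If the estimator lies outside \<open>{0<..<1}\<close>, the confidence interval degenerates to a point different from \<open>\<alpha>\<close>. The
value \<open>z\<close> is for this case: any \<open>z\<close> beyond the quantile makes coverage the same as smallness of the studentized error.
\<close>

definition studentized_error :: "real \<Rightarrow> nat \<Rightarrow> 'a \<Rightarrow> real" where
  "studentized_error z n \<omega> = (if estimator n \<omega> \<in> {0<..<1}
     then sqrt (k n \<omega>) * sqrt (fisher_info (estimator n \<omega>)) * (estimator n \<omega> - \<alpha>) else z)"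

lemma det_studentized_error: "det n (studentized_error z n)"
proof (rule detI)
  fix \<omega> \<omega>' assume *: "\<omega> \<in> space M" "\<omega>' \<in> space M" "Z n \<omega> = Z n \<omega>'"
  have "estimator n \<omega> = estimator n \<omega>'" "k n \<omega> = k n \<omega>'"
    by (rule detD[OF det_estimator *(3,1,2)], rule detD[OF det_N[OF order_refl] *(3,1,2)])
  then show "studentized_error z n \<omega> = studentized_error z n \<omega>'" by (simp add: studentized_error_def)
qed

text \<open>
The studentized error is the normed error times \<open>sqrt (fisher_info (estimator) / info)\<close>. The first factor is bounded in
probability and the second tends to 1, by consistency of the estimator and continuity of the Fisher information.
\<close>

lemma studentized_error_close:
  assumes r: "r > 0"
  shows "(\<lambda>n. prob {\<omega>\<in>space M. r < \<bar>studentized_error z n \<omega> - normed_score n \<omega>\<bar>}) \<longlonglongrightarrow> 0"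
proof (rule order_tendstoI)
  show "\<forall>\<^sub>F n in sequentially. a < prob {\<omega>\<in>space M. r < \<bar>studentized_error z n \<omega> - normed_score n \<omega>\<bar>}" if "a < 0" for a
    using that by (intro always_eventually allI) (auto intro: less_le_trans)
  fix d :: real assume d: "d > 0"
  obtain L where L: "L > 0" "\<And>n. n \<ge> 1 \<Longrightarrow> prob {\<omega>\<in>space M. L < \<bar>normed_score n \<omega>\<bar>} < d / 2"
    using normed_score_tight[of "d / 2"] d by auto
  define q where "q = r / (2 * (L + 1))"
  have q: "q > 0" "(L + 1) * q \<le> r / 2" using r L by (auto simp: q_def field_simps)
  have cont: "isCont (\<lambda>x. sqrt (fisher_info x / info)) \<alpha>"
    using isCont_fisher_info[OF alpha] info_ge_1 by (intro continuous_intros) auto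
  have "sqrt (info / info) = 1" using info_ge_1 by simp
  with cont q(1) obtain s where s: "s > 0" "\<And>x. \<bar>x - \<alpha>\<bar> < s \<Longrightarrow> \<bar>sqrt (fisher_info x / info) - 1\<bar> < q"
    unfolding continuous_at_eps_delta dist_real_def by metis
  define r' where "r' = min (s / 2) (min 1 (r / 2))"
  have r': "r' > 0" "r' < s" "r' \<le> 1" "r' \<le> r / 2" using s r by (auto simp: r'_def min_def)
  have d2: "d / 2 > 0" using d by simp
  show "\<forall>\<^sub>F n in sequentially. prob {\<omega>\<in>space M. r < \<bar>studentized_error z n \<omega> - normed_score n \<omega>\<bar>} < d"
    using prob_not_accurate[OF r'(1) d2] eventually_ge_at_top[of 1]
  proof eventually_elim
    case (elim n)
    let ?A = "{\<omega>\<in>space M. \<not> accurate r' n \<omega>}" and ?C = "{\<omega>\<in>space M. L < \<bar>normed_score n \<omega>\<bar>}"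
    have evs: "?A \<in> events" "?C \<in> events"
      by (rule det_event[of n], rule det_comp[where f=Not], rule det_accurate)
        (rule det_event[of n], rule det_comp[where f="\<lambda>x. L < \<bar>x\<bar>"], rule det_normed_score)
    have "{\<omega>\<in>space M. r < \<bar>studentized_error z n \<omega> - normed_score n \<omega>\<bar>} \<subseteq> ?A \<union> ?C"
    proof (rule subsetI, rule ccontr)
      fix \<omega> assume 1: "\<omega> \<in> {\<omega>\<in>space M. r < \<bar>studentized_error z n \<omega> - normed_score n \<omega>\<bar>}" "\<omega> \<notin> ?A \<union> ?C"
      then have \<omega>: "\<omega> \<in> space M" "accurate r' n \<omega>" "\<bar>normed_score n \<omega>\<bar> \<le> L" by auto
      define a where "a = estimator n \<omega>"
      have a: "a \<in> {0<..<1}" "\<bar>a - \<alpha>\<bar> < s" "\<bar>normed_error n \<omega> - normed_score n \<omega>\<bar> \<le> r'"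
        using \<omega>(2) r'(2) by (auto simp: accurate_def a_def normed_error_def)
      have "studentized_error z n \<omega> = normed_error n \<omega> * sqrt (fisher_info a / info)"
        using a(1) info_ge_1 by (simp add: studentized_error_def normed_error_def a_def real_sqrt_mult real_sqrt_divide)
      then have "studentized_error z n \<omega> - normed_error n \<omega> = normed_error n \<omega> * (sqrt (fisher_info a / info) - 1)"
        by (simp add: right_diff_distrib)
      then have "\<bar>studentized_error z n \<omega> - normed_error n \<omega>\<bar> = \<bar>normed_error n \<omega>\<bar> * \<bar>sqrt (fisher_info a / info) - 1\<bar>"
        by (simp add: abs_mult)
      also have "\<dots> \<le> (L + 1) * q"
        using a(3) \<omega>(3) r'(3) s(2)[OF a(2)] L by (intro mult_mono) auto
      finally have "\<bar>studentized_error z n \<omega> - normed_score n \<omega>\<bar> \<le> r" using q(2) a(3) r'(4) by linarith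
      then show False using 1(1) by auto
    qed
    then have "prob {\<omega>\<in>space M. r < \<bar>studentized_error z n \<omega> - normed_score n \<omega>\<bar>} \<le> prob (?A \<union> ?C)"
      using evs by (intro finite_measure_mono sets.Un)
    also have "\<dots> \<le> prob ?A + prob ?C" using evs by (intro measure_Un_le)
    also have "\<dots> < d" using elim(1) L(2)[OF elim(2)] by linarith
    finally show ?case .
  qed
qed

lemmas char_studentized_error = char_perturb[OF _ _ _ det_studentized_error studentized_error_close]

end

section \<open>Gibbs weights mixed over a compact interval\<close>

text \<open>
The complement of the support is a union of open null sets, and by Lindelof's theorem countably many of them suffice.
\<close>

lemma AE_in_measure_support:
  fixes \<mu> :: "real measure"
  assumes sets: "sets \<mu> = sets borel"
  shows "AE x in \<mu>. x \<in> measure_support \<mu>"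
proof -
  define F where "F = {U. open U \<and> emeasure \<mu> U = 0}"
  obtain F' where F': "F' \<subseteq> F" "countable F'" "\<Union>F' = \<Union>F"
    using Lindelof[of F] by (auto simp: F_def)
  have "\<Union>F' \<in> null_sets \<mu>"
  proof -
    have "(\<Union>U\<in>F'. U) \<in> null_sets \<mu>"
      using F'(1) by (intro null_sets_UN' F'(2)) (auto simp: F_def null_sets_def sets)
    then show ?thesis by simp
  qed
  then have "AE x in \<mu>. x \<notin> \<Union>F'" by (rule AE_not_in)
  then show ?thesis
  proof eventually_elim
    case (elim x)
    then show ?case unfolding F'(3) by (auto simp: measure_support_def F_def zero_less_iff_neq_zero)
  qed
qed

locale mixing_measure =
  fixes \<alpha> l u :: real and \<mu> :: "real measure"
  assumes alpha: "0 < \<alpha>" "\<alpha> < 1" and bounds: "- \<alpha> < l" "l \<le> 0" "0 \<le> u"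
    and mu: "real_distribution \<mu>" and support: "measure_support \<mu> \<subseteq> {l..u}"
begin

sublocale mu: real_distribution \<mu> by (rule mu)

abbreviation v where "v \<equiv> mixed_weight \<alpha> \<mu>"

lemma AE_interval: "AE \<theta> in \<mu>. \<theta> \<in> {l..u}"
  using AE_in_measure_support[OF mu.events_eq_borel] by eventually_elim (use support in auto)

lemma gibbs_weight_pos:
  assumes "\<theta> \<in> {l..u}"
  shows "0 < gibbs_weight \<alpha> \<theta> n k"
proof -
  have "0 < \<theta> + real i * \<alpha>" if "i \<ge> 1" for i
  proof -
    have "1 * \<alpha> \<le> real i * \<alpha>" using that alpha by (intro mult_right_mono) auto
    moreover have "- \<alpha> < \<theta>" using assms bounds by simp
    ultimately show ?thesis by linarith
  qed
  moreover have "0 < \<theta> + real i" if "i \<ge> 1" for i using that assms bounds alpha by auto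
  ultimately show ?thesis
    unfolding gibbs_weight_def by (intro divide_pos_pos prod_pos) auto
qed

lemma continuous_on_gibbs_weight: "continuous_on {l..u} (\<lambda>\<theta>. gibbs_weight \<alpha> \<theta> n k)"
proof -
  have "\<theta> + real i \<noteq> 0" if "\<theta> \<in> {l..u}" "i \<ge> 1" for \<theta> i using that bounds alpha by auto
  then show ?thesis
    unfolding gibbs_weight_def by (intro continuous_intros) auto
qed

text \<open>
By compactness; the lower bound makes the mixed weights positive, so that the transition probabilities are well defined.
\<close>

lemma gibbs_weight_bounds:
  obtains a b where "0 < a" "\<And>\<theta>. \<theta> \<in> {l..u} \<Longrightarrow> a \<le> gibbs_weight \<alpha> \<theta> n k" "\<And>\<theta>. \<theta> \<in> {l..u} \<Longrightarrow> gibbs_weight \<alpha> \<theta> n k \<le> b"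
proof -
  have ne: "{l..u} \<noteq> {}" using bounds by auto
  obtain x where x: "x \<in> {l..u}" "\<forall>y\<in>{l..u}. gibbs_weight \<alpha> x n k \<le> gibbs_weight \<alpha> y n k"
    using continuous_attains_inf[OF compact_Icc ne continuous_on_gibbs_weight] by blast
  obtain y where y: "\<forall>z\<in>{l..u}. gibbs_weight \<alpha> z n k \<le> gibbs_weight \<alpha> y n k"
    using continuous_attains_sup[OF compact_Icc ne continuous_on_gibbs_weight] by blast
  show ?thesis
    by (rule that[of "gibbs_weight \<alpha> x n k" "gibbs_weight \<alpha> y n k"])
      (use x y gibbs_weight_pos[OF x(1)] in auto)
qed

lemma integrable_gibbs_weight: "integrable \<mu> (\<lambda>\<theta>. gibbs_weight \<alpha> \<theta> n k)"
proof -
  obtain a b where ab: "0 < a" "\<And>\<theta>. \<theta> \<in> {l..u} \<Longrightarrow> a \<le> gibbs_weight \<alpha> \<theta> n k" "\<And>\<theta>. \<theta> \<in> {l..u} \<Longrightarrow> gibbs_weight \<alpha> \<theta> n k \<le> b"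
    using gibbs_weight_bounds[of n k] by blast
  show ?thesis
  proof (rule mu.integrable_const_bound[of _ b])
    show "AE \<theta> in \<mu>. norm (gibbs_weight \<alpha> \<theta> n k) \<le> b"
      using AE_interval
    proof eventually_elim
      case (elim \<theta>)
      then show ?case using ab(3)[OF elim] gibbs_weight_pos[OF elim, of n k] by simp
    qed
    show "(\<lambda>\<theta>. gibbs_weight \<alpha> \<theta> n k) \<in> borel_measurable \<mu>"
      unfolding gibbs_weight_def by measurable
  qed
qed

lemma mixed_weight_pos: "0 < v n k"
proof -
  obtain a b where ab: "0 < a" "\<And>\<theta>. \<theta> \<in> {l..u} \<Longrightarrow> a \<le> gibbs_weight \<alpha> \<theta> n k" "\<And>\<theta>. \<theta> \<in> {l..u} \<Longrightarrow> gibbs_weight \<alpha> \<theta> n k \<le> b"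
    using gibbs_weight_bounds[of n k] by blast
  have "a = (\<integral>\<theta>. a \<partial>\<mu>)" using mu.prob_space by simp
  also have "\<dots> \<le> v n k"
    unfolding mixed_weight_def
  proof (rule integral_mono_AE[OF _ integrable_gibbs_weight])
    show "AE \<theta> in \<mu>. a \<le> gibbs_weight \<alpha> \<theta> n k"
      using AE_interval by eventually_elim (rule ab(2))
  qed simp
  finally show ?thesis using ab(1) by linarith
qed

lemma gibbs_weight_new:
  assumes "1 \<le> k" "1 \<le> n" "\<theta> \<in> {l..u}"
  shows "gibbs_weight \<alpha> \<theta> (Suc n) (Suc k) = gibbs_weight \<alpha> \<theta> n k * ((\<theta> + real k * \<alpha>) / (\<theta> + real n))"
    "gibbs_weight \<alpha> \<theta> (Suc n) k = gibbs_weight \<alpha> \<theta> n k / (\<theta> + real n)" "0 < \<theta> + real n"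
  using assms bounds alpha by (auto simp: gibbs_weight_def)

text \<open>
The transition probabilities out of a partition with \<open>k\<close> blocks add up to 1, because the block sizes add up to \<open>n\<close>. The
recursion is linear in the weights and thus inherited by mixtures.
\<close>

lemma mixed_weight_recursion:
  assumes "1 \<le> k" "1 \<le> n"
  shows "v n k = v (Suc n) (Suc k) + (real n - \<alpha> * real k) * v (Suc n) k"
proof -
  have "v n k = (\<integral>\<theta>. gibbs_weight \<alpha> \<theta> (Suc n) (Suc k) + (real n - \<alpha> * real k) * gibbs_weight \<alpha> \<theta> (Suc n) k \<partial>\<mu>)"
    unfolding mixed_weight_def
  proof (rule integral_cong_AE)
    show "AE \<theta> in \<mu>. gibbs_weight \<alpha> \<theta> n k = gibbs_weight \<alpha> \<theta> (Suc n) (Suc k) + (real n - \<alpha> * real k) * gibbs_weight \<alpha> \<theta> (Suc n) k"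
      using AE_interval
    proof eventually_elim
      case (elim \<theta>)
      note w = gibbs_weight_new[OF assms elim]
      let ?g = "gibbs_weight \<alpha> \<theta> n k"
      have "gibbs_weight \<alpha> \<theta> (Suc n) (Suc k) + (real n - \<alpha> * real k) * gibbs_weight \<alpha> \<theta> (Suc n) k
          = (?g * (\<theta> + real k * \<alpha>) + (real n - \<alpha> * real k) * ?g) / (\<theta> + real n)"
        unfolding w(1,2) times_divide_eq_right by (rule add_divide_distrib[symmetric])
      also have "?g * (\<theta> + real k * \<alpha>) + (real n - \<alpha> * real k) * ?g = ?g * (\<theta> + real n)"
        by (simp add: algebra_simps)
      finally show ?case using w(3) by simp
    qed
  qed (use integrable_gibbs_weight in auto)
  also have "\<dots> = v (Suc n) (Suc k) + (real n - \<alpha> * real k) * v (Suc n) k"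
    unfolding mixed_weight_def using integrable_gibbs_weight by simp
  finally show ?thesis .
qed

text \<open>
For each \<open>\<theta>\<close> in the interval the bounds hold for the ratio \<open>(\<theta> + k * \<alpha>) / (\<theta> + n)\<close> of the weights, and inequalities
between the integrands survive integration over \<open>\<theta>\<close>.
\<close>

lemma mixed_weight_new_bounds:
  assumes k: "1 \<le> k" "k \<le> n"
  shows "(l + \<alpha>) * real k / real n * v n k \<le> v (Suc n) (Suc k)"
    "\<bar>v (Suc n) (Suc k) - \<alpha> * real k / real n * v n k\<bar> \<le> (u - l) / (1 - \<alpha>) / real n * v n k"
proof -
  have n: "1 \<le> n" using k by simp
  have kn: "real k * \<alpha> \<le> real n"
  proof -
    have "real k * \<alpha> \<le> real n * 1" using k alpha by (intro mult_mono) auto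
    then show ?thesis by simp
  qed
  define \<rho> where "\<rho> \<theta> = (\<theta> + real k * \<alpha>) / (\<theta> + real n)" for \<theta>
  have rho: "(l + \<alpha>) * real k / real n \<le> \<rho> \<theta>" "\<bar>\<rho> \<theta> - \<alpha> * real k / real n\<bar> \<le> (u - l) / (1 - \<alpha>) / real n"
    if \<theta>: "\<theta> \<in> {l..u}" for \<theta>
  proof -
    have pos: "0 < \<theta> + real n" "0 < real n" using gibbs_weight_new(3)[OF k(1) n \<theta>] n by auto
    have cf: "0 \<le> real n - real k * \<alpha> - real k * l"
    proof -
      have "real k * l \<le> 0" using bounds by (simp add: mult_nonneg_nonpos)
      then show ?thesis using kn by linarith
    qed
    have "l * (real n - real k * \<alpha> - real k * l) \<le> \<theta> * (real n - real k * \<alpha> - real k * l)"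
      using \<theta> cf by (intro mult_right_mono) auto
    moreover have "0 \<le> l * (real n - real k * \<alpha> - real k * l) - real k * l * real n"
    proof -
      have "0 \<le> (- l) * ((real k - 1) * real n + real k * (\<alpha> + l))"
      proof (rule mult_nonneg_nonneg)
        have "0 \<le> (real k - 1) * real n" "0 \<le> real k * (\<alpha> + l)"
          using bounds k by (intro mult_nonneg_nonneg; simp)+
        then show "0 \<le> (real k - 1) * real n + real k * (\<alpha> + l)" by linarith
      qed (use bounds in simp)
      then show ?thesis by (simp add: algebra_simps)
    qed
    ultimately have "(l + \<alpha>) * real k * (\<theta> + real n) \<le> (\<theta> + real k * \<alpha>) * real n"
      by (simp add: algebra_simps)
    then show "(l + \<alpha>) * real k / real n \<le> \<rho> \<theta>"
      unfolding \<rho>_def using pos by (simp add: divide_simps mult.commute)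
    have "\<rho> \<theta> - \<alpha> * real k / real n = \<theta> * (real n - real k * \<alpha>) / ((\<theta> + real n) * real n)"
      unfolding \<rho>_def using pos by (simp add: divide_simps) (simp add: algebra_simps)
    then have "\<bar>\<rho> \<theta> - \<alpha> * real k / real n\<bar> = \<bar>\<theta>\<bar> * (real n - real k * \<alpha>) / ((\<theta> + real n) * real n)"
      using pos kn by (simp add: abs_mult)
    also have "\<dots> \<le> (u - l) * real n / (((1 - \<alpha>) * real n) * real n)"
    proof (rule frac_le)
      show "\<bar>\<theta>\<bar> * (real n - real k * \<alpha>) \<le> (u - l) * real n"
        using \<theta> bounds kn alpha by (intro mult_mono) auto
      have "\<alpha> * 1 \<le> \<alpha> * real n" using alpha n by (intro mult_left_mono) auto
      moreover have "- \<alpha> < \<theta>" using \<theta> bounds by simp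
      moreover have "(1 - \<alpha>) * real n = real n - \<alpha> * real n" by (simp add: left_diff_distrib)
      ultimately have "(1 - \<alpha>) * real n \<le> \<theta> + real n" by linarith
      then show "((1 - \<alpha>) * real n) * real n \<le> (\<theta> + real n) * real n" by (intro mult_right_mono) auto
    qed (use bounds alpha pos in auto)
    also have "\<dots> = (u - l) / (1 - \<alpha>) / real n" using pos by simp
    finally show "\<bar>\<rho> \<theta> - \<alpha> * real k / real n\<bar> \<le> (u - l) / (1 - \<alpha>) / real n" .
  qed
  \<comment> \<open>Bounds on the ratio for every \<open>\<theta>\<close> pass to the mixture.\<close>
  have lower: "a * v n k \<le> v (Suc n) (Suc k)" if "\<And>\<theta>. \<theta> \<in> {l..u} \<Longrightarrow> a \<le> \<rho> \<theta>" for a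
  proof -
    have "a * v n k = (\<integral>\<theta>. a * gibbs_weight \<alpha> \<theta> n k \<partial>\<mu>)" by (simp add: mixed_weight_def)
    also have "\<dots> \<le> v (Suc n) (Suc k)"
      unfolding mixed_weight_def
    proof (rule integral_mono_AE)
      show "AE \<theta> in \<mu>. a * gibbs_weight \<alpha> \<theta> n k \<le> gibbs_weight \<alpha> \<theta> (Suc n) (Suc k)"
        using AE_interval
      proof eventually_elim
        case (elim \<theta>)
        show ?case
          unfolding gibbs_weight_new(1)[OF k(1) n elim] \<rho>_def[symmetric]
          using mult_left_mono[OF that[OF elim], of "gibbs_weight \<alpha> \<theta> n k"] gibbs_weight_pos[OF elim, of n k]
          by (simp add: mult.commute)
      qed
    qed (use integrable_gibbs_weight in auto)
    finally show ?thesis .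
  qed
  have upper: "v (Suc n) (Suc k) \<le> b * v n k" if "\<And>\<theta>. \<theta> \<in> {l..u} \<Longrightarrow> \<rho> \<theta> \<le> b" for b
  proof -
    have "v (Suc n) (Suc k) \<le> (\<integral>\<theta>. b * gibbs_weight \<alpha> \<theta> n k \<partial>\<mu>)"
      unfolding mixed_weight_def
    proof (rule integral_mono_AE)
      show "AE \<theta> in \<mu>. gibbs_weight \<alpha> \<theta> (Suc n) (Suc k) \<le> b * gibbs_weight \<alpha> \<theta> n k"
        using AE_interval
      proof eventually_elim
        case (elim \<theta>)
        show ?case
          unfolding gibbs_weight_new(1)[OF k(1) n elim] \<rho>_def[symmetric]
          using mult_left_mono[OF that[OF elim], of "gibbs_weight \<alpha> \<theta> n k"] gibbs_weight_pos[OF elim, of n k]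
          by (simp add: mult.commute)
      qed
    qed (use integrable_gibbs_weight in auto)
    also have "\<dots> = b * v n k" by (simp add: mixed_weight_def)
    finally show ?thesis .
  qed
  show "(l + \<alpha>) * real k / real n * v n k \<le> v (Suc n) (Suc k)" by (rule lower) (rule rho(1))
  define e where "e = (u - l) / (1 - \<alpha>) / real n"
  have e: "\<alpha> * real k / real n - e \<le> \<rho> \<theta>" "\<rho> \<theta> \<le> \<alpha> * real k / real n + e" if "\<theta> \<in> {l..u}" for \<theta>
    using rho(2)[OF that] unfolding e_def[symmetric] by (auto simp: abs_le_iff)
  have "(\<alpha> * real k / real n - e) * v n k \<le> v (Suc n) (Suc k)" "v (Suc n) (Suc k) \<le> (\<alpha> * real k / real n + e) * v n k"
    by (rule lower, rule e(1), assumption) (rule upper, rule e(2), assumption)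
  then show "\<bar>v (Suc n) (Suc k) - \<alpha> * real k / real n * v n k\<bar> \<le> (u - l) / (1 - \<alpha>) / real n * v n k"
    unfolding e_def[symmetric] by (simp add: abs_le_iff algebra_simps)
qed

end

section \<open>The block sizes of a Gibbs partition\<close>

text \<open>
Removal of the element \<open>n + 1\<close>; it recovers the past of a consistent sequence of partitions from its present.
\<close>

definition restrict_partition :: "nat \<Rightarrow> nat set set \<Rightarrow> nat set set" where
  "restrict_partition n Q = (\<lambda>V. V - {Suc n}) ` Q - {{}}"

definition join_block :: "nat \<Rightarrow> nat set set \<Rightarrow> nat set \<Rightarrow> nat set set" where
  "join_block n P U = insert (insert (Suc n) U) (P - {U})"

definition successors :: "nat \<Rightarrow> nat set set \<Rightarrow> nat set set set" where
  "successors n P = insert (insert {Suc n} P) (join_block n P ` P)"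

text \<open>
The size that the block of \<open>n + 1\<close> had before this element was added.
\<close>

definition joined_size :: "nat \<Rightarrow> nat set set \<Rightarrow> nat" where
  "joined_size n Q = card (THE V. V \<in> Q \<and> Suc n \<in> V) - 1"

definition large_blocks :: "nat set set \<Rightarrow> nat \<Rightarrow> nat" where
  "large_blocks P s = card {U\<in>P. s < card U}"

context
  fixes n :: nat and P :: "nat set set"
  assumes P: "partition_on {1..n} P"
begin

lemma block_properties:
  assumes "U \<in> P"
  shows "U \<subseteq> {1..n}" "U \<noteq> {}" "finite U" "Suc n \<notin> U" "1 \<le> card U" "card U \<le> n"
proof -
  show 1: "U \<subseteq> {1..n}" "U \<noteq> {}" using P assms by (auto simp: partition_on_def)
  then show 2: "finite U" "Suc n \<notin> U" by (auto intro: finite_subset)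
  show "1 \<le> card U" using 1 2 by (simp add: Suc_le_eq card_gt_0_iff)
  show "card U \<le> n" using card_mono[OF _ 1(1)] by simp
qed

lemma finite_partition: "finite P"
  by (rule finite_elements[OF _ P]) simp

lemma new_block_notin: "{Suc n} \<notin> P" "insert (Suc n) U \<notin> P"
  using block_properties(4) by blast+

lemma sum_block_sizes: "(\<Sum>U\<in>P. card U) = n"
proof -
  have "card (\<Union>P) = (\<Sum>U\<in>P. card U)"
    by (rule card_Union_disjoint) (use P block_properties(3) in \<open>auto simp: partition_on_def disjoint_def pairwise_def disjnt_def\<close>)
  moreover have "\<Union>P = {1..n}" using P by (simp add: partition_on_def)
  ultimately show ?thesis by simp
qed

lemma card_partition_bounds: "n \<ge> 1 \<Longrightarrow> 1 \<le> card P" "card P \<le> n"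
proof -
  assume "n \<ge> 1"
  then have "P \<noteq> {}" using P by (auto simp: partition_on_def)
  then show "1 \<le> card P" using finite_partition by (simp add: Suc_le_eq card_gt_0_iff)
next
  have "card P = (\<Sum>U\<in>P. 1)" by simp
  also have "\<dots> \<le> (\<Sum>U\<in>P. card U)" by (intro sum_mono block_properties(5))
  finally show "card P \<le> n" using sum_block_sizes by simp
qed

lemma restrict_new_block: "restrict_partition n (insert {Suc n} P) = P"
proof -
  have "(\<lambda>V. V - {Suc n}) ` P = (\<lambda>V. V) ` P" using block_properties(4) by (intro image_cong) auto
  moreover have "{} \<notin> P" using block_properties(2) by blast
  ultimately show ?thesis by (auto simp: restrict_partition_def)
qed

lemma restrict_join_block:
  assumes U: "U \<in> P"
  shows "restrict_partition n (join_block n P U) = P"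
proof -
  have "(\<lambda>V. V - {Suc n}) ` (P - {U}) = (\<lambda>V. V) ` (P - {U})" using block_properties(4) by (intro image_cong) auto
  moreover have "insert (Suc n) U - {Suc n} = U" using block_properties(4)[OF U] by auto
  moreover have "{} \<notin> P" using block_properties(2) by blast
  ultimately show ?thesis using U by (auto simp: restrict_partition_def join_block_def)
qed

lemma restrict_successors: "Q \<in> successors n P \<Longrightarrow> restrict_partition n Q = P"
  by (auto simp: successors_def restrict_new_block restrict_join_block)

lemma joined_size_new_block: "joined_size n (insert {Suc n} P) = 0"
proof -
  have "(THE V. V \<in> insert {Suc n} P \<and> Suc n \<in> V) = {Suc n}"
    using block_properties(4) by (intro the_equality) auto
  then show ?thesis by (simp add: joined_size_def)
qed

lemma joined_size_join_block:
  assumes U: "U \<in> P"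
  shows "joined_size n (join_block n P U) = card U"
proof -
  have "(THE V. V \<in> join_block n P U \<and> Suc n \<in> V) = insert (Suc n) U"
    using block_properties(4) by (intro the_equality) (auto simp: join_block_def)
  then show ?thesis using block_properties(3,4)[OF U] by (simp add: joined_size_def)
qed

lemma large_blocks_new_block: "large_blocks (insert {Suc n} P) s = large_blocks P s + of_bool (s = 0)"
proof -
  have "{U \<in> insert {Suc n} P. s < card U} = (if s = 0 then insert {Suc n} {U\<in>P. s < card U} else {U\<in>P. s < card U})"
    by auto
  then show ?thesis using finite_partition new_block_notin(1) by (simp add: large_blocks_def)
qed

lemma large_blocks_join_block:
  assumes U: "U \<in> P"
  shows "large_blocks (join_block n P U) s = large_blocks P s + of_bool (card U = s)"
proof -
  have fin: "finite {V\<in>P - {U}. s < card V}" using finite_partition by simp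
  have c: "card (insert (Suc n) U) = Suc (card U)" using block_properties(3,4)[OF U] by simp
  have 1: "{V\<in>P. s < card V} = (if s < card U then insert U {V\<in>P - {U}. s < card V} else {V\<in>P - {U}. s < card V})"
    using U by auto
  have 2: "{V\<in>join_block n P U. s < card V} = (if s \<le> card U then insert (insert (Suc n) U) {V\<in>P - {U}. s < card V}
      else {V\<in>P - {U}. s < card V})"
    using c by (auto simp: join_block_def)
  have "insert (Suc n) U \<notin> {V\<in>P - {U}. s < card V}" using new_block_notin(2) by blast
  then show ?thesis unfolding large_blocks_def 1 2 using fin by auto
qed

lemma large_blocks_successor:
  "Q \<in> successors n P \<Longrightarrow> large_blocks Q s = large_blocks P s + of_bool (joined_size n Q = s)"
  by (auto simp: successors_def joined_size_new_block large_blocks_new_block joined_size_join_block large_blocks_join_block)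

lemma joined_size_le: "Q \<in> successors n P \<Longrightarrow> joined_size n Q \<le> n"
  by (auto simp: successors_def joined_size_new_block joined_size_join_block block_properties(6))

lemma sum_successors:
  fixes f :: "nat set set \<Rightarrow> real"
  shows "(\<Sum>Q\<in>successors n P. f Q) = f (insert {Suc n} P) + (\<Sum>U\<in>P. f (join_block n P U))"
proof -
  have inj: "inj_on (join_block n P) P"
  proof (rule inj_onI)
    fix U U' assume U: "U \<in> P" "U' \<in> P" "join_block n P U = join_block n P U'"
    have "insert (Suc n) U \<in> join_block n P U" by (simp add: join_block_def)
    then have "insert (Suc n) U \<in> insert (insert (Suc n) U') (P - {U'})" unfolding U(3) by (simp only: join_block_def)
    then have eq: "insert (Suc n) U = insert (Suc n) U'" using new_block_notin(2)[of U] by blast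
    have "U = insert (Suc n) U - {Suc n}" using block_properties(4)[OF U(1)] by simp
    also have "\<dots> = U'" unfolding eq using block_properties(4)[OF U(2)] by simp
    finally show "U = U'" .
  qed
  have "insert {Suc n} P \<noteq> join_block n P U" if U: "U \<in> P" for U
  proof
    assume "insert {Suc n} P = join_block n P U"
    then have "{Suc n} \<in> insert (insert (Suc n) U) (P - {U})" unfolding join_block_def by blast
    then have "{Suc n} = insert (Suc n) U" using new_block_notin(1) by blast
    then show False using block_properties(2,4)[OF U] by blast
  qed
  then have "insert {Suc n} P \<notin> join_block n P ` P" by blast
  then show ?thesis
    unfolding successors_def using finite_partition inj by (simp add: sum.reindex)
qed

lemma finite_successors: "finite (successors n P)"
  using finite_partition by (simp add: successors_def)

lemma card_large_blocks: "large_blocks P 0 = card P"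
proof -
  have "{U\<in>P. 0 < card U} = P" using block_properties(5) by force
  then show ?thesis by (simp add: large_blocks_def)
qed

lemma large_blocks_Suc_le: "large_blocks P (Suc s) \<le> large_blocks P s"
  unfolding large_blocks_def using finite_partition by (intro card_mono) auto

lemma blocks_of_size_eq:
  assumes "s \<ge> 1"
  shows "real (blocks_of_size P s) = real (large_blocks P (s - 1)) - real (large_blocks P s)"
proof -
  have "{U\<in>P. s - 1 < card U} = {U\<in>P. card U = s} \<union> {U\<in>P. s < card U}" using assms by auto
  moreover have "card ({U\<in>P. card U = s} \<union> {U\<in>P. s < card U}) = card {U\<in>P. card U = s} + card {U\<in>P. s < card U}"
    using finite_partition by (intro card_Un_disjoint) auto
  ultimately show ?thesis by (simp add: blocks_of_size_def large_blocks_def)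
qed

lemma sum_over_blocks:
  fixes h :: "nat \<Rightarrow> real"
  shows "(\<Sum>U\<in>P. h (card U)) = (\<Sum>s=1..n. real (blocks_of_size P s) * h s)"
proof -
  have "(\<Sum>U\<in>P. h (card U)) = (\<Sum>s=1..n. \<Sum>U | U \<in> P \<and> card U = s. h (card U))"
    using block_properties(5,6) finite_partition by (intro sum.group[symmetric]) auto
  also have "\<dots> = (\<Sum>s=1..n. real (blocks_of_size P s) * h s)"
    by (intro sum.cong refl) (simp add: blocks_of_size_def)
  finally show ?thesis .
qed

lemma large_blocks_eq_0: "n \<le> s \<Longrightarrow> large_blocks P s = 0"
proof -
  assume "n \<le> s"
  then have "{U\<in>P. s < card U} = {}" using block_properties(6) by fastforce
  then show ?thesis by (simp only: large_blocks_def card.empty)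
qed

text \<open>
Abel summation, with \<open>blocks_of_size P j\<close> as difference of the numbers of blocks larger than \<open>j - 1\<close> and \<open>j\<close>.
\<close>

lemma quasi_score_eq:
  "quasi_score n P x = score_fun n (real (card P) - 1) (\<lambda>s. real (large_blocks P s)) x"
proof -
  let ?N = "\<lambda>s. real (large_blocks P s)"
  \<comment> \<open>The boundary term at \<open>m = n\<close> vanishes, as no block is larger than \<open>n\<close>.\<close>
  have abel: "(\<Sum>j=2..m. (?N (j - 1) - ?N j) * hazard_sum x (j - 1))
      = (\<Sum>s=1..<m. ?N s / (real s - x)) - ?N m * hazard_sum x (m - 1)" if "m \<ge> 1" for m
    using that
  proof (induction m rule: nat_induct_at_least)
    case (Suc m)
    obtain r where r: "m = Suc r" using Suc.hyps by (cases m) auto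
    show ?case using Suc.IH Suc.hyps unfolding r
      by (simp add: hazard_sum_Suc[of x r] algebra_simps)
  qed simp
  have "(\<Sum>j=2..n. real (blocks_of_size P j) * (\<Sum>i=1..j-1. 1 / (real i - x)))
      = (\<Sum>j=2..n. (?N (j - 1) - ?N j) * hazard_sum x (j - 1))"
    by (intro sum.cong refl) (simp add: blocks_of_size_eq hazard_sum_def)
  also have "\<dots> = (\<Sum>s=1..<n. ?N s / (real s - x))"
    using abel[of n] large_blocks_eq_0[of n] by (cases "n \<ge> 1") auto
  finally show ?thesis by (simp add: quasi_score_def score_fun_def)
qed

end

locale gibbs_process = prob_space M + mixing_measure \<alpha> l u \<mu>
  for M :: "'a measure" and \<alpha> l u :: real and \<mu> :: "real measure" +
  fixes Part :: "nat \<Rightarrow> 'a \<Rightarrow> nat set set"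
  assumes gibbs: "gibbs_partition M \<alpha> v Part"
begin

lemma Part_measurable: "Part n \<in> M \<rightarrow>\<^sub>M count_space {P. partition_on {1..n} P}"
  using gibbs by (auto simp: gibbs_partition_def)

lemma Part_partition: "\<omega> \<in> space M \<Longrightarrow> partition_on {1..n} (Part n \<omega>)"
  using measurable_space[OF Part_measurable, of \<omega> n] by simp

lemma Part_1: "\<omega> \<in> space M \<Longrightarrow> Part 1 \<omega> = {{1}}"
  using gibbs by (simp add: gibbs_partition_def)

lemma finite_partitions: "finite {P. partition_on {1..n::nat} P}"
  by (rule finitely_many_partition_on) simp

lemma Part_measurable_UNIV: "Part n \<in> M \<rightarrow>\<^sub>M count_space UNIV"
proof (rule measurableI)
  fix S assume "S \<in> sets (count_space (UNIV :: nat set set set))"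
  have "Part n -` (S \<inter> {P. partition_on {1..n} P}) \<inter> space M \<in> events"
    by (rule measurable_sets[OF Part_measurable]) simp
  moreover have "Part n -` (S \<inter> {P. partition_on {1..n} P}) \<inter> space M = Part n -` S \<inter> space M"
    using Part_partition by auto
  ultimately show "Part n -` S \<inter> space M \<in> events" by simp
qed simp

lemma Part_event: "{\<omega>\<in>space M. Part n \<omega> \<in> S} \<in> events"
  using measurable_sets[OF Part_measurable_UNIV, of S n] by (simp add: vimage_def Int_def conj_commute)

lemma Part_event_eq: "{\<omega>\<in>space M. Part n \<omega> = P} \<in> events"
  using Part_event[of n "{P}"] by simp

definition p_new :: "nat \<Rightarrow> nat \<Rightarrow> real" where
  "p_new n k = v (Suc n) (Suc k) / v n k"

definition p_join :: "nat \<Rightarrow> nat \<Rightarrow> real" where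
  "p_join n k = v (Suc n) k / v n k"

lemma p_recursion:
  assumes "1 \<le> k" "1 \<le> n"
  shows "p_new n k + (real n - \<alpha> * real k) * p_join n k = 1"
proof -
  have "v n k \<noteq> 0" using mixed_weight_pos[of n k] by simp
  then show ?thesis
    using mixed_weight_recursion[OF assms]
    by (simp add: p_new_def p_join_def add_divide_distrib[symmetric])
qed

abbreviation step_event :: "nat \<Rightarrow> nat set set \<Rightarrow> nat set set \<Rightarrow> 'a set" where
  "step_event n P Q \<equiv> {\<omega>\<in>space M. Part n \<omega> = P \<and> Part (Suc n) \<omega> = Q}"

lemma step_event: "step_event n P Q \<in> events"
proof -
  have "step_event n P Q = {\<omega>\<in>space M. Part n \<omega> = P} \<inter> {\<omega>\<in>space M. Part (Suc n) \<omega> = Q}" by auto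
  then show ?thesis using Part_event_eq by auto
qed

lemma prob_step:
  assumes n: "n \<ge> 1"
  shows "prob (step_event n P (insert {Suc n} P)) = p_new n (card P) * prob {\<omega>\<in>space M. Part n \<omega> = P}"
    "U \<in> P \<Longrightarrow> prob (step_event n P (join_block n P U))
        = p_join n (card P) * (real (card U) - \<alpha>) * prob {\<omega>\<in>space M. Part n \<omega> = P}"
proof -
  let ?p = "prob {\<omega>\<in>space M. Part n \<omega> = P}"
  have zero: "prob (step_event n P Q) = 0" if "?p = 0" for Q
  proof -
    have "prob (step_event n P Q) \<le> ?p" by (intro finite_measure_mono Part_event_eq) auto
    then show ?thesis using that by (simp add: measure_le_0_iff)
  qed
  have swap: "{\<omega>\<in>space M. Part (Suc n) \<omega> = Q \<and> Part n \<omega> = P} = step_event n P Q" for n P Q by auto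
  have new: "?p > 0 \<Longrightarrow> prob (step_event n P (insert {Suc n} P)) / ?p = p_new n (card P)"
    and join: "?p > 0 \<Longrightarrow> U \<in> P \<Longrightarrow> prob (step_event n P (join_block n P U)) / ?p = p_join n (card P) * (real (card U) - \<alpha>)"
    using gibbs n unfolding gibbs_partition_def cond_prob_def
    by (auto simp: swap join_block_def p_new_def p_join_def)
  show "prob (step_event n P (insert {Suc n} P)) = p_new n (card P) * ?p"
    using new zero by (cases "?p = 0") (auto simp: zero_less_measure_iff field_simps)
  show "prob (step_event n P (join_block n P U)) = p_join n (card P) * (real (card U) - \<alpha>) * ?p" if "U \<in> P"
    using join[OF _ that] zero by (cases "?p = 0") (auto simp: zero_less_measure_iff field_simps)
qed

lemma sum_p_join:
  assumes "partition_on {1..n} P"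
  shows "(\<Sum>U\<in>P. p_join n (card P) * (real (card U) - \<alpha>)) = p_join n (card P) * (real n - \<alpha> * real (card P))"
proof -
  have "(\<Sum>U\<in>P. real (card U)) = real n" using sum_block_sizes[OF assms] by (metis of_nat_sum)
  then show ?thesis by (simp add: sum_distrib_left[symmetric] sum_subtractf)
qed

text \<open>
The prescribed transition probabilities already add up to 1, which leaves no mass for any other partition.
\<close>

lemma AE_successor:
  assumes n: "n \<ge> 1"
  shows "AE \<omega> in M. Part (Suc n) \<omega> \<in> successors n (Part n \<omega>)"
proof -
  have one: "AE \<omega> in M. Part n \<omega> = P \<longrightarrow> Part (Suc n) \<omega> \<in> successors n P" if P: "partition_on {1..n} P" for P
  proof -
    let ?p = "prob {\<omega>\<in>space M. Part n \<omega> = P}"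
    let ?A = "\<Union>Q\<in>successors n P. step_event n P Q"
    have A: "?A \<in> events" using finite_successors[OF P] step_event by (intro sets.finite_UN) auto
    have "prob ?A = (\<Sum>Q\<in>successors n P. prob (step_event n P Q))"
      using finite_successors[OF P] step_event
      by (intro finite_measure_finite_Union) (auto simp: disjoint_family_on_def)
    also have "\<dots> = p_new n (card P) * ?p + (\<Sum>U\<in>P. p_join n (card P) * (real (card U) - \<alpha>) * ?p)"
      unfolding sum_successors[OF P] by (simp add: prob_step[OF n])
    also have "\<dots> = (p_new n (card P) + (\<Sum>U\<in>P. p_join n (card P) * (real (card U) - \<alpha>))) * ?p"
      by (simp only: distrib_right sum_distrib_right)
    also have "\<dots> = ?p"
      using p_recursion[OF card_partition_bounds(1)[OF P n] n] sum_p_join[OF P] by (simp add: mult.commute)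
    finally have "prob ({\<omega>\<in>space M. Part n \<omega> = P} - ?A) = 0"
      using A by (subst finite_measure_Diff) (auto intro: Part_event_eq)
    then have "{\<omega>\<in>space M. Part n \<omega> = P} - ?A \<in> null_sets M"
      using A Part_event_eq[of n P] by (auto simp: null_sets_def emeasure_eq_measure)
    then have "AE \<omega> in M. \<omega> \<notin> {\<omega>\<in>space M. Part n \<omega> = P} - ?A" by (rule AE_not_in)
    then show ?thesis using AE_space by eventually_elim auto
  qed
  have "AE \<omega> in M. \<forall>P\<in>{P. partition_on {1..n} P}. Part n \<omega> = P \<longrightarrow> Part (Suc n) \<omega> \<in> successors n P"
    by (rule AE_finite_allI[OF finite_partitions]) (use one in auto)
  then show ?thesis using AE_space by eventually_elim (use Part_partition in auto)
qed

text \<open>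
The definition of a Gibbs partition guarantees only almost surely that each partition extends the preceding one.
\<close>

definition consistent :: "'a set" where
  "consistent = {\<omega>\<in>space M. \<forall>n\<ge>1. Part (Suc n) \<omega> \<in> successors n (Part n \<omega>)}"

text \<open>
Off the consistent event the sequence is replaced by that of the partitions into singletons, so that every path is
consistent and the combinatorial facts hold at every point of the space.
\<close>

definition path :: "nat \<Rightarrow> 'a \<Rightarrow> nat set set" where
  "path n \<omega> = (if \<omega> \<in> consistent then Part n \<omega> else (\<lambda>i. {i}) ` {1..n})"

lemma AE_consistent: "AE \<omega> in M. \<omega> \<in> consistent"
proof -
  have "AE \<omega> in M. \<forall>n. n \<ge> 1 \<longrightarrow> Part (Suc n) \<omega> \<in> successors n (Part n \<omega>)"
    unfolding AE_all_countable using AE_successor by auto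
  then show ?thesis using AE_space by eventually_elim (auto simp: consistent_def)
qed

lemma AE_path_eq: "AE \<omega> in M. \<forall>n. path n \<omega> = Part n \<omega>"
  using AE_consistent by eventually_elim (simp add: path_def)

lemma consistent_event: "consistent \<in> events"
proof -
  have "{\<omega>\<in>space M. Part (Suc n) \<omega> \<in> successors n (Part n \<omega>)}
      = (\<Union>P\<in>{P. partition_on {1..n} P}. {\<omega>\<in>space M. Part n \<omega> \<in> {P}} \<inter> {\<omega>\<in>space M. Part (Suc n) \<omega> \<in> successors n P})" for n
    using Part_partition by auto
  then have *: "{\<omega>\<in>space M. Part (Suc n) \<omega> \<in> successors n (Part n \<omega>)} \<in> events" for n
    by (simp only:) (intro sets.finite_UN finite_partitions sets.Int Part_event)
  have "consistent = (\<Inter>n\<in>{1..}. {\<omega>\<in>space M. Part (Suc n) \<omega> \<in> successors n (Part n \<omega>)})"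
    by (auto simp: consistent_def)
  also have "\<dots> \<in> events" using * by (intro sets.countable_INT') auto
  finally show ?thesis .
qed

lemma path_partition: "\<omega> \<in> space M \<Longrightarrow> partition_on {1..n} (path n \<omega>)"
  using Part_partition partition_on_singletons[of "{1..n}"] by (simp add: path_def)

lemma path_1: "\<omega> \<in> space M \<Longrightarrow> path 1 \<omega> = {{1}}"
  using Part_1 by (simp add: path_def)

lemma path_successor: "n \<ge> 1 \<Longrightarrow> \<omega> \<in> space M \<Longrightarrow> path (Suc n) \<omega> \<in> successors n (path n \<omega>)"
proof (cases "\<omega> \<in> consistent")
  case False
  have "(\<lambda>i. {i}) ` {1..Suc n} = insert {Suc n} ((\<lambda>i. {i}) ` {1..n})"
    by (simp add: atLeastAtMostSuc_conv)
  then show ?thesis using False by (simp add: path_def successors_def)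
qed (simp add: path_def consistent_def)

lemma path_measurable: "path n \<in> M \<rightarrow>\<^sub>M count_space UNIV"
  unfolding path_def[abs_def] using consistent_event Part_measurable_UNIV
  by (intro measurable_If_set) auto

lemma path_event_eq: "{\<omega>\<in>space M. path n \<omega> = P} \<in> events"
  using measurable_sets[OF path_measurable, of "{P}" n] by (simp add: vimage_def Int_def conj_commute)

definition jump :: "nat \<Rightarrow> 'a \<Rightarrow> nat" where
  "jump n \<omega> = joined_size n (path (Suc n) \<omega>)"

lemma jump_0: "\<omega> \<in> space M \<Longrightarrow> jump 0 \<omega> = 0"
proof -
  assume "\<omega> \<in> space M"
  then have "jump 0 \<omega> = joined_size 0 (insert {Suc 0} {})" using path_1[of \<omega>] by (simp add: jump_def)
  also have "\<dots> = 0" by (rule joined_size_new_block) (simp add: partition_on_def)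
  finally show ?thesis .
qed

lemma tally_jump:
  assumes \<omega>: "\<omega> \<in> space M" and n: "n \<ge> 1"
  shows "tally jump s n \<omega> = large_blocks (path n \<omega>) s"
  using n
proof (induction n rule: nat_induct_at_least)
  case base
  have "{U. U = {1::nat} \<and> s < card U} = (if s = 0 then {{1}} else {})" by auto
  then show ?case using jump_0[OF \<omega>] path_1[OF \<omega>] by (auto simp: tally_Suc large_blocks_def)
next
  case (Suc n)
  show ?case
    using Suc.IH large_blocks_successor[OF path_partition[OF \<omega>] path_successor[OF Suc.hyps \<omega>]]
    by (simp add: tally_Suc jump_def)
qed

lemma tally_jump_0: "\<omega> \<in> space M \<Longrightarrow> n \<ge> 1 \<Longrightarrow> tally jump 0 n \<omega> = card (path n \<omega>)"
  by (simp add: tally_jump card_large_blocks[OF path_partition])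

definition new_prob :: "nat \<Rightarrow> 'a \<Rightarrow> real" where
  "new_prob n \<omega> = p_new n (card (path n \<omega>))"

lemma prob_path_step:
  assumes n: "n \<ge> 1"
  shows "prob {\<omega>\<in>space M. path n \<omega> = P \<and> path (Suc n) \<omega> = Q} = prob (step_event n P Q)"
    "prob {\<omega>\<in>space M. path n \<omega> = P} = prob {\<omega>\<in>space M. Part n \<omega> = P}"
proof -
  have ev: "{\<omega>\<in>space M. path n \<omega> = P \<and> path (Suc n) \<omega> = Q} \<in> events"
  proof -
    have "{\<omega>\<in>space M. path n \<omega> = P \<and> path (Suc n) \<omega> = Q} = {\<omega>\<in>space M. path n \<omega> = P} \<inter> {\<omega>\<in>space M. path (Suc n) \<omega> = Q}"
      by auto
    then show ?thesis using path_event_eq by auto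
  qed
  show "prob {\<omega>\<in>space M. path n \<omega> = P \<and> path (Suc n) \<omega> = Q} = prob (step_event n P Q)"
    using AE_path_eq ev step_event by (intro measure_eq_AE) auto
  show "prob {\<omega>\<in>space M. path n \<omega> = P} = prob {\<omega>\<in>space M. Part n \<omega> = P}"
    using AE_path_eq path_event_eq Part_event_eq by (intro measure_eq_AE) auto
qed

text \<open>
The transition law, summed over the finitely many partitions and their successors; blocks of equal size are collected,
which produces \<open>jump_weight\<close>.
\<close>

lemma one_step_path:
  fixes \<gamma> :: "nat \<Rightarrow> nat set set \<Rightarrow> real"
  assumes n: "n \<ge> 1"
  shows "(\<integral>\<omega>. \<gamma> (jump n \<omega>) (path n \<omega>) \<partial>M)
    = (\<integral>\<omega>. (\<Sum>s\<le>n. jump_weight \<alpha> jump new_prob n s \<omega> * \<gamma> s (path n \<omega>)) \<partial>M)"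
proof -
  let ?S = "{P. partition_on {1..n} P}"
  let ?E = "\<lambda>P Q. {\<omega>\<in>space M. path n \<omega> = P \<and> path (Suc n) \<omega> = Q}"
  let ?B = "\<lambda>P. {\<omega>\<in>space M. path n \<omega> = P}"
  have evE: "?E P Q \<in> events" for P Q
  proof -
    have "?E P Q = ?B P \<inter> {\<omega>\<in>space M. path (Suc n) \<omega> = Q}" by auto
    then show ?thesis using path_event_eq by auto
  qed
  \<comment> \<open>The conditional mean of the integrand, given that the partition is \<open>P\<close>.\<close>
  define \<rho> where "\<rho> P = p_new n (card P) * \<gamma> 0 P + (\<Sum>U\<in>P. p_join n (card P) * (real (card U) - \<alpha>) * \<gamma> (card U) P)" for P
  have "(\<integral>\<omega>. \<gamma> (jump n \<omega>) (path n \<omega>) \<partial>M)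
      = (\<integral>\<omega>. (\<Sum>P\<in>?S. \<Sum>Q\<in>successors n P. \<gamma> (joined_size n Q) P * indicator (?E P Q) \<omega>) \<partial>M)"
  proof (rule Bochner_Integration.integral_cong)
    fix \<omega> assume \<omega>: "\<omega> \<in> space M"
    have "(\<Sum>P\<in>?S. \<Sum>Q\<in>successors n P. \<gamma> (joined_size n Q) P * indicator (?E P Q) \<omega>)
        = (\<Sum>P\<in>?S. if P = path n \<omega> then (\<Sum>Q\<in>successors n P. \<gamma> (joined_size n Q) P * indicator (?E P Q) \<omega>) else 0)"
      by (intro sum.cong refl) auto
    also have "\<dots> = (\<Sum>Q\<in>successors n (path n \<omega>). \<gamma> (joined_size n Q) (path n \<omega>) * indicator (?E (path n \<omega>) Q) \<omega>)"
      using finite_partitions path_partition[OF \<omega>] by simp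
    also have "\<dots> = (\<Sum>Q\<in>successors n (path n \<omega>). if Q = path (Suc n) \<omega> then \<gamma> (joined_size n Q) (path n \<omega>) else 0)"
      using \<omega> by (intro sum.cong refl) auto
    also have "\<dots> = \<gamma> (jump n \<omega>) (path n \<omega>)"
      using finite_successors[OF path_partition[OF \<omega>]] path_successor[OF n \<omega>] by (simp add: jump_def)
    finally show "\<gamma> (jump n \<omega>) (path n \<omega>) = (\<Sum>P\<in>?S. \<Sum>Q\<in>successors n P. \<gamma> (joined_size n Q) P * indicator (?E P Q) \<omega>)" ..
  qed simp
  also have "\<dots> = (\<Sum>P\<in>?S. \<Sum>Q\<in>successors n P. \<gamma> (joined_size n Q) P * prob (?E P Q))"
  proof -
    have i: "integrable M (\<lambda>\<omega>. a * indicator (?E P Q) \<omega> :: real)" for a P Q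
      using evE[of P Q] by (intro integrable_mult_right integrable_real_indicator) (auto simp: less_top[symmetric])
    show ?thesis
      using i evE by (simp add: Bochner_Integration.integral_sum Bochner_Integration.integrable_sum)
  qed
  also have "\<dots> = (\<Sum>P\<in>?S. \<rho> P * prob (?B P))"
  proof (rule sum.cong[OF refl])
    fix P assume "P \<in> ?S"
    then have P: "partition_on {1..n} P" by simp
    have "(\<Sum>Q\<in>successors n P. \<gamma> (joined_size n Q) P * prob (?E P Q))
        = \<gamma> 0 P * (p_new n (card P) * prob (?B P))
          + (\<Sum>U\<in>P. \<gamma> (card U) P * (p_join n (card P) * (real (card U) - \<alpha>) * prob (?B P)))"
      unfolding sum_successors[OF P] prob_path_step(1)[OF n] prob_path_step(2)[OF n]
      by (simp add: joined_size_new_block[OF P] joined_size_join_block[OF P] prob_step[OF n])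
    also have "\<dots> = \<rho> P * prob (?B P)"
      unfolding \<rho>_def by (simp add: distrib_left sum_distrib_left mult_ac)
    finally show "(\<Sum>Q\<in>successors n P. \<gamma> (joined_size n Q) P * prob (?E P Q)) = \<rho> P * prob (?B P)" .
  qed
  also have "\<dots> = (\<integral>\<omega>. (\<Sum>P\<in>?S. \<rho> P * indicator (?B P) \<omega>) \<partial>M)"
  proof -
    have i: "integrable M (\<lambda>\<omega>. a * indicator (?B P) \<omega> :: real)" for a P
      using path_event_eq[of n P] by (intro integrable_mult_right integrable_real_indicator) (auto simp: less_top[symmetric])
    show ?thesis
      using i path_event_eq by (simp add: Bochner_Integration.integral_sum)
  qed
  also have "\<dots> = (\<integral>\<omega>. (\<Sum>s\<le>n. jump_weight \<alpha> jump new_prob n s \<omega> * \<gamma> s (path n \<omega>)) \<partial>M)"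
  proof (rule Bochner_Integration.integral_cong)
    fix \<omega> assume \<omega>: "\<omega> \<in> space M"
    define P where "P = path n \<omega>"
    have P: "partition_on {1..n} P" unfolding P_def by (rule path_partition[OF \<omega>])
    have k: "1 \<le> card P" "card P \<le> n" using card_partition_bounds[OF P] n by auto
    have kn: "0 < real n - \<alpha> * real (card P)"
    proof -
      have "\<alpha> * real (card P) \<le> \<alpha> * real n" using k alpha by (intro mult_left_mono) auto
      also have "\<dots> < 1 * real n" using n alpha by (intro mult_strict_right_mono) auto
      finally show ?thesis by simp
    qed
    have q: "(1 - p_new n (card P)) / (real n - \<alpha> * real (card P)) = p_join n (card P)"
      using p_recursion[OF k(1) n] kn by (simp add: divide_eq_eq algebra_simps)
    have "(\<Sum>P\<in>?S. \<rho> P * indicator (?B P) \<omega>) = (\<Sum>Q\<in>?S. if Q = P then \<rho> Q else 0)"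
      using \<omega> by (intro sum.cong refl) (auto simp: P_def)
    also have "\<dots> = \<rho> P" using finite_partitions P by simp
    also have "\<dots> = p_new n (card P) * \<gamma> 0 P + (\<Sum>s=1..n. real (blocks_of_size P s) * (p_join n (card P) * (real s - \<alpha>) * \<gamma> s P))"
      unfolding \<rho>_def sum_over_blocks[OF P, of "\<lambda>s. p_join n (card P) * (real s - \<alpha>) * \<gamma> s P"] ..
    also have "(\<Sum>s=1..n. real (blocks_of_size P s) * (p_join n (card P) * (real s - \<alpha>) * \<gamma> s P))
        = (\<Sum>s=1..n. jump_weight \<alpha> jump new_prob n s \<omega> * \<gamma> s (path n \<omega>))"
    proof (rule sum.cong[OF refl])
      fix s assume s: "s \<in> {1..n}"
      then have s1: "s \<ge> 1" by simp
      have "jump_weight \<alpha> jump new_prob n s \<omega> = p_join n (card P) * (real s - \<alpha>) * real (blocks_of_size P s)"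
        unfolding blocks_of_size_eq[OF P s1] q[symmetric] using s1
        by (simp add: jump_weight_def new_prob_def tally_jump[OF \<omega> n] P_def[symmetric] card_large_blocks[OF P])
      then show "real (blocks_of_size P s) * (p_join n (card P) * (real s - \<alpha>) * \<gamma> s P)
          = jump_weight \<alpha> jump new_prob n s \<omega> * \<gamma> s (path n \<omega>)" by (simp add: P_def[symmetric] mult_ac)
    qed
    also have "p_new n (card P) * \<gamma> 0 P = jump_weight \<alpha> jump new_prob n 0 \<omega> * \<gamma> 0 (path n \<omega>)"
      by (simp add: jump_weight_def new_prob_def P_def)
    also have "jump_weight \<alpha> jump new_prob n 0 \<omega> * \<gamma> 0 (path n \<omega>) + (\<Sum>s=1..n. jump_weight \<alpha> jump new_prob n s \<omega> * \<gamma> s (path n \<omega>))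
        = (\<Sum>s\<le>n. jump_weight \<alpha> jump new_prob n s \<omega> * \<gamma> s (path n \<omega>))"
      by (simp add: atMost_atLeast0 sum.atLeast_Suc_atMost)
    finally show "(\<Sum>P\<in>?S. \<rho> P * indicator (?B P) \<omega>) = (\<Sum>s\<le>n. jump_weight \<alpha> jump new_prob n s \<omega> * \<gamma> s (path n \<omega>))" .
  qed simp
  finally show ?thesis .
qed

end

sublocale gibbs_process \<subseteq> chain: size_chain M path jump new_prob \<alpha> "(u - l) / (1 - \<alpha>)" "l + \<alpha>"
proof
  show "0 < \<alpha>" "\<alpha> < 1" "0 < l + \<alpha>" using alpha bounds by auto
  show "path n \<in> M \<rightarrow>\<^sub>M count_space UNIV" for n by (rule path_measurable)
  show "finite (path n ` space M)" for n
    by (rule finite_subset[OF _ finite_partitions[of n]]) (use path_partition in auto)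
  show "determined_by M (path (Suc n)) (path n)" if "n \<ge> 1" for n
    unfolding determined_by_def
  proof (intro ballI impI)
    fix \<omega> \<omega>' assume *: "\<omega> \<in> space M" "\<omega>' \<in> space M" "path (Suc n) \<omega> = path (Suc n) \<omega>'"
    have "path n \<omega> = restrict_partition n (path (Suc n) \<omega>)" if "\<omega> \<in> space M" for \<omega>
      by (rule restrict_successors[OF path_partition[OF that] path_successor[OF \<open>n \<ge> 1\<close> that], symmetric])
    from this[OF *(1)] this[OF *(2)] *(3) show "path n \<omega> = path n \<omega>'" by simp
  qed
  show "determined_by M (path (Suc n)) (jump n)" for n
    by (simp add: determined_by_def jump_def)
  show "determined_by M (path n) (new_prob n)" for n
    by (simp add: determined_by_def new_prob_def)
  show "jump 0 \<omega> = 0" if "\<omega> \<in> space M" for \<omega> by (rule jump_0[OF that])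
  show "jump n \<omega> \<le> n" if "\<omega> \<in> space M" for n \<omega>
  proof (cases "n = 0")
    case False
    then show ?thesis unfolding jump_def
      using joined_size_le[OF path_partition[OF that] path_successor[OF _ that]] by simp
  qed (simp add: jump_0[OF that])
  show "tally jump (Suc s) n \<omega> \<le> tally jump s n \<omega>" if "n \<ge> 1" "\<omega> \<in> space M" for n s \<omega>
    by (simp only: tally_jump[OF that(2,1)] large_blocks_Suc_le[OF path_partition[OF that(2)]])
  fix n :: nat and \<omega> assume n: "n \<ge> 1" and \<omega>: "\<omega> \<in> space M"
  define k where "k = card (path n \<omega>)"
  have k: "1 \<le> k" "k \<le> n" using card_partition_bounds[OF path_partition[OF \<omega>]] n by (auto simp: k_def)
  have tk: "tally jump 0 n \<omega> = k" unfolding k_def by (rule tally_jump_0[OF \<omega> n])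
  have np: "new_prob n \<omega> = v (Suc n) (Suc k) / v n k" by (simp add: new_prob_def p_new_def k_def)
  have vp: "0 < v n k" by (rule mixed_weight_pos)
  show "(l + \<alpha>) * tally jump 0 n \<omega> / real n \<le> new_prob n \<omega>"
    unfolding tk np using mixed_weight_new_bounds(1)[OF k] vp by (simp add: pos_le_divide_eq)
  show "new_prob n \<omega> \<le> 1"
  proof -
    have "\<alpha> * real k \<le> 1 * real n" using k alpha by (intro mult_mono) auto
    then have "0 \<le> (real n - \<alpha> * real k) * v (Suc n) k" using mixed_weight_pos[of "Suc n" k] by simp
    then show ?thesis unfolding np using mixed_weight_recursion[OF k(1) n] vp by simp
  qed
  show "\<bar>new_prob n \<omega> - \<alpha> * tally jump 0 n \<omega> / real n\<bar> \<le> (u - l) / (1 - \<alpha>) / real n"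
  proof -
    have "new_prob n \<omega> - \<alpha> * real k / real n = (v (Suc n) (Suc k) - \<alpha> * real k / real n * v n k) / v n k"
      unfolding np using vp by (simp add: diff_divide_distrib)
    then have "\<bar>new_prob n \<omega> - \<alpha> * real k / real n\<bar> = \<bar>v (Suc n) (Suc k) - \<alpha> * real k / real n * v n k\<bar> / v n k"
      using vp by (simp add: abs_divide)
    also have "\<dots> \<le> (u - l) / (1 - \<alpha>) / real n"
      using mixed_weight_new_bounds(2)[OF k] vp by (simp only: pos_divide_le_eq)
    finally show ?thesis unfolding tk .
  qed
next
  fix n :: nat and G :: "nat \<Rightarrow> 'a \<Rightarrow> real"
  assume n: "n \<ge> 1" and G: "\<And>s. determined_by M (path n) (G s)"
  define \<gamma> where "\<gamma> s P = G s (SOME \<omega>. \<omega> \<in> space M \<and> path n \<omega> = P)" for s P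
  have \<gamma>: "G s \<omega> = \<gamma> s (path n \<omega>)" if \<omega>: "\<omega> \<in> space M" for s \<omega>
  proof -
    define \<omega>' where "\<omega>' = (SOME \<omega>'. \<omega>' \<in> space M \<and> path n \<omega>' = path n \<omega>)"
    have "\<omega>' \<in> space M \<and> path n \<omega>' = path n \<omega>" unfolding \<omega>'_def by (rule someI[of _ \<omega>]) (use \<omega> in simp)
    then have "G s \<omega> = G s \<omega>'" using G[of s] \<omega> unfolding determined_by_def by metis
    then show ?thesis by (simp add: \<gamma>_def \<omega>'_def)
  qed
  have "(\<integral>\<omega>. G (jump n \<omega>) \<omega> \<partial>M) = (\<integral>\<omega>. \<gamma> (jump n \<omega>) (path n \<omega>) \<partial>M)"
    by (intro Bochner_Integration.integral_cong refl \<gamma>)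
  also have "\<dots> = (\<integral>\<omega>. (\<Sum>s\<le>n. jump_weight \<alpha> jump new_prob n s \<omega> * \<gamma> s (path n \<omega>)) \<partial>M)"
    by (rule one_step_path[OF n])
  also have "\<dots> = (\<integral>\<omega>. (\<Sum>s\<le>n. jump_weight \<alpha> jump new_prob n s \<omega> * G s \<omega>) \<partial>M)"
    by (intro Bochner_Integration.integral_cong refl sum.cong) (simp add: \<gamma>)
  finally show "(\<integral>\<omega>. G (jump n \<omega>) \<omega> \<partial>M) = (\<integral>\<omega>. (\<Sum>s\<le>n. jump_weight \<alpha> jump new_prob n s \<omega> * G s \<omega>) \<partial>M)" .
qed

section \<open>Stable convergence and coverage for Gibbs partitions\<close>

lemma std_normal_singleton: "measure std_normal_distribution {x} = 0"
proof -
  have "{x} \<in> null_sets lborel" by (simp add: null_sets_def)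
  then have "{x} \<in> null_sets std_normal_distribution"
    using absolutely_continuousI_density[of std_normal_density lborel] unfolding absolutely_continuous_def by auto
  then show ?thesis by (simp add: measure_def null_sets_def)
qed

lemma std_normal_symmetric: "measure std_normal_distribution {..<- x} = measure std_normal_distribution {x<..}"
proof -
  have "emeasure std_normal_distribution {..<- x} = (\<integral>\<^sup>+y. ennreal (std_normal_density y) * indicator {..<- x} y \<partial>lborel)"
    by (rule emeasure_density) auto
  also have "\<dots> = (\<integral>\<^sup>+y. ennreal (std_normal_density (- y)) * indicator {..<- x} (- y) \<partial>lborel)"
    by (subst nn_integral_real_affine[where c="- 1" and t=0]) auto
  also have "\<dots> = (\<integral>\<^sup>+y. ennreal (std_normal_density y) * indicator {x<..} y \<partial>lborel)"
    by (intro nn_integral_cong) (auto simp: normal_density_def split: split_indicator)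
  also have "\<dots> = emeasure std_normal_distribution {x<..}"
    by (rule emeasure_density[symmetric]) auto
  finally show ?thesis by (simp add: measure_def)
qed

text \<open>
The distribution function is continuous, so that it attains the level \<open>p\<close> at its generalized inverse.
\<close>

lemma cdf_quantile_std_normal:
  assumes "0 < p" "p < 1"
  shows "cdf std_normal_distribution (quantile std_normal_distribution p) = p"
proof -
  interpret D: real_distribution std_normal_distribution by (rule real_dist_normal_dist)
  let ?F = "cdf std_normal_distribution"
  have cont: "isCont ?F x" for x using D.isCont_cdf std_normal_singleton by simp
  have contS: "continuous_on UNIV ?F" using cont by (simp add: continuous_at_imp_continuous_on)
  have "\<forall>\<^sub>F x in at_bot. ?F x < p" using D.cdf_lim_at_bot assms(1) by (rule order_tendstoD(2))
  then obtain a where a: "?F a < p" by (auto simp: eventually_at_bot_linorder)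
  have "\<forall>\<^sub>F x in at_top. p < ?F x" using D.cdf_lim_at_top_prob assms(2) by (rule order_tendstoD(1))
  then obtain b where b: "p < ?F b" by (auto simp: eventually_at_top_linorder)
  have ab: "a \<le> b" using D.cdf_nondecreasing[of b a] a b by force
  obtain x0 where x0: "?F x0 = p"
    using IVT'[of ?F a p b] a b ab continuous_on_subset[OF contS subset_UNIV] by force
  define S where "S = {x. p \<le> ?F x}"
  have bdd: "bdd_below S"
  proof (rule bdd_belowI)
    fix x assume "x \<in> S"
    then show "a \<le> x" using D.cdf_nondecreasing[of x a] a by (force simp: S_def)
  qed
  have "closed S"
    unfolding S_def using contS by (intro closed_Collect_le continuous_intros) auto
  moreover have "x0 \<in> S" using x0 by (simp add: S_def)
  ultimately have "Inf S \<in> S" using bdd by (intro closed_contains_Inf) auto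
  then have "p \<le> ?F (Inf S)" by (simp add: S_def)
  moreover have "?F (Inf S) \<le> p"
    using D.cdf_nondecreasing[OF cInf_lower[OF \<open>x0 \<in> S\<close> bdd]] x0 by simp
  ultimately show ?thesis by (simp add: quantile_def S_def)
qed

lemma std_normal_central_interval:
  assumes "0 < e" "e < 1"
  defines "z \<equiv> quantile std_normal_distribution (1 - e / 2)"
  shows "0 < z" "measure std_normal_distribution {- z..z} = 1 - e"
proof -
  interpret D: real_distribution std_normal_distribution by (rule real_dist_normal_dist)
  have split: "cdf std_normal_distribution x + measure std_normal_distribution {x<..} = 1" for x
  proof -
    have "measure std_normal_distribution ({..x} \<union> {x<..}) = measure std_normal_distribution {..x} + measure std_normal_distribution {x<..}"
      by (intro D.finite_measure_Union) auto
    moreover have "{..x} \<union> {x<..} = space std_normal_distribution" by auto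
    ultimately show ?thesis using D.prob_space by (simp add: cdf_def)
  qed
  have cz: "cdf std_normal_distribution z = 1 - e / 2"
    unfolding z_def using assms by (intro cdf_quantile_std_normal) auto
  have "cdf std_normal_distribution 0 = measure std_normal_distribution ({..<0} \<union> {0})"
    unfolding cdf_def by (rule arg_cong[where f="measure _"]) auto
  also have "\<dots> = measure std_normal_distribution {..<0} + measure std_normal_distribution {0}"
    by (intro D.finite_measure_Union) auto
  finally have "cdf std_normal_distribution 0 = 1 / 2"
    using std_normal_symmetric[of 0] split[of 0] std_normal_singleton[of 0] by simp
  then show z: "0 < z" using D.cdf_nondecreasing[of z 0] cz assms by force
  have "measure std_normal_distribution ({..<- z} \<union> {- z..z}) = measure std_normal_distribution {..<- z} + measure std_normal_distribution {- z..z}"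
    by (intro D.finite_measure_Union) auto
  moreover have "{..<- z} \<union> {- z..z} = {..z}" using z by auto
  ultimately show "measure std_normal_distribution {- z..z} = 1 - e"
    using cz split[of z] std_normal_symmetric[of z] by (simp add: cdf_def)
qed

context gibbs_process
begin

lemma qmle_path:
  assumes "\<omega> \<in> space M" "n \<ge> 1"
  shows "qmle n (path n \<omega>) = chain.estimator n \<omega>"
proof -
  have k: "real (tally jump 0 n \<omega>) = real (card (path n \<omega>))" using tally_jump_0[OF assms] by simp
  have "(\<lambda>s. real (tally jump s n \<omega>)) = (\<lambda>s. real (large_blocks (path n \<omega>) s))"
    using tally_jump[OF assms] by simp
  then show ?thesis
    unfolding qmle_def chain.estimator_def k quasi_score_eq[OF path_partition[OF assms(1)]] by simp
qed

definition standardized_qmle :: "nat \<Rightarrow> 'a \<Rightarrow> real" where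
  "standardized_qmle n \<omega> = sqrt (real (card (Part n \<omega>)) * fisher_info \<alpha>) * (qmle n (Part n \<omega>) - \<alpha>)"

lemma AE_standardized_qmle:
  assumes "n \<ge> 1"
  shows "AE \<omega> in M. standardized_qmle n \<omega> = chain.normed_error n \<omega>"
  using AE_path_eq AE_space
proof eventually_elim
  case (elim \<omega>)
  then show ?case
    using qmle_path[OF elim(2) assms] tally_jump_0[OF elim(2) assms]
    by (simp add: standardized_qmle_def chain.normed_error_def)
qed

lemma fun_Part_measurable: "(\<lambda>\<omega>. f (Part n \<omega>) :: 'b::topological_space) \<in> borel_measurable M"
  by (rule measurable_compose[OF Part_measurable_UNIV]) simp

lemma space_sigma_infinity: "space (sigma_infinity M Part) = space M"
  by (simp add: sigma_infinity_def space_measure_of_conv)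

lemma sets_sigma_infinity:
  "sets (sigma_infinity M Part)
    = sigma_sets (space M) (\<Union>n\<in>{1..}. sets (vimage_algebra (space M) (Part n) (count_space UNIV)))"
proof -
  have "(\<Union>n\<in>{1..}. sets (vimage_algebra (space M) (Part n) (count_space UNIV))) \<subseteq> Pow (space M)"
    using sets.sets_into_space[of _ "vimage_algebra (space M) (Part _) (count_space UNIV)"] by fastforce
  then show ?thesis unfolding sigma_infinity_def by (rule sets_measure_of)
qed

text \<open>
Events of \<open>F_\<infinity>\<close> that are known, up to a null set, at some finite time. Null sets have to be allowed for because the
\<open>\<sigma>\<close>-field is generated by \<open>Part\<close> and not by its consistent modification \<open>path\<close>.
\<close>

definition path_events :: "'a set set" where
  "path_events = {A \<in> sets (sigma_infinity M Part).
     \<exists>m\<ge>1. \<exists>R. determined_by M (path m) R \<and> (AE \<omega> in M. (\<omega> \<in> A) = R \<omega>)}"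

lemma generators_path_events:
  "(\<Union>n\<in>{1..}. sets (vimage_algebra (space M) (Part n) (count_space UNIV))) \<subseteq> path_events"
proof
  fix A assume A: "A \<in> (\<Union>n\<in>{1..}. sets (vimage_algebra (space M) (Part n) (count_space UNIV)))"
  then obtain n where n: "n \<ge> 1" "A \<in> sets (vimage_algebra (space M) (Part n) (count_space UNIV))" by auto
  then obtain S where S: "A = Part n -` S \<inter> space M" by (auto simp: sets_vimage_algebra2)
  have "AE \<omega> in M. (\<omega> \<in> A) = (path n \<omega> \<in> S)"
    using AE_path_eq AE_space by eventually_elim (auto simp: S)
  moreover have "determined_by M (path n) (\<lambda>\<omega>. path n \<omega> \<in> S)" by (simp add: determined_by_def)
  moreover have "A \<in> sets (sigma_infinity M Part)"
    unfolding sets_sigma_infinity using A by (rule sigma_sets.Basic)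
  ultimately show "A \<in> path_events" unfolding path_events_def using n(1) by blast
qed

text \<open>
Two events of this kind are both known at the later of the two times, because the state at that time determines the
earlier one. The single \<open>\<sigma>\<close>-fields of \<open>Part n\<close> increase only up to null sets, so their union need not be closed under
intersection.
\<close>

lemma Int_stable_path_events: "Int_stable path_events"
proof (rule Int_stableI)
  fix A B assume "A \<in> path_events" "B \<in> path_events"
  then obtain m R m' R' where A: "A \<in> sets (sigma_infinity M Part)" "m \<ge> 1" "determined_by M (path m) R"
      "AE \<omega> in M. (\<omega> \<in> A) = R \<omega>"
    and B: "B \<in> sets (sigma_infinity M Part)" "m' \<ge> 1" "determined_by M (path m') R'" "AE \<omega> in M. (\<omega> \<in> B) = R' \<omega>"
    unfolding path_events_def by blast
  have "determined_by M (path (max m m')) R" "determined_by M (path (max m m')) R'"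
    using chain.det_mono[OF A(3,2), of "max m m'"] chain.det_mono[OF B(3,2), of "max m m'"] by auto
  then have "determined_by M (path (max m m')) (\<lambda>\<omega>. R \<omega> \<and> R' \<omega>)" by (rule chain.det_comp2)
  moreover have "AE \<omega> in M. (\<omega> \<in> A \<inter> B) = (R \<omega> \<and> R' \<omega>)" using A(4) B(4) by eventually_elim auto
  moreover have "1 \<le> max m m'" using A(2) by simp
  ultimately show "A \<inter> B \<in> path_events" unfolding path_events_def using A(1) B(1) by blast
qed

lemma path_events_events: "path_events \<subseteq> events"
proof -
  have "Part n -` S \<inter> space M \<in> events" for n S using measurable_sets[OF Part_measurable_UNIV, of S n] by simp
  then have "sigma_sets (space M) (\<Union>n\<in>{1..}. sets (vimage_algebra (space M) (Part n) (count_space UNIV))) \<subseteq> events"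
    by (intro sets.sigma_sets_subset) (auto simp: sets_vimage_algebra2)
  then show ?thesis unfolding path_events_def sets_sigma_infinity by auto
qed

lemma sigma_sets_path_events: "sets (sigma_infinity M Part) = sigma_sets (space M) path_events"
proof (rule antisym)
  show "sets (sigma_infinity M Part) \<subseteq> sigma_sets (space M) path_events"
    unfolding sets_sigma_infinity using generators_path_events by (rule sigma_sets_mono')
  have "path_events \<subseteq> sets (sigma_infinity M Part)" by (auto simp: path_events_def)
  from sets.sigma_sets_subset[OF this]
  show "sigma_sets (space M) path_events \<subseteq> sets (sigma_infinity M Part)" by (simp add: space_sigma_infinity)
qed

lemma char_standardized_qmle:
  assumes "A \<in> path_events"
  shows "(\<lambda>n. \<integral>\<omega>. indicator A \<omega> * iexp (t * standardized_qmle n \<omega>) \<partial>M) \<longlonglongrightarrow> prob A * exp (- t\<^sup>2 / 2)"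
proof -
  obtain m R where m: "m \<ge> 1" and R: "determined_by M (path m) R" "AE \<omega> in M. (\<omega> \<in> A) = R \<omega>"
    using assms by (auto simp: path_events_def)
  have [measurable]: "A \<in> events" using assms path_events_events by auto
  define g where "g \<omega> = (of_bool (R \<omega>) :: real)" for \<omega>
  have g: "determined_by M (path m) g" unfolding g_def by (rule chain.det_comp[OF R(1)])
  have [measurable]: "g \<in> borel_measurable M" by (rule chain.det_measurable[OF g])
  have "prob A = (\<integral>\<omega>. indicator A \<omega> \<partial>M)" by simp
  also have "\<dots> = (\<integral>\<omega>. g \<omega> \<partial>M)"
  proof (rule integral_cong_AE)
    show "AE \<omega> in M. indicator A \<omega> = g \<omega>"
      using R(2) by eventually_elim (simp add: g_def indicator_def)
  qed auto
  finally have pA: "prob A = (\<integral>\<omega>. g \<omega> \<partial>M)" .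
  have "(\<lambda>n. \<integral>\<omega>. g \<omega> * iexp (t * chain.normed_error n \<omega>) \<partial>M) \<longlonglongrightarrow> (\<integral>\<omega>. g \<omega> \<partial>M) * exp (- t\<^sup>2 / 2)"
    by (rule chain.char_normed_error[OF g _ m]) (simp add: g_def)
  moreover have "\<forall>\<^sub>F n in sequentially. (\<integral>\<omega>. g \<omega> * iexp (t * chain.normed_error n \<omega>) \<partial>M)
      = (\<integral>\<omega>. indicator A \<omega> * iexp (t * standardized_qmle n \<omega>) \<partial>M)"
  proof (rule eventually_mono[OF eventually_ge_at_top[of 1]])
    fix n :: nat assume n: "n \<ge> 1"
    have [measurable]: "chain.normed_error n \<in> borel_measurable M" by (rule chain.det_measurable[OF chain.det_normed_error])
    have [measurable]: "standardized_qmle n \<in> borel_measurable M"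
      unfolding standardized_qmle_def by (rule fun_Part_measurable)
    show "(\<integral>\<omega>. g \<omega> * iexp (t * chain.normed_error n \<omega>) \<partial>M) = (\<integral>\<omega>. indicator A \<omega> * iexp (t * standardized_qmle n \<omega>) \<partial>M)"
    proof (rule integral_cong_AE)
      show "AE \<omega> in M. g \<omega> * iexp (t * chain.normed_error n \<omega>) = indicator A \<omega> * iexp (t * standardized_qmle n \<omega>)"
        using R(2) AE_standardized_qmle[OF n] by eventually_elim (auto simp: g_def indicator_def)
    qed measurable
  qed
  ultimately show ?thesis unfolding pA by (rule Lim_transform_eventually)
qed

lemma stable_conv_standardized_qmle:
  assumes N: "N \<in> borel_measurable M" "distr M borel N = std_normal_distribution"
    and indep: "indep_set (sets (sigma_infinity M Part)) (sets (vimage_algebra (space M) N borel))"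
  shows "stable_conv M (sigma_infinity M Part) standardized_qmle N"
proof (rule stable_conv_std_normalI[OF space_sigma_infinity sigma_sets_path_events Int_stable_path_events path_events_events])
  show "space M \<in> path_events"
  proof -
    have "AE \<omega> in M. (\<omega> \<in> space M) = True" using AE_space by eventually_elim simp
    moreover have "space M \<in> sets (sigma_infinity M Part)"
      using sets.top[of "sigma_infinity M Part"] by (simp add: space_sigma_infinity)
    ultimately show ?thesis unfolding path_events_def using chain.det_const[of 1 True] by blast
  qed
  show "standardized_qmle n \<in> borel_measurable M" for n
    unfolding standardized_qmle_def by (rule fun_Part_measurable)
qed (use char_standardized_qmle N indep in auto)

text \<open>
If the estimator lies outside \<open>{0<..<1}\<close>, the interval is a single point other than \<open>\<alpha>\<close>, and the studentized error
is \<open>z + 1 > z\<close> by its default value. Otherwise both sides say that the error is at most the radius.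
\<close>

lemma coverage_event:
  assumes z: "0 < z" and \<omega>: "\<omega> \<in> space M" and n: "n \<ge> 1" and a: "a = chain.estimator n \<omega>"
  shows "\<alpha> \<in> {a - z / sqrt (card (path n \<omega>)) * inv_sqrt_fisher_info a..a + z / sqrt (card (path n \<omega>)) * inv_sqrt_fisher_info a}
    \<longleftrightarrow> \<bar>chain.studentized_error (z + 1) n \<omega>\<bar> \<le> z"
proof (cases "a \<in> {0<..<1}")
  case True
  have k: "real (tally jump 0 n \<omega>) = real (card (path n \<omega>))" using tally_jump_0[OF \<omega> n] by simp
  define s where "s = sqrt (card (path n \<omega>)) * sqrt (fisher_info a)"
  have "0 < fisher_info a"
  proof (rule less_le_trans)
    show "0 < 1 / a\<^sup>2" using True by simp
    show "1 / a\<^sup>2 \<le> fisher_info a" using True by (intro fisher_info_ge) simp_all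
  qed
  moreover have "0 < card (path n \<omega>)" using card_partition_bounds(1)[OF path_partition[OF \<omega>] n] by simp
  ultimately have s: "0 < s" by (simp add: s_def)
  have r: "z / sqrt (card (path n \<omega>)) * inv_sqrt_fisher_info a = z / s"
    using True by (simp add: inv_sqrt_fisher_info_def s_def)
  have "chain.studentized_error (z + 1) n \<omega> = s * (a - \<alpha>)"
    using True by (simp add: chain.studentized_error_def s_def k a)
  then have "\<bar>chain.studentized_error (z + 1) n \<omega>\<bar> = \<bar>a - \<alpha>\<bar> * s"
    using s by (simp only: abs_mult abs_of_pos mult.commute)
  then have "\<bar>chain.studentized_error (z + 1) n \<omega>\<bar> \<le> z \<longleftrightarrow> \<bar>a - \<alpha>\<bar> \<le> z / s"
    by (simp only: pos_le_divide_eq[OF s])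
  moreover have "\<bar>a - \<alpha>\<bar> \<le> z / s \<longleftrightarrow> \<alpha> \<in> {a - z / s..a + z / s}"
    unfolding atLeastAtMost_iff abs_le_iff by linarith
  ultimately show ?thesis unfolding r by (simp only:)
next
  case False
  then have "chain.studentized_error (z + 1) n \<omega> = z + 1"
    unfolding chain.studentized_error_def a[symmetric] by (simp only: if_False)
  moreover have "a \<noteq> \<alpha>" using False alpha by auto
  moreover have "inv_sqrt_fisher_info a = 0" using False by (simp only: inv_sqrt_fisher_info_def if_False)
  ultimately show ?thesis using z by simp
qed

text \<open>
The boundary of \<open>{- z..z}\<close> is a null set of the normal law, so that weak convergence of the studentized error gives the
limit of the coverage probabilities.
\<close>

lemma coverage_probability:
  assumes e: "e \<in> {0<..<1}"
  shows "(\<lambda>n. \<P>(\<omega> in M. let a = qmle n (Part n \<omega>);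
      r = quantile std_normal_distribution (1 - e / 2) / sqrt (real (card (Part n \<omega>))) * inv_sqrt_fisher_info a
      in \<alpha> \<in> {a - r..a + r})) \<longlonglongrightarrow> 1 - e"
proof -
  define z where "z = quantile std_normal_distribution (1 - e / 2)"
  have z: "0 < z" "measure std_normal_distribution {- z..z} = 1 - e"
    using std_normal_central_interval[of e] e by (auto simp: z_def)
  define X where "X = chain.studentized_error (z + 1)"
  have [measurable]: "X n \<in> borel_measurable M" for n
    unfolding X_def by (rule chain.det_measurable[OF chain.det_studentized_error])
  interpret D: real_distribution std_normal_distribution by (rule real_dist_normal_dist)
  have weak: "weak_conv_m (\<lambda>n. distr M borel (X n)) std_normal_distribution"
  proof (rule levy_continuity)
    fix t
    have "(\<lambda>n. \<integral>\<omega>. complex_of_real 1 * iexp (t * X n \<omega>) \<partial>M) \<longlonglongrightarrow> complex_of_real ((\<integral>\<omega>. 1 \<partial>M) * exp (- t\<^sup>2 / 2))"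
      unfolding X_def by (rule chain.char_studentized_error[OF chain.det_const[of 1] _ order_refl]) simp
    then show "(\<lambda>n. char (distr M borel (X n)) t) \<longlonglongrightarrow> char std_normal_distribution t"
      unfolding char_std_normal_distribution by (simp add: char_def integral_distr prob_space)
  qed (auto intro: real_dist_normal_dist)
  have front: "measure std_normal_distribution (frontier {- z..z}) = 0"
  proof -
    have "frontier {- z..z} = {- z} \<union> {z}" using z(1) by (auto simp: frontier_def)
    moreover have "measure std_normal_distribution ({- z} \<union> {z}) \<le> measure std_normal_distribution {- z} + measure std_normal_distribution {z}"
      by (rule measure_Un_le) auto
    ultimately show ?thesis by (simp add: std_normal_singleton measure_le_0_iff)
  qed
  have "(\<lambda>n. measure (distr M borel (X n)) {- z..z}) \<longlonglongrightarrow> measure std_normal_distribution {- z..z}"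
    by (rule weak_conv_imp_continuity_set_conv[OF _ real_dist_normal_dist weak])
      (use front in \<open>auto simp: D.emeasure_eq_measure\<close>)
  then have "(\<lambda>n. measure (distr M borel (X n)) {- z..z}) \<longlonglongrightarrow> 1 - e" unfolding z(2) .
  moreover have "\<forall>\<^sub>F n in sequentially. measure (distr M borel (X n)) {- z..z}
      = \<P>(\<omega> in M. let a = qmle n (Part n \<omega>); r = z / sqrt (real (card (Part n \<omega>))) * inv_sqrt_fisher_info a in \<alpha> \<in> {a - r..a + r})"
  proof (rule eventually_mono[OF eventually_ge_at_top[of 1]])
    fix n :: nat assume n: "n \<ge> 1"
    let ?R = "\<lambda>P. let a = qmle n P; r = z / sqrt (real (card P)) * inv_sqrt_fisher_info a in \<alpha> \<in> {a - r..a + r}"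
    have "measure (distr M borel (X n)) {- z..z} = prob (X n -` {- z..z} \<inter> space M)"
      by (rule measure_distr) auto
    also have "\<dots> = prob {\<omega>\<in>space M. ?R (Part n \<omega>)}"
    proof (rule measure_eq_AE)
      show "AE \<omega> in M. (\<omega> \<in> X n -` {- z..z} \<inter> space M) = (\<omega> \<in> {\<omega>\<in>space M. ?R (Part n \<omega>)})"
        using AE_path_eq AE_space
      proof eventually_elim
        case (elim \<omega>)
        have "?R (path n \<omega>) \<longleftrightarrow> \<bar>X n \<omega>\<bar> \<le> z"
          unfolding Let_def qmle_path[OF elim(2) n] X_def by (rule coverage_event[OF z(1) elim(2) n refl])
        then have "?R (Part n \<omega>) \<longleftrightarrow> X n \<omega> \<in> {- z..z}" using elim(1) by (simp add: abs_le_iff) linarith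
        then show ?case using elim(2) by auto
      qed
      show "{\<omega>\<in>space M. ?R (Part n \<omega>)} \<in> events" using Part_event[of n "{P. ?R P}"] by simp
    qed measurable
    finally show "measure (distr M borel (X n)) {- z..z} = \<P>(\<omega> in M. ?R (Part n \<omega>))" .
  qed
  ultimately show ?thesis unfolding z_def[symmetric] by (rule Lim_transform_eventually)
qed

end

theorem corollary3p4:
  fixes M :: "'a measure" and \<mu> :: "real measure"
    and \<alpha> \<theta>_lower \<theta>_upper :: real
    and Part :: "nat \<Rightarrow> 'a \<Rightarrow> nat set set" and N :: "'a \<Rightarrow> real"
  assumes "prob_space M"
    and "0 < \<alpha>" and "\<alpha> < 1"
    and "real_distribution \<mu>"
    and "measure_support \<mu> \<subseteq> {\<theta>_lower..\<theta>_upper}"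
    and "- \<alpha> < \<theta>_lower" and "\<theta>_lower \<le> 0" and "0 \<le> \<theta>_upper"
    and "gibbs_partition M \<alpha> (mixed_weight \<alpha> \<mu>) Part"
    and "N \<in> borel_measurable M" and "distr M borel N = std_normal_distribution"
    and "prob_space.indep_set M (sets (sigma_infinity M Part))
           (sets (vimage_algebra (space M) N borel))"
  shows "stable_conv M (sigma_infinity M Part)
           (\<lambda>n \<omega>. sqrt (real (card (Part n \<omega>)) * fisher_info \<alpha>) * (qmle n (Part n \<omega>) - \<alpha>)) N
       \<and> (\<forall>\<epsilon>\<in>{0<..<1}.
           (\<lambda>n. \<P>(\<omega> in M.
              let a = qmle n (Part n \<omega>);
                  r = quantile std_normal_distribution (1 - \<epsilon> / 2)
                        / sqrt (real (card (Part n \<omega>))) * inv_sqrt_fisher_info a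
              in \<alpha> \<in> {a - r..a + r}))
           \<longlonglongrightarrow> 1 - \<epsilon>)"
proof -
  interpret gibbs_process M \<alpha> \<theta>_lower \<theta>_upper \<mu> Part
    using assms by (intro gibbs_process.intro mixing_measure.intro gibbs_process_axioms.intro)
  show ?thesis
    using stable_conv_standardized_qmle[OF assms(10-12)] coverage_probability
    unfolding standardized_qmle_def[abs_def] by blast
qed

end
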